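(* (The Green–Kubo relation) Let $V\in C^\infty(\mathbb R^d;\mathbb R)$ satisfy Assumptions (I) and (II), let $\boldsymbol\sigma\in\mathbb R^{d\times d}$ be constant and nonsingular, let $W\in C_c^\infty(\mathbb R^d;\mathbb R)$, and for $\varepsilon>0$ let $\rho^\varepsilon(\cdot,t)$ be the density of the law at time $t$ of the solution of $$d\mathbf q^\varepsilon_t=\boldsymbol\sigma\boldsymbol\sigma^T\big(-\nabla V(\mathbf q^\varepsilon_t)+\varepsilon\nabla W(\mathbf q^\varepsilon_t)\big)dt+\sqrt2\,\boldsymbol\sigma\,d\mathbf B_t,\qquad\mathbf q^\varepsilon_0\sim\rho_0:=\tfrac1Ze^{-V},\quad Z:=\int_{\mathbb R^d}e^{-V}d\mathbf q.$$ For any $g\in C_c^\infty(\mathbb R^d)$, $$\lim_{\varepsilon\to0^+}\lim_{t\to\infty}R(t,\varepsilon;\mathcal L_0g)=\int_{\mathbb R^d}W(\mathbf q)(\mathcal L_0g)(\mathbf q)\rho_0(\mathbf q)\,d\mathbf q=-\int_0^\infty\int_{\mathbb R^d}\big[e^{s\mathcal L_0}(\mathcal L_0g)\big](\mathcal L_0W)\rho_0\,d\mathbf q\,ds.$$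
   Context: Assumption (I): there exist $\alpha>0$ and constants $C_1,C_2$ such that $|\nabla V(\mathbf x)|\le C_1|\mathbf x|^\alpha+C_2$ for all $\mathbf x$, and $\limsup_{|\mathbf x|\to\infty}\frac{-\mathbf x\cdot\nabla V(\mathbf x)}{|\mathbf x|^{\alpha+1}}=:\gamma_1<0$. Assumption (II): $\lambda:=\liminf_{|\mathbf x|\to\infty}\big(|\boldsymbol\sigma^T\nabla V(\mathbf x)|^2-2\,\mathrm{tr}(\boldsymbol\sigma\boldsymbol\sigma^T\nabla^2V(\mathbf x))\big)>0$. For $\varphi\in C_c^\infty(\mathbb R^d)$ the response function is $R(t,\varepsilon;\varphi):=\frac1\varepsilon\big(\int\varphi(\mathbf q)\rho^\varepsilon(\mathbf q,t)\,d\mathbf q-\int\varphi(\mathbf q)\rho_0(\mathbf q)\,d\mathbf q\big)$. The unperturbed generator is $\mathcal L_0f=-\boldsymbol\sigma\boldsymbol\sigma^T\nabla V\cdot\nabla f+\boldsymbol\sigma\boldsymbol\sigma^T:\nabla^2f$, and $e^{t\mathcal L_0}\varphi$ denotes the solution at time $t$ of $\partial_tf=\mathcal L_0f$, $f(\cdot,0)=\varphi$ (the semigroup generated by $\mathcal L_0$ on $L^2(\rho_0\,d\mathbf q)$). $\mathbf B$ is a standard $d$-dimensional Brownian motion independent of the initial datum. *)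

theory Defs
  imports "HOL-Probability.Probability"
begin

section \<open>Calculus on Euclidean space\<close>

definition partial_deriv :: "'n::finite \<Rightarrow> (real ^ 'n \<Rightarrow> real) \<Rightarrow> real ^ 'n \<Rightarrow> real" where
  "partial_deriv i f x = frechet_derivative f (at x) (axis i 1)"

definition grad :: "(real ^ 'n::finite \<Rightarrow> real) \<Rightarrow> real ^ 'n \<Rightarrow> real ^ 'n" where
  "grad f x = (\<chi> i. partial_deriv i f x)"

definition hessian :: "(real ^ 'n::finite \<Rightarrow> real) \<Rightarrow> real ^ 'n \<Rightarrow> real ^ 'n ^ 'n" where
  "hessian f x = (\<chi> i j. partial_deriv i (partial_deriv j f) x)"

primrec continuously_differentiable :: "nat \<Rightarrow> (real ^ 'n::finite \<Rightarrow> real) \<Rightarrow> bool" where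
  "continuously_differentiable 0 f \<longleftrightarrow> continuous_on UNIV f"
| "continuously_differentiable (Suc k) f \<longleftrightarrow>
     f differentiable_on UNIV \<and> (\<forall>i. continuously_differentiable k (partial_deriv i f))"

definition smooth :: "(real ^ 'n::finite \<Rightarrow> real) \<Rightarrow> bool" where
  "smooth f \<longleftrightarrow> (\<forall>k. continuously_differentiable k f)"

definition test_function :: "(real ^ 'n::finite \<Rightarrow> real) \<Rightarrow> bool" where
  "test_function f \<longleftrightarrow> smooth f \<and> compact (closure {x. f x \<noteq> 0})"


section \<open>The potential and the unperturbed dynamics\<close>

definition growth_assumption :: "(real ^ 'n::finite \<Rightarrow> real) \<Rightarrow> bool" where
  "growth_assumption V \<longleftrightarrow>
     (\<exists>\<alpha>>0. (\<exists>C1 C2. \<forall>x. norm (grad V x) \<le> C1 * norm x powr \<alpha> + C2) \<and>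
        Limsup at_infinity (\<lambda>x. ereal (- (x \<bullet> grad V x) / norm x powr (\<alpha> + 1))) < 0)"

text \<open>The lower limit is taken in the extended reals; the value infinity is allowed.\<close>

definition confinement_assumption :: "real ^ 'n ^ 'n \<Rightarrow> (real ^ 'n::finite \<Rightarrow> real) \<Rightarrow> bool" where
  "confinement_assumption \<sigma> V \<longleftrightarrow>
     Liminf at_infinity (\<lambda>x. ereal ((norm (transpose \<sigma> *v grad V x))\<^sup>2
        - 2 * trace (\<sigma> ** transpose \<sigma> ** hessian V x))) > 0"

definition partition_function :: "(real ^ 'n::finite \<Rightarrow> real) \<Rightarrow> real" where
  "partition_function V = (LINT x|lborel. exp (- V x))"

definition gibbs_density :: "(real ^ 'n::finite \<Rightarrow> real) \<Rightarrow> real ^ 'n \<Rightarrow> real" where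
  "gibbs_density V x = exp (- V x) / partition_function V"

definition gibbs_measure :: "(real ^ 'n::finite \<Rightarrow> real) \<Rightarrow> (real ^ 'n) measure" where
  "gibbs_measure V = density lborel (\<lambda>x. ennreal (gibbs_density V x))"

text \<open>The inner product on matrices is the Frobenius product, i.e. the double contraction of
  \<open>\<sigma>\<sigma>\<^sup>T\<close> with the Hessian.\<close>

definition unperturbed_generator ::
    "real ^ 'n ^ 'n \<Rightarrow> (real ^ 'n::finite \<Rightarrow> real) \<Rightarrow> (real ^ 'n \<Rightarrow> real) \<Rightarrow> real ^ 'n \<Rightarrow> real" where
  "unperturbed_generator \<sigma> V f x =
     - (((\<sigma> ** transpose \<sigma>) *v grad V x) \<bullet> grad f x) + (\<sigma> ** transpose \<sigma>) \<bullet> hessian f x"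


section \<open>Semigroups on a square-integrable function space\<close>

text \<open>Elements of \<open>L\<^sup>2(\<mu>)\<close> are represented by functions; two functions represent the same element
  if they agree almost everywhere.\<close>

definition L2_space :: "'a measure \<Rightarrow> ('a \<Rightarrow> real) set" where
  "L2_space \<mu> = {f \<in> borel_measurable \<mu>. integrable \<mu> (\<lambda>x. (f x)\<^sup>2)}"

definition L2_norm :: "'a measure \<Rightarrow> ('a \<Rightarrow> real) \<Rightarrow> real" where
  "L2_norm \<mu> f = sqrt (LINT x|\<mu>. (f x)\<^sup>2)"

definition C0_semigroup :: "'a measure \<Rightarrow> (real \<Rightarrow> ('a \<Rightarrow> real) \<Rightarrow> 'a \<Rightarrow> real) \<Rightarrow> bool" where
  "C0_semigroup \<mu> S \<longleftrightarrow>
     (\<forall>t\<ge>0. \<forall>f\<in>L2_space \<mu>. S t f \<in> L2_space \<mu>) \<and>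
     (\<forall>t\<ge>0. \<forall>f\<in>L2_space \<mu>. \<forall>g\<in>L2_space \<mu>. \<forall>a b.
        AE x in \<mu>. S t (\<lambda>x. a * f x + b * g x) x = a * S t f x + b * S t g x) \<and>
     (\<forall>t\<ge>0. \<exists>C. \<forall>f\<in>L2_space \<mu>. L2_norm \<mu> (S t f) \<le> C * L2_norm \<mu> f) \<and>
     (\<forall>f\<in>L2_space \<mu>. AE x in \<mu>. S 0 f x = f x) \<and>
     (\<forall>s\<ge>0. \<forall>t\<ge>0. \<forall>f\<in>L2_space \<mu>. AE x in \<mu>. S (s + t) f x = S s (S t f) x) \<and>
     (\<forall>f\<in>L2_space \<mu>. ((\<lambda>t. L2_norm \<mu> (\<lambda>x. S t f x - f x)) \<longlongrightarrow> 0) (at_right 0))"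

definition semigroup_generator_graph ::
    "'a measure \<Rightarrow> (real \<Rightarrow> ('a \<Rightarrow> real) \<Rightarrow> 'a \<Rightarrow> real) \<Rightarrow> (('a \<Rightarrow> real) \<times> ('a \<Rightarrow> real)) set" where
  "semigroup_generator_graph \<mu> S =
     {(f, h). f \<in> L2_space \<mu> \<and> h \<in> L2_space \<mu> \<and>
        ((\<lambda>t. L2_norm \<mu> (\<lambda>x. (S t f x - f x) / t - h x)) \<longlongrightarrow> 0) (at_right 0)}"

definition L2_closure_graph ::
    "'a measure \<Rightarrow> ('a \<Rightarrow> real) set \<Rightarrow> (('a \<Rightarrow> real) \<Rightarrow> 'a \<Rightarrow> real) \<Rightarrow>
     (('a \<Rightarrow> real) \<times> ('a \<Rightarrow> real)) set" where
  "L2_closure_graph \<mu> D A =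
     {(f, h). f \<in> L2_space \<mu> \<and> h \<in> L2_space \<mu> \<and>
        (\<exists>u :: nat \<Rightarrow> 'a \<Rightarrow> real. (\<forall>n. u n \<in> D) \<and>
           (\<lambda>n. L2_norm \<mu> (\<lambda>x. u n x - f x)) \<longlonglongrightarrow> 0 \<and>
           (\<lambda>n. L2_norm \<mu> (\<lambda>x. A (u n) x - h x)) \<longlonglongrightarrow> 0)}"

text \<open>\<open>S t \<phi>\<close> is \<open>e\<^bsup>tL\<^esup> \<phi>\<close>, where \<open>L\<close> is the unperturbed generator, realized on the \<open>L\<^sup>2\<close> space of the
  Gibbs measure as the closure of its restriction to test functions.  In particular, for every test
  function \<open>\<phi>\<close> the map \<open>t \<mapsto> S t \<phi>\<close> is the solution in \<open>L\<^sup>2\<close> of \<open>\<partial>\<^sub>t f = L f\<close>, \<open>f(0) = \<phi>\<close>.\<close>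

definition unperturbed_semigroup ::
    "real ^ 'n ^ 'n \<Rightarrow> (real ^ 'n::finite \<Rightarrow> real) \<Rightarrow>
     (real \<Rightarrow> (real ^ 'n \<Rightarrow> real) \<Rightarrow> real ^ 'n \<Rightarrow> real) \<Rightarrow> bool" where
  "unperturbed_semigroup \<sigma> V S \<longleftrightarrow>
     C0_semigroup (gibbs_measure V) S \<and>
     semigroup_generator_graph (gibbs_measure V) S =
       L2_closure_graph (gibbs_measure V) (Collect test_function) (unperturbed_generator \<sigma> V)"


section \<open>Brownian motion and the perturbed dynamics\<close>

definition brownian_motion :: "'w measure \<Rightarrow> (real \<Rightarrow> 'w \<Rightarrow> real ^ 'n::finite) \<Rightarrow> bool" where
  "brownian_motion M B \<longleftrightarrow>
     prob_space M \<and>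
     (\<forall>t\<ge>0. B t \<in> borel_measurable M) \<and>
     (AE \<omega> in M. B 0 \<omega> = 0) \<and>
     (AE \<omega> in M. continuous_on {0..} (\<lambda>t. B t \<omega>)) \<and>
     (\<forall>(\<tau> :: nat \<Rightarrow> real) n. 0 \<le> \<tau> 0 \<and> mono \<tau> \<longrightarrow>
        prob_space.indep_vars M (\<lambda>_. borel) (\<lambda>k \<omega>. B (\<tau> (Suc k)) \<omega> - B (\<tau> k) \<omega>) {..<n}) \<and>
     (\<forall>s t. 0 \<le> s \<and> s < t \<longrightarrow>
        distributed M lborel (\<lambda>\<omega>. B t \<omega> - B s \<omega>)
          (\<lambda>x. ennreal (\<Prod>i\<in>UNIV. normal_density 0 (sqrt (t - s)) (x $ i))))"

text \<open>Solutions of \<open>dq = b(q) dt + A dB\<close> with a constant matrix \<open>A\<close>: the stochastic integral of a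
  constant is \<open>A B\<^sub>t\<close>, so the integral equation is meaningful path by path.  If \<open>b\<close> is locally
  Lipschitz, its solutions are pathwise unique and hence automatically adapted to the completed
  filtration generated by the initial datum and \<open>B\<close>.\<close>

definition additive_sde_solution ::
    "'w measure \<Rightarrow> (real \<Rightarrow> 'w \<Rightarrow> real ^ 'n::finite) \<Rightarrow> (real ^ 'n \<Rightarrow> real ^ 'n) \<Rightarrow> real ^ 'n ^ 'n \<Rightarrow>
     (real \<Rightarrow> 'w \<Rightarrow> real ^ 'n) \<Rightarrow> bool" where
  "additive_sde_solution M B b A q \<longleftrightarrow>
     (\<forall>t\<ge>0. q t \<in> borel_measurable M) \<and>
     (AE \<omega> in M. continuous_on {0..} (\<lambda>t. q t \<omega>) \<and>
        (\<forall>t\<ge>0. q t \<omega> = q 0 \<omega> + integral {0..t} (\<lambda>s. b (q s \<omega>)) + A *v B t \<omega>))"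

definition independent_of_process ::
    "'w measure \<Rightarrow> ('w \<Rightarrow> real ^ 'n::finite) \<Rightarrow> (real \<Rightarrow> 'w \<Rightarrow> real ^ 'n) \<Rightarrow> bool" where
  "independent_of_process M X B \<longleftrightarrow>
     prob_space.indep_set M
       (sets (vimage_algebra (space M) X borel))
       (sets (vimage_algebra (space M) (\<lambda>\<omega>. \<lambda>t\<in>{0..}. B t \<omega>) (\<Pi>\<^sub>M t\<in>{0..}. borel)))"

definition perturbed_drift ::
    "real ^ 'n ^ 'n \<Rightarrow> (real ^ 'n::finite \<Rightarrow> real) \<Rightarrow> (real ^ 'n \<Rightarrow> real) \<Rightarrow> real \<Rightarrow> real ^ 'n \<Rightarrow> real ^ 'n" where
  "perturbed_drift \<sigma> V W \<epsilon> x =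
     (\<sigma> ** transpose \<sigma>) *v (- grad V x + \<epsilon> *\<^sub>R grad W x)"

definition response ::
    "(real \<Rightarrow> real \<Rightarrow> real ^ 'n::finite \<Rightarrow> real) \<Rightarrow> (real ^ 'n \<Rightarrow> real) \<Rightarrow>
     real \<Rightarrow> real \<Rightarrow> (real ^ 'n \<Rightarrow> real) \<Rightarrow> real" where
  "response \<rho> \<rho>\<^sub>0 t \<epsilon> \<phi> =
     (1 / \<epsilon>) * ((LINT x|lborel. \<phi> x * \<rho> \<epsilon> t x) - (LINT x|lborel. \<phi> x * \<rho>\<^sub>0 x))"

end

theory Submission
  imports Defs
begin

text \<open>
  Write \<open>L\<close> for the unperturbed generator, \<open>a = \<sigma>\<sigma>\<^sup>T\<close>, \<open>\<mu>\<close> for the Gibbs measure, \<open>U = V - \<epsilon> W\<close>, \<open>L\<^sub>\<epsilon> = L + \<epsilon> a\<nabla>W \<bullet> \<nabla>\<close>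
  for the perturbed generator and \<open>\<psi> = a\<nabla>W \<bullet> \<nabla>g\<close>.

  The time integral lives entirely in \<open>L\<^sup>2(\<mu>)\<close>.  The closed generator is symmetric and dissipative, so
  the semigroup consists of symmetric contractions.  The energy identity
  \<open>d/ds \<langle>S\<^sub>s Lg, S\<^sub>s g\<rangle> = 2 \<parallel>S\<^sub>s Lg\<parallel>\<^sup>2\<close> shows that \<open>\<parallel>S\<^sub>s Lg\<parallel>\<^sup>2\<close> is integrable and that \<open>S\<^sub>s Lg \<rightarrow> 0\<close>, and
  \<open>\<langle>S\<^sub>s Lg, LW\<rangle> = d/ds \<langle>S\<^sub>s Lg, W\<rangle>\<close> is integrated directly.

  For the response, the Euler chain with step \<open>h\<close> of a truncated potential is reversible up to an error
  \<open>O(h\<^bsup>3/2\<^esup>)\<close> per step.  In the limit, if \<open>h\<^sub>0\<close> is the initial density relative to \<open>e\<^bsup>-U\<^esup>\<close> and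
  \<open>F(t) = E h\<^sub>0(q\<^sub>t)\<close>, then \<open>(E f(q\<^sub>t) - E f(q\<^sub>s))\<^sup>2\<close> is at most \<open>\<integral> f\<^sup>2 e\<^bsup>-U\<^esup>\<close> times the second difference
  \<open>F(2t) - 2 F(t + s) + F(2s)\<close>.  So \<open>F\<close> is midpoint convex and bounded, hence nonincreasing and
  convergent, and \<open>E f(q\<^sub>t)\<close> has a limit \<open>\<ell>\<^sub>\<epsilon>(f)\<close>.  Expanding \<open>E f(q\<^sub>t)\<close> in time gives \<open>\<ell>\<^sub>\<epsilon>(L\<^sub>\<epsilon> f) = 0\<close>,
  so the response of \<open>Lg\<close> tends to \<open>- \<ell>\<^sub>\<epsilon>(\<psi>)\<close> as \<open>t \<rightarrow> \<infinity>\<close>.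

  Finally \<open>S\<^sub>t \<psi> \<rightarrow> \<integral> \<psi> d\<mu>\<close> in \<open>L\<^sup>1(\<mu>)\<close> by a Poincare inequality on balls, so \<open>\<psi> - \<integral> \<psi> d\<mu>\<close> is an
  \<open>L\<^sup>1(\<mu>)\<close>-limit of functions \<open>Lu\<close> with \<open>u\<close> a test function.  Since the law of \<open>q\<^sub>t\<close> has a density with respect to \<open>\<mu>\<close>
  that is bounded uniformly in \<open>t\<close> and in small \<open>\<epsilon>\<close>, it follows that \<open>\<ell>\<^sub>\<epsilon>(\<psi>) \<rightarrow> \<integral> \<psi> d\<mu> = - \<integral> W Lg d\<mu>\<close>.
\<close>

section \<open>Partial derivatives and test functions\<close>

text \<open>The process and the semigroup are never identified with each other; they meet only
  through the generator on test functions. Density of the functions \<open>L u\<close> is wanted in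
  L1(\<mu>), because laws with bounded density pass L1 errors on to expectations uniformly in time,
  and because a Poincare inequality on one large ball and small mass outside it then suffice. The
  gradient of V may grow, so the Euler scheme is run for truncated potentials with bounded
  derivatives. Their weights have infinite mass, hence all estimates concern densities h with
  \<open>h w\<close> integrable. There are about t/h steps up to time t, so an error of order
  h^(3/2) per step disappears. The step size tends to 0 first and the truncation level to infinity
  afterwards; before a path leaves a sublevel set the truncation is invisible. The second difference
  appears because a reversible chain satisfies F(n + m) = <h n, h m>, which makes it a squared
  distance of two densities. The limit of the response comes from writing L as the perturbed
  generator minus \<epsilon> times a first-order term, dividing by \<epsilon>, and using that
  \<open>L g\<close> has \<mu>-mean 0.\<close>

lemma differentiable_on_UNIV_D: "f differentiable_on UNIV \<Longrightarrow> f differentiable (at x)"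
  by (simp add: differentiable_on_eq_differentiable_at)

lemma partial_deriv_eq:
  "(f has_derivative f') (at x) \<Longrightarrow> partial_deriv i f x = f' (axis i 1)"
  unfolding partial_deriv_def using frechet_derivative_at by metis

lemma has_derivative_partial:
  fixes f :: "real ^ 'n::finite \<Rightarrow> real"
  assumes "f differentiable (at x)"
  shows "(f has_derivative (\<lambda>v. \<Sum>i\<in>UNIV. v $ i * partial_deriv i f x)) (at x)"
proof -
  have d: "(f has_derivative frechet_derivative f (at x)) (at x)"
    using assms frechet_derivative_works by blast
  then interpret bounded_linear "frechet_derivative f (at x)"
    by (rule has_derivative_bounded_linear)
  have "frechet_derivative f (at x) v = (\<Sum>i\<in>UNIV. v $ i * partial_deriv i f x)" for v
  proof -
    have "v = (\<Sum>i\<in>UNIV. (v $ i) *\<^sub>R axis i 1)"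
      using basis_expansion[of v] by (simp add: scalar_mult_eq_scaleR)
    then have "frechet_derivative f (at x) v = frechet_derivative f (at x) (\<Sum>i\<in>UNIV. (v $ i) *\<^sub>R axis i 1)"
      by simp
    also have "\<dots> = (\<Sum>i\<in>UNIV. (v $ i) * partial_deriv i f x)"
      by (simp add: sum scaleR partial_deriv_def)
    finally show ?thesis .
  qed
  then have "frechet_derivative f (at x) = (\<lambda>v. \<Sum>i\<in>UNIV. v $ i * partial_deriv i f x)" by (rule ext)
  with d show ?thesis by simp
qed

lemma has_real_derivative_line:
  fixes f :: "real ^ 'n::finite \<Rightarrow> real"
  assumes "f differentiable_on UNIV"
  shows "((\<lambda>t. f (x + t *\<^sub>R v)) has_real_derivative (\<Sum>i\<in>UNIV. v $ i * partial_deriv i f (x + t *\<^sub>R v))) (at t)"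
proof -
  have "((\<lambda>t. x + t *\<^sub>R v) has_derivative (\<lambda>s. s *\<^sub>R v)) (at t)"
    by (auto intro!: derivative_eq_intros)
  from has_derivative_compose[OF this has_derivative_partial[OF differentiable_on_UNIV_D[OF assms]]]
  have "((\<lambda>t. f (x + t *\<^sub>R v)) has_derivative
     (\<lambda>s. \<Sum>i\<in>UNIV. (s *\<^sub>R v) $ i * partial_deriv i f (x + t *\<^sub>R v))) (at t)" .
  moreover have "(\<lambda>s. \<Sum>i\<in>UNIV. (s *\<^sub>R v) $ i * partial_deriv i f (x + t *\<^sub>R v)) =
     (*) (\<Sum>i\<in>UNIV. v $ i * partial_deriv i f (x + t *\<^sub>R v))"
    by (rule ext) (simp add: sum_distrib_left sum_distrib_right mult_ac)
  ultimately show ?thesis unfolding has_field_derivative_def by simp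
qed

lemma partial_deriv_const: "partial_deriv i (\<lambda>x. c) = (\<lambda>x. 0)"
  by (rule ext) (rule partial_deriv_eq, auto intro!: derivative_eq_intros)

lemma partial_deriv_add:
  assumes "f differentiable_on UNIV" "g differentiable_on UNIV"
  shows "partial_deriv i (\<lambda>x. f x + g x) = (\<lambda>x. partial_deriv i f x + partial_deriv i g x)"
proof
  fix x
  have "(f has_derivative frechet_derivative f (at x)) (at x)" "(g has_derivative frechet_derivative g (at x)) (at x)"
    using assms frechet_derivative_works differentiable_on_UNIV_D by blast+
  from has_derivative_add[OF this] show "partial_deriv i (\<lambda>x. f x + g x) x = partial_deriv i f x + partial_deriv i g x"
    by (subst partial_deriv_eq) (auto simp: partial_deriv_def)
qed

lemma partial_deriv_mult:
  assumes "f differentiable_on UNIV" "g differentiable_on UNIV"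
  shows "partial_deriv i (\<lambda>x. f x * g x) = (\<lambda>x. f x * partial_deriv i g x + partial_deriv i f x * g x)"
proof
  fix x
  have "(f has_derivative frechet_derivative f (at x)) (at x)" "(g has_derivative frechet_derivative g (at x)) (at x)"
    using assms frechet_derivative_works differentiable_on_UNIV_D by blast+
  from has_derivative_mult[OF this]
  show "partial_deriv i (\<lambda>x. f x * g x) x = f x * partial_deriv i g x + partial_deriv i f x * g x"
    by (subst partial_deriv_eq) (auto simp: partial_deriv_def)
qed

lemma partial_deriv_compose:
  assumes "f differentiable_on UNIV" "\<And>s. (\<phi> has_real_derivative \<phi>' s) (at s)"
  shows "partial_deriv i (\<lambda>x. \<phi> (f x)) = (\<lambda>x. \<phi>' (f x) * partial_deriv i f x)"
proof
  fix x
  have "(f has_derivative frechet_derivative f (at x)) (at x)"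
    using assms frechet_derivative_works differentiable_on_UNIV_D by blast
  from DERIV_compose_FDERIV[OF assms(2) this]
  show "partial_deriv i (\<lambda>x. \<phi> (f x)) x = \<phi>' (f x) * partial_deriv i f x"
    by (subst partial_deriv_eq) (auto simp: partial_deriv_def mult.commute)
qed

lemma differentiable_on_compose_real:
  fixes f :: "real ^ 'n::finite \<Rightarrow> real"
  assumes "f differentiable_on UNIV" "\<And>s. (\<phi> has_real_derivative \<phi>' s) (at s)"
  shows "(\<lambda>x. \<phi> (f x)) differentiable_on UNIV"
  unfolding differentiable_on_eq_differentiable_at[OF open_UNIV]
proof
  fix x
  have "(f has_derivative frechet_derivative f (at x)) (at x)"
    using assms frechet_derivative_works differentiable_on_UNIV_D by blast
  from DERIV_compose_FDERIV[OF assms(2) this] show "(\<lambda>x. \<phi> (f x)) differentiable (at x)"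
    unfolding differentiable_def by blast
qed

lemma continuously_differentiable_pred:
  "continuously_differentiable (Suc k) f \<Longrightarrow> continuously_differentiable k f"
proof (induction k arbitrary: f)
  case 0 then show ?case by (auto intro: differentiable_imp_continuous_on)
next
  case (Suc k)
  then show ?case by (metis continuously_differentiable.simps(2))
qed

lemma continuously_differentiable_mono:
  "continuously_differentiable m f \<Longrightarrow> k \<le> m \<Longrightarrow> continuously_differentiable k f"
  by (induction m) (auto simp: le_Suc_eq intro: continuously_differentiable_pred
    simp del: continuously_differentiable.simps(2))

lemma continuously_differentiable_continuous:
  "continuously_differentiable k f \<Longrightarrow> continuous_on UNIV f"
  using continuously_differentiable_mono[of k f 0] by simp

lemma continuously_differentiable_const: "continuously_differentiable k (\<lambda>x. c)"
  by (induction k arbitrary: c) (auto simp: partial_deriv_const)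

lemma continuously_differentiable_add:
  "continuously_differentiable k f \<Longrightarrow> continuously_differentiable k g \<Longrightarrow>
   continuously_differentiable k (\<lambda>x. f x + g x)"
  by (induction k arbitrary: f g)
    (auto simp: partial_deriv_add intro: continuous_on_add differentiable_on_add)

lemma continuously_differentiable_mult:
  "continuously_differentiable k f \<Longrightarrow> continuously_differentiable k g \<Longrightarrow>
   continuously_differentiable k (\<lambda>x. f x * g x)"
proof (induction k arbitrary: f g)
  case 0 then show ?case by (auto intro: continuous_on_mult)
next
  case (Suc k)
  then have d: "f differentiable_on UNIV" "g differentiable_on UNIV" by auto
  show ?case unfolding continuously_differentiable.simps
  proof (intro conjI allI)
    show "(\<lambda>x. f x * g x) differentiable_on UNIV" using d by (rule differentiable_on_mult)
    fix i
    show "continuously_differentiable k (partial_deriv i (\<lambda>x. f x * g x))"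
      unfolding partial_deriv_mult[OF d]
      using Suc.prems by (intro continuously_differentiable_add Suc.IH) (auto intro: continuously_differentiable_pred)
  qed
qed

text \<open>\<open>\<phi>\<close> is a whole tower of derivatives, so the induction step can shift
  it by one. Asking mere continuity of the top member admits the splines \<open>cut R\<close>, which
  have three derivatives, as well as the exponential.\<close>

lemma continuously_differentiable_compose:
  assumes "continuously_differentiable k f"
    and "\<And>j s. j < k \<Longrightarrow> (\<phi> j has_real_derivative \<phi> (Suc j) s) (at s)" "continuous_on UNIV (\<phi> k)"
  shows "continuously_differentiable k (\<lambda>x. \<phi> 0 (f x))"
  using assms
proof (induction k arbitrary: f \<phi>)
  case 0 then show ?case
    using continuous_on_compose2[of UNIV "\<phi> 0" UNIV f] by simp
next
  case (Suc k)
  then have d: "f differentiable_on UNIV" by auto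
  have dphi: "(\<phi> 0 has_real_derivative \<phi> (Suc 0) s) (at s)" for s using Suc.prems(2) by auto
  show ?case unfolding continuously_differentiable.simps
  proof (intro conjI allI)
    show "(\<lambda>x. \<phi> 0 (f x)) differentiable_on UNIV" using differentiable_on_compose_real[OF d dphi] .
    fix i
    have "continuously_differentiable k (\<lambda>x. \<phi> (Suc 0) (f x))"
      using Suc.IH[of f "\<lambda>j. \<phi> (Suc j)"] Suc.prems continuously_differentiable_pred by auto
    then show "continuously_differentiable k (partial_deriv i (\<lambda>x. \<phi> 0 (f x)))"
      unfolding partial_deriv_compose[OF d dphi]
      using Suc.prems by (intro continuously_differentiable_mult) auto
  qed
qed

lemma smooth_const: "smooth (\<lambda>x. c)"
  by (simp add: smooth_def continuously_differentiable_const)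
lemma smooth_add: "smooth f \<Longrightarrow> smooth g \<Longrightarrow> smooth (\<lambda>x. f x + g x)"
  by (simp add: smooth_def continuously_differentiable_add)
lemma smooth_mult: "smooth f \<Longrightarrow> smooth g \<Longrightarrow> smooth (\<lambda>x. f x * g x)"
  by (simp add: smooth_def continuously_differentiable_mult)
lemma smooth_cmult: "smooth f \<Longrightarrow> smooth (\<lambda>x. c * f x)"
  by (intro smooth_mult smooth_const)
lemma smooth_uminus: "smooth f \<Longrightarrow> smooth (\<lambda>x. - f x)"
  using smooth_cmult[of f "-1"] by simp
lemma smooth_diff: "smooth f \<Longrightarrow> smooth g \<Longrightarrow> smooth (\<lambda>x. f x - g x)"
  using smooth_add[of f "\<lambda>x. - g x"] smooth_uminus by auto
lemma smooth_sum: "(\<And>i. i \<in> I \<Longrightarrow> smooth (f i)) \<Longrightarrow> smooth (\<lambda>x. \<Sum>i\<in>I. f i x)"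
  by (induction I rule: infinite_finite_induct) (auto intro: smooth_const smooth_add)
lemma smooth_partial_deriv: "smooth f \<Longrightarrow> smooth (partial_deriv i f)"
  unfolding smooth_def by (metis continuously_differentiable.simps(2))
lemma smooth_differentiable: "smooth f \<Longrightarrow> f differentiable_on UNIV"
  unfolding smooth_def by (metis continuously_differentiable.simps(2))
lemma smooth_continuous: "smooth f \<Longrightarrow> continuous_on UNIV f"
  unfolding smooth_def by (metis continuously_differentiable.simps(1))

lemmas smooth_intros = smooth_const smooth_add smooth_mult smooth_uminus smooth_diff smooth_sum smooth_partial_deriv

lemma test_function_iff: "test_function f \<longleftrightarrow> smooth f \<and> bounded {x. f x \<noteq> 0}"
  by (simp add: test_function_def)

lemma test_function_smooth: "test_function f \<Longrightarrow> smooth f"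
  by (simp add: test_function_iff)

lemma test_function_subset:
  "test_function f \<Longrightarrow> smooth g \<Longrightarrow> (\<And>x. f x = 0 \<Longrightarrow> g x = 0) \<Longrightarrow> test_function g"
  unfolding test_function_iff using bounded_subset[of "{x. f x \<noteq> 0}" "{x. g x \<noteq> 0}"] by blast

lemma test_function_mult: "smooth g \<Longrightarrow> test_function f \<Longrightarrow> test_function (\<lambda>x. g x * f x)"
  by (rule test_function_subset[of f]) (auto intro: smooth_mult test_function_smooth)

lemma test_function_zero: "test_function (\<lambda>x. 0)"
  by (simp add: test_function_iff smooth_const)

lemma test_function_add:
  assumes "test_function f" "test_function g" shows "test_function (\<lambda>x. f x + g x)"
  unfolding test_function_iff
proof
  show "smooth (\<lambda>x. f x + g x)" using assms by (intro smooth_add test_function_smooth)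
  have "bounded ({x. f x \<noteq> 0} \<union> {x. g x \<noteq> 0})" using assms by (simp add: test_function_iff)
  then show "bounded {x. f x + g x \<noteq> 0}" by (rule bounded_subset) auto
qed

lemma test_function_cmult: "test_function f \<Longrightarrow> test_function (\<lambda>x. c * f x)"
  by (intro test_function_mult smooth_const)

lemma test_function_uminus: "test_function f \<Longrightarrow> test_function (\<lambda>x. - f x)"
  using test_function_cmult[of f "-1"] by simp

lemma test_function_diff: "test_function f \<Longrightarrow> test_function g \<Longrightarrow> test_function (\<lambda>x. f x - g x)"
  using test_function_add[of f "\<lambda>x. - g x"] test_function_uminus by auto

lemma test_function_sum: "(\<And>i. i \<in> I \<Longrightarrow> test_function (f i)) \<Longrightarrow> test_function (\<lambda>x. \<Sum>i\<in>I. f i x)"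
  by (induction I rule: infinite_finite_induct) (auto intro: test_function_zero test_function_add)

lemma partial_deriv_outside:
  assumes "open X" "x \<in> X" "\<And>y. y \<in> X \<Longrightarrow> f y = g y" "f differentiable (at x)"
  shows "partial_deriv i f x = partial_deriv i g x"
  unfolding partial_deriv_def
  by (subst frechet_derivative_transform_within_open[OF assms(4,1,2,3)]) auto

lemma partial_deriv_locally_const:
  assumes "open X" "x \<in> X" "\<And>y. y \<in> X \<Longrightarrow> f y = c"
  shows "partial_deriv i f x = 0"
proof -
  have "partial_deriv i (\<lambda>_. c) x = partial_deriv i f x"
    by (rule partial_deriv_outside[OF assms(1,2)]) (simp_all add: assms(3))
  then show ?thesis by (simp add: partial_deriv_const)
qed

text \<open>Off the closed support the function vanishes on a whole neighbourhood. Iterating this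
  keeps the supports of all higher derivatives inside one closed set.\<close>

lemma partial_deriv_support:
  assumes "partial_deriv i f x \<noteq> 0" shows "x \<in> closure {x. f x \<noteq> 0}"
proof (rule ccontr)
  assume x: "x \<notin> closure {x. f x \<noteq> 0}"
  have "partial_deriv i f x = 0"
  proof (rule partial_deriv_locally_const[of "- closure {x. f x \<noteq> 0}" x f 0 i])
    fix y assume "y \<in> - closure {x. f x \<noteq> 0}"
    then have "y \<notin> {x. f x \<noteq> 0}" using closure_subset[of "{x. f x \<noteq> 0}"] by blast
    then show "f y = 0" by simp
  qed (use x in \<open>auto simp: open_Compl\<close>)
  with assms show False by simp
qed

lemma test_function_partial_deriv:
  assumes "test_function f" shows "test_function (partial_deriv i f)"
  unfolding test_function_iff
proof
  show "smooth (partial_deriv i f)" using assms by (intro smooth_partial_deriv test_function_smooth)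
  have "bounded (closure {x. f x \<noteq> 0})" using assms by (simp add: test_function_iff bounded_closure)
  then show "bounded {x. partial_deriv i f x \<noteq> 0}"
    by (rule bounded_subset) (auto dest: partial_deriv_support)
qed

lemma continuous_bounded_support_bounded:
  fixes f :: "'a::euclidean_space \<Rightarrow> real"
  assumes "continuous_on UNIV f" "bounded {x. f x \<noteq> 0}"
  obtains K where "K \<ge> 0" "\<And>x. \<bar>f x\<bar> \<le> K"
proof -
  have "continuous_on (closure {x. f x \<noteq> 0}) f"
    using assms(1) by (rule continuous_on_subset) simp
  then have "compact (f ` closure {x. f x \<noteq> 0})"
    using assms(2) by (intro compact_continuous_image) (simp_all add: compact_closure)
  then obtain K where K: "\<And>y. y \<in> f ` closure {x. f x \<noteq> 0} \<Longrightarrow> norm y \<le> K"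
    by (meson bounded_iff compact_imp_bounded)
  have "\<bar>f x\<bar> \<le> max K 0" for x
  proof (cases "f x = 0")
    case False
    then have "x \<in> closure {x. f x \<noteq> 0}" using closure_subset[of "{x. f x \<noteq> 0}"] by (simp add: subset_iff)
    then show ?thesis using K[of "f x"] by simp
  qed auto
  then show ?thesis using that[of "max K 0"] by auto
qed

lemma test_function_bounded:
  assumes "test_function f" obtains K where "K \<ge> 0" "\<And>x. \<bar>f x\<bar> \<le> K"
  using continuous_bounded_support_bounded[of f] assms that
  by (auto simp: test_function_iff smooth_continuous)

lemma integrable_continuous_bounded_support:
  fixes f :: "'a::euclidean_space \<Rightarrow> real"
  assumes "continuous_on UNIV f" "bounded {x. f x \<noteq> 0}"
  shows "integrable lborel f"
proof -
  have "integrable lborel (\<lambda>x. indicator (closure {x. f x \<noteq> 0}) x *\<^sub>R f x)"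
    using assms(2) continuous_on_subset[OF assms(1)] by (intro borel_integrable_compact) simp_all
  moreover have "(\<lambda>x. indicator (closure {x. f x \<noteq> 0}) x *\<^sub>R f x) = f"
    using closure_subset[of "{x. f x \<noteq> 0}"] by (auto simp: indicator_def fun_eq_iff)
  ultimately show ?thesis by simp
qed

section \<open>Integration by parts\<close>

lemma integral_translation:
  fixes f :: "'a::euclidean_space \<Rightarrow> real"
  assumes "f \<in> borel_measurable borel"
  shows "(LINT x|lborel. f (x + v)) = (LINT x|lborel. f x)"
proof -
  have "(LINT x|lborel. f x) = (LINT x|distr lborel borel ((+) v). f x)"
    by (simp add: lborel_distr_plus)
  also have "\<dots> = (LINT x|lborel. f (v + x))"
    using assms by (intro integral_distr) auto
  finally show ?thesis by (simp add: add.commute)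
qed

lemma increment_le_partial_deriv_bound:
  fixes F :: "real ^ 'n::finite \<Rightarrow> real"
  assumes "F differentiable_on UNIV" "\<And>x. \<bar>partial_deriv i F x\<bar> \<le> K" "0 \<le> s"
  shows "\<bar>F (x + s *\<^sub>R axis i 1) - F x\<bar> \<le> K * s"
proof (cases "s = 0")
  case False
  have d: "((\<lambda>t. F (x + t *\<^sub>R axis i 1)) has_real_derivative partial_deriv i F (x + t *\<^sub>R axis i 1)) (at t)" for t
    using has_real_derivative_line[OF assms(1), of x "axis i 1" t]
    by (simp add: axis_def if_distrib [where f="\<lambda>c. c * _"] cong: if_cong)
  have "\<exists>z>0. z < s \<and> F (x + s *\<^sub>R axis i 1) - F (x + 0 *\<^sub>R axis i 1) = (s - 0) * partial_deriv i F (x + z *\<^sub>R axis i 1)"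
    using MVT2[of 0 s "\<lambda>t. F (x + t *\<^sub>R axis i 1)" "\<lambda>t. partial_deriv i F (x + t *\<^sub>R axis i 1)"] d assms(3) False
    by auto
  then obtain z where "F (x + s *\<^sub>R axis i 1) - F x = s * partial_deriv i F (x + z *\<^sub>R axis i 1)" by auto
  then show ?thesis using assms(2)[of "x + z *\<^sub>R axis i 1"] assms(3)
    by (simp add: abs_mult mult.commute[of K] mult_left_mono)
qed auto

text \<open>Translation invariance gives every difference quotient the integral 0, and dominated
  convergence passes to the derivative. This is the divergence theorem for compact support, from
  which the integration by parts below follows.\<close>

lemma integral_partial_deriv_eq_0:
  fixes F :: "real ^ 'n::finite \<Rightarrow> real"
  assumes F: "test_function F"
  shows "(LINT x|lborel. partial_deriv i F x) = 0"
proof -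
  have Fd: "F differentiable_on UNIV" and Fc: "continuous_on UNIV F"
    using F by (auto simp: test_function_iff smooth_differentiable smooth_continuous)
  obtain K where K: "K \<ge> 0" "\<And>x. \<bar>partial_deriv i F x\<bar> \<le> K"
    using test_function_bounded[OF test_function_partial_deriv[OF F]] by blast
  obtain r where r: "r > 0" "\<And>x. F x \<noteq> 0 \<Longrightarrow> norm x \<le> r"
    using F unfolding test_function_iff bounded_pos by auto
  define D where "D n x = real (Suc n) * (F (x + (1 / real (Suc n)) *\<^sub>R axis i 1) - F x)" for n x
  \<comment> \<open>For steps of length at most 1 the quotient is supported in the ball enlarged by
    1, where the bound on the derivative dominates it.\<close>
  have bnd: "norm (D n x) \<le> K * indicator (cball 0 (r + 1)) x" for n x
  proof (cases "x \<in> cball 0 (r + 1)")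
    case True
    have "\<bar>F (x + (1 / real (Suc n)) *\<^sub>R axis i 1) - F x\<bar> \<le> K * (1 / real (Suc n))"
      by (rule increment_le_partial_deriv_bound[OF Fd K(2)]) simp
    then have "real (Suc n) * \<bar>F (x + (1 / real (Suc n)) *\<^sub>R axis i 1) - F x\<bar> \<le> real (Suc n) * (K * (1 / real (Suc n)))"
      by (rule mult_left_mono) simp
    then have "norm (D n x) \<le> K" unfolding D_def real_norm_def abs_mult by simp
    then show ?thesis using True by simp
  next
    case False
    then have n1: "norm x > r + 1" by simp
    have "norm ((1 / real (Suc n)) *\<^sub>R (axis i 1 :: real ^ 'n)) \<le> 1" by (simp add: norm_axis_1)
    then have "norm (x + (1 / real (Suc n)) *\<^sub>R axis i 1) > r"
      using n1 norm_diff_ineq[of x "(1 / real (Suc n)) *\<^sub>R axis i 1"] by linarith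
    then have "F (x + (1 / real (Suc n)) *\<^sub>R axis i 1) = 0" "F x = 0" using r(2) n1 by force+
    then show ?thesis by (simp add: D_def K)
  qed
  have int: "integrable lborel (\<lambda>x::real^'n. K * indicator (cball 0 (r + 1)) x)"
    by (intro integrable_mult_right integrable_real_indicator) (use emeasure_bounded_finite[of "cball (0::real^'n) (r + 1)"] in auto)
  have meas [measurable]: "F \<in> borel_measurable borel" "partial_deriv i F \<in> borel_measurable borel"
    using Fc F smooth_continuous[OF test_function_smooth[OF test_function_partial_deriv[OF F]]]
    by (auto intro: borel_measurable_continuous_onI)
  have [measurable]: "D n \<in> borel_measurable borel" for n unfolding D_def[abs_def] by measurable
  have lim: "(\<lambda>n. D n x) \<longlonglongrightarrow> partial_deriv i F x" for x
  proof -
    have "((\<lambda>t. F (x + t *\<^sub>R axis i 1)) has_real_derivative partial_deriv i F x) (at 0)"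
      using has_real_derivative_line[OF Fd, of x "axis i 1" 0]
      by (simp add: axis_def if_distrib [where f="\<lambda>c. c * _"] cong: if_cong)
    then have "((\<lambda>h. (F (x + h *\<^sub>R axis i 1) - F x) / h) \<longlongrightarrow> partial_deriv i F x) (at 0)"
      by (simp add: DERIV_def)
    moreover have "filterlim (\<lambda>n. 1 / real (Suc n)) (at 0) sequentially"
      unfolding filterlim_at using LIMSEQ_inverse_real_of_nat by (auto simp: inverse_eq_divide)
    ultimately have "((\<lambda>n. (F (x + (1 / real (Suc n)) *\<^sub>R axis i 1) - F x) / (1 / real (Suc n))) \<longlongrightarrow> partial_deriv i F x) sequentially"
      by (rule filterlim_compose)
    then show ?thesis unfolding D_def by (simp add: mult.commute)
  qed
  have "(\<lambda>n. LINT x|lborel. D n x) \<longlonglongrightarrow> (LINT x|lborel. partial_deriv i F x)"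
    by (rule integral_dominated_convergence[OF _ _ int]) (use bnd lim in \<open>auto simp: D_def\<close>)
  moreover have "(LINT x|lborel. D n x) = 0" for n
  proof -
    have iF: "integrable lborel F"
      using F Fc by (intro integrable_continuous_bounded_support) (auto simp: test_function_iff)
    have "integrable lborel (D n)"
      by (rule Bochner_Integration.integrable_bound[OF int]) (use bnd[of n] K in auto)
    then have "integrable lborel (\<lambda>x. D n x / real (Suc n) + F x)" using iF by simp
    then have iF2: "integrable lborel (\<lambda>x. F (x + (1 / real (Suc n)) *\<^sub>R axis i 1))" by (simp add: D_def)
    show ?thesis unfolding D_def using iF iF2 integral_translation[of F "(1 / real (Suc n)) *\<^sub>R axis i 1"] by simp
  qed
  ultimately show ?thesis by (simp add: LIMSEQ_const_iff)
qed

section \<open>The generator in divergence form\<close>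

abbreviation diffusion :: "real ^ 'n ^ 'n \<Rightarrow> real ^ 'n::finite ^ 'n" where
  "diffusion \<sigma> \<equiv> \<sigma> ** transpose \<sigma>"

lemma diffusion_sym: "diffusion \<sigma> $ i $ j = diffusion \<sigma> $ j $ i"
  by (simp add: matrix_matrix_mult_def transpose_def mult.commute)

lemma unperturbed_generator_sum:
  "unperturbed_generator \<sigma> V f x =
     (\<Sum>i\<in>UNIV. \<Sum>j\<in>UNIV. diffusion \<sigma> $ i $ j *
        (partial_deriv i (partial_deriv j f) x - partial_deriv i V x * partial_deriv j f x))"
proof -
  have "(diffusion \<sigma> *v grad V x) \<bullet> grad f x
      = (\<Sum>j\<in>UNIV. \<Sum>i\<in>UNIV. diffusion \<sigma> $ j $ i * partial_deriv i V x * partial_deriv j f x)"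
    by (simp add: inner_vec_def matrix_vector_mult_def grad_def sum_distrib_right)
  also have "\<dots> = (\<Sum>i\<in>UNIV. \<Sum>j\<in>UNIV. diffusion \<sigma> $ i $ j * (partial_deriv i V x * partial_deriv j f x))"
    by (subst sum.swap) (auto simp: diffusion_sym[of \<sigma>] mult_ac intro!: sum.cong)
  finally show ?thesis
    unfolding unperturbed_generator_def
    by (simp add: inner_vec_def hessian_def right_diff_distrib sum_subtractf)
qed

lemma smooth_generator: "smooth V \<Longrightarrow> smooth f \<Longrightarrow> smooth (unperturbed_generator \<sigma> V f)"
  unfolding unperturbed_generator_sum[abs_def] by (intro smooth_intros)

lemma test_function_generator:
  "smooth V \<Longrightarrow> test_function f \<Longrightarrow> test_function (unperturbed_generator \<sigma> V f)"
  unfolding unperturbed_generator_sum[abs_def]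
  by (intro test_function_sum test_function_cmult test_function_diff test_function_partial_deriv
    test_function_mult smooth_partial_deriv)

text \<open>The carre du champ of the generator:
  \<open>L (f g) = f L g + g L f + 2 carre f g\<close>. Writing it with \<sigma> transposed makes
  symmetry and nonnegativity on the diagonal evident.\<close>

definition carre :: "real ^ 'n ^ 'n \<Rightarrow> (real ^ 'n::finite \<Rightarrow> real) \<Rightarrow> (real ^ 'n \<Rightarrow> real) \<Rightarrow> real ^ 'n \<Rightarrow> real" where
  "carre \<sigma> f g x = (transpose \<sigma> *v grad f x) \<bullet> (transpose \<sigma> *v grad g x)"

lemma carre_alt: "carre \<sigma> f g x = (diffusion \<sigma> *v grad f x) \<bullet> grad g x"
proof -
  have "(\<sigma> *v u) \<bullet> w = u \<bullet> (transpose \<sigma> *v w)" for u w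
    using dot_lmul_matrix[of u "transpose \<sigma>" w] by (simp only: vector_transpose_matrix)
  then show ?thesis unfolding carre_def by (metis matrix_vector_mul_assoc)
qed

lemma carre_sum: "carre \<sigma> f g x = (\<Sum>i\<in>UNIV. \<Sum>j\<in>UNIV. diffusion \<sigma> $ i $ j * partial_deriv j f x * partial_deriv i g x)"
  unfolding carre_alt by (simp add: inner_vec_def matrix_vector_mult_def grad_def sum_distrib_right)

lemma smooth_exp_uminus: "smooth V \<Longrightarrow> smooth (\<lambda>x. exp (- V x))"
  unfolding smooth_def
proof
  fix k assume "\<forall>k. continuously_differentiable k V"
  then have "continuously_differentiable k (\<lambda>x. (-1) ^ 0 * exp (- V x))"
    by (intro continuously_differentiable_compose[of k V "\<lambda>j s. (-1) ^ j * exp (- s)"])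
      (auto intro!: derivative_eq_intros continuous_intros)
  then show "continuously_differentiable k (\<lambda>x. exp (- V x))" by simp
qed

lemma partial_deriv_exp_uminus:
  "smooth V \<Longrightarrow> partial_deriv i (\<lambda>x. exp (- V x)) = (\<lambda>x. - exp (- V x) * partial_deriv i V x)"
  by (rule partial_deriv_compose) (auto intro!: derivative_eq_intros smooth_differentiable)

lemma test_function_mult': "smooth g \<Longrightarrow> test_function f \<Longrightarrow> test_function (\<lambda>x. f x * g x)"
  using test_function_mult[of g f] by (simp add: mult.commute)

lemma test_function_carre:
  "test_function f \<Longrightarrow> smooth g \<Longrightarrow> test_function (carre \<sigma> f g)"
  "smooth f \<Longrightarrow> test_function g \<Longrightarrow> test_function (carre \<sigma> f g)"
  unfolding carre_sum[abs_def]
  by (intro test_function_sum test_function_mult' test_function_cmult smooth_partial_deriv test_function_partial_deriv; assumption)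
    (intro test_function_sum test_function_mult smooth_cmult smooth_partial_deriv test_function_partial_deriv; assumption)

lemma test_function_integrable: "test_function f \<Longrightarrow> integrable lborel f"
  by (intro integrable_continuous_bounded_support) (auto simp: test_function_iff smooth_continuous)

text \<open>\<open>exp (- V) L f\<close> is the divergence of \<open>exp (- V)\<close> times the
  flux \<open>\<sigma>\<sigma>\<^sup>T \<nabla>f\<close>; multiplying the flux by g yields the field
  \<open>F\<close>. Compact support is asked of f alone, so g = 1 is allowed and shows that
  \<open>L f\<close> has mean 0.\<close>

lemma generator_integration_by_parts:
  fixes f g V :: "real ^ 'n::finite \<Rightarrow> real"
  assumes V: "smooth V" and f: "test_function f" and g: "smooth g"
  shows "(LINT x|lborel. g x * unperturbed_generator \<sigma> V f x * exp (- V x))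
       = - (LINT x|lborel. carre \<sigma> f g x * exp (- V x))"
proof -
  define H where "H i x = (\<Sum>j\<in>UNIV. diffusion \<sigma> $ i $ j * partial_deriv j f x)" for i x
  define F where "F i x = exp (- V x) * (g x * H i x)" for i x
  have H: "test_function (H i)" for i
    unfolding H_def[abs_def] by (intro test_function_sum test_function_cmult test_function_partial_deriv f)
  have F: "test_function (F i)" for i
    unfolding F_def[abs_def] by (intro test_function_mult H g smooth_exp_uminus V)
  note sd = smooth_differentiable
  have pH: "partial_deriv i (H i) = (\<lambda>x. \<Sum>j\<in>UNIV. diffusion \<sigma> $ i $ j * partial_deriv i (partial_deriv j f) x)" for i
  proof -
    have *: "partial_deriv i (\<lambda>x. \<Sum>j\<in>J. diffusion \<sigma> $ i $ j * partial_deriv j f x) =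
       (\<lambda>x. \<Sum>j\<in>J. diffusion \<sigma> $ i $ j * partial_deriv i (partial_deriv j f) x)" if "finite J" for J
      using that
    proof (induction J)
      case (insert j J)
      have "partial_deriv i (\<lambda>x. diffusion \<sigma> $ i $ j * partial_deriv j f x + (\<Sum>j\<in>J. diffusion \<sigma> $ i $ j * partial_deriv j f x))
        = (\<lambda>x. partial_deriv i (\<lambda>x. diffusion \<sigma> $ i $ j * partial_deriv j f x) x + partial_deriv i (\<lambda>x. \<Sum>j\<in>J. diffusion \<sigma> $ i $ j * partial_deriv j f x) x)"
        by (intro partial_deriv_add sd smooth_intros test_function_smooth f)
      moreover have "partial_deriv i (\<lambda>x. diffusion \<sigma> $ i $ j * partial_deriv j f x) = (\<lambda>x. diffusion \<sigma> $ i $ j * partial_deriv i (partial_deriv j f) x)"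
        using test_function_smooth[OF f] by (subst partial_deriv_mult) (auto simp: partial_deriv_const intro!: sd smooth_intros)
      ultimately show ?case using insert by simp
    qed (simp add: partial_deriv_const)
    show ?thesis unfolding H_def[abs_def] by (rule *) simp
  qed
  have pF: "partial_deriv i (F i) x = exp (- V x) * (g x * (\<Sum>j\<in>UNIV. diffusion \<sigma> $ i $ j * (partial_deriv i (partial_deriv j f) x - partial_deriv i V x * partial_deriv j f x)))
     + exp (- V x) * (\<Sum>j\<in>UNIV. diffusion \<sigma> $ i $ j * partial_deriv j f x * partial_deriv i g x)" for i x
  proof -
    have "partial_deriv i (F i) = (\<lambda>x. exp (- V x) * partial_deriv i (\<lambda>x. g x * H i x) x + partial_deriv i (\<lambda>x. exp (- V x)) x * (g x * H i x))"
      unfolding F_def[abs_def]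
      by (intro partial_deriv_mult sd smooth_mult smooth_exp_uminus V g test_function_smooth H)
    moreover have "partial_deriv i (\<lambda>x. g x * H i x) = (\<lambda>x. g x * partial_deriv i (H i) x + partial_deriv i g x * H i x)"
      by (intro partial_deriv_mult sd g test_function_smooth H)
    ultimately show ?thesis
      by (simp add: partial_deriv_exp_uminus[OF V] pH H_def sum_subtractf right_diff_distrib sum_distrib_left sum_distrib_right algebra_simps sum_negf)
  qed
  have "0 = (\<Sum>i\<in>UNIV. LINT x|lborel. partial_deriv i (F i) x)"
    using integral_partial_deriv_eq_0[OF F] by simp
  also have "\<dots> = (LINT x|lborel. (\<Sum>i\<in>UNIV. partial_deriv i (F i) x))"
    by (intro Bochner_Integration.integral_sum[symmetric] test_function_integrable test_function_partial_deriv F)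
  also have "\<dots> = (LINT x|lborel. g x * unperturbed_generator \<sigma> V f x * exp (- V x) + carre \<sigma> f g x * exp (- V x))"
    by (intro Bochner_Integration.integral_cong refl)
      (simp add: pF unperturbed_generator_sum carre_sum sum.distrib sum_distrib_left sum_distrib_right mult_ac)
  also have "\<dots> = (LINT x|lborel. g x * unperturbed_generator \<sigma> V f x * exp (- V x)) + (LINT x|lborel. carre \<sigma> f g x * exp (- V x))"
    by (intro Bochner_Integration.integral_add test_function_integrable test_function_mult' test_function_mult
        smooth_exp_uminus V g test_function_generator f test_function_carre(1))
  finally show ?thesis by simp
qed

section \<open>The Hilbert space of square-integrable functions\<close>

lemma L2_space_iff: "f \<in> L2_space \<mu> \<longleftrightarrow> f \<in> borel_measurable \<mu> \<and> integrable \<mu> (\<lambda>x. (f x)\<^sup>2)"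
  by (simp add: L2_space_def)

lemma L2_space_integrable_mult:
  assumes "f \<in> L2_space \<mu>" "g \<in> L2_space \<mu>" shows "integrable \<mu> (\<lambda>x. f x * g x)"
proof (rule Bochner_Integration.integrable_bound)
  show "integrable \<mu> (\<lambda>x. (f x)\<^sup>2 + (g x)\<^sup>2)" "(\<lambda>x. f x * g x) \<in> borel_measurable \<mu>"
    using assms by (auto simp: L2_space_iff)
  have "\<bar>f x * g x\<bar> \<le> (f x)\<^sup>2 + (g x)\<^sup>2" for x
  proof -
    have "0 \<le> (\<bar>f x\<bar> - \<bar>g x\<bar>)\<^sup>2" by simp
    then have "2 * \<bar>f x * g x\<bar> \<le> (f x)\<^sup>2 + (g x)\<^sup>2" by (simp add: power2_diff abs_mult)
    then show ?thesis by linarith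
  qed
  then show "AE x in \<mu>. norm (f x * g x) \<le> norm ((f x)\<^sup>2 + (g x)\<^sup>2)" by simp
qed

lemma L2_space_add:
  assumes "f \<in> L2_space \<mu>" "g \<in> L2_space \<mu>" shows "(\<lambda>x. f x + g x) \<in> L2_space \<mu>"
proof -
  have "integrable \<mu> (\<lambda>x. (f x)\<^sup>2 + (g x)\<^sup>2 + 2 * (f x * g x))"
    using assms L2_space_integrable_mult[OF assms] by (auto simp: L2_space_iff)
  then show ?thesis using assms by (auto simp: L2_space_iff power2_sum mult.assoc)
qed

lemma L2_space_scale: "f \<in> L2_space \<mu> \<Longrightarrow> (\<lambda>x. c * f x) \<in> L2_space \<mu>"
  by (auto simp: L2_space_iff power_mult_distrib)

lemma L2_space_diff: "f \<in> L2_space \<mu> \<Longrightarrow> g \<in> L2_space \<mu> \<Longrightarrow> (\<lambda>x. f x - g x) \<in> L2_space \<mu>"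
  using L2_space_add[of f \<mu> "\<lambda>x. - 1 * g x"] L2_space_scale[of g \<mu> "- 1"] by simp

lemma L2_space_zero: "(\<lambda>x. 0) \<in> L2_space \<mu>"
  by (simp add: L2_space_iff)

\<comment> \<open>A type cannot depend on V, so the Hilbert space is built once over Lebesgue
  measure, and the spaces L2(\<mu>) are carried over by an isometry. Classes rather than functions
  are needed for a norm that separates points.\<close>
quotient_type (overloaded) 'a l2 = "'a::euclidean_space \<Rightarrow> real" / partial:
  "\<lambda>f g. f \<in> L2_space lborel \<and> g \<in> L2_space lborel \<and> (AE x in lborel. f x = g x)"
proof (rule part_equivpI)
  show "\<exists>f::'a \<Rightarrow> real. f \<in> L2_space lborel \<and> f \<in> L2_space lborel \<and> (AE x in lborel. f x = f x)"
    using L2_space_zero by auto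
  show "symp (\<lambda>f (g::'a \<Rightarrow> real). f \<in> L2_space lborel \<and> g \<in> L2_space lborel \<and> (AE x in lborel. f x = g x))"
    by (rule sympI) auto
  show "transp (\<lambda>f (g::'a \<Rightarrow> real). f \<in> L2_space lborel \<and> g \<in> L2_space lborel \<and> (AE x in lborel. f x = g x))"
    by (rule transpI) auto
qed

instantiation l2 :: (euclidean_space) real_inner
begin

lift_definition zero_l2 :: "'a l2" is "\<lambda>x. 0" by (simp add: L2_space_zero)
lift_definition plus_l2 :: "'a l2 \<Rightarrow> 'a l2 \<Rightarrow> 'a l2" is "\<lambda>f g x. f x + g x"
  by (auto intro: L2_space_add)
lift_definition minus_l2 :: "'a l2 \<Rightarrow> 'a l2 \<Rightarrow> 'a l2" is "\<lambda>f g x. f x - g x"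
  by (auto intro: L2_space_diff)
lift_definition uminus_l2 :: "'a l2 \<Rightarrow> 'a l2" is "\<lambda>f x. - f x"
  using L2_space_scale[of _ _ "-1"] by auto
lift_definition scaleR_l2 :: "real \<Rightarrow> 'a l2 \<Rightarrow> 'a l2" is "\<lambda>c f x. c * f x"
  by (auto intro: L2_space_scale)
lift_definition inner_l2 :: "'a l2 \<Rightarrow> 'a l2 \<Rightarrow> real" is "\<lambda>f g. LINT x|lborel. f x * g x"
  by (rule integral_cong_AE) (auto simp: L2_space_iff)
definition norm_l2 :: "'a l2 \<Rightarrow> real" where "norm_l2 f = sqrt (inner f f)"
definition sgn_l2 :: "'a l2 \<Rightarrow> 'a l2" where "sgn_l2 f = scaleR (inverse (norm f)) f"
definition dist_l2 :: "'a l2 \<Rightarrow> 'a l2 \<Rightarrow> real" where "dist_l2 f g = norm (f - g)"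
definition uniformity_l2 :: "('a l2 \<times> 'a l2) filter" where
  "uniformity_l2 = (INF e\<in>{0<..}. principal {(x, y). dist x y < e})"
definition open_l2 :: "'a l2 set \<Rightarrow> bool" where
  "open_l2 U \<longleftrightarrow> (\<forall>x\<in>U. \<forall>\<^sub>F (x', y) in uniformity. x' = x \<longrightarrow> y \<in> U)"

instance
proof
  fix x y z :: "'a l2" and r s :: real and U :: "'a l2 set"
  show "x + y + z = x + (y + z)" by transfer (auto intro!: L2_space_add simp: add.assoc)
  show "x + y = y + x" by transfer (auto intro!: L2_space_add simp: add.commute)
  show "0 + x = x" by transfer auto
  show "- x + x = 0" by transfer (auto simp: L2_space_zero)
  show "x - y = x + - y"
    by transfer (auto intro!: L2_space_diff)
  show "r *\<^sub>R (x + y) = r *\<^sub>R x + r *\<^sub>R y"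
    by transfer (auto intro!: L2_space_scale L2_space_add simp: distrib_left)
  show "(r + s) *\<^sub>R x = r *\<^sub>R x + s *\<^sub>R x"
    by transfer (auto intro!: L2_space_scale L2_space_add simp: distrib_right)
  show "r *\<^sub>R s *\<^sub>R x = (r * s) *\<^sub>R x"
    by transfer (auto intro!: L2_space_scale simp: mult.assoc)
  show "1 *\<^sub>R x = x" by transfer auto
  show "sgn x = scaleR (inverse (norm x)) x" by (rule sgn_l2_def)
  show "dist x y = norm (x - y)" by (rule dist_l2_def)
  show "uniformity = (INF e\<in>{0<..}. principal {(x, y::'a l2). dist x y < e})" by (rule uniformity_l2_def)
  show "open U = (\<forall>x\<in>U. \<forall>\<^sub>F (x', y) in uniformity. x' = x \<longrightarrow> y \<in> U)" by (rule open_l2_def)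
  show "inner x y = inner y x" by transfer (simp add: mult.commute)
  show "inner (x + y) z = inner x z + inner y z"
    by transfer (simp add: distrib_right L2_space_integrable_mult)
  show "inner (r *\<^sub>R x) y = r * inner x y"
    by transfer (simp add: mult.assoc L2_space_integrable_mult)
  show "0 \<le> inner x x" by transfer simp
  show "(inner x x = 0) = (x = 0)"
    by transfer (auto simp: L2_space_iff power2_eq_square[symmetric] integral_nonneg_eq_0_iff_AE)
  show "norm x = sqrt (inner x x)" by (rule norm_l2_def)
qed

end

lemma rep_l2_mem: "rep_l2 F \<in> L2_space lborel"
  using Quotient_rep_reflp[OF Quotient_l2, of F] by simp

lemma abs_rep_l2: "abs_l2 (rep_l2 F) = F"
  by (rule Quotient_abs_rep[OF Quotient_l2])

lemma abs_l2_eq_iff: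
  "f \<in> L2_space lborel \<Longrightarrow> g \<in> L2_space lborel \<Longrightarrow> abs_l2 f = abs_l2 g \<longleftrightarrow> (AE x in lborel. f x = g x)"
  using Quotient_rel[OF Quotient_l2, of f g] by auto

lemma abs_l2_add: "f \<in> L2_space lborel \<Longrightarrow> g \<in> L2_space lborel \<Longrightarrow>
    abs_l2 (\<lambda>x. f x + g x) = abs_l2 f + abs_l2 g"
  by (rule plus_l2.abs_eq[symmetric]) auto

lemma abs_l2_diff: "f \<in> L2_space lborel \<Longrightarrow> g \<in> L2_space lborel \<Longrightarrow>
    abs_l2 (\<lambda>x. f x - g x) = abs_l2 f - abs_l2 g"
  by (rule minus_l2.abs_eq[symmetric]) auto

lemma abs_l2_scale: "f \<in> L2_space lborel \<Longrightarrow> abs_l2 (\<lambda>x. c * f x) = c *\<^sub>R abs_l2 f"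
  by (rule scaleR_l2.abs_eq[symmetric]) auto

lemma inner_abs_l2: "f \<in> L2_space lborel \<Longrightarrow> g \<in> L2_space lborel \<Longrightarrow>
    abs_l2 f \<bullet> abs_l2 g = (LINT x|lborel. f x * g x)"
  by (rule inner_l2.abs_eq) auto

lemma norm_abs_l2: "f \<in> L2_space lborel \<Longrightarrow> norm (abs_l2 f) = L2_norm lborel f"
  by (simp add: norm_l2_def inner_abs_l2 L2_norm_def power2_eq_square)

text \<open>By the arithmetic-geometric mean inequality 2 |d n| is at most 2^(-n) + 2^n (d n)^2.
  This turns a bound on square integrals into absolute convergence at almost every point.\<close>

lemma summable_if_summable_weighted_squares:
  fixes d :: "nat \<Rightarrow> real"
  assumes "summable (\<lambda>n. 2 ^ n * (d n)\<^sup>2)"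
  shows "summable d"
proof (rule summable_rabs_cancel, rule summable_comparison_test')
  show "summable (\<lambda>n. (1 / 2) ^ n + 2 ^ n * (d n)\<^sup>2)"
    using assms by (intro summable_add) simp_all
  fix n assume "n \<ge> (0::nat)"
  have "0 \<le> (1 - 2 ^ n * \<bar>d n\<bar>)\<^sup>2" by simp
  then have "2 * 2 ^ n * \<bar>d n\<bar> \<le> 1 + (2 ^ n)\<^sup>2 * (d n)\<^sup>2"
    by (simp add: power2_diff power_mult_distrib)
  then have "2 * 2 ^ n * \<bar>d n\<bar> / 2 ^ n \<le> (1 + (2 ^ n)\<^sup>2 * (d n)\<^sup>2) / 2 ^ n"
    by (rule divide_right_mono) simp
  then have "2 * \<bar>d n\<bar> \<le> (1 / 2) ^ n + 2 ^ n * (d n)\<^sup>2"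
    by (simp add: add_divide_distrib power2_eq_square power_one_over)
  moreover have "0 \<le> (1 / 2 :: real) ^ n + 2 ^ n * (d n)\<^sup>2" by simp
  ultimately show "norm \<bar>d n\<bar> \<le> (1 / 2) ^ n + 2 ^ n * (d n)\<^sup>2" by simp
qed

text \<open>The Riesz-Fischer argument for a rapidly convergent sequence. The squared increments
  weighted with 2^n have integrals at most 2^(-n), so the weighted sum is finite almost everywhere
  and the sequence converges there. Fatou's lemma then bounds the distance to the pointwise
  limit.\<close>

lemma l2_fast_Cauchy_convergent:
  fixes Y :: "nat \<Rightarrow> 'a::euclidean_space l2"
  assumes Y: "\<And>n. norm (Y (Suc n) - Y n) \<le> (1 / 2) ^ n"
  shows "convergent Y"
proof -
  define y where "y n = rep_l2 (Y n)" for n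
  have y: "y n \<in> L2_space lborel" for n by (simp add: y_def rep_l2_mem)
  have [measurable]: "y n \<in> borel_measurable borel" for n using y[of n] by (simp add: L2_space_iff)
  have Yy: "Y n = abs_l2 (y n)" for n by (simp add: y_def abs_rep_l2)
  have sq: "(norm (Y m - Y n))\<^sup>2 = (LINT x|lborel. (y m x - y n x)\<^sup>2)" for m n
    by (simp add: Yy abs_l2_diff[symmetric] y norm_abs_l2 L2_space_diff L2_norm_def integral_nonneg_AE)
  have isq: "integrable lborel (\<lambda>x. (y m x - y n x)\<^sup>2)" for m n
    using L2_space_diff[OF y y, of m n] by (simp add: L2_space_iff)
  have dist: "norm (Y m - Y n) \<le> 2 * (1 / 2) ^ n" if "n \<le> m" for m n
  proof -
    have "norm (Y m - Y n) \<le> 2 * (1 / 2) ^ n - 2 * (1 / 2) ^ m"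
      using that
    proof (induction m rule: dec_induct)
      case (step m)
      have "norm (Y (Suc m) - Y n) \<le> norm (Y (Suc m) - Y m) + norm (Y m - Y n)"
        using norm_triangle_ineq[of "Y (Suc m) - Y m" "Y m - Y n"] by simp
      then show ?case using step Y[of m] by simp
    qed simp
    moreover have "0 \<le> 2 * (1 / 2 :: real) ^ m" by simp
    ultimately show ?thesis by linarith
  qed
  define d where "d n x = y (Suc n) x - y n x" for n x
  have [measurable]: "d n \<in> borel_measurable borel" for n unfolding d_def[abs_def] by measurable
  have "(\<integral>\<^sup>+x. (\<Sum>n. ennreal (2 ^ n * (d n x)\<^sup>2)) \<partial>lborel) = (\<Sum>n. \<integral>\<^sup>+x. ennreal (2 ^ n * (d n x)\<^sup>2) \<partial>lborel)"
    by (rule nn_integral_suminf) auto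
  also have "\<dots> \<le> (\<Sum>n. ennreal ((1 / 2) ^ n))"
  proof (rule suminf_le)
    fix n
    have "(\<integral>\<^sup>+x. ennreal (2 ^ n * (d n x)\<^sup>2) \<partial>lborel) = ennreal (LINT x|lborel. 2 ^ n * (d n x)\<^sup>2)"
      using isq[of "Suc n" n] by (intro nn_integral_eq_integral) (auto simp: d_def)
    also have "(LINT x|lborel. 2 ^ n * (d n x)\<^sup>2) = 2 ^ n * (norm (Y (Suc n) - Y n))\<^sup>2"
      unfolding sq by (simp add: d_def)
    also have "\<dots> \<le> 2 ^ n * ((1 / 2) ^ n)\<^sup>2"
      by (intro mult_left_mono power_mono Y) auto
    also have "\<dots> = (1 / 2) ^ n" by (simp add: power2_eq_square power_one_over)
    finally show "(\<integral>\<^sup>+x. ennreal (2 ^ n * (d n x)\<^sup>2) \<partial>lborel) \<le> ennreal ((1 / 2) ^ n)"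
      by (simp add: ennreal_leI)
  qed auto
  also have "\<dots> < \<top>"
    by (subst suminf_ennreal2) auto
  finally have "AE x in lborel. (\<Sum>n. ennreal (2 ^ n * (d n x)\<^sup>2)) \<noteq> \<infinity>"
    by (intro nn_integral_noteq_infinite) auto
  then have conv: "AE x in lborel. convergent (\<lambda>n. y n x)"
  proof eventually_elim
    case (elim x)
    then have "summable (\<lambda>n. 2 ^ n * (d n x)\<^sup>2)"
      by (intro summable_suminf_not_top) auto
    then have "summable (\<lambda>n. y (Suc n) x - y n x)"
      unfolding d_def by (rule summable_if_summable_weighted_squares)
    then have "convergent (\<lambda>n. \<Sum>i<n. y (Suc i) x - y i x)" by (simp add: summable_iff_convergent)
    moreover have "(\<lambda>n. \<Sum>i<n. y (Suc i) x - y i x) = (\<lambda>n. y n x - y 0 x)"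
      by (rule ext) (rule sum_lessThan_telescope)
    ultimately have "convergent (\<lambda>n. y n x - y 0 x)" by simp
    then have "convergent (\<lambda>n. (y n x - y 0 x) + y 0 x)" by (intro convergent_add convergent_const)
    then show ?case by simp
  qed
  define z where "z x = lim (\<lambda>n. y n x)" for x
  have z_meas [measurable]: "z \<in> borel_measurable borel" unfolding z_def[abs_def] by measurable
  have zlim: "AE x in lborel. (\<lambda>n. y n x) \<longlonglongrightarrow> z x"
    using conv by eventually_elim (simp add: z_def convergent_LIMSEQ_iff)
  have bound: "(\<integral>\<^sup>+x. ennreal ((z x - y n x)\<^sup>2) \<partial>lborel) \<le> ennreal ((2 * (1 / 2) ^ n)\<^sup>2)" for n
  proof -
    have "(\<integral>\<^sup>+x. ennreal ((z x - y n x)\<^sup>2) \<partial>lborel) = (\<integral>\<^sup>+x. liminf (\<lambda>m. ennreal ((y m x - y n x)\<^sup>2)) \<partial>lborel)"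
    proof (rule nn_integral_cong_AE)
      show "AE x in lborel. ennreal ((z x - y n x)\<^sup>2) = liminf (\<lambda>m. ennreal ((y m x - y n x)\<^sup>2))"
        using zlim
      proof eventually_elim
        case (elim x)
        have "(\<lambda>m. ennreal ((y m x - y n x)\<^sup>2)) \<longlonglongrightarrow> ennreal ((z x - y n x)\<^sup>2)"
          by (intro tendsto_ennrealI tendsto_intros elim)
        then show ?case by (rule lim_imp_Liminf[OF sequentially_bot, symmetric])
      qed
    qed
    also have "\<dots> \<le> liminf (\<lambda>m. \<integral>\<^sup>+x. ennreal ((y m x - y n x)\<^sup>2) \<partial>lborel)"
      by (rule nn_integral_liminf) auto
    also have "\<dots> \<le> liminf (\<lambda>m. ennreal ((2 * (1 / 2) ^ n)\<^sup>2))"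
    proof (rule Liminf_mono, rule eventually_sequentiallyI)
      fix m assume "n \<le> m"
      have "(\<integral>\<^sup>+x. ennreal ((y m x - y n x)\<^sup>2) \<partial>lborel) = ennreal ((norm (Y m - Y n))\<^sup>2)"
        unfolding sq by (intro nn_integral_eq_integral isq) auto
      also have "\<dots> \<le> ennreal ((2 * (1 / 2) ^ n)\<^sup>2)"
        by (intro ennreal_leI power_mono dist \<open>n \<le> m\<close>) simp
      finally show "(\<integral>\<^sup>+x. ennreal ((y m x - y n x)\<^sup>2) \<partial>lborel) \<le> ennreal ((2 * (1 / 2) ^ n)\<^sup>2)" .
    qed
    also have "\<dots> = ennreal ((2 * (1 / 2) ^ n)\<^sup>2)" by (simp add: Liminf_const)
    finally show ?thesis .
  qed
  have zy: "(\<lambda>x. z x - y n x) \<in> L2_space lborel" for n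
  proof -
    have "integrable lborel (\<lambda>x. (z x - y n x)\<^sup>2)"
      using le_less_trans[OF bound[of n]] by (intro integrableI_bounded) auto
    then show ?thesis by (auto simp: L2_space_iff)
  qed
  have z: "z \<in> L2_space lborel" using L2_space_add[OF zy[of 0] y[of 0]] by simp
  have "norm (Y n - abs_l2 z) \<le> 2 * (1 / 2) ^ n" for n
  proof -
    have norm_eq: "norm (Y n - abs_l2 z) = L2_norm lborel (\<lambda>x. z x - y n x)"
      by (subst norm_minus_commute) (simp add: Yy abs_l2_diff[symmetric] norm_abs_l2 y z zy)
    have "(LINT x|lborel. (z x - y n x)\<^sup>2) \<le> (2 * (1 / 2) ^ n)\<^sup>2"
      using bound[of n] zy[of n] by (subst (asm) nn_integral_eq_integral) (auto simp: L2_space_iff)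
    then have "L2_norm lborel (\<lambda>x. z x - y n x) \<le> 2 * (1 / 2) ^ n"
      unfolding L2_norm_def by (intro real_le_lsqrt) auto
    then show ?thesis using norm_eq by simp
  qed
  moreover have "(\<lambda>n. 2 * (1 / 2 :: real) ^ n) \<longlonglongrightarrow> 0" by (intro tendsto_eq_intros) auto
  ultimately have "(\<lambda>n. Y n - abs_l2 z) \<longlonglongrightarrow> 0"
    by (intro Lim_null_comparison[of "\<lambda>n. Y n - abs_l2 z" "\<lambda>n. 2 * (1 / 2) ^ n"] always_eventually allI)
  then have "Y \<longlonglongrightarrow> abs_l2 z" by (rule LIM_zero_cancel)
  then show ?thesis unfolding convergent_def by blast
qed

instance l2 :: (euclidean_space) complete_space
proof
  fix X :: "nat \<Rightarrow> 'a l2"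
  assume X: "Cauchy X"
  have "\<exists>N. \<forall>m\<ge>N. \<forall>n\<ge>N. norm (X m - X n) < (1 / 2) ^ k" for k
    using X[unfolded Cauchy_def, rule_format, of "(1/2) ^ k"] by (auto simp: dist_norm)
  then obtain N where N: "\<And>k m n. m \<ge> N k \<Longrightarrow> n \<ge> N k \<Longrightarrow> norm (X m - X n) < (1 / 2) ^ k" by metis
  \<comment> \<open>The sum makes \<open>r k\<close> at least \<open>N k\<close>, and the summand k
    makes r strictly increasing.\<close>
  define r where "r k = (\<Sum>i\<le>k. N i) + k" for k
  have rN: "N k \<le> r k" for k unfolding r_def using member_le_sum[of k "{..k}" N] by simp
  have r: "strict_mono r" by (rule strict_mono_Suc_iff[THEN iffD2]) (auto simp: r_def)
  have "norm ((X \<circ> r) (Suc k) - (X \<circ> r) k) \<le> (1 / 2) ^ k" for k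
    using N[of k "r (Suc k)" "r k"] rN[of k] strict_monoD[OF r, of k "Suc k"] by simp
  then have "convergent (X \<circ> r)" by (rule l2_fast_Cauchy_convergent)
  then show "convergent X"
    using Cauchy_converges_subseq[OF X r] unfolding convergent_def by blast
qed

section \<open>Symmetric dissipative semigroups\<close>

text \<open>Baire's theorem: the closed sets \<open>E k\<close> cover the space, so one of them
  contains a ball. Adding a vector of length r / 2 to the centre stays inside that ball, which
  explains the factor 4 k / r.\<close>

lemma uniform_boundedness:
  fixes T :: "nat \<Rightarrow> 'a::{real_normed_vector,complete_space} \<Rightarrow> 'b::real_normed_vector"
  assumes lin: "\<And>n. bounded_linear (T n)" and bdd: "\<And>x. \<exists>K. \<forall>n. norm (T n x) \<le> K"
  shows "\<exists>K. \<forall>n x. norm (T n x) \<le> K * norm x"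
proof -
  define E where "E k = {x. \<forall>n. norm (T n x) \<le> real k}" for k :: nat
  have closed: "closed (E k)" for k
  proof -
    have "closed {x. norm (T n x) \<le> real k}" for n
      by (intro closed_Collect_le continuous_on_norm linear_continuous_on lin continuous_on_const)
    then have "closed (\<Inter>n. {x. norm (T n x) \<le> real k})" by blast
    moreover have "(\<Inter>n. {x. norm (T n x) \<le> real k}) = E k" by (auto simp: E_def)
    ultimately show ?thesis by simp
  qed
  have cover: "\<Union>(range E) = UNIV"
  proof -
    have "\<exists>k. x \<in> E k" for x
    proof -
      obtain K where "\<And>n. norm (T n x) \<le> K" using bdd by blast
      moreover obtain k :: nat where "K \<le> real k" using real_arch_simple by blast
      ultimately have "\<forall>n. norm (T n x) \<le> real k" by (meson order_trans)
      then show ?thesis unfolding E_def by blast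
    qed
    then show ?thesis by auto
  qed
  have "\<exists>k. interior (E k) \<noteq> {}"
  proof (rule ccontr)
    assume "\<not> (\<exists>k. interior (E k) \<noteq> {})"
    then have "euclidean interior_of \<Union>(range E) = {}"
      using closed by (intro Baire_category_alt) (auto simp: completely_metrizable_space_euclidean)
    then show False unfolding cover by simp
  qed
  then obtain k x0 where "x0 \<in> interior (E k)" by blast
  then obtain r where r: "r > 0" "ball x0 r \<subseteq> E k" unfolding mem_interior by blast
  have "norm (T n y) \<le> 4 * real k / r * norm y" for n y
  proof (cases "y = 0")
    case True then show ?thesis using linear_simps(3)[OF lin] by simp
  next
    case False
    interpret bounded_linear "T n" by (rule lin)
    define c where "c = r / 2 / norm y"
    have "norm (c *\<^sub>R y) < r" using False r by (simp add: c_def)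
    then have "x0 + c *\<^sub>R y \<in> E k" "x0 \<in> E k" using r by (auto simp: dist_norm subset_iff)
    then have "norm (T n (x0 + c *\<^sub>R y)) \<le> k" "norm (T n x0) \<le> k" by (auto simp: E_def)
    then have "norm (T n (x0 + c *\<^sub>R y) - T n x0) \<le> 2 * real k"
      using norm_triangle_ineq4[of "T n (x0 + c *\<^sub>R y)" "T n x0"] by linarith
    moreover have "T n (x0 + c *\<^sub>R y) - T n x0 = T n (c *\<^sub>R y)" by (simp add: add)
    ultimately have "norm (T n (c *\<^sub>R y)) \<le> 2 * real k" by simp
    then show ?thesis using False r by (simp add: scaleR c_def field_simps)
  qed
  then show ?thesis by blast
qed

text \<open>The generator is a graph, since its domain is not the whole space. Symmetry and
  dissipativity are demanded of the generator, because this is what integration by parts provides;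
  monotone norms and symmetry of \<open>T t\<close> on the domain are derived.\<close>

locale symmetric_semigroup =
  fixes T :: "real \<Rightarrow> 'h \<Rightarrow> 'h::{real_inner,complete_space}" and G :: "('h \<times> 'h) set"
  assumes lin: "t \<ge> 0 \<Longrightarrow> bounded_linear (T t)"
    and T0: "T 0 x = x"
    and Tadd: "s \<ge> 0 \<Longrightarrow> t \<ge> 0 \<Longrightarrow> T (s + t) x = T s (T t x)"
    and cont0: "((\<lambda>t. T t x) \<longlongrightarrow> x) (at_right 0)"
    and G_iff: "(f, h) \<in> G \<longleftrightarrow> ((\<lambda>t. (T t f - f) /\<^sub>R t) \<longlongrightarrow> h) (at_right 0)"
    and sym: "(f, h) \<in> G \<Longrightarrow> (f', h') \<in> G \<Longrightarrow> h \<bullet> f' = f \<bullet> h'"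
    and dissipative: "(f, h) \<in> G \<Longrightarrow> h \<bullet> f \<le> 0"
begin

text \<open>If no bound held near 0, there would be times t n \<rightarrow> 0 at which the operator
  norm exceeds n + 1. Strong continuity makes every orbit bounded along this sequence, which
  contradicts the uniform boundedness principle.\<close>

lemma locally_bounded_0: "\<exists>\<delta>>0. \<exists>K\<ge>1. \<forall>t\<in>{0..\<delta>}. \<forall>x. norm (T t x) \<le> K * norm x"
proof (rule ccontr)
  assume *: "\<not> ?thesis"
  have "\<exists>t x. 0 \<le> t \<and> t \<le> 1 / real (Suc n) \<and> norm (T t x) > real (Suc n) * norm x" for n
  proof (rule ccontr)
    assume "\<not> ?thesis"
    then have "\<forall>t\<in>{0..1 / real (Suc n)}. \<forall>x. norm (T t x) \<le> real (Suc n) * norm x"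
      by (meson atLeastAtMost_iff not_le)
    moreover have "1 / real (Suc n) > 0" "real (Suc n) \<ge> 1" by auto
    ultimately show False using * by blast
  qed
  then obtain t x where t: "\<And>n. 0 \<le> t n" "\<And>n. t n \<le> 1 / real (Suc n)"
    and x: "\<And>n. norm (T (t n) (x n)) > real (Suc n) * norm (x n)" by metis
  have "\<exists>K. \<forall>n y. norm (T (t n) y) \<le> K * norm y"
  proof (rule uniform_boundedness)
    fix y
    have "(\<lambda>n. T (t n) y) \<longlonglongrightarrow> y"
    proof -
      have "((\<lambda>t. T t y) \<longlongrightarrow> T 0 y) (at 0 within {0..})" using cont0[of y] T0 by (simp add: at_within_Ici_at_right)
      then have "continuous (at 0 within {0..}) (\<lambda>t. T t y)" by (simp add: continuous_within)
      moreover have "t \<longlonglongrightarrow> 0"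
        using LIMSEQ_inverse_real_of_nat
        by (rule tendsto_sandwich[OF _ _ tendsto_const, rotated 2]) (use t in \<open>auto simp: inverse_eq_divide\<close>)
      ultimately show ?thesis using t T0[of y] unfolding continuous_within_sequentially o_def by auto
    qed
    then have "Bseq (\<lambda>n. T (t n) y)" by (intro convergent_imp_Bseq) (auto simp: convergent_def)
    then show "\<exists>K. \<forall>n. norm (T (t n) y) \<le> K" unfolding Bseq_def by blast
  qed (use t lin in auto)
  then obtain K where K: "\<And>n y. norm (T (t n) y) \<le> K * norm y" by blast
  obtain n :: nat where n: "K \<le> real n" using real_arch_simple by blast
  have "real (Suc n) * norm (x n) < K * norm (x n)" using x[of n] K[of n "x n"] by linarith
  moreover have "K * norm (x n) \<le> real (Suc n) * norm (x n)" using n by (intro mult_right_mono) auto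
  ultimately show False by linarith
qed

text \<open>The semigroup law propagates the bound over multiples of \<delta>; K \<ge> 1 lets
  shorter times share the same power of K.\<close>

lemma locally_bounded:
  obtains K where "K \<ge> 1" "\<And>t x. 0 \<le> t \<Longrightarrow> t \<le> S \<Longrightarrow> norm (T t x) \<le> K * norm x"
proof -
  obtain \<delta> K where \<delta>: "\<delta> > 0" and K: "K \<ge> 1" "\<And>t x. 0 \<le> t \<Longrightarrow> t \<le> \<delta> \<Longrightarrow> norm (T t x) \<le> K * norm x"
    using locally_bounded_0 by (metis atLeastAtMost_iff)
  have "\<forall>t x. 0 \<le> t \<longrightarrow> t \<le> real n * \<delta> \<longrightarrow> norm (T t x) \<le> K ^ n * norm x" for n
  proof (induction n)
    case 0 then show ?case using T0 by force
  next
    case (Suc n)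
    show ?case
    proof (intro allI impI)
      fix t x assume t: "0 \<le> t" "t \<le> real (Suc n) * \<delta>"
      show "norm (T t x) \<le> K ^ Suc n * norm x"
      proof (cases "t \<le> \<delta>")
        case True
        then have "norm (T t x) \<le> K ^ 1 * norm x" using K t by simp
        also have "\<dots> \<le> K ^ Suc n * norm x" using K(1) by (intro mult_right_mono power_increasing) auto
        finally show ?thesis .
      next
        case False
        have "norm (T t x) = norm (T \<delta> (T (t - \<delta>) x))" using Tadd[of \<delta> "t - \<delta>" x] False \<delta> by simp
        also have "\<dots> \<le> K * norm (T (t - \<delta>) x)" using K \<delta> by simp
        also have "\<dots> \<le> K * (K ^ n * norm x)" using Suc False t K(1) by (intro mult_left_mono) (auto simp: algebra_simps)
        finally show ?thesis by simp
      qed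
    qed
  qed
  moreover obtain n :: nat where "S / \<delta> \<le> real n" using real_arch_simple by blast
  then have "S \<le> real n * \<delta>" using \<delta> by (simp add: field_simps)
  ultimately show ?thesis using that[of "K ^ n"] K(1) one_le_power[of K n] by (meson order_trans)
qed

lemma T_diff: "t \<ge> 0 \<Longrightarrow> T t (x - y) = T t x - T t y"
  using linear_simps(2)[OF lin] by blast
lemma T_scale: "t \<ge> 0 \<Longrightarrow> T t (c *\<^sub>R x) = c *\<^sub>R T t x"
  using linear_simps(5)[OF lin] by blast

lemma cont_at_0: "((\<lambda>s. T \<bar>s - t\<bar> x) \<longlongrightarrow> x) (at t within A)"
proof -
  have "((\<lambda>t. T t x) \<longlongrightarrow> T 0 x) (at 0 within {0..})" using cont0[of x] T0 by (simp add: at_within_Ici_at_right)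
  then have "((\<lambda>t. T t x) \<longlongrightarrow> x) (inf (nhds 0) (principal {0..}))"
    unfolding T0 using tendsto_at_within_iff_tendsto_nhds[of "\<lambda>t. T t x" 0 "{0..}"] T0 by simp
  moreover have "filterlim (\<lambda>s. \<bar>s - t\<bar>) (inf (nhds 0) (principal {0..})) (at t within A)"
    unfolding filterlim_inf filterlim_principal
    by (auto intro!: tendsto_eq_intros)
  ultimately show ?thesis by (rule filterlim_compose)
qed

text \<open>The operator at the smaller time is factored out, so continuity from the left as well as
  from the right reduces to continuity at 0.\<close>

lemma increment_bound:
  assumes "\<And>t x. 0 \<le> t \<Longrightarrow> t \<le> S \<Longrightarrow> norm (T t x) \<le> K * norm x" "0 \<le> s" "s \<le> S" "0 \<le> t" "t \<le> S"
  shows "norm (T s x - T t x) \<le> K * norm (T \<bar>s - t\<bar> x - x)"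
proof -
  have *: "norm (T s x - T t x) \<le> K * norm (T (s - t) x - x)" if "0 \<le> t" "t \<le> s" "s \<le> S" for s t
    using that Tadd[of t "s - t" x] assms(1)[of t "T (s - t) x - x"] by (simp add: T_diff)
  show ?thesis using *[of t s] *[of s t] assms(2-) by (cases "t \<le> s") (auto simp: norm_minus_commute)
qed

lemma continuous_T: "continuous_on {0..} (\<lambda>t. T t x)"
  unfolding continuous_on_def
proof
  fix t :: real assume "t \<in> {0..}" then have t: "t \<ge> 0" by simp
  obtain K where K: "K \<ge> 1" "\<And>s x. 0 \<le> s \<Longrightarrow> s \<le> t + 1 \<Longrightarrow> norm (T s x) \<le> K * norm x"
    by (rule locally_bounded[of "t + 1"]) blast
  have "((\<lambda>s. T s x - T t x) \<longlongrightarrow> 0) (at t within {0..})"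
  proof (rule Lim_null_comparison)
    have "eventually (\<lambda>s. s < t + 1) (at t within {0..})"
      by (rule order_tendstoD(2)[OF tendsto_ident_at]) simp
    moreover have "eventually (\<lambda>s. s \<ge> 0) (at t within {0..})"
      by (auto simp: eventually_at_filter)
    ultimately show "\<forall>\<^sub>F s in at t within {0..}. norm (T s x - T t x) \<le> K * norm (T \<bar>s - t\<bar> x - x)"
      by eventually_elim (rule increment_bound[OF K(2)], use t in auto)
    show "((\<lambda>s. K * norm (T \<bar>s - t\<bar> x - x)) \<longlongrightarrow> 0) (at t within {0..})"
      by (intro tendsto_mult_right_zero tendsto_norm_zero LIM_zero cont_at_0)
  qed
  then show "((\<lambda>t. T t x) \<longlongrightarrow> T t x) (at t within {0..})" by (rule LIM_zero_cancel)
qed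

lemma G_invariant:
  assumes "(f, h) \<in> G" "t \<ge> 0" shows "(T t f, T t h) \<in> G"
proof -
  interpret bounded_linear "T t" using lin assms(2) .
  have "((\<lambda>s. T t ((T s f - f) /\<^sub>R s)) \<longlongrightarrow> T t h) (at_right 0)"
    using assms(1) unfolding G_iff by (rule tendsto)
  moreover have "\<forall>\<^sub>F s in at_right 0. T t ((T s f - f) /\<^sub>R s) = (T s (T t f) - T t f) /\<^sub>R s"
    unfolding eventually_at_filter
  proof (intro always_eventually allI impI)
    fix s :: real assume "s \<in> {0<..}"
    then show "T t ((T s f - f) /\<^sub>R s) = (T s (T t f) - T t f) /\<^sub>R s"
      using Tadd[of s t f] Tadd[of t s f] assms(2) by (simp add: scaleR diff add.commute)
  qed
  ultimately show ?thesis unfolding G_iff by (rule Lim_transform_eventually)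
qed

lemma quotient_error:
  assumes "(f, h) \<in> G"
  shows "((\<lambda>s. (T \<bar>s - t\<bar> f - f) /\<^sub>R \<bar>s - t\<bar> - h) \<longlongrightarrow> 0) (at t within A)"
proof -
  have "filterlim (\<lambda>s. \<bar>s - t\<bar>) (at_right 0) (at t within A)"
    unfolding filterlim_at
    by (auto intro!: tendsto_eq_intros simp: eventually_at_filter)
  from filterlim_compose[OF assms[unfolded G_iff] this] show ?thesis by (rule LIM_zero)
qed

text \<open>To the right of t the difference quotient is \<open>T t\<close> applied to a quotient at
  0. To the left the factor is \<open>T s\<close> with s still moving, which costs the additional
  error \<open>T s h - T t h\<close>. Local boundedness covers both cases.\<close>

lemma has_vector_derivative_T:
  assumes G: "(f, h) \<in> G" and t: "t \<ge> 0"
  shows "((\<lambda>s. T s f) has_vector_derivative T t h) (at t within {0..})"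
  unfolding has_vector_derivative_def has_derivative_within
proof (intro conjI)
  show "bounded_linear (\<lambda>x. x *\<^sub>R T t h)" by (rule bounded_linear_scaleR_left)
  obtain K where K: "K \<ge> 1" "\<And>s x. 0 \<le> s \<Longrightarrow> s \<le> t + 1 \<Longrightarrow> norm (T s x) \<le> K * norm x"
    by (rule locally_bounded[of "t + 1"]) blast
  show "((\<lambda>s. (1 / norm (s - t)) *\<^sub>R (T s f - (T t f + (s - t) *\<^sub>R T t h))) \<longlongrightarrow> 0) (at t within {0..})"
  proof (rule Lim_null_comparison)
    let ?r = "\<lambda>s. (T \<bar>s - t\<bar> f - f) /\<^sub>R \<bar>s - t\<bar> - h"
    show "((\<lambda>s. K * norm (?r s) + norm (T s h - T t h)) \<longlongrightarrow> 0) (at t within {0..})"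
    proof (intro tendsto_add_zero tendsto_mult_right_zero tendsto_norm_zero quotient_error[OF G])
      show "((\<lambda>s. T s h - T t h) \<longlongrightarrow> 0) (at t within {0..})"
        using continuous_T t unfolding continuous_on_def by (intro LIM_zero) auto
    qed
    have "eventually (\<lambda>s. s < t + 1) (at t within {0..})"
      by (rule order_tendstoD(2)[OF tendsto_ident_at]) simp
    moreover have "eventually (\<lambda>s. s \<ge> 0 \<and> s \<noteq> t) (at t within {0..})"
      by (auto simp: eventually_at_filter)
    ultimately show "\<forall>\<^sub>F s in at t within {0..}. norm ((1 / norm (s - t)) *\<^sub>R (T s f - (T t f + (s - t) *\<^sub>R T t h)))
       \<le> K * norm (?r s) + norm (T s h - T t h)"
    proof eventually_elim
      case (elim s)
      show ?case
      proof (cases "t < s")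
        case True
        have "T s f = T t (T (s - t) f)" using Tadd[of t "s - t" f] t True by simp
        then have "(1 / norm (s - t)) *\<^sub>R (T s f - (T t f + (s - t) *\<^sub>R T t h)) = T t (?r s)"
        proof -
          have "T t (?r s) = (T s f - T t f) /\<^sub>R (s - t) - T t h"
            using True t \<open>T s f = _\<close> by (simp add: T_diff T_scale)
          moreover have "(1 / norm (s - t)) *\<^sub>R (T s f - (T t f + (s - t) *\<^sub>R T t h)) = (T s f - T t f) /\<^sub>R (s - t) - T t h"
            using True by (simp add: scaleR_diff_right scaleR_add_right divide_inverse)
          ultimately show ?thesis by simp
        qed
        then show ?thesis using K(2)[of t "?r s"] t by (auto intro: add_increasing2)
      next
        case False
        then have s: "s < t" using elim by simp
        have "T t f = T s (T (t - s) f)" using Tadd[of s "t - s" f] elim s by simp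
        then have "(1 / norm (s - t)) *\<^sub>R (T s f - (T t f + (s - t) *\<^sub>R T t h)) = - T s (?r s) - (T s h - T t h)"
        proof -
          have "T s (?r s) = (T t f - T s f) /\<^sub>R (t - s) - T s h"
            using s elim \<open>T t f = _\<close> by (simp add: T_diff T_scale)
          moreover have "(1 / norm (s - t)) *\<^sub>R (T s f - (T t f + (s - t) *\<^sub>R T t h))
              = (1 / (t - s)) *\<^sub>R (T s f - T t f) + T t h"
          proof -
            have "(s - t) / (t - s) = -1" using s by (simp add: field_simps)
            then show ?thesis using s by (simp add: scaleR_diff_right scaleR_add_right )
          qed
          ultimately show ?thesis using s by (simp add: scaleR_diff_right divide_inverse)
        qed
        then have "norm ((1 / norm (s - t)) *\<^sub>R (T s f - (T t f + (s - t) *\<^sub>R T t h))) \<le> norm (T s (?r s)) + norm (T s h - T t h)"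
          using norm_triangle_ineq4[of "- T s (?r s)" "T s h - T t h"] by simp
        then show ?thesis using K(2)[of s "?r s"] elim by simp
      qed
    qed
  qed
qed

lemma has_real_derivative_inner_T:
  assumes "(f, h) \<in> G" "(f', h') \<in> G" "t > 0"
  shows "((\<lambda>s. T s f \<bullet> T s f') has_real_derivative T t h \<bullet> T t f' + T t f \<bullet> T t h') (at t)"
proof -
  have at: "at t within {0..} = at t" using assms(3) by (intro at_within_interior) simp
  note d = has_vector_derivative_T[OF assms(1), of t, unfolded has_vector_derivative_def at]
     has_vector_derivative_T[OF assms(2), of t, unfolded has_vector_derivative_def at]
  have "((\<lambda>s. T s f \<bullet> T s f') has_derivative (\<lambda>r. T t f \<bullet> (r *\<^sub>R T t h') + (r *\<^sub>R T t h) \<bullet> T t f')) (at t)"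
    using assms(3) by (intro has_derivative_inner d) auto
  moreover have "(\<lambda>r. T t f \<bullet> (r *\<^sub>R T t h') + (r *\<^sub>R T t h) \<bullet> T t f') = (*) (T t h \<bullet> T t f' + T t f \<bullet> T t h')"
    by (auto simp: algebra_simps)
  ultimately show ?thesis unfolding has_field_derivative_def by simp
qed

lemma norm_T_antimono:
  assumes "(f, h) \<in> G" "0 \<le> s" "s \<le> t" shows "norm (T t f) \<le> norm (T s f)"
proof -
  have "- (T s f \<bullet> T s f) \<le> - (T t f \<bullet> T t f)"
  proof (rule DERIV_nonneg_imp_increasing_open[OF assms(3)])
    fix u assume "s < u" "u < t"
    then have u: "u > 0" using assms by simp
    have "((\<lambda>u. - (T u f \<bullet> T u f)) has_real_derivative - (T u h \<bullet> T u f + T u f \<bullet> T u h)) (at u)"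
      by (intro DERIV_minus has_real_derivative_inner_T assms u)
    moreover have "- (T u h \<bullet> T u f + T u f \<bullet> T u h) \<ge> 0"
      using dissipative[OF G_invariant[OF assms(1), of u]] u by (simp add: inner_commute)
    ultimately show "\<exists>y. ((\<lambda>u. - (T u f \<bullet> T u f)) has_real_derivative y) (at u) \<and> 0 \<le> y" by blast
    next
    have "continuous_on {s..t} (\<lambda>t. T t f)"
      by (rule continuous_on_subset[OF continuous_T]) (use assms in auto)
    then show "continuous_on {s..t} (\<lambda>u. - (T u f \<bullet> T u f))"
      by (intro continuous_intros)
  qed
  then show ?thesis by (simp add: norm_le)
qed

text \<open>The function s \<mapsto> \<open>T s f \<bullet> T (t - s) f'\<close> has derivative 0 by
  symmetry of the generator, and its end values are the two sides.\<close>

lemma symmetric_T: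
  assumes "(f, h) \<in> G" "(f', h') \<in> G" "0 \<le> t"
  shows "T t f \<bullet> f' = f \<bullet> T t f'"
proof (cases "t = 0")
  case False
  then have t: "0 < t" using assms by simp
  let ?\<phi> = "\<lambda>s. T s f \<bullet> T (t - s) f'"
  have "?\<phi> t = ?\<phi> 0"
  proof (rule DERIV_isconst_end[OF t])
    have "continuous_on {0..t} (\<lambda>s. T s f)"
      by (rule continuous_on_subset[OF continuous_T]) auto
    moreover have "continuous_on {0..t} (\<lambda>s. T (t - s) f')"
      by (rule continuous_on_compose2[OF continuous_T]) (auto intro!: continuous_intros)
    ultimately show "continuous_on {0..t} ?\<phi>" by (intro continuous_intros)
    fix s assume s: "0 < s" "s < t"
    have at: "at s within {0..} = at s" "at (t - s) within {0..} = at (t - s)"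
      using s by (auto intro: at_within_interior)
    have d1: "((\<lambda>s. T s f) has_vector_derivative T s h) (at s)"
      using has_vector_derivative_T[OF assms(1), of s] s at by simp
    have d2: "((\<lambda>s. T s f') has_vector_derivative T (t - s) h') (at (t - s))"
      using has_vector_derivative_T[OF assms(2), of "t - s"] s at by simp
    have "((\<lambda>s. t - s) has_vector_derivative -1) (at s)"
      by (auto intro!: derivative_eq_intros simp flip: has_real_derivative_iff_has_vector_derivative)
    from vector_diff_chain_at[OF this d2]
    have d3: "((\<lambda>s. T (t - s) f') has_vector_derivative - T (t - s) h') (at s)" by (simp add: o_def)
    have "(?\<phi> has_derivative (\<lambda>r. T s f \<bullet> (r *\<^sub>R - T (t - s) h') + (r *\<^sub>R T s h) \<bullet> T (t - s) f')) (at s)"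
      using d1 d3 unfolding has_vector_derivative_def by (intro has_derivative_inner)
    moreover have "T s h \<bullet> T (t - s) f' = T s f \<bullet> T (t - s) h'"
      using s by (intro sym G_invariant assms) auto
    ultimately show "(?\<phi> has_real_derivative 0) (at s)" unfolding has_field_derivative_def
      by (simp add: lambda_zero)
  qed
  then show ?thesis by (simp add: T0)
qed (simp add: T0)

end

section \<open>Energy identity, decay and autocorrelation\<close>

context symmetric_semigroup begin

lemma continuous_on_inner_T: "A \<subseteq> {0..} \<Longrightarrow> continuous_on A (\<lambda>s. T s f \<bullet> T s f')"
  by (intro continuous_on_inner continuous_on_subset[OF continuous_T])

lemma has_real_derivative_energy:
  assumes "(f, h) \<in> G" "(h, h2) \<in> G" "s > 0"
  shows "((\<lambda>s. T s f \<bullet> T s h) has_real_derivative 2 * (norm (T s h))\<^sup>2) (at s)"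
proof -
  have "T s f \<bullet> T s h2 = T s h \<bullet> T s h"
    using sym[OF G_invariant[OF assms(1)] G_invariant[OF assms(2)], of s s] assms(3) by simp
  then show ?thesis
    using has_real_derivative_inner_T[OF assms] by (simp add: power2_norm_eq_inner)
qed

lemma energy_nonpos: "(f, h) \<in> G \<Longrightarrow> s \<ge> 0 \<Longrightarrow> T s f \<bullet> T s h \<le> 0"
  using dissipative[OF G_invariant[of f h s]] by (simp add: inner_commute)

text \<open>The energy \<open>T s f \<bullet> T s h\<close> rises from \<open>f \<bullet> h\<close>
  to at most 0. Its slope is twice the square of a nonincreasing norm, so over [0, t] it rises by at
  least 2 t times the square of the final norm.\<close>

lemma decay_bound:
  assumes "(f, h) \<in> G" "(h, h2) \<in> G" "t > 0"
  shows "(norm (T t h))\<^sup>2 \<le> - (f \<bullet> h) / (2 * t)"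
proof -
  let ?\<chi> = "\<lambda>s. T s f \<bullet> T s h"
  have "\<exists>l z. 0 < z \<and> z < t \<and> (?\<chi> has_real_derivative l) (at z) \<and> ?\<chi> t - ?\<chi> 0 = (t - 0) * l"
  proof (rule MVT[OF assms(3)])
    show "continuous_on {0..t} ?\<chi>" by (intro continuous_on_inner_T) auto
    fix s assume "0 < s" "s < t"
    then show "?\<chi> differentiable (at s)"
      using has_real_derivative_energy[OF assms(1,2)] real_differentiable_def by blast
  qed
  then obtain l z where z: "0 < z" "z < t" "(?\<chi> has_real_derivative l) (at z)" "?\<chi> t - ?\<chi> 0 = t * l" by auto
  have "l = 2 * (norm (T z h))\<^sup>2" using DERIV_unique[OF z(3) has_real_derivative_energy[OF assms(1,2) z(1)]] .
  moreover have "(norm (T t h))\<^sup>2 \<le> (norm (T z h))\<^sup>2"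
    using norm_T_antimono[OF assms(2), of z t] z by (intro power_mono) auto
  ultimately have "t * (2 * (norm (T t h))\<^sup>2) \<le> ?\<chi> t - ?\<chi> 0"
    unfolding z(4) using assms(3) by (intro mult_left_mono) auto
  also have "\<dots> \<le> - (f \<bullet> h)" using energy_nonpos[OF assms(1), of t] assms(3) by (simp add: T0)
  finally show ?thesis using assms(3) by (simp add: field_simps)
qed

lemma decay:
  assumes "(f, h) \<in> G" "(h, h2) \<in> G"
  shows "((\<lambda>t. T t h) \<longlongrightarrow> 0) at_top"
proof -
  have "((\<lambda>t. (norm (T t h))\<^sup>2) \<longlongrightarrow> 0) at_top"
  proof (rule tendsto_sandwich[OF _ _ tendsto_const])
    show "((\<lambda>t. - (f \<bullet> h) / (2 * t)) \<longlongrightarrow> 0) at_top"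
      by (intro tendsto_divide_0[OF tendsto_const] filterlim_at_top_imp_at_infinity
          filterlim_tendsto_pos_mult_at_top[OF tendsto_const] filterlim_ident) simp
    show "\<forall>\<^sub>F t in at_top. (norm (T t h))\<^sup>2 \<le> - (f \<bullet> h) / (2 * t)"
      using eventually_gt_at_top[of 0] by eventually_elim (rule decay_bound[OF assms])
  qed auto
  from tendsto_real_sqrt[OF this] show ?thesis by (simp add: tendsto_norm_zero_iff)
qed

text \<open>Half of the time is moved to the other factor, so that both factors carry norms that the
  energy identity makes square-integrable.\<close>

lemma inner_T_half:
  assumes "(h, h2) \<in> G" "(h', h3) \<in> G" "s \<ge> 0"
  shows "T s h \<bullet> h' = T (s / 2) h \<bullet> T (s / 2) h'"
proof -
  have "T s h = T (s / 2) (T (s / 2) h)" using Tadd[of "s/2" "s/2" h] assms(3) by simp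
  then show ?thesis using symmetric_T[OF G_invariant[OF assms(1)] assms(2), of "s/2" "s/2"] assms(3) by simp
qed

lemma autocorrelation_integrable:
  assumes G: "(f, h) \<in> G" "(h, h2) \<in> G" "(w, h') \<in> G" "(h', h3) \<in> G"
  shows "set_integrable lborel {0..} (\<lambda>s. T s h \<bullet> h')"
proof -
  have cont: "continuous_on {0..} (\<lambda>s. T s h \<bullet> h')"
    by (intro continuous_on_inner continuous_T continuous_on_const)
  \<comment> \<open>\<open>?b\<close> bounds the integrand, and \<open>?D\<close> is a primitive of
    it that is never positive: the 1/2 from the chain rule cancels the 2 of the energy
    identity.\<close>
  let ?b = "\<lambda>s. ((norm (T (s / 2) h))\<^sup>2 + (norm (T (s / 2) h'))\<^sup>2) / 2"
  let ?D = "\<lambda>s. (T (s / 2) f \<bullet> T (s / 2) h + T (s / 2) w \<bullet> T (s / 2) h') / 2"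
  have bnd: "\<bar>T s h \<bullet> h'\<bar> \<le> ?b s" if "s \<ge> 0" for s
  proof -
    have "\<bar>T (s / 2) h \<bullet> T (s / 2) h'\<bar> \<le> norm (T (s / 2) h) * norm (T (s / 2) h')"
      by (rule Cauchy_Schwarz_ineq2)
    also have "\<dots> \<le> ?b s"
      using sum_squares_bound[of "norm (T (s / 2) h)" "norm (T (s / 2) h')"] by simp
    finally show ?thesis using inner_T_half[OF G(2,4) that] by simp
  qed
  have deriv: "(?D has_real_derivative ?b s) (at s)" if "s > 0" for s
  proof -
    have half: "((\<lambda>s::real. s / 2) has_real_derivative 1 / 2) (at s)" by (auto intro!: derivative_eq_intros)
    have d: "(\<lambda>s. T (s / 2) F \<bullet> T (s / 2) H) = (\<lambda>s. T s F \<bullet> T s H) \<circ> (\<lambda>s. s / 2)" for F H by auto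
    have d1: "((\<lambda>s. T (s / 2) f \<bullet> T (s / 2) h) has_real_derivative 2 * (norm (T (s / 2) h))\<^sup>2 * (1 / 2)) (at s)"
      unfolding d by (rule DERIV_chain[OF has_real_derivative_energy[OF G(1,2)] half]) (use that in simp)
    have d2: "((\<lambda>s. T (s / 2) w \<bullet> T (s / 2) h') has_real_derivative 2 * (norm (T (s / 2) h'))\<^sup>2 * (1 / 2)) (at s)"
      unfolding d by (rule DERIV_chain[OF has_real_derivative_energy[OF G(3,4)] half]) (use that in simp)
    show ?thesis using DERIV_cdivide[OF DERIV_add[OF d1 d2], of 2] by simp
  qed
  have Dle: "?D s \<le> 0" if "s \<ge> 0" for s
    using energy_nonpos[OF G(1), of "s/2"] energy_nonpos[OF G(3), of "s/2"] that by simp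
  have Dmono: "?D s \<le> ?D t" if "1 \<le> s" "s \<le> t" for s t
  proof (rule DERIV_nonneg_imp_nondecreasing[OF that(2)])
    fix x assume "s \<le> x" "x \<le> t"
    then have "(?D has_real_derivative ?b x) (at x)" using that by (intro deriv) simp
    then show "\<exists>y. (?D has_real_derivative y) (at x) \<and> 0 \<le> y" by (intro exI[of _ "?b x"]) simp
  qed
  define L where "L = Sup (?D ` {1..})"
  have bdd: "bdd_above (?D ` {1..})" using Dle by (intro bdd_aboveI[of _ 0]) auto
  have Dlim: "(?D \<longlongrightarrow> L) at_top"
  proof (rule increasing_tendsto)
    show "\<forall>\<^sub>F n in at_top. ?D n \<le> L"
      using eventually_ge_at_top[of 1] unfolding L_def
      by eventually_elim (intro cSup_upper imageI bdd, simp)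
    fix x assume "x < L"
    then obtain s where s: "s \<ge> 1" "x < ?D s"
      using less_cSup_iff[of "?D ` {1..}" x] bdd unfolding L_def by auto
    show "\<forall>\<^sub>F n in at_top. x < ?D n" using eventually_ge_at_top[of s]
      by eventually_elim (rule less_le_trans[OF s(2) Dmono[OF s(1)]])
  qed
  \<comment> \<open>The derivative of the primitive is available for s > 0. Starting at 1 avoids the
    endpoint, and continuity takes care of [0, 1].\<close>
  have "set_integrable lborel {1..} (\<lambda>s. T s h \<bullet> h')"
    unfolding set_integrable_def
  proof (rule integrableI_bounded)
    show "(\<lambda>x. indicat_real {1..} x *\<^sub>R (T x h \<bullet> h')) \<in> borel_measurable lborel"
      using borel_measurable_continuous_on_indicator[of "{1..}" "\<lambda>s. T s h \<bullet> h'"] continuous_on_subset[OF cont, of "{1..}"]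
      by (simp add: set_borel_measurable_def)
    have "(\<integral>\<^sup>+x. ennreal (norm (indicat_real {1..} x *\<^sub>R (T x h \<bullet> h'))) \<partial>lborel)
      \<le> (\<integral>\<^sup>+x. ennreal (indicator {1..} x *\<^sub>R ?b x) * indicator {1..} x \<partial>lborel)"
      by (intro nn_integral_mono) (use bnd in \<open>auto simp: indicator_def intro!: ennreal_leI\<close>)
    also have "\<dots> = (\<integral>\<^sup>+x. ennreal (indicator {0<..} x *\<^sub>R ?b x) * indicator {1..} x \<partial>lborel)"
      by (intro nn_integral_cong) (auto simp: indicator_def)
    also have "\<dots> = ennreal (L - ?D 1)"
    proof (rule nn_integral_FTC_atLeast[OF _ _ _ Dlim])
      have "continuous_on {0<..} ?b"
        by (intro continuous_intros continuous_on_compose2[OF continuous_T]) auto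
      then show "(\<lambda>x. indicat_real {0<..} x *\<^sub>R ?b x) \<in> borel_measurable borel"
        using borel_measurable_continuous_on_indicator[of "{0<..}" ?b] by (simp add: set_borel_measurable_def)
      fix x :: real assume "1 \<le> x"
      then show "(?D has_real_derivative indicat_real {0<..} x *\<^sub>R ?b x) (at x)" using deriv[of x] by simp
    qed auto
    also have "\<dots> < \<infinity>" by simp
    finally show "(\<integral>\<^sup>+x. ennreal (norm (indicat_real {1..} x *\<^sub>R (T x h \<bullet> h'))) \<partial>lborel) < \<infinity>" .
  qed
  moreover have "set_integrable lborel {0..1} (\<lambda>s. T s h \<bullet> h')"
    unfolding set_integrable_def
    by (rule borel_integrable_compact) (auto intro: continuous_on_subset[OF cont])
  ultimately have "set_integrable lborel ({0..1} \<union> {1..}) (\<lambda>s. T s h \<bullet> h')"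
    by (intro set_integrable_Un) auto
  moreover have "{0..1} \<union> {1..} = {0::real..}" by auto
  ultimately show ?thesis by simp
qed

lemma autocorrelation_integral:
  assumes G: "(f, h) \<in> G" "(h, h2) \<in> G" "(w, h') \<in> G" "(h', h3) \<in> G"
  shows "(LINT s:{0..}|lborel. T s h \<bullet> h') = - (h \<bullet> w)"
proof -
  have "((\<lambda>b. LINT s:{0..b}|lborel. T s h \<bullet> h') \<longlongrightarrow> (LINT s:{0..}|lborel. T s h \<bullet> h')) at_top"
    by (rule tendsto_set_lebesgue_integral_at_top) (use autocorrelation_integrable[OF G] in auto)
  moreover have "((\<lambda>b. LINT s:{0..b}|lborel. T s h \<bullet> h') \<longlongrightarrow> - (h \<bullet> w)) at_top"
  proof (rule Lim_transform_eventually)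
    have "((\<lambda>b. T b h \<bullet> w - h \<bullet> w) \<longlongrightarrow> 0 \<bullet> w - h \<bullet> w) at_top"
      by (intro tendsto_intros decay[OF G(1,2)])
    then show "((\<lambda>b. T b h \<bullet> w - h \<bullet> w) \<longlongrightarrow> - (h \<bullet> w)) at_top" by simp
    show "\<forall>\<^sub>F b in at_top. T b h \<bullet> w - h \<bullet> w = (LINT s:{0..b}|lborel. T s h \<bullet> h')"
      using eventually_ge_at_top[of 0]
    proof eventually_elim
      case (elim b)
      have "has_bochner_integral lborel (\<lambda>s. indicator {0..b} s *\<^sub>R (T s h \<bullet> h')) (T b h \<bullet> w - T 0 h \<bullet> w)"
      proof (rule has_bochner_integral_FTC_Icc[OF elim])
        show "continuous_on {0..b} (\<lambda>s. T s h \<bullet> h')"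
          by (intro continuous_on_inner continuous_on_const continuous_on_subset[OF continuous_T]) auto
        fix s assume s: "0 \<le> s" "s \<le> b"
        have "((\<lambda>s. T s h) has_vector_derivative T s h2) (at s within {0..b})"
          by (rule has_vector_derivative_within_subset[OF has_vector_derivative_T[OF G(2) s(1)]]) auto
        then have "((\<lambda>s. T s h \<bullet> w) has_vector_derivative T s h2 \<bullet> w) (at s within {0..b})"
          by (intro bounded_linear.has_vector_derivative[OF bounded_linear_inner_left])
        moreover have "T s h2 \<bullet> w = T s h \<bullet> h'" using sym[OF G_invariant[OF G(2) s(1)] G(3)] .
        ultimately show "((\<lambda>s. T s h \<bullet> w) has_vector_derivative T s h \<bullet> h') (at s within {0..b})" by simp
      qed
      then show ?case unfolding set_lebesgue_integral_def by (simp add: has_bochner_integral_integral_eq T0)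
    qed
  qed
  ultimately show ?thesis by (rule tendsto_unique[OF trivial_limit_at_top_linorder])
qed

lemma G_zero: "(0, 0) \<in> G"
proof -
  have "\<forall>\<^sub>F s in at_right 0. 0 = (T s 0 - 0) /\<^sub>R s"
    by (auto simp: eventually_at_filter linear_simps(3)[OF lin])
  from Lim_transform_eventually[OF tendsto_const this] show ?thesis unfolding G_iff by simp
qed

lemma G_add: assumes "(f, h) \<in> G" "(f', h') \<in> G" shows "(f + f', h + h') \<in> G"
proof -
  have "((\<lambda>s. (T s f - f) /\<^sub>R s + (T s f' - f') /\<^sub>R s) \<longlongrightarrow> h + h') (at_right 0)"
    using assms unfolding G_iff by (rule tendsto_add)
  moreover have "\<forall>\<^sub>F s in at_right 0. (T s f - f) /\<^sub>R s + (T s f' - f') /\<^sub>R s = (T s (f + f') - (f + f')) /\<^sub>R s"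
    unfolding eventually_at_filter
    by (auto intro!: always_eventually simp: linear_simps(1)[OF lin] algebra_simps)
  ultimately show ?thesis unfolding G_iff by (rule Lim_transform_eventually)
qed

lemma G_scale: assumes "(f, h) \<in> G" shows "(c *\<^sub>R f, c *\<^sub>R h) \<in> G"
proof -
  have "((\<lambda>s. c *\<^sub>R ((T s f - f) /\<^sub>R s)) \<longlongrightarrow> c *\<^sub>R h) (at_right 0)"
    using assms unfolding G_iff by (intro tendsto_intros)
  moreover have "\<forall>\<^sub>F s in at_right 0. c *\<^sub>R ((T s f - f) /\<^sub>R s) = (T s (c *\<^sub>R f) - c *\<^sub>R f) /\<^sub>R s"
    unfolding eventually_at_filter
    by (auto intro!: always_eventually simp: T_scale algebra_simps)
  ultimately show ?thesis unfolding G_iff by (rule Lim_transform_eventually)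
qed

lemma G_sum: "(\<And>k. k < n \<Longrightarrow> (F k, H k) \<in> G) \<Longrightarrow> ((\<Sum>k<n. F k), (\<Sum>k<n. H k)) \<in> G" for n :: nat
  by (induction n) (auto simp: G_zero intro: G_add)

text \<open>The witness is a Riemann sum for \<open>\<integral>\<^sub>0\<^sup>t T s f ds\<close>.\<close>

lemma increment_in_closure_of_range:
  assumes fh: "(f, h) \<in> G" and t: "t > 0" and \<eta>: "\<eta> > 0"
  obtains u v where "(u, v) \<in> G" "norm (T t f - f - v) < \<eta>"
proof -
  obtain K where K: "K \<ge> 1" "\<And>s x. 0 \<le> s \<Longrightarrow> s \<le> t \<Longrightarrow> norm (T s x) \<le> K * norm x"
    by (rule locally_bounded[of t]) blast
  have "((\<lambda>s. norm ((T s f - f) /\<^sub>R s - h)) \<longlongrightarrow> 0) (at_right 0)"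
    using fh unfolding G_iff by (intro tendsto_norm_zero LIM_zero)
  moreover have "\<eta> / (t * K) > 0" using t K \<eta> by simp
  ultimately have "\<forall>\<^sub>F s in at_right 0. norm ((T s f - f) /\<^sub>R s - h) < \<eta> / (t * K)"
    by (rule order_tendstoD(2))
  then obtain b where b: "b > 0" "\<And>s. 0 < s \<Longrightarrow> s < b \<Longrightarrow> norm ((T s f - f) /\<^sub>R s - h) < \<eta> / (t * K)"
    unfolding eventually_at_right_field by auto
  obtain n :: nat where n: "t / b < real n" using reals_Archimedean2 by blast
  have n0: "real n > 0" using n t b by (smt (verit) divide_pos_pos)
  define \<delta> where "\<delta> = t / real n"
  have \<delta>: "\<delta> > 0" "\<delta> < b" "real n * \<delta> = t"
    using n n0 t b(1) by (auto simp: \<delta>_def field_simps)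
  define r where "r = (T \<delta> f - f) /\<^sub>R \<delta> - h"
  have r: "norm r < \<eta> / (t * K)" unfolding r_def using b(2) \<delta> by blast
  let ?u = "\<Sum>k<n. \<delta> *\<^sub>R T (real k * \<delta>) f" and ?v = "\<Sum>k<n. \<delta> *\<^sub>R T (real k * \<delta>) h"
  have "(?u, ?v) \<in> G" by (intro G_sum G_scale G_invariant fh) (use \<delta> in auto)
  moreover have "norm (T t f - f - ?v) < \<eta>"
  proof -
    have step: "T (real (Suc k) * \<delta>) f - T (real k * \<delta>) f - \<delta> *\<^sub>R T (real k * \<delta>) h = \<delta> *\<^sub>R T (real k * \<delta>) r" for k
    proof -
      have "T (real (Suc k) * \<delta>) f = T (real k * \<delta>) (T \<delta> f)"
        using Tadd[of "real k * \<delta>" \<delta> f] \<delta>(1) by (simp add: algebra_simps)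
      then show ?thesis using \<delta>(1) by (simp add: r_def T_diff T_scale scaleR_diff_right)
    qed
    have "T t f - f = (\<Sum>k<n. T (real (Suc k) * \<delta>) f - T (real k * \<delta>) f)"
      using sum_lessThan_telescope[of "\<lambda>k. T (real k * \<delta>) f" n] \<delta>(3) by (simp add: T0)
    then have "T t f - f - ?v = (\<Sum>k<n. \<delta> *\<^sub>R T (real k * \<delta>) r)"
      by (simp only: sum_subtractf[symmetric] step)
    also have "norm \<dots> \<le> (\<Sum>k<n. \<delta> * (K * norm r))"
    proof (rule sum_norm_le)
      fix k assume "k \<in> {..<n}"
      then have "real k * \<delta> \<le> real n * \<delta>" using \<delta>(1) by (intro mult_right_mono) auto
      then show "norm (\<delta> *\<^sub>R T (real k * \<delta>) r) \<le> \<delta> * (K * norm r)"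
        using K(2)[of "real k * \<delta>" r] \<delta> by simp
    qed
    also have "\<dots> = t * K * norm r" using \<delta>(3) by (simp add: algebra_simps)
    also have "\<dots> < t * K * (\<eta> / (t * K))" using r t K(1) by (intro mult_strict_left_mono) auto
    also have "\<dots> = \<eta>" using t K(1) by simp
    finally show ?thesis .
  qed
  ultimately show ?thesis using that by blast
qed

end

section \<open>The semigroup on the Gibbs space\<close>

locale gibbs =
  fixes V :: "real ^ 'n::finite \<Rightarrow> real"
  assumes smooth_V: "smooth V" and integrable_exp: "integrable lborel (\<lambda>x. exp (- V x))"
begin

abbreviation "\<rho> \<equiv> gibbs_density V"
abbreviation "\<mu> \<equiv> gibbs_measure V"

lemma partition_pos: "partition_function V > 0"
proof -
  have "partition_function V \<ge> 0" unfolding partition_function_def by simp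
  moreover have "partition_function V \<noteq> 0"
  proof
    assume "partition_function V = 0"
    then have "AE x in lborel. exp (- V x) = 0"
      using integral_nonneg_eq_0_iff_AE[OF integrable_exp] by (simp add: partition_function_def)
    then have "AE x in (lborel :: (real^'n) measure). False" by simp
    then show False by (simp add: eventually_False ae_filter_eq_bot_iff)
  qed
  ultimately show ?thesis by simp
qed

lemma V_measurable [measurable]: "V \<in> borel_measurable borel"
  using smooth_continuous[OF smooth_V] by (rule borel_measurable_continuous_onI)

lemma density_pos: "\<rho> x > 0" using partition_pos by (simp add: gibbs_density_def)
lemma density_nonneg: "\<rho> x \<ge> 0" using density_pos[of x] by simp

lemma density_continuous: "continuous_on UNIV \<rho>"
  unfolding gibbs_density_def[abs_def] using smooth_continuous[OF smooth_V] partition_pos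
  by (intro continuous_intros) auto

lemma density_measurable [measurable]: "\<rho> \<in> borel_measurable borel"
  using density_continuous by (rule borel_measurable_continuous_onI)

lemma sets_\<mu> [simp, measurable_cong]: "sets \<mu> = sets borel" by (simp add: gibbs_measure_def)
lemma space_\<mu> [simp]: "space \<mu> = UNIV" by (simp add: gibbs_measure_def)

lemma integrable_gibbs_density: "integrable lborel \<rho>"
  unfolding gibbs_density_def[abs_def] using integrable_exp by simp

lemma integral_gibbs_density: "(LINT x|lborel. \<rho> x) = 1"
  unfolding gibbs_density_def using partition_pos by (simp add: partition_function_def[symmetric])

lemma prob_space_\<mu>: "prob_space \<mu>"
proof
  have "emeasure \<mu> (space \<mu>) = (\<integral>\<^sup>+x. ennreal (\<rho> x) \<partial>lborel)"
    unfolding gibbs_measure_def by (subst emeasure_density) auto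
  also have "\<dots> = ennreal (LINT x|lborel. \<rho> x)"
    by (intro nn_integral_eq_integral integrable_gibbs_density) (simp add: density_nonneg)
  finally show "emeasure \<mu> (space \<mu>) = 1" by (simp add: integral_gibbs_density)
qed

lemma integral_\<mu>: "f \<in> borel_measurable borel \<Longrightarrow> (LINT x|\<mu>. f x) = (LINT x|lborel. f x * \<rho> x)"
  unfolding gibbs_measure_def
  by (subst integral_density) (auto simp: density_nonneg mult.commute)

lemma integrable_\<mu>: "f \<in> borel_measurable borel \<Longrightarrow> integrable \<mu> f \<longleftrightarrow> integrable lborel (\<lambda>x. f x * \<rho> x)"
  unfolding gibbs_measure_def
  by (subst integrable_density) (auto simp: density_nonneg mult.commute)

lemma AE_\<mu>: "(AE x in \<mu>. P x) \<longleftrightarrow> (AE x in lborel. P x)"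
  unfolding gibbs_measure_def by (subst AE_density) (auto simp: density_pos)

text \<open>The isometry of \<open>L\<^sup>2(\<mu>)\<close> onto \<open>L\<^sup>2\<close> of Lebesgue measure.\<close>

definition \<Phi> :: "(real ^ 'n \<Rightarrow> real) \<Rightarrow> (real ^ 'n) l2" where "\<Phi> f = abs_l2 (\<lambda>x. f x * sqrt (\<rho> x))"
definition \<Psi> :: "(real ^ 'n) l2 \<Rightarrow> real ^ 'n \<Rightarrow> real" where "\<Psi> F x = rep_l2 F x / sqrt (\<rho> x)"

lemma L2_measurable: "f \<in> L2_space \<mu> \<Longrightarrow> f \<in> borel_measurable borel"
  using measurable_cong_sets[OF sets_\<mu> refl] by (auto simp: L2_space_iff)

lemma weighted_mem: "f \<in> L2_space \<mu> \<Longrightarrow> (\<lambda>x. f x * sqrt (\<rho> x)) \<in> L2_space lborel"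
  by (auto simp: L2_space_iff integrable_\<mu> power_mult_distrib density_nonneg)

lemma \<Psi>_mem: "\<Psi> F \<in> L2_space \<mu>"
proof -
  have [measurable]: "rep_l2 F \<in> borel_measurable borel" using rep_l2_mem[of F] by (simp add: L2_space_iff)
  have [measurable]: "\<Psi> F \<in> borel_measurable borel" unfolding \<Psi>_def[abs_def] by measurable
  have "(\<Psi> F x)\<^sup>2 * \<rho> x = (rep_l2 F x)\<^sup>2" for x
    using density_pos[of x] by (simp add: \<Psi>_def power_divide)
  then show ?thesis using rep_l2_mem[of F] by (simp add: L2_space_iff integrable_\<mu>)
qed

lemma \<Phi>_\<Psi>: "\<Phi> (\<Psi> F) = F"
proof -
  have "(\<lambda>x. \<Psi> F x * sqrt (\<rho> x)) = rep_l2 F"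
    using density_pos by (auto simp: \<Psi>_def fun_eq_iff less_imp_neq[symmetric])
  then show ?thesis by (simp add: \<Phi>_def abs_rep_l2)
qed

lemma \<Phi>_eq_iff: "f \<in> L2_space \<mu> \<Longrightarrow> g \<in> L2_space \<mu> \<Longrightarrow> \<Phi> f = \<Phi> g \<longleftrightarrow> (AE x in \<mu>. f x = g x)"
  unfolding \<Phi>_def AE_\<mu> using density_pos
  by (subst abs_l2_eq_iff) (auto simp: weighted_mem less_imp_neq[symmetric])

lemma \<Phi>_cong: "f \<in> L2_space \<mu> \<Longrightarrow> g \<in> L2_space \<mu> \<Longrightarrow> AE x in \<mu>. f x = g x \<Longrightarrow> \<Phi> f = \<Phi> g"
  using \<Phi>_eq_iff by blast

lemma \<Phi>_add: "f \<in> L2_space \<mu> \<Longrightarrow> g \<in> L2_space \<mu> \<Longrightarrow> \<Phi> (\<lambda>x. f x + g x) = \<Phi> f + \<Phi> g"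
  unfolding \<Phi>_def by (subst abs_l2_add[symmetric]) (auto simp: weighted_mem distrib_right)
lemma \<Phi>_diff: "f \<in> L2_space \<mu> \<Longrightarrow> g \<in> L2_space \<mu> \<Longrightarrow> \<Phi> (\<lambda>x. f x - g x) = \<Phi> f - \<Phi> g"
  unfolding \<Phi>_def by (subst abs_l2_diff[symmetric]) (auto simp: weighted_mem left_diff_distrib)
lemma \<Phi>_scale: "f \<in> L2_space \<mu> \<Longrightarrow> \<Phi> (\<lambda>x. c * f x) = c *\<^sub>R \<Phi> f"
  unfolding \<Phi>_def by (subst abs_l2_scale[symmetric]) (auto simp: weighted_mem mult.assoc)

lemma inner_\<Phi>: "f \<in> L2_space \<mu> \<Longrightarrow> g \<in> L2_space \<mu> \<Longrightarrow> \<Phi> f \<bullet> \<Phi> g = (LINT x|\<mu>. f x * g x)"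
proof -
  assume fg: "f \<in> L2_space \<mu>" "g \<in> L2_space \<mu>"
  have "(f x * sqrt (\<rho> x)) * (g x * sqrt (\<rho> x)) = f x * g x * \<rho> x" for x
  proof -
    have "(f x * sqrt (\<rho> x)) * (g x * sqrt (\<rho> x)) = f x * g x * (sqrt (\<rho> x) * sqrt (\<rho> x))" by (simp only: mult_ac)
    then show ?thesis using density_nonneg[of x] by simp
  qed
  note eq = this
  have "\<Phi> f \<bullet> \<Phi> g = (LINT x|lborel. (f x * sqrt (\<rho> x)) * (g x * sqrt (\<rho> x)))"
    unfolding \<Phi>_def using fg by (intro inner_abs_l2 weighted_mem)
  also have "\<dots> = (LINT x|lborel. f x * g x * \<rho> x)" by (simp only: eq)
  also have "\<dots> = (LINT x|\<mu>. f x * g x)" using fg by (intro integral_\<mu>[symmetric] borel_measurable_times L2_measurable)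
  finally show ?thesis .
qed

lemma norm_\<Phi>: "f \<in> L2_space \<mu> \<Longrightarrow> norm (\<Phi> f) = L2_norm \<mu> f"
  by (simp add: norm_eq_sqrt_inner inner_\<Phi> L2_norm_def power2_eq_square)

lemma bounded_mem_L2:
  assumes [measurable]: "f \<in> borel_measurable borel" and "\<And>x. \<bar>f x\<bar> \<le> K" shows "f \<in> L2_space \<mu>"
proof -
  interpret prob_space \<mu> by (rule prob_space_\<mu>)
  have "norm ((f x)\<^sup>2) \<le> K\<^sup>2" for x using power_mono[OF assms(2)[of x], of 2] by simp
  then have "integrable \<mu> (\<lambda>x. (f x)\<^sup>2)" by (intro integrable_const_bound[of _ "K\<^sup>2"]) auto
  then show ?thesis by (simp add: L2_space_iff)
qed

lemma test_function_measurable: "test_function f \<Longrightarrow> f \<in> borel_measurable borel"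
  by (intro borel_measurable_continuous_onI smooth_continuous test_function_smooth)

lemma test_function_L2: assumes "test_function f" shows "f \<in> L2_space \<mu>"
proof -
  obtain K where "\<And>x. \<bar>f x\<bar> \<le> K" using test_function_bounded[OF assms] by blast
  then show ?thesis by (intro bounded_mem_L2 test_function_measurable assms)
qed

lemma const_L2: "(\<lambda>x. c) \<in> L2_space \<mu>" by (rule bounded_mem_L2[of _ "\<bar>c\<bar>"]) auto

lemma integral_test_\<mu>:
  assumes "f \<in> borel_measurable borel" shows "(LINT x|\<mu>. f x) = (LINT x|lborel. f x * exp (- V x)) / partition_function V"
  using assms by (simp add: integral_\<mu> gibbs_density_def)

lemma generator_\<mu>:
  assumes f: "test_function f" and g: "smooth g"
  shows "(LINT x|\<mu>. g x * unperturbed_generator \<sigma> V f x) = - (LINT x|\<mu>. carre \<sigma> f g x)"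
proof -
  note m = borel_measurable_continuous_onI[OF smooth_continuous]
  have "(\<lambda>x. g x * unperturbed_generator \<sigma> V f x) \<in> borel_measurable borel" "carre \<sigma> f g \<in> borel_measurable borel"
    by (intro m smooth_mult g smooth_generator smooth_V test_function_smooth[OF f] test_function_smooth[OF test_function_carre(1)] f)+
  then show ?thesis
    using generator_integration_by_parts[OF smooth_V f g, of \<sigma>] by (simp add: integral_test_\<mu>)
qed

lemma carre_sym: "carre \<sigma> f g x = carre \<sigma> g f x"
  by (simp add: carre_def inner_commute)

lemma L1_le_norm: assumes "f \<in> L2_space \<mu>" shows "(LINT x|\<mu>. \<bar>f x\<bar>) \<le> norm (\<Phi> f)"
proof -
  interpret prob_space \<mu> by (rule prob_space_\<mu>)
  have a: "(\<lambda>x. \<bar>f x\<bar>) \<in> L2_space \<mu>" using assms by (auto simp: L2_space_iff)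
  have "(LINT x|\<mu>. \<bar>f x\<bar>) = \<Phi> (\<lambda>x. \<bar>f x\<bar>) \<bullet> \<Phi> (\<lambda>x. 1)"
    using inner_\<Phi>[OF a const_L2[of 1]] by simp
  also have "\<dots> \<le> norm (\<Phi> (\<lambda>x. \<bar>f x\<bar>)) * norm (\<Phi> (\<lambda>x. 1))" by (rule norm_cauchy_schwarz)
  also have "norm (\<Phi> (\<lambda>x. 1)) = 1" by (simp add: norm_\<Phi> const_L2 L2_norm_def prob_space[unfolded space_\<mu>])
  also have "norm (\<Phi> (\<lambda>x. \<bar>f x\<bar>)) = norm (\<Phi> f)" by (simp add: norm_\<Phi> a assms L2_norm_def)
  finally show ?thesis by simp
qed

end

locale gibbs_semigroup = gibbs V for V :: "real ^ 'n::finite \<Rightarrow> real" +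
  fixes \<sigma> :: "real ^ 'n ^ 'n" and S :: "real \<Rightarrow> (real ^ 'n \<Rightarrow> real) \<Rightarrow> real ^ 'n \<Rightarrow> real"
  assumes semigroup: "unperturbed_semigroup \<sigma> V S"
begin

abbreviation "L \<equiv> unperturbed_generator \<sigma> V"

text \<open>The laws of \<open>S\<close> hold only almost everywhere; conjugated by the isometry
  they become exact equations on the Hilbert space.\<close>

definition "T t F = \<Phi> (S t (\<Psi> F))"
definition "G = {(F, H). ((\<lambda>t. (T t F - F) /\<^sub>R t) \<longlongrightarrow> H) (at_right 0)}"

lemma C0: "C0_semigroup \<mu> S" and graph: "semigroup_generator_graph \<mu> S = L2_closure_graph \<mu> (Collect test_function) L"
  using semigroup by (auto simp: unperturbed_semigroup_def)

lemma S_mem: "t \<ge> 0 \<Longrightarrow> f \<in> L2_space \<mu> \<Longrightarrow> S t f \<in> L2_space \<mu>"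
  using C0 by (auto simp: C0_semigroup_def)

lemma S_linear: "t \<ge> 0 \<Longrightarrow> f \<in> L2_space \<mu> \<Longrightarrow> g \<in> L2_space \<mu> \<Longrightarrow>
   \<Phi> (S t (\<lambda>x. a * f x + b * g x)) = a *\<^sub>R \<Phi> (S t f) + b *\<^sub>R \<Phi> (S t g)"
proof -
  assume a: "t \<ge> 0" "f \<in> L2_space \<mu>" "g \<in> L2_space \<mu>"
  have "AE x in \<mu>. S t (\<lambda>x. a * f x + b * g x) x = a * S t f x + b * S t g x"
    using C0 a by (auto simp: C0_semigroup_def)
  then have "\<Phi> (S t (\<lambda>x. a * f x + b * g x)) = \<Phi> (\<lambda>x. a * S t f x + b * S t g x)"
    by (intro \<Phi>_cong S_mem L2_space_add L2_space_scale a)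
  also have "\<dots> = a *\<^sub>R \<Phi> (S t f) + b *\<^sub>R \<Phi> (S t g)"
    using a by (simp add: \<Phi>_add \<Phi>_scale S_mem L2_space_scale)
  finally show ?thesis .
qed

lemma S_bounded: "t \<ge> 0 \<Longrightarrow> \<exists>C. \<forall>f\<in>L2_space \<mu>. norm (\<Phi> (S t f)) \<le> C * norm (\<Phi> f)"
  using C0 S_mem unfolding C0_semigroup_def by (simp add: norm_\<Phi>)

text \<open>\<open>C0_semigroup\<close> does not state that \<open>S t\<close> sends almost equal
  functions to almost equal functions. This follows from linearity and boundedness: the difference
  of two representatives has norm 0, hence so has its image.\<close>

lemma T_\<Phi>:
  assumes "t \<ge> 0" "f \<in> L2_space \<mu>" shows "T t (\<Phi> f) = \<Phi> (S t f)"
proof -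
  obtain C where C: "\<And>f. f \<in> L2_space \<mu> \<Longrightarrow> norm (\<Phi> (S t f)) \<le> C * norm (\<Phi> f)"
    using S_bounded[OF assms(1)] by blast
  let ?u = "\<Psi> (\<Phi> f)"
  let ?d = "\<lambda>x. 1 * ?u x + (-1) * f x"
  have d: "?d \<in> L2_space \<mu>" by (intro L2_space_add L2_space_scale \<Psi>_mem assms)
  have "\<Phi> ?d = 1 *\<^sub>R \<Phi> ?u + (-1) *\<^sub>R \<Phi> f"
    using \<Phi>_add[OF L2_space_scale[OF \<Psi>_mem, of 1] L2_space_scale[OF assms(2), of "-1"]]
     \<Phi>_scale[OF \<Psi>_mem, of 1] \<Phi>_scale[OF assms(2), of "-1"] by simp
  then have "\<Phi> ?d = 0" by (simp add: \<Phi>_\<Psi>)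
  moreover have "\<Phi> (S t ?d) = 1 *\<^sub>R \<Phi> (S t ?u) + (-1) *\<^sub>R \<Phi> (S t f)"
    by (intro S_linear assms \<Psi>_mem)
  ultimately show ?thesis using C[OF d] by (simp add: T_def)
qed

lemma graph_iff:
  assumes "f \<in> L2_space \<mu>" "h \<in> L2_space \<mu>"
  shows "(f, h) \<in> semigroup_generator_graph \<mu> S \<longleftrightarrow> (\<Phi> f, \<Phi> h) \<in> G"
proof -
  have "L2_norm \<mu> (\<lambda>x. (S t f x - f x) / t - h x) = norm ((T t (\<Phi> f) - \<Phi> f) /\<^sub>R t - \<Phi> h)" if "t \<ge> 0" for t
  proof -
    have a: "(\<lambda>x. inverse t * (S t f x - f x)) \<in> L2_space \<mu>" "(\<lambda>x. S t f x - f x) \<in> L2_space \<mu>"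
      using assms that by (auto intro!: L2_space_scale L2_space_diff S_mem)
    have "(T t (\<Phi> f) - \<Phi> f) /\<^sub>R t - \<Phi> h = \<Phi> (\<lambda>x. inverse t * (S t f x - f x) - h x)"
      using assms that a by (simp add: T_\<Phi> \<Phi>_diff \<Phi>_scale S_mem)
    then show ?thesis using a assms by (simp add: norm_\<Phi> L2_space_diff divide_inverse mult.commute)
  qed
  then have "((\<lambda>t. L2_norm \<mu> (\<lambda>x. (S t f x - f x) / t - h x)) \<longlongrightarrow> 0) (at_right 0) \<longleftrightarrow>
     ((\<lambda>t. norm ((T t (\<Phi> f) - \<Phi> f) /\<^sub>R t - \<Phi> h)) \<longlongrightarrow> 0) (at_right 0)"
    by (intro tendsto_cong) (auto simp: eventually_at_filter)
  also have "\<dots> \<longleftrightarrow> (\<Phi> f, \<Phi> h) \<in> G"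
    unfolding G_def by (simp add: tendsto_norm_zero_iff LIM_zero_iff)
  finally show ?thesis using assms by (simp add: semigroup_generator_graph_def)
qed

text \<open>Test functions form a core: this is the inclusion of the generator graph in the closure.
  The opposite inclusion is behind \<open>test_in_G\<close>.\<close>

lemma G_closure:
  assumes "(F, H) \<in> G"
  obtains u where "\<And>n::nat. test_function (u n)" "(\<lambda>n. \<Phi> (u n)) \<longlonglongrightarrow> F" "(\<lambda>n. \<Phi> (L (u n))) \<longlonglongrightarrow> H"
proof -
  have "(\<Psi> F, \<Psi> H) \<in> L2_closure_graph \<mu> (Collect test_function) L"
    using graph_iff[OF \<Psi>_mem \<Psi>_mem, of F H] assms graph by (simp add: \<Phi>_\<Psi>)
  then obtain u where u: "\<And>n::nat. test_function (u n)"
      "(\<lambda>n. L2_norm \<mu> (\<lambda>x. u n x - \<Psi> F x)) \<longlonglongrightarrow> 0" "(\<lambda>n. L2_norm \<mu> (\<lambda>x. L (u n) x - \<Psi> H x)) \<longlonglongrightarrow> 0"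
    unfolding L2_closure_graph_def by auto
  have Lu: "test_function (L (u n))" for n by (intro test_function_generator smooth_V u)
  have "L2_norm \<mu> (\<lambda>x. u n x - \<Psi> F x) = norm (\<Phi> (u n) - F)" "L2_norm \<mu> (\<lambda>x. L (u n) x - \<Psi> H x) = norm (\<Phi> (L (u n)) - H)" for n
    using norm_\<Phi>[OF L2_space_diff[OF test_function_L2[OF u(1)] \<Psi>_mem[of F]], of n]
      norm_\<Phi>[OF L2_space_diff[OF test_function_L2[OF Lu] \<Psi>_mem[of H]], of n]
    by (simp_all add: \<Phi>_diff test_function_L2 u Lu \<Psi>_mem \<Phi>_\<Psi>)
  then have "(\<lambda>n. \<Phi> (u n)) \<longlonglongrightarrow> F" "(\<lambda>n. \<Phi> (L (u n))) \<longlonglongrightarrow> H"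
    using u(2,3) by (simp_all add: tendsto_norm_zero_iff LIM_zero_iff)
  with u(1) that show ?thesis by blast
qed

lemma test_in_G: assumes "test_function f" shows "(\<Phi> f, \<Phi> (L f)) \<in> G"
proof -
  have Lf: "test_function (L f)" by (intro test_function_generator smooth_V assms)
  have "(f, L f) \<in> L2_closure_graph \<mu> (Collect test_function) L"
    unfolding L2_closure_graph_def using assms Lf
    by (auto simp: test_function_L2 L2_norm_def intro!: exI[of _ "\<lambda>_::nat. f"])
  then show ?thesis using graph_iff[of f "L f"] graph assms Lf test_function_L2 by auto
qed

lemma inner_L_test:
  assumes "test_function f" "test_function g"
  shows "\<Phi> (L f) \<bullet> \<Phi> g = - (LINT x|\<mu>. carre \<sigma> f g x)"
  using generator_\<mu>[OF assms(1) test_function_smooth[OF assms(2)], of \<sigma>] assms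
  by (simp add: inner_\<Phi> test_function_L2 test_function_generator smooth_V mult.commute)

lemma bounded_linear_T:
  assumes t: "t \<ge> 0" shows "bounded_linear (T t)"
proof -
  obtain C where C: "\<And>f. f \<in> L2_space \<mu> \<Longrightarrow> norm (\<Phi> (S t f)) \<le> C * norm (\<Phi> f)"
    using S_bounded[OF t] by blast
  show ?thesis
  proof (rule bounded_linear_intro)
    fix F H :: "(real ^ 'n) l2" and r :: real
    have "F + H = \<Phi> (\<lambda>x. 1 * \<Psi> F x + 1 * \<Psi> H x)" by (simp add: \<Phi>_add \<Psi>_mem \<Phi>_\<Psi>)
    then have "T t (F + H) = \<Phi> (S t (\<lambda>x. 1 * \<Psi> F x + 1 * \<Psi> H x))"
      using T_\<Phi>[OF t L2_space_add[OF L2_space_scale[OF \<Psi>_mem] L2_space_scale[OF \<Psi>_mem]], of 1 F 1 H] by simp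
    also have "\<dots> = 1 *\<^sub>R \<Phi> (S t (\<Psi> F)) + 1 *\<^sub>R \<Phi> (S t (\<Psi> H))" by (rule S_linear[OF t \<Psi>_mem \<Psi>_mem])
    finally show "T t (F + H) = T t F + T t H" by (simp add: T_def)
    have "r *\<^sub>R F = \<Phi> (\<lambda>x. r * \<Psi> F x + 0 * \<Psi> F x)" by (simp add: \<Phi>_scale \<Psi>_mem \<Phi>_\<Psi>)
    then have "T t (r *\<^sub>R F) = \<Phi> (S t (\<lambda>x. r * \<Psi> F x + 0 * \<Psi> F x))"
      using T_\<Phi>[OF t L2_space_add[OF L2_space_scale[OF \<Psi>_mem] L2_space_scale[OF \<Psi>_mem]], of r F 0 F] by simp
    also have "\<dots> = r *\<^sub>R \<Phi> (S t (\<Psi> F)) + 0 *\<^sub>R \<Phi> (S t (\<Psi> F))" by (rule S_linear[OF t \<Psi>_mem \<Psi>_mem])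
    finally show "T t (r *\<^sub>R F) = r *\<^sub>R T t F" by (simp add: T_def)
    show "norm (T t F) \<le> norm F * C" unfolding T_def using C[OF \<Psi>_mem, of F] by (simp add: \<Phi>_\<Psi> mult.commute)
  qed
qed

text \<open>Symmetry and dissipativity hold for test functions by integration by parts, and both
  survive the limits that define the closure.\<close>

sublocale symmetric_semigroup T G
proof (rule symmetric_semigroup.intro)
  fix t :: real assume "t \<ge> 0"
  then show "bounded_linear (T t)" by (rule bounded_linear_T)
next
  fix F :: "(real ^ 'n) l2"
  have "AE x in \<mu>. S 0 (\<Psi> F) x = \<Psi> F x" using C0 \<Psi>_mem[of F] by (auto simp: C0_semigroup_def)
  then have "\<Phi> (S 0 (\<Psi> F)) = \<Phi> (\<Psi> F)" by (intro \<Phi>_cong S_mem \<Psi>_mem) auto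
  then show "T 0 F = F" by (simp add: T_def \<Phi>_\<Psi>)
next
  fix s t :: real and F :: "(real ^ 'n) l2" assume st: "s \<ge> 0" "t \<ge> 0"
  have "AE x in \<mu>. S (s + t) (\<Psi> F) x = S s (S t (\<Psi> F)) x" using C0 \<Psi>_mem[of F] st by (auto simp: C0_semigroup_def)
  then have "\<Phi> (S (s + t) (\<Psi> F)) = \<Phi> (S s (S t (\<Psi> F)))" using st by (intro \<Phi>_cong S_mem \<Psi>_mem) auto
  also have "\<dots> = T s (\<Phi> (S t (\<Psi> F)))" using T_\<Phi>[OF st(1) S_mem[OF st(2) \<Psi>_mem]] by simp
  finally show "T (s + t) F = T s (T t F)" by (simp add: T_def)
next
  fix F :: "(real ^ 'n) l2"
  have "((\<lambda>t. L2_norm \<mu> (\<lambda>x. S t (\<Psi> F) x - \<Psi> F x)) \<longlongrightarrow> 0) (at_right 0)"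
    using C0 \<Psi>_mem[of F] by (auto simp: C0_semigroup_def)
  moreover have "\<forall>\<^sub>F t in at_right 0. L2_norm \<mu> (\<lambda>x. S t (\<Psi> F) x - \<Psi> F x) = norm (T t F - F)"
    unfolding eventually_at_filter
  proof (intro always_eventually allI impI)
    fix t :: real assume "t \<in> {0<..}"
    then have m: "S t (\<Psi> F) \<in> L2_space \<mu>" by (intro S_mem \<Psi>_mem) simp
    then show "L2_norm \<mu> (\<lambda>x. S t (\<Psi> F) x - \<Psi> F x) = norm (T t F - F)"
      using norm_\<Phi>[OF L2_space_diff[OF m \<Psi>_mem[of F]]] by (simp add: \<Phi>_diff \<Psi>_mem T_def \<Phi>_\<Psi>)
  qed
  ultimately have "((\<lambda>t. norm (T t F - F)) \<longlongrightarrow> 0) (at_right 0)" by (rule Lim_transform_eventually)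
  then show "((\<lambda>t. T t F) \<longlongrightarrow> F) (at_right 0)" by (simp add: tendsto_norm_zero_iff LIM_zero_iff)
next
  fix F H :: "(real ^ 'n) l2"
  show "(F, H) \<in> G \<longleftrightarrow> ((\<lambda>t. (T t F - F) /\<^sub>R t) \<longlongrightarrow> H) (at_right 0)" by (simp add: G_def)
next
  fix F H F' H' :: "(real ^ 'n) l2" assume FH: "(F, H) \<in> G" and FH': "(F', H') \<in> G"
  obtain u where u: "\<And>n::nat. test_function (u n)" "(\<lambda>n. \<Phi> (u n)) \<longlonglongrightarrow> F" "(\<lambda>n. \<Phi> (L (u n))) \<longlonglongrightarrow> H"
    by (rule G_closure[OF FH]) blast
  obtain u' where u': "\<And>n::nat. test_function (u' n)" "(\<lambda>n. \<Phi> (u' n)) \<longlonglongrightarrow> F'" "(\<lambda>n. \<Phi> (L (u' n))) \<longlonglongrightarrow> H'"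
    by (rule G_closure[OF FH']) blast
  have "\<Phi> (L (u n)) \<bullet> \<Phi> (u' n) = \<Phi> (u n) \<bullet> \<Phi> (L (u' n))" for n
    using inner_L_test[OF u(1) u'(1), of n n] inner_L_test[OF u'(1) u(1), of n n] carre_sym[of \<sigma> "u n" "u' n"]
    by (simp add: inner_commute)
  then show "H \<bullet> F' = F \<bullet> H'"
    using tendsto_inner[OF u(3) u'(2)] tendsto_inner[OF u(2) u'(3)] LIMSEQ_unique by simp
next
  fix F H :: "(real ^ 'n) l2" assume FH: "(F, H) \<in> G"
  obtain u where u: "\<And>n::nat. test_function (u n)" "(\<lambda>n. \<Phi> (u n)) \<longlonglongrightarrow> F" "(\<lambda>n. \<Phi> (L (u n))) \<longlonglongrightarrow> H"
    by (rule G_closure[OF FH]) blast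
  have "\<Phi> (L (u n)) \<bullet> \<Phi> (u n) \<le> 0" for n
    unfolding inner_L_test[OF u(1) u(1)] by (simp add: carre_def)
  then show "H \<bullet> F \<le> 0" using tendsto_upperbound[OF tendsto_inner[OF u(3) u(2)]] by simp
qed

lemma green_kubo_semigroup:
  assumes g: "test_function g" and W: "test_function W"
  defines "k \<equiv> \<lambda>s. LINT x|lborel. S s (L g) x * L W x * \<rho> x"
  shows "set_integrable lborel {0..} k"
    and "(LINT x|lborel. W x * L g x * \<rho> x) = - (LINT s:{0..}|lborel. k s)"
proof -
  note tg = test_function_generator[OF smooth_V]
  have k: "k s = T s (\<Phi> (L g)) \<bullet> \<Phi> (L W)" if "s \<ge> 0" for s
  proof -
    have m: "S s (L g) \<in> L2_space \<mu>" "L W \<in> L2_space \<mu>" using that by (intro S_mem test_function_L2 tg g W; simp)+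
    have [measurable]: "S s (L g) \<in> borel_measurable borel" "L W \<in> borel_measurable borel" by (intro L2_measurable m)+
    show ?thesis using that m unfolding k_def by (simp add: T_\<Phi> test_function_L2 tg g inner_\<Phi> integral_\<mu>)
  qed
  \<comment> \<open>Smoothness of V makes L map test functions to test functions, so L may be
    applied twice to g and to W, as the autocorrelation results demand.\<close>
  note G = test_in_G[OF g] test_in_G[OF tg[OF g]] test_in_G[OF W] test_in_G[OF tg[OF W]]
  have eq: "indicat_real {0..} s *\<^sub>R k s = indicat_real {0..} s *\<^sub>R (T s (\<Phi> (L g)) \<bullet> \<Phi> (L W))" for s
    using k[of s] by (simp add: indicator_def)
  show "set_integrable lborel {0..} k"
    using autocorrelation_integrable[OF G] unfolding set_integrable_def eq .
  have [measurable]: "W \<in> borel_measurable borel" "L g \<in> borel_measurable borel"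
    by (intro test_function_measurable tg g W)+
  have "(LINT x|lborel. W x * L g x * \<rho> x) = \<Phi> (L g) \<bullet> \<Phi> W"
    by (simp add: inner_\<Phi> test_function_L2 tg g W integral_\<mu> mult.commute[of "W _"])
  moreover have "(LINT s:{0..}|lborel. k s) = - (\<Phi> (L g) \<bullet> \<Phi> W)"
    using autocorrelation_integral[OF G] unfolding set_lebesgue_integral_def eq .
  ultimately show "(LINT x|lborel. W x * L g x * \<rho> x) = - (LINT s:{0..}|lborel. k s)" by simp
qed

end

section \<open>Density of the range of the generator\<close>

lemma nn_integral_translation:
  fixes f :: "'a::euclidean_space \<Rightarrow> ennreal"
  assumes "f \<in> borel_measurable borel"
  shows "(\<integral>\<^sup>+x. f (v + x) \<partial>lborel) = (\<integral>\<^sup>+x. f x \<partial>lborel)"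
proof -
  have "(\<integral>\<^sup>+x. f x \<partial>lborel) = (\<integral>\<^sup>+x. f x \<partial>distr lborel borel ((+) v))"
    by (simp add: lborel_distr_plus)
  also have "\<dots> = (\<integral>\<^sup>+x. f (v + x) \<partial>lborel)"
    using assms by (intro nn_integral_distr) auto
  finally show ?thesis by simp
qed

lemma smooth_grad_measurable:
  assumes "smooth u" shows "grad u \<in> borel_measurable borel"
proof (rule borel_measurable_continuous_onI)
  show "continuous_on UNIV (grad u)"
    unfolding grad_def[abs_def] by (intro continuous_on_vec_lambda smooth_continuous smooth_partial_deriv assms)
qed

lemma increment_le_integral_grad:
  fixes u :: "real ^ 'n::finite \<Rightarrow> real"
  assumes u: "smooth u"
  shows "ennreal \<bar>u x - u (x + v)\<bar> \<le> (\<integral>\<^sup>+s. indicator {0..1} s * ennreal (norm v * norm (grad u (x + s *\<^sub>R v))) \<partial>lborel)"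
proof -
  have cg: "continuous_on UNIV (grad u)"
    unfolding grad_def[abs_def] by (intro continuous_on_vec_lambda smooth_continuous smooth_partial_deriv u)
  have cg': "continuous_on {0..1::real} (\<lambda>s. grad u (x + s *\<^sub>R v))"
    by (rule continuous_on_compose2[OF cg]) (auto intro!: continuous_intros)
  have "has_bochner_integral lborel (\<lambda>s. indicator {0..1} s *\<^sub>R (v \<bullet> grad u (x + s *\<^sub>R v))) (u (x + 1 *\<^sub>R v) - u (x + 0 *\<^sub>R v))"
  proof (rule has_bochner_integral_FTC_Icc)
    fix s :: real
    have "((\<lambda>t. u (x + t *\<^sub>R v)) has_real_derivative v \<bullet> grad u (x + s *\<^sub>R v)) (at s)"
      using has_real_derivative_line[OF smooth_differentiable[OF u], of x v s]
      by (simp add: inner_vec_def grad_def)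
    then show "((\<lambda>t. u (x + t *\<^sub>R v)) has_vector_derivative v \<bullet> grad u (x + s *\<^sub>R v)) (at s within {0..1})"
      by (simp add: has_real_derivative_iff_has_vector_derivative has_vector_derivative_at_within)
  qed (auto intro!: continuous_intros cg')
  then have int: "integrable lborel (\<lambda>s. indicator {0..1} s *\<^sub>R (v \<bullet> grad u (x + s *\<^sub>R v)))"
     and eq: "(LINT s|lborel. indicator {0..1} s *\<^sub>R (v \<bullet> grad u (x + s *\<^sub>R v))) = u (x + v) - u x"
    by (auto simp: has_bochner_integral_iff)
  have "ennreal \<bar>u x - u (x + v)\<bar> = ennreal (norm (LINT s|lborel. indicator {0..1} s *\<^sub>R (v \<bullet> grad u (x + s *\<^sub>R v))))"
    unfolding eq by (simp add: abs_minus_commute)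
  also have "\<dots> \<le> (\<integral>\<^sup>+s. ennreal (norm (indicator {0..1} s *\<^sub>R (v \<bullet> grad u (x + s *\<^sub>R v)))) \<partial>lborel)"
    by (rule integral_norm_bound_ennreal[OF int])
  also have "\<dots> \<le> (\<integral>\<^sup>+s. indicator {0..1} s * ennreal (norm v * norm (grad u (x + s *\<^sub>R v))) \<partial>lborel)"
    by (intro nn_integral_mono) (auto simp: indicator_def intro!: ennreal_leI Cauchy_Schwarz_ineq2)
  finally show ?thesis .
qed

text \<open>After y = x + v the increment is integrated along the segment, which stays in the convex
  ball B. Translation by s v leaves the integral of the gradient over B as a bound for every s, and
  v ranges over the ball of radius 2 r, whence the volume factor.\<close>

lemma local_poincare:
  fixes u :: "real ^ 'n::finite \<Rightarrow> real"
  assumes u: "smooth u" and r: "r \<ge> 0"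
  defines "B \<equiv> cball (0::real^'n) r"
  shows "(\<integral>\<^sup>+x. \<integral>\<^sup>+y. indicator B x * indicator B y * ennreal \<bar>u x - u y\<bar> \<partial>lborel \<partial>lborel)
     \<le> ennreal (2 * r) * emeasure lborel (cball (0::real^'n) (2 * r)) *
        (\<integral>\<^sup>+x. indicator B x * ennreal (norm (grad u x)) \<partial>lborel)"
proof -
  have [measurable]: "u \<in> borel_measurable borel" "grad u \<in> borel_measurable borel"
    using u by (auto intro: borel_measurable_continuous_onI smooth_continuous smooth_grad_measurable)
  have [measurable]: "B \<in> sets borel" by (simp add: B_def)
  define J where "J = (\<integral>\<^sup>+x. indicator B x * ennreal (norm (grad u x)) \<partial>lborel)"
  have "(\<integral>\<^sup>+x. \<integral>\<^sup>+y. indicator B x * indicator B y * ennreal \<bar>u x - u y\<bar> \<partial>lborel \<partial>lborel)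
     = (\<integral>\<^sup>+x. \<integral>\<^sup>+v. indicator B x * indicator B (x + v) * ennreal \<bar>u x - u (x + v)\<bar> \<partial>lborel \<partial>lborel)"
    by (intro nn_integral_cong nn_integral_translation[symmetric]) measurable
  also have "\<dots> = (\<integral>\<^sup>+v. \<integral>\<^sup>+x. indicator B x * indicator B (x + v) * ennreal \<bar>u x - u (x + v)\<bar> \<partial>lborel \<partial>lborel)"
    by (rule lborel_pair.Fubini') measurable
  also have "\<dots> \<le> (\<integral>\<^sup>+v. indicator (cball (0::real^'n) (2 * r)) v * (ennreal (2 * r) * J) \<partial>lborel)"
  proof (rule nn_integral_mono)
    fix v :: "real ^ 'n"
    have pt: "indicator B x * indicator B (x + v) * ennreal \<bar>u x - u (x + v)\<bar> \<le>
       (\<integral>\<^sup>+s. indicator (cball 0 (2 * r)) v * indicator {0..1} s * ennreal (2 * r) * (indicator B (s *\<^sub>R v + x) * ennreal (norm (grad u (s *\<^sub>R v + x)))) \<partial>lborel)" for x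
    proof (cases "x \<in> B \<and> x + v \<in> B")
      case True
      have "norm v \<le> norm (x + v) + norm x" using norm_triangle_ineq4[of "x + v" x] by simp
      then have v: "norm v \<le> 2 * r" using True by (simp add: B_def)
      have inB: "s *\<^sub>R v + x \<in> B" if "s \<in> {0..1}" for s
      proof -
        have "(1 - s) *\<^sub>R x + s *\<^sub>R (x + v) \<in> B"
          using convexD_alt[of B x "x + v" s] True that by (simp add: B_def)
        then show ?thesis by (simp add: algebra_simps)
      qed
      have "indicator B x * indicator B (x + v) * ennreal \<bar>u x - u (x + v)\<bar> = ennreal \<bar>u x - u (x + v)\<bar>"
        using True by simp
      also have "\<dots> \<le> (\<integral>\<^sup>+s. indicator {0..1} s * ennreal (norm v * norm (grad u (x + s *\<^sub>R v))) \<partial>lborel)"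
        by (rule increment_le_integral_grad[OF u])
      also have "\<dots> \<le> (\<integral>\<^sup>+s. indicator (cball 0 (2 * r)) v * indicator {0..1} s * ennreal (2 * r) * (indicator B (s *\<^sub>R v + x) * ennreal (norm (grad u (s *\<^sub>R v + x)))) \<partial>lborel)"
      proof (rule nn_integral_mono)
        fix s :: real
        show "indicator {0..1} s * ennreal (norm v * norm (grad u (x + s *\<^sub>R v))) \<le>
          indicator (cball 0 (2 * r)) v * indicator {0..1} s * ennreal (2 * r) * (indicator B (s *\<^sub>R v + x) * ennreal (norm (grad u (s *\<^sub>R v + x))))"
          using v inB[of s] r by (auto simp: indicator_def add.commute ennreal_mult[symmetric] intro!: ennreal_leI mult_right_mono)
      qed
      finally show ?thesis .
    qed (auto simp: indicator_def)
    have "(\<integral>\<^sup>+x. indicator B x * indicator B (x + v) * ennreal \<bar>u x - u (x + v)\<bar> \<partial>lborel)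
      \<le> (\<integral>\<^sup>+x. \<integral>\<^sup>+s. indicator (cball 0 (2 * r)) v * indicator {0..1} s * ennreal (2 * r) * (indicator B (s *\<^sub>R v + x) * ennreal (norm (grad u (s *\<^sub>R v + x)))) \<partial>lborel \<partial>lborel)"
      by (intro nn_integral_mono pt)
    also have "\<dots> = (\<integral>\<^sup>+s. \<integral>\<^sup>+x. indicator (cball 0 (2 * r)) v * indicator {0..1} s * ennreal (2 * r) * (indicator B (s *\<^sub>R v + x) * ennreal (norm (grad u (s *\<^sub>R v + x)))) \<partial>lborel \<partial>lborel)"
      by (rule lborel_pair.Fubini') measurable
    also have "\<dots> = (\<integral>\<^sup>+s. indicator (cball 0 (2 * r)) v * indicator {0..1} s * ennreal (2 * r) * J \<partial>(lborel::real measure))"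
    proof (rule nn_integral_cong)
      fix s :: real
      have "(\<integral>\<^sup>+x. indicator B (s *\<^sub>R v + x) * ennreal (norm (grad u (s *\<^sub>R v + x))) \<partial>lborel) = J"
        unfolding J_def by (rule nn_integral_translation) measurable
      then show "(\<integral>\<^sup>+x. indicator (cball 0 (2 * r)) v * indicator {0..1} s * ennreal (2 * r) * (indicator B (s *\<^sub>R v + x) * ennreal (norm (grad u (s *\<^sub>R v + x)))) \<partial>lborel)
        = indicator (cball 0 (2 * r)) v * indicator {0..1} s * ennreal (2 * r) * J"
        by (simp add: nn_integral_cmult)
    qed
    also have "\<dots> = (\<integral>\<^sup>+s. (indicator (cball 0 (2 * r)) v * ennreal (2 * r) * J) * indicator {0..1} s \<partial>(lborel::real measure))"
      by (simp only: mult_ac)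
    also have "\<dots> = indicator (cball 0 (2 * r)) v * (ennreal (2 * r) * J)"
      by (simp add: nn_integral_cmult mult.assoc)
    finally show "(\<integral>\<^sup>+x. indicator B x * indicator B (x + v) * ennreal \<bar>u x - u (x + v)\<bar> \<partial>lborel) \<le> \<dots>" .
  qed
  also have "\<dots> = ennreal (2 * r) * emeasure lborel (cball (0::real^'n) (2 * r)) * J"
    by (subst nn_integral_multc) (auto simp: mult_ac intro!: borel_measurable_indicator)
  finally show ?thesis unfolding J_def .
qed

lemma invertible_norm_bound:
  fixes A :: "real ^ 'n ^ 'n::finite"
  assumes "invertible A"
  obtains c where "c > 0" "\<And>x. norm x \<le> c * norm (transpose A *v x)"
proof -
  have "invertible (transpose A)" using assms by (simp add: invertible_det_nz det_transpose)
  then obtain A' where inv: "A' ** transpose A = mat 1" unfolding invertible_def by blast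
  obtain c where c: "c > 0" "\<And>x. norm (A' *v x) \<le> c * norm x"
    using linear_bounded_pos[OF matrix_vector_mul_linear[of A']] by blast
  have "norm x \<le> c * norm (transpose A *v x)" for x
  proof -
    have "A' *v (transpose A *v x) = x" by (simp only: matrix_vector_mul_assoc inv matrix_vector_mul_lid)
    then show ?thesis using c(2)[of "transpose A *v x"] by metis
  qed
  with c(1) that show ?thesis by blast
qed

context gibbs begin

lemma nn_integral_\<mu>: "f \<in> borel_measurable borel \<Longrightarrow> (\<integral>\<^sup>+x. f x \<partial>\<mu>) = (\<integral>\<^sup>+x. ennreal (\<rho> x) * f x \<partial>lborel)"
  unfolding gibbs_measure_def by (subst nn_integral_density) auto

text \<open>On a ball the Gibbs density lies between two positive constants, so the unweighted
  inequality transfers to \<mu>. Cauchy-Schwarz replaces the L1 norm of the gradient by the root of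
  the Dirichlet energy.\<close>

lemma oscillation_on_ball:
  assumes \<sigma>: "invertible \<sigma>" and r: "r \<ge> 0"
  obtains C where "C \<ge> 0" "\<And>u. test_function u \<Longrightarrow>
     (\<integral>\<^sup>+x. \<integral>\<^sup>+y. indicator (cball 0 r) x * indicator (cball 0 r) y * ennreal \<bar>u x - u y\<bar> \<partial>\<mu> \<partial>\<mu>)
      \<le> ennreal (C * sqrt (LINT x|\<mu>. carre \<sigma> u u x))"
proof -
  let ?B = "cball (0::real^'n) r"
  obtain c where c: "c > 0" "\<And>x. norm x \<le> c * norm (transpose \<sigma> *v x)" by (rule invertible_norm_bound[OF \<sigma>]) blast
  have cpt: "compact (\<rho> ` ?B)"
    by (intro compact_continuous_image continuous_on_subset[OF density_continuous]) auto
  have ne: "\<rho> ` ?B \<noteq> {}" using r by auto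
  obtain M where M: "\<And>x. x \<in> ?B \<Longrightarrow> \<rho> x \<le> M" using compact_attains_sup[OF cpt ne] by (metis imageI)
  obtain x0 where x0: "\<And>x. x \<in> ?B \<Longrightarrow> \<rho> x0 \<le> \<rho> x" using compact_attains_inf[OF cpt ne] by (metis imageE imageI)
  define m where "m = \<rho> x0"
  have m: "m > 0" "\<And>x. x \<in> ?B \<Longrightarrow> m \<le> \<rho> x" using x0 density_pos by (auto simp: m_def)
  have "M \<ge> 0" using M[of 0] density_pos[of 0] r by auto
  define vol where "vol = measure lborel (cball (0::real^'n) (2 * r))"
  have vol: "emeasure lborel (cball (0::real^'n) (2 * r)) = ennreal vol"
    unfolding vol_def using emeasure_bounded_finite[of "cball (0::real^'n) (2*r)"]
    by (intro emeasure_eq_ennreal_measure) auto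
  have "vol \<ge> 0" by (simp add: vol_def)
  \<comment> \<open>Each of the two \<mu>-integrals costs a factor M, the middle factor is the
    constant of \<open>local_poincare\<close>, and c / m comes from inverting \<sigma> and from the
    lower bound on the density.\<close>
  define C where "C = M * M * (2 * r * vol) * (c / m)"
  have "C \<ge> 0" using \<open>M \<ge> 0\<close> \<open>vol \<ge> 0\<close> c m r by (simp add: C_def)
  moreover have "(\<integral>\<^sup>+x. \<integral>\<^sup>+y. indicator ?B x * indicator ?B y * ennreal \<bar>u x - u y\<bar> \<partial>\<mu> \<partial>\<mu>)
      \<le> ennreal (C * sqrt (LINT x|\<mu>. carre \<sigma> u u x))" if u: "test_function u" for u
  proof -
    have [measurable]: "u \<in> borel_measurable borel" "grad u \<in> borel_measurable borel" "carre \<sigma> u u \<in> borel_measurable borel"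
      using u by (auto intro!: test_function_measurable smooth_grad_measurable test_function_smooth test_function_carre)
    have [measurable]: "?B \<in> sets borel" by simp
    have w: "(\<lambda>x. sqrt (carre \<sigma> u u x)) \<in> L2_space \<mu>"
    proof -
      obtain K where "\<And>x. \<bar>carre \<sigma> u u x\<bar> \<le> K" using test_function_bounded[OF test_function_carre(1)[OF u test_function_smooth[OF u]]] by blast
      then have "\<bar>sqrt (carre \<sigma> u u x)\<bar> \<le> sqrt K" for x
        using real_sqrt_le_mono[of "carre \<sigma> u u x" K] by (auto simp: carre_def abs_le_iff)
      then show ?thesis by (rule bounded_mem_L2[rotated]) measurable
    qed
    have wnn: "carre \<sigma> u u x \<ge> 0" for x by (simp add: carre_def)
    have grad_le: "norm (grad u x) \<le> c * sqrt (carre \<sigma> u u x)" for x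
      using c(2)[of "grad u x"] by (simp add: carre_def norm_eq_sqrt_inner)
    have "(\<integral>\<^sup>+x. indicator ?B x * ennreal (norm (grad u x)) \<partial>lborel) \<le> (\<integral>\<^sup>+x. ennreal (\<rho> x) * ennreal (c / m * sqrt (carre \<sigma> u u x)) \<partial>lborel)"
    proof (rule nn_integral_mono)
      fix x :: "real^'n"
      show "indicator ?B x * ennreal (norm (grad u x)) \<le> ennreal (\<rho> x) * ennreal (c / m * sqrt (carre \<sigma> u u x))"
      proof (cases "x \<in> ?B")
        case True
        have "norm (grad u x) \<le> m * (c / m * sqrt (carre \<sigma> u u x))" using grad_le[of x] m(1) by simp
        also have "\<dots> \<le> \<rho> x * (c / m * sqrt (carre \<sigma> u u x))"
          using m(1) m(2)[OF True] c(1) wnn[of x] by (intro mult_right_mono) auto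
        finally show ?thesis using True density_nonneg[of x]
          by (simp add: ennreal_mult'[symmetric] ennreal_leI)
      qed simp
    qed
    also have "\<dots> = (\<integral>\<^sup>+x. ennreal (c / m * sqrt (carre \<sigma> u u x)) \<partial>\<mu>)"
      by (subst nn_integral_\<mu>) auto
    also have "\<dots> = ennreal (LINT x|\<mu>. c / m * sqrt (carre \<sigma> u u x))"
    proof (rule nn_integral_eq_integral)
      have "integrable \<mu> (\<lambda>x. sqrt (carre \<sigma> u u x) * 1)" by (rule L2_space_integrable_mult[OF w const_L2])
      then show "integrable \<mu> (\<lambda>x. c / m * sqrt (carre \<sigma> u u x))" by simp
    qed (use c m wnn in auto)
    also have "(LINT x|\<mu>. c / m * sqrt (carre \<sigma> u u x)) = c / m * (LINT x|\<mu>. \<bar>sqrt (carre \<sigma> u u x)\<bar>)" using wnn by simp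
    also have "ennreal \<dots> \<le> ennreal (c / m * norm (\<Phi> (\<lambda>x. sqrt (carre \<sigma> u u x))))"
      using c m by (intro ennreal_leI mult_left_mono L1_le_norm w) auto
    also have "norm (\<Phi> (\<lambda>x. sqrt (carre \<sigma> u u x))) = sqrt (LINT x|\<mu>. carre \<sigma> u u x)"
      using wnn by (simp add: norm_\<Phi>[OF w] L2_norm_def)
    finally have grad_int: "(\<integral>\<^sup>+x. indicator ?B x * ennreal (norm (grad u x)) \<partial>lborel) \<le> ennreal (c / m * sqrt (LINT x|\<mu>. carre \<sigma> u u x))" .
    have "(\<integral>\<^sup>+x. \<integral>\<^sup>+y. indicator ?B x * indicator ?B y * ennreal \<bar>u x - u y\<bar> \<partial>\<mu> \<partial>\<mu>)
      = (\<integral>\<^sup>+x. ennreal (\<rho> x) * (\<integral>\<^sup>+y. ennreal (\<rho> y) * (indicator ?B x * indicator ?B y * ennreal \<bar>u x - u y\<bar>) \<partial>lborel) \<partial>lborel)"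
    proof -
      have "(\<integral>\<^sup>+y. indicator ?B x * indicator ?B y * ennreal \<bar>u x - u y\<bar> \<partial>\<mu>)
         = (\<integral>\<^sup>+y. ennreal (\<rho> y) * (indicator ?B x * indicator ?B y * ennreal \<bar>u x - u y\<bar>) \<partial>lborel)" for x
        by (rule nn_integral_\<mu>) measurable
      then show ?thesis by (simp only:) (rule nn_integral_\<mu>, measurable)
    qed
    also have "\<dots> \<le> (\<integral>\<^sup>+x. ennreal M * (\<integral>\<^sup>+y. ennreal M * (indicator ?B x * indicator ?B y * ennreal \<bar>u x - u y\<bar>) \<partial>lborel) \<partial>lborel)"
    proof (rule nn_integral_mono)
      fix x :: "real^'n"
      show "ennreal (\<rho> x) * (\<integral>\<^sup>+y. ennreal (\<rho> y) * (indicator ?B x * indicator ?B y * ennreal \<bar>u x - u y\<bar>) \<partial>lborel) \<le>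
        ennreal M * (\<integral>\<^sup>+y. ennreal M * (indicator ?B x * indicator ?B y * ennreal \<bar>u x - u y\<bar>) \<partial>lborel)"
      proof (cases "x \<in> ?B")
        case True
        have "ennreal (\<rho> y) * (indicator ?B x * indicator ?B y * ennreal \<bar>u x - u y\<bar>) \<le> ennreal M * (indicator ?B x * indicator ?B y * ennreal \<bar>u x - u y\<bar>)" for y
          using M[of y] by (cases "y \<in> ?B") (auto intro!: mult_right_mono ennreal_leI)
        then show ?thesis by (intro mult_mono[OF ennreal_leI[OF M[OF True]]] nn_integral_mono) auto
      qed simp
    qed
    also have "\<dots> = ennreal M * (ennreal M * (\<integral>\<^sup>+x. \<integral>\<^sup>+y. indicator ?B x * indicator ?B y * ennreal \<bar>u x - u y\<bar> \<partial>lborel \<partial>lborel))"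
      by (simp add: nn_integral_cmult)
    also have "\<dots> \<le> ennreal M * (ennreal M * (ennreal (2 * r) * ennreal vol * ennreal (c / m * sqrt (LINT x|\<mu>. carre \<sigma> u u x))))"
      unfolding vol[symmetric]
      by (intro mult_left_mono order_trans[OF local_poincare[OF test_function_smooth[OF u] r]] grad_int) auto
    also have "\<dots> = ennreal (M * (M * (2 * r * vol * (c / m * sqrt (LINT x|\<mu>. carre \<sigma> u u x)))))"
    proof -
      have "ennreal M * (ennreal M * (ennreal k * ennreal vol * ennreal s)) = ennreal (M * (M * (k * vol * s)))"
        if "k \<ge> 0" "s \<ge> 0" for k s
        using that \<open>M \<ge> 0\<close> \<open>vol \<ge> 0\<close> by (simp add: ennreal_mult)
      then show ?thesis using c(1) m(1) r wnn by (simp add: integral_nonneg_AE)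
    qed
    also have "M * (M * (2 * r * vol * (c / m * sqrt (LINT x|\<mu>. carre \<sigma> u u x)))) = C * sqrt (LINT x|\<mu>. carre \<sigma> u u x)"
      by (simp add: C_def)
    finally show ?thesis .
  qed
  ultimately show ?thesis using that by blast
qed

text \<open>Unless both points lie in B, |u x - u y| is at most (1(x) + 1(y)) (|u x| + |u y|), where
  1 is the indicator of the complement. Integrated, this is 2 Q + 2 P \<integral>|u|, and both terms
  are at most 2 sqrt P times the L2 norm of u, which gives the 4.\<close>

lemma deviation_bound:
  assumes [measurable]: "B \<in> sets borel" and u: "test_function u"
    and osc: "(\<integral>\<^sup>+x. \<integral>\<^sup>+y. indicator B x * indicator B y * ennreal \<bar>u x - u y\<bar> \<partial>\<mu> \<partial>\<mu>) \<le> ennreal D" and D: "D \<ge> 0"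
  shows "(LINT x|\<mu>. \<bar>u x - (LINT y|\<mu>. u y)\<bar>) \<le> D + 4 * norm (\<Phi> u) * sqrt (measure \<mu> (- B))"
proof -
  interpret prob_space \<mu> by (rule prob_space_\<mu>)
  have [measurable]: "u \<in> borel_measurable borel" by (rule test_function_measurable[OF u])
  have uL2: "u \<in> L2_space \<mu>" "(\<lambda>x. \<bar>u x\<bar>) \<in> L2_space \<mu>" "indicator (- B) \<in> L2_space \<mu>"
    using test_function_L2[OF u] bounded_mem_L2[of "indicator (- B)" 1] by (auto simp: L2_space_iff)
  have iu: "integrable \<mu> u" using L2_space_integrable_mult[OF uL2(1) const_L2[of 1]] by simp
  have iau: "integrable \<mu> (\<lambda>x. \<bar>u x\<bar>)" using iu by simp
  have iab: "integrable \<mu> (\<lambda>x. indicator (- B) x * \<bar>u x\<bar>)" using L2_space_integrable_mult[OF uL2(3,2)] .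
  let ?a = "\<lambda>x. indicator (- B) x :: ennreal" and ?b = "\<lambda>x. ennreal \<bar>u x\<bar>"
  define P where "P = measure \<mu> (- B)"
  define Q where "Q = (LINT x|\<mu>. indicator (- B) x * \<bar>u x\<bar>)"
  have P: "0 \<le> P" "P \<le> 1" by (auto simp: P_def)
  have Qle: "Q \<le> sqrt P * norm (\<Phi> u)"
  proof -
    have "Q = \<Phi> (indicator (- B)) \<bullet> \<Phi> (\<lambda>x. \<bar>u x\<bar>)" by (simp add: Q_def inner_\<Phi> uL2)
    also have "\<dots> \<le> norm (\<Phi> (indicator (- B))) * norm (\<Phi> (\<lambda>x. \<bar>u x\<bar>))" by (rule norm_cauchy_schwarz)
    also have "norm (\<Phi> (\<lambda>x. \<bar>u x\<bar>)) = norm (\<Phi> u)" by (simp add: norm_\<Phi> uL2 L2_norm_def)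
    also have "norm (\<Phi> (indicator (- B))) = sqrt P"
    proof -
      have "(indicator (- B) x)\<^sup>2 = indicat_real (- B) x" for x by (simp add: indicator_def)
      then show ?thesis using uL2(3) by (simp add: norm_\<Phi> L2_norm_def P_def)
    qed
    finally show ?thesis .
  qed
  have E: "(LINT x|\<mu>. \<bar>u x\<bar>) \<le> norm (\<Phi> u)" by (rule L1_le_norm[OF uL2(1)])
  have sumI: "(\<integral>\<^sup>+x. \<integral>\<^sup>+y. (?a x + ?a y) * (?b x + ?b y) \<partial>\<mu> \<partial>\<mu>) = ennreal (2 * Q + 2 * P * (LINT x|\<mu>. \<bar>u x\<bar>))"
  proof -
    have e1: "(\<integral>\<^sup>+x. ?b x \<partial>\<mu>) = ennreal (LINT x|\<mu>. \<bar>u x\<bar>)" using iau by (intro nn_integral_eq_integral) auto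
    have e2: "(\<integral>\<^sup>+x. ?a x \<partial>\<mu>) = ennreal P" by (simp add: P_def emeasure_eq_measure)
    have e3: "(\<integral>\<^sup>+x. ?a x * ?b x \<partial>\<mu>) = ennreal Q"
    proof -
      have "(\<integral>\<^sup>+x. ?a x * ?b x \<partial>\<mu>) = (\<integral>\<^sup>+x. ennreal (indicator (- B) x * \<bar>u x\<bar>) \<partial>\<mu>)"
        by (intro nn_integral_cong) (auto simp: indicator_def)
      also have "\<dots> = ennreal Q" unfolding Q_def using iab by (intro nn_integral_eq_integral) auto
      finally show ?thesis .
    qed
    have "(\<integral>\<^sup>+y. (?a x + ?a y) * (?b x + ?b y) \<partial>\<mu>) = ?a x * ?b x + ?a x * ennreal (LINT x|\<mu>. \<bar>u x\<bar>) + ennreal P * ?b x + ennreal Q" for x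
    proof -
      have "(\<integral>\<^sup>+y. (?a x + ?a y) * (?b x + ?b y) \<partial>\<mu>) = (\<integral>\<^sup>+y. ?a x * ?b x + ?a x * ?b y + ?a y * ?b x + ?a y * ?b y \<partial>\<mu>)"
        by (simp only: distrib_left distrib_right add.assoc add.left_commute)
      also have "\<dots> = (\<integral>\<^sup>+y. ?a x * ?b x \<partial>\<mu>) + (\<integral>\<^sup>+y. ?a x * ?b y \<partial>\<mu>) + (\<integral>\<^sup>+y. ?a y * ?b x \<partial>\<mu>) + (\<integral>\<^sup>+y. ?a y * ?b y \<partial>\<mu>)"
        by (simp add: nn_integral_add)
      also have "\<dots> = ?a x * ?b x + ?a x * ennreal (LINT x|\<mu>. \<bar>u x\<bar>) + ennreal P * ?b x + ennreal Q"
        by (subst nn_integral_cmult, simp, subst nn_integral_multc, simp) (simp only: e1 e2 e3 nn_integral_const emeasure_space_1 mult_1_right)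
      finally show ?thesis .
    qed
    then have "(\<integral>\<^sup>+x. \<integral>\<^sup>+y. (?a x + ?a y) * (?b x + ?b y) \<partial>\<mu> \<partial>\<mu>) = (\<integral>\<^sup>+x. ?a x * ?b x + ?a x * ennreal (LINT x|\<mu>. \<bar>u x\<bar>) + ennreal P * ?b x + ennreal Q \<partial>\<mu>)"
      by simp
    also have "\<dots> = (\<integral>\<^sup>+x. ?a x * ?b x \<partial>\<mu>) + (\<integral>\<^sup>+x. ?a x * ennreal (LINT x|\<mu>. \<bar>u x\<bar>) \<partial>\<mu>) + (\<integral>\<^sup>+x. ennreal P * ?b x \<partial>\<mu>) + (\<integral>\<^sup>+x. ennreal Q \<partial>\<mu>)"
      by (simp add: nn_integral_add)
    also have "\<dots> = ennreal Q + ennreal P * ennreal (LINT x|\<mu>. \<bar>u x\<bar>) + ennreal P * ennreal (LINT x|\<mu>. \<bar>u x\<bar>) + ennreal Q"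
      by (subst nn_integral_cmult, simp, subst nn_integral_multc, simp) (simp only: e1 e2 e3 nn_integral_const emeasure_space_1 mult_1_right)
    also have "\<dots> = ennreal (2 * Q + 2 * P * (LINT x|\<mu>. \<bar>u x\<bar>))"
    proof -
      have "Q \<ge> 0" by (simp add: Q_def integral_nonneg_AE)
      then show ?thesis using P by (simp add: ennreal_mult[symmetric] ennreal_plus[symmetric] integral_nonneg_AE algebra_simps del: ennreal_plus)
    qed
    finally show ?thesis .
  qed
  have "ennreal (LINT x|\<mu>. \<bar>u x - (LINT y|\<mu>. u y)\<bar>) = (\<integral>\<^sup>+x. ennreal \<bar>u x - (LINT y|\<mu>. u y)\<bar> \<partial>\<mu>)"
    using iu by (intro nn_integral_eq_integral[symmetric]) auto
  also have "\<dots> \<le> (\<integral>\<^sup>+x. \<integral>\<^sup>+y. ennreal \<bar>u x - u y\<bar> \<partial>\<mu> \<partial>\<mu>)"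
  proof (rule nn_integral_mono)
    fix x
    have "u x - (LINT y|\<mu>. u y) = (LINT y|\<mu>. u x - u y)" using iu by (simp add: prob_space[unfolded space_\<mu>])
    then have "ennreal \<bar>u x - (LINT y|\<mu>. u y)\<bar> = ennreal (norm (LINT y|\<mu>. u x - u y))" by simp
    also have "\<dots> \<le> (\<integral>\<^sup>+y. ennreal (norm (u x - u y)) \<partial>\<mu>)" using iu by (intro integral_norm_bound_ennreal) auto
    finally show "ennreal \<bar>u x - (LINT y|\<mu>. u y)\<bar> \<le> (\<integral>\<^sup>+y. ennreal \<bar>u x - u y\<bar> \<partial>\<mu>)" by simp
  qed
  also have "\<dots> \<le> (\<integral>\<^sup>+x. \<integral>\<^sup>+y. indicator B x * indicator B y * ennreal \<bar>u x - u y\<bar> + (?a x + ?a y) * (?b x + ?b y) \<partial>\<mu> \<partial>\<mu>)"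
  proof (intro nn_integral_mono)
    fix x y
    have le: "ennreal \<bar>u x - u y\<bar> \<le> ?b x + ?b y" by (simp add: ennreal_plus[symmetric] ennreal_leI del: ennreal_plus)
    show "ennreal \<bar>u x - u y\<bar> \<le> indicator B x * indicator B y * ennreal \<bar>u x - u y\<bar> + (?a x + ?a y) * (?b x + ?b y)"
    proof (cases "x \<in> B \<and> y \<in> B")
      case False
      have "?b x + ?b y \<le> (?a x + ?a y) * (?b x + ?b y)"
        using False mult_right_mono[of 1 "?a x + ?a y" "?b x + ?b y"] by (auto simp: indicator_def)
      then show ?thesis using le False by (auto intro: order_trans)
    qed auto
  qed
  also have "\<dots> = (\<integral>\<^sup>+x. \<integral>\<^sup>+y. indicator B x * indicator B y * ennreal \<bar>u x - u y\<bar> \<partial>\<mu> \<partial>\<mu>) + (\<integral>\<^sup>+x. \<integral>\<^sup>+y. (?a x + ?a y) * (?b x + ?b y) \<partial>\<mu> \<partial>\<mu>)"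
    by (simp add: nn_integral_add)
  also have "\<dots> \<le> ennreal D + ennreal (2 * Q + 2 * P * (LINT x|\<mu>. \<bar>u x\<bar>))"
    unfolding sumI by (intro add_right_mono osc)
  also have "\<dots> = ennreal (D + (2 * Q + 2 * P * (LINT x|\<mu>. \<bar>u x\<bar>)))"
    using D P by (intro ennreal_plus[symmetric]) (auto simp: Q_def integral_nonneg_AE)
  finally have "(LINT x|\<mu>. \<bar>u x - (LINT y|\<mu>. u y)\<bar>) \<le> D + (2 * Q + 2 * P * (LINT x|\<mu>. \<bar>u x\<bar>))"
    using D P by (subst (asm) ennreal_le_iff) (auto simp: Q_def integral_nonneg_AE)
  also have "\<dots> \<le> D + (2 * (sqrt P * norm (\<Phi> u)) + 2 * sqrt P * norm (\<Phi> u))"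
  proof -
    have "P \<le> sqrt P" using P by (simp add: real_le_rsqrt power2_eq_square mult_left_le)
    then have "P * (LINT x|\<mu>. \<bar>u x\<bar>) \<le> sqrt P * norm (\<Phi> u)" using E P by (intro mult_mono) auto
    then show ?thesis using Qle by simp
  qed
  finally show ?thesis by (simp add: P_def algebra_simps)
qed

end

context gibbs_semigroup begin

text \<open>Increments of orbits lie in the closure of the range of the generator, and the range is
  orthogonal to 1. The orthogonality is proved on test functions and extended by closure, because
  the constant 1 is not itself a test function.\<close>

lemma T_preserves_mean:
  assumes "(F, H) \<in> G" "t \<ge> 0" shows "T t F \<bullet> \<Phi> (\<lambda>x. 1) = F \<bullet> \<Phi> (\<lambda>x. 1)"
proof (cases "t = 0")
  case False
  then have t: "t > 0" using assms by simp
  have range_orth: "v \<bullet> \<Phi> (\<lambda>x. 1) = 0" if uv: "(u, v) \<in> G" for u v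
  proof -
    obtain w where w: "\<And>n::nat. test_function (w n)" "(\<lambda>n. \<Phi> (w n)) \<longlonglongrightarrow> u" "(\<lambda>n. \<Phi> (L (w n))) \<longlonglongrightarrow> v"
      by (rule G_closure[OF uv]) blast
    have "\<Phi> (L (w n)) \<bullet> \<Phi> (\<lambda>x. 1) = 0" for n
    proof -
      have "carre \<sigma> (w n) (\<lambda>x. 1) x = 0" for x by (simp add: carre_sum partial_deriv_const)
      then show ?thesis
        using generator_\<mu>[of "w n" "\<lambda>x. 1" \<sigma>]
        by (simp add: inner_\<Phi> test_function_L2 test_function_generator smooth_V w(1) const_L2 smooth_const)
    qed
    then show ?thesis using tendsto_inner[OF w(3) tendsto_const[of "\<Phi> (\<lambda>x. 1)"]] by (simp add: LIMSEQ_const_iff)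
  qed
  have "\<bar>(T t F - F) \<bullet> \<Phi> (\<lambda>x. 1)\<bar> \<le> \<eta> * norm (\<Phi> (\<lambda>x. 1))" if \<eta>: "\<eta> > 0" for \<eta>
  proof -
    obtain u v where uv: "(u, v) \<in> G" "norm (T t F - F - v) < \<eta>"
      by (rule increment_in_closure_of_range[OF assms(1) t \<eta>]) blast
    have "(T t F - F) \<bullet> \<Phi> (\<lambda>x. 1) = (T t F - F - v) \<bullet> \<Phi> (\<lambda>x. 1)"
      using range_orth[OF uv(1)] by (simp add: inner_diff_left)
    also have "\<bar>\<dots>\<bar> \<le> norm (T t F - F - v) * norm (\<Phi> (\<lambda>x. 1))" by (rule Cauchy_Schwarz_ineq2)
    also have "\<dots> \<le> \<eta> * norm (\<Phi> (\<lambda>x. 1))" using uv(2) by (intro mult_right_mono) auto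
    finally show ?thesis .
  qed
  moreover have "norm (\<Phi> (\<lambda>x. 1)) = 1"
    using prob_space.prob_space[OF prob_space_\<mu>] by (simp add: norm_\<Phi> const_L2 L2_norm_def)
  ultimately have bd: "\<bar>(T t F - F) \<bullet> \<Phi> (\<lambda>x. 1)\<bar> \<le> \<eta>" if "\<eta> > 0" for \<eta>
    using that by simp
  have "\<bar>(T t F - F) \<bullet> \<Phi> (\<lambda>x. 1)\<bar> \<le> 0"
    by (rule field_le_epsilon) (simp only: add_0 bd)
  then show ?thesis by (simp add: inner_diff_left)
qed (simp add: T0)

lemma G_approx:
  assumes "(F, H) \<in> G" "\<eta> > 0"
  obtains u where "test_function u" "norm (\<Phi> u - F) < \<eta>" "norm (\<Phi> (L u) - H) < \<eta>"
proof -
  obtain w where w: "\<And>n::nat. test_function (w n)" "(\<lambda>n. \<Phi> (w n)) \<longlonglongrightarrow> F" "(\<lambda>n. \<Phi> (L (w n))) \<longlonglongrightarrow> H"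
    by (rule G_closure[OF assms(1)]) blast
  have "\<forall>\<^sub>F n in sequentially. dist (\<Phi> (w n)) F < \<eta>" "\<forall>\<^sub>F n in sequentially. dist (\<Phi> (L (w n))) H < \<eta>"
    using w assms(2) by (auto intro: tendstoD)
  then have "\<forall>\<^sub>F n in sequentially. dist (\<Phi> (w n)) F < \<eta> \<and> dist (\<Phi> (L (w n))) H < \<eta>" by eventually_elim simp
  then obtain n where "dist (\<Phi> (w n)) F < \<eta>" "dist (\<Phi> (L (w n))) H < \<eta>"
    using eventually_happens'[OF sequentially_bot] by blast
  then show ?thesis using that[OF w(1)] by (simp add: dist_norm)
qed

lemma tail_small:
  assumes "\<eta> > 0" obtains r where "r \<ge> 0" "measure \<mu> (- cball 0 r) < \<eta>"
proof -
  interpret prob_space \<mu> by (rule prob_space_\<mu>)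
  have "(\<lambda>n. measure \<mu> (- cball 0 (real n))) \<longlonglongrightarrow> measure \<mu> (\<Inter>n. - cball 0 (real n))"
    by (rule finite_Lim_measure_decseq) (auto simp: decseq_def)
  moreover have "(\<Inter>n. - cball (0::real^'n) (real n)) = {}" using real_arch_simple by fastforce
  ultimately have "(\<lambda>n. measure \<mu> (- cball 0 (real n))) \<longlonglongrightarrow> 0" by simp
  from order_tendstoD(2)[OF this assms] have "\<forall>\<^sub>F n in sequentially. measure \<mu> (- cball 0 (real n)) < \<eta>" .
  then obtain n :: nat where "measure \<mu> (- cball 0 (real n)) < \<eta>" using eventually_happens'[OF sequentially_bot] by blast
  then show ?thesis using that[of "real n"] by simp
qed

text \<open>Along \<open>T n \<psi>\<close> the L2 norm stays bounded while the Dirichlet energy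
  tends to 0, so the function approaches its mean in L1, and this mean is conserved. The difference
  of \<open>T n \<psi>\<close> and \<psi> lies in the closure of the range. The radius of the ball
  must be fixed before n, since the oscillation constant depends on it.\<close>

lemma generator_range_dense:
  assumes \<sigma>: "invertible \<sigma>" and \<psi>: "test_function \<psi>" and \<eta>: "\<eta> > 0"
  obtains u where "test_function u" "(LINT x|\<mu>. \<bar>\<psi> x - (LINT y|\<mu>. \<psi> y) - L u x\<bar>) < \<eta>"
proof -
  interpret \<mu>: prob_space \<mu> by (rule prob_space_\<mu>)
  note tg = test_function_generator[OF smooth_V]
  define F H where "F = \<Phi> \<psi>" and "H = \<Phi> (L \<psi>)"
  define c where "c = (LINT y|\<mu>. \<psi> y)"
  define K where "K = norm F + 1"
  have K: "K > 0" unfolding K_def using norm_ge_zero[of F] by linarith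
  have FH: "(F, H) \<in> G" unfolding F_def H_def by (rule test_in_G[OF \<psi>])
  have HH: "(H, \<Phi> (L (L \<psi>))) \<in> G" unfolding H_def by (intro test_in_G tg \<psi>)
  \<comment> \<open>The oscillation estimate is available for test functions, so the orbit is
    replaced by test functions close to it in graph norm.\<close>
  have "\<exists>u. test_function u \<and> norm (\<Phi> u - T (real n) F) < inverse (real (Suc n)) \<and> norm (\<Phi> (L u) - T (real n) H) < inverse (real (Suc n))" for n
  proof -
    have "inverse (real (Suc n)) > 0" "real n \<ge> 0" by auto
    from G_approx[OF G_invariant[OF FH this(2)] this(1)] show ?thesis by metis
  qed
  then obtain u where u: "\<And>n. test_function (u n)" "\<And>n. norm (\<Phi> (u n) - T (real n) F) < inverse (real (Suc n))"
     "\<And>n. norm (\<Phi> (L (u n)) - T (real n) H) < inverse (real (Suc n))" by metis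
  have inv0: "(\<lambda>n. inverse (real (Suc n))) \<longlonglongrightarrow> 0" by (rule LIMSEQ_inverse_real_of_nat)
  have u_bd: "norm (\<Phi> (u n)) \<le> K" for n
  proof -
    have "norm (T (real n) F) \<le> norm F" using norm_T_antimono[OF FH, of 0 "real n"] by (simp add: T0)
    moreover have "inverse (real (Suc n)) \<le> 1" by (simp add: inverse_eq_divide)
    moreover have "norm (\<Phi> (u n)) \<le> norm (T (real n) F) + norm (\<Phi> (u n) - T (real n) F)" by (rule norm_triangle_sub)
    ultimately show ?thesis using u(2)[of n] by (simp add: K_def)
  qed
  have uF: "(\<lambda>n. \<Phi> (u n) - T (real n) F) \<longlonglongrightarrow> 0"
    by (rule Lim_null_comparison[OF _ inv0]) (intro always_eventually allI less_imp_le u)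
  have Lu0: "(\<lambda>n. \<Phi> (L (u n))) \<longlonglongrightarrow> 0"
  proof -
    have "(\<lambda>n. \<Phi> (L (u n)) - T (real n) H) \<longlonglongrightarrow> 0"
      by (rule Lim_null_comparison[OF _ inv0]) (intro always_eventually allI less_imp_le u)
    moreover have "(\<lambda>n. T (real n) H) \<longlonglongrightarrow> 0"
      by (rule filterlim_compose[OF decay[OF FH HH] filterlim_real_sequentially])
    ultimately have "(\<lambda>n. (\<Phi> (L (u n)) - T (real n) H) + T (real n) H) \<longlonglongrightarrow> 0 + 0" by (rule tendsto_add)
    then show ?thesis by simp
  qed
  define e where "e n = (LINT x|\<mu>. carre \<sigma> (u n) (u n) x)" for n
  have e0: "(\<lambda>n. e n) \<longlonglongrightarrow> 0"
  proof (rule Lim_null_comparison)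
    show "\<forall>\<^sub>F n in sequentially. norm (e n) \<le> norm (\<Phi> (L (u n))) * K"
    proof (intro always_eventually allI)
      fix n
      have "norm (e n) = \<bar>\<Phi> (L (u n)) \<bullet> \<Phi> (u n)\<bar>"
        using inner_L_test[OF u(1) u(1), of n n] by (simp add: e_def)
      also have "\<dots> \<le> norm (\<Phi> (L (u n))) * norm (\<Phi> (u n))" by (rule Cauchy_Schwarz_ineq2)
      also have "\<dots> \<le> norm (\<Phi> (L (u n))) * K" by (intro mult_left_mono u_bd) simp
      finally show "norm (e n) \<le> norm (\<Phi> (L (u n))) * K" .
    qed
    show "(\<lambda>n. norm (\<Phi> (L (u n))) * K) \<longlonglongrightarrow> 0" using Lu0 by (intro tendsto_mult_left_zero tendsto_norm_zero)
  qed
  define m where "m n = (LINT y|\<mu>. u n y)" for n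
  have m: "(\<lambda>n. m n) \<longlonglongrightarrow> c"
  proof -
    have "m n - c = (\<Phi> (u n) - T (real n) F) \<bullet> \<Phi> (\<lambda>x. 1)" for n
      using T_preserves_mean[OF FH, of "real n"] inner_\<Phi>[OF test_function_L2[OF u(1)] const_L2[of 1], of n]
        inner_\<Phi>[OF test_function_L2[OF \<psi>] const_L2[of 1]]
      by (simp add: inner_diff_left m_def c_def F_def)
    then have "(\<lambda>n. m n - c) \<longlonglongrightarrow> 0" using tendsto_inner[OF uF tendsto_const[of "\<Phi> (\<lambda>x. 1)"]] by simp
    then show ?thesis by (rule LIM_zero_cancel)
  qed
  \<comment> \<open>The tail contribution 4 K sqrt \<theta> becomes \<eta> / 10; altogether six
    tenths of \<eta> are spent.\<close>
  define \<theta> where "\<theta> = (\<eta> / (40 * K))\<^sup>2"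
  have \<theta>: "\<theta> > 0" "sqrt \<theta> = \<eta> / (40 * K)" using \<eta> K by (auto simp: \<theta>_def)
  obtain r where r: "r \<ge> 0" "measure \<mu> (- cball 0 r) < \<theta>" by (rule tail_small[OF \<theta>(1)]) blast
  obtain C where C: "C \<ge> 0" "\<And>u. test_function u \<Longrightarrow>
     (\<integral>\<^sup>+x. \<integral>\<^sup>+y. indicator (cball 0 r) x * indicator (cball 0 r) y * ennreal \<bar>u x - u y\<bar> \<partial>\<mu> \<partial>\<mu>)
      \<le> ennreal (C * sqrt (LINT x|\<mu>. carre \<sigma> u u x))"
    by (rule oscillation_on_ball[OF \<sigma> r(1)]) blast
  have dev: "(LINT x|\<mu>. \<bar>u n x - m n\<bar>) \<le> C * sqrt (e n) + \<eta> / 10" for n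
  proof -
    have "(LINT x|\<mu>. \<bar>u n x - m n\<bar>) \<le> C * sqrt (e n) + 4 * norm (\<Phi> (u n)) * sqrt (measure \<mu> (- cball 0 r))"
      unfolding m_def e_def
      by (rule deviation_bound[OF _ u(1) C(2)[OF u(1)]]) (use C(1) in \<open>auto simp: carre_def integral_nonneg_AE\<close>)
    also have "4 * norm (\<Phi> (u n)) * sqrt (measure \<mu> (- cball 0 r)) \<le> 4 * K * sqrt \<theta>"
      using u_bd[of n] r(2) K by (intro mult_mono real_sqrt_le_mono) auto
    also have "4 * K * sqrt \<theta> = \<eta> / 10" using K by (simp add: \<theta>)
    finally show ?thesis by simp
  qed
  have "(\<lambda>n. C * sqrt (e n) + norm (m n - c) + norm (\<Phi> (u n) - T (real n) F)) \<longlonglongrightarrow> C * sqrt 0 + 0 + 0"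
    by (intro tendsto_intros e0 tendsto_norm_zero uF LIM_zero m)
  then have "(\<lambda>n. C * sqrt (e n) + norm (m n - c) + norm (\<Phi> (u n) - T (real n) F)) \<longlonglongrightarrow> 0" by simp
  moreover have "\<eta> / 10 > 0" using \<eta> by simp
  ultimately have "\<forall>\<^sub>F n in sequentially. C * sqrt (e n) + norm (m n - c) + norm (\<Phi> (u n) - T (real n) F) < \<eta> / 10"
    by (rule order_tendstoD(2))
  then have "\<forall>\<^sub>F n in sequentially. C * sqrt (e n) + norm (m n - c) + norm (\<Phi> (u n) - T (real n) F) < \<eta> / 10 \<and> n > 0"
    using eventually_gt_at_top[of "0::nat"] by eventually_elim simp
  then obtain n where n: "C * sqrt (e n) + norm (m n - c) + norm (\<Phi> (u n) - T (real n) F) < \<eta> / 10" "n > 0"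
    using eventually_happens'[OF sequentially_bot] by blast
  have en: "e n \<ge> 0" by (simp add: e_def carre_def integral_nonneg_AE)
  then have n': "C * sqrt (e n) < \<eta> / 10" "\<bar>m n - c\<bar> < \<eta> / 10" "norm (\<Phi> (u n) - T (real n) F) < \<eta> / 10"
    using n(1) C(1) mult_nonneg_nonneg[OF C(1) real_sqrt_ge_zero[OF en]] norm_ge_zero[of "m n - c"] norm_ge_zero[of "\<Phi> (u n) - T (real n) F"]
    unfolding real_norm_def by linarith+
  have eta10: "\<eta> / 10 > 0" and n0: "real n > 0" using \<eta> n(2) by auto
  obtain U Y where UY: "(U, Y) \<in> G" "norm (T (real n) F - F - Y) < \<eta> / 10"
    by (rule increment_in_closure_of_range[OF FH n0 eta10]) blast
  obtain w where w: "test_function w" "norm (\<Phi> w - U) < \<eta> / 10" "norm (\<Phi> (L w) - Y) < \<eta> / 10"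
    by (rule G_approx[OF UY(1) eta10]) blast
  let ?d = "\<lambda>x. (\<psi> x + L w x) - u n x"
  have L2: "\<psi> \<in> L2_space \<mu>" "L w \<in> L2_space \<mu>" "u n \<in> L2_space \<mu>" by (intro test_function_L2 tg \<psi> w u)+
  then have d: "?d \<in> L2_space \<mu>" by (intro L2_space_diff L2_space_add)
  define a b z where "a = \<Phi> (L w) - Y" and "b = T (real n) F - F - Y" and "z = \<Phi> (u n) - T (real n) F"
  have "\<Phi> ?d = (F + \<Phi> (L w)) - \<Phi> (u n)" using L2 by (simp add: \<Phi>_diff \<Phi>_add L2_space_add F_def)
  then have ab: "\<Phi> ?d = a - b - z" by (simp add: a_def b_def z_def)
  have "norm (a - b - z) \<le> norm a + norm b + norm z"
    by (rule order_trans[OF norm_triangle_ineq4 add_right_mono[OF norm_triangle_ineq4]])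
  moreover have "norm a < \<eta> / 10" "norm b < \<eta> / 10" "norm z < \<eta> / 10"
    unfolding a_def b_def z_def by (rule w(3) UY(2) n'(3))+
  ultimately have "norm (\<Phi> ?d) < 3 * \<eta> / 10" unfolding ab by linarith
  then have d1: "(LINT x|\<mu>. \<bar>?d x\<bar>) < 3 * \<eta> / 10" using L1_le_norm[OF d] by linarith
  have i1: "integrable \<mu> f" if "f \<in> L2_space \<mu>" for f
    using L2_space_integrable_mult[OF that const_L2[of 1]] by simp
  have "(LINT x|\<mu>. \<bar>\<psi> x - c + L w x\<bar>) \<le> (LINT x|\<mu>. \<bar>?d x\<bar> + \<bar>u n x - m n\<bar> + \<bar>m n - c\<bar>)"
    by (rule integral_mono) (use i1[OF d] i1 L2 in auto)
  also have "\<dots> = (LINT x|\<mu>. \<bar>?d x\<bar>) + (LINT x|\<mu>. \<bar>u n x - m n\<bar>) + \<bar>m n - c\<bar>"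
    using i1[OF d] i1[OF L2(3)] by (simp add: \<mu>.prob_space[unfolded space_\<mu>])
  also have "\<dots> < \<eta>" using d1 dev[of n] n'(1,2) \<eta> by linarith
  finally have "(LINT x|\<mu>. \<bar>\<psi> x - c + L w x\<bar>) < \<eta>" .
  \<comment> \<open>\<open>L w\<close> approximates \<open>T n F - F\<close>, which is close to c -
    \<psi>; hence the sign of the witness.\<close>
  moreover have "L (\<lambda>x. - w x) x = - L w x" for x
  proof -
    have "partial_deriv i (\<lambda>x. - f x) = (\<lambda>x. - partial_deriv i f x)" if "smooth f" for i and f :: "real^'n \<Rightarrow> real"
      using partial_deriv_mult[of "\<lambda>_. -1" f i] smooth_differentiable[OF that]
      by (simp add: partial_deriv_const)
    then have "partial_deriv j (\<lambda>x. - w x) = (\<lambda>x. - partial_deriv j w x)"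
      "partial_deriv i (\<lambda>x. - partial_deriv j w x) = (\<lambda>x. - partial_deriv i (partial_deriv j w) x)" for i j
      using test_function_smooth[OF w(1)] smooth_partial_deriv by blast+
    then have "L (\<lambda>x. - w x) x = (\<Sum>i\<in>UNIV. \<Sum>j\<in>UNIV. - (diffusion \<sigma> $ i $ j *
        (partial_deriv i (partial_deriv j w) x - partial_deriv i V x * partial_deriv j w x)))"
      unfolding unperturbed_generator_sum by (intro sum.cong refl) (simp add: algebra_simps)
    then show ?thesis unfolding unperturbed_generator_sum by (simp only: sum_negf)
  qed
  ultimately have "(LINT x|\<mu>. \<bar>\<psi> x - c - L (\<lambda>x. - w x) x\<bar>) < \<eta>" by simp
  then show ?thesis using that[of "\<lambda>x. - w x"] test_function_uminus[OF w(1)] unfolding c_def by blast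
qed

end

section \<open>Almost reversible Markov chains\<close>

lemma weighted_Cauchy_Schwarz:
  fixes f g w :: "'a::euclidean_space \<Rightarrow> real"
  assumes [measurable]: "f \<in> borel_measurable borel" "g \<in> borel_measurable borel" "w \<in> borel_measurable borel"
    and w: "\<And>x. w x \<ge> 0" and "integrable lborel (\<lambda>x. (f x)\<^sup>2 * w x)" "integrable lborel (\<lambda>x. (g x)\<^sup>2 * w x)"
  shows "(LINT x|lborel. f x * g x * w x)\<^sup>2 \<le> (LINT x|lborel. (f x)\<^sup>2 * w x) * (LINT x|lborel. (g x)\<^sup>2 * w x)"
proof -
  have m: "(\<lambda>x. f x * sqrt (w x)) \<in> L2_space lborel" "(\<lambda>x. g x * sqrt (w x)) \<in> L2_space lborel"
    using assms by (auto simp: L2_space_iff power_mult_distrib)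
  have e: "(a * sqrt (w x)) * (b * sqrt (w x)) = a * b * w x" for a b x
  proof -
    have "(a * sqrt (w x)) * (b * sqrt (w x)) = a * b * (sqrt (w x) * sqrt (w x))" by (simp only: mult_ac)
    then show ?thesis using w[of x] by simp
  qed
  show ?thesis
    using Cauchy_Schwarz_ineq[of "abs_l2 (\<lambda>x. f x * sqrt (w x))" "abs_l2 (\<lambda>x. g x * sqrt (w x))"]
    unfolding inner_abs_l2[OF m] inner_abs_l2[OF m(1) m(1)] inner_abs_l2[OF m(2) m(2)] e
    by (simp add: power2_eq_square)
qed

text \<open>The kernel \<open>p\<close> satisfies detailed balance with respect to the weight \<open>w\<close> up to the error \<open>\<kappa>\<close>.\<close>

locale almost_reversible =
  fixes w :: "'a::euclidean_space \<Rightarrow> real" and p :: "'a \<Rightarrow> 'a \<Rightarrow> real" and \<kappa> :: real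
  assumes w_pos: "w x > 0" and w_meas [measurable]: "w \<in> borel_measurable borel"
    and p_nonneg: "p x y \<ge> 0"
    and p_meas [measurable]: "(\<lambda>z. p (fst z) (snd z)) \<in> borel_measurable (borel \<Otimes>\<^sub>M borel)"
    and p_total: "(\<integral>\<^sup>+y. ennreal (p x y) \<partial>lborel) = 1"
    and error: "(\<integral>\<^sup>+x. ennreal \<bar>w x * p x y / w y - p y x\<bar> \<partial>lborel) \<le> ennreal \<kappa>"
    and \<kappa>: "\<kappa> \<ge> 0"
begin

lemma p_meas' [measurable]:
  assumes [measurable]: "f \<in> measurable M borel" "g \<in> measurable M borel"
  shows "(\<lambda>z. p (f z) (g z)) \<in> borel_measurable M"
  using measurable_compose[OF measurable_Pair[OF assms] p_meas] by simp

text \<open>\<open>ps\<close> is the kernel of the time-reversed chain with respect to w, so P is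
  the adjoint of Q in the w-weighted pairing and transports densities. Exact detailed balance would
  mean \<open>ps = p\<close> and P = Q.\<close>

definition "ps y x = w x * p x y / w y"
definition "Q f x = (LINT y|lborel. p x y * f y)"
definition "P f y = (LINT x|lborel. ps y x * f x)"

lemma ps_nonneg: "ps y x \<ge> 0" using w_pos[of x] w_pos[of y] p_nonneg by (simp add: ps_def)

lemma ps_meas [measurable]:
  assumes [measurable]: "f \<in> measurable M borel" "g \<in> measurable M borel"
  shows "(\<lambda>z. ps (f z) (g z)) \<in> borel_measurable M"
  unfolding ps_def by measurable

lemma p_integrable: "integrable lborel (p x)"
  using p_total[of x] p_nonneg by (intro integrableI_bounded) auto
lemma integral_p: "(LINT y|lborel. p x y) = 1"
  using p_total[of x] p_nonneg p_integrable[of x] by (subst (asm) nn_integral_eq_integral) auto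

lemma diff_integrable: "integrable lborel (\<lambda>x. ps y x - p y x)"
  and integral_diff_le: "(LINT x|lborel. \<bar>ps y x - p y x\<bar>) \<le> \<kappa>"
proof -
  show i: "integrable lborel (\<lambda>x. ps y x - p y x)"
    using error[of y] le_less_trans[OF error[of y]] unfolding ps_def[symmetric]
    by (intro integrableI_bounded) auto
  show "(LINT x|lborel. \<bar>ps y x - p y x\<bar>) \<le> \<kappa>"
    using error[of y] i \<kappa> unfolding ps_def[symmetric] by (subst (asm) nn_integral_eq_integral) auto
qed

lemma ps_integrable: "integrable lborel (ps y)"
  using Bochner_Integration.integrable_add[OF diff_integrable p_integrable, of y y] by simp

text \<open>The reversed kernel need not be Markov; its possible excess mass \<kappa> is the source
  of all the factors (1 + \<kappa>)^k below.\<close>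

lemma integral_ps_le: "(LINT x|lborel. ps y x) \<le> 1 + \<kappa>"
proof -
  have "(LINT x|lborel. ps y x) \<le> (LINT x|lborel. \<bar>ps y x - p y x\<bar> + p y x)"
    by (intro integral_mono ps_integrable Bochner_Integration.integrable_add integrable_abs diff_integrable p_integrable) auto
  also have "\<dots> \<le> \<kappa> + 1" using integral_diff_le[of y] diff_integrable[of y] p_integrable[of y] by (simp add: integral_p)
  finally show ?thesis by simp
qed

lemma bounded_mult_integrable:
  fixes k f :: "'a \<Rightarrow> real"
  assumes "integrable lborel k" "f \<in> borel_measurable borel" "\<And>x. \<bar>f x\<bar> \<le> C"
  shows "integrable lborel (\<lambda>x. k x * f x)"
proof (rule Bochner_Integration.integrable_bound)
  show "integrable lborel (\<lambda>x. C * k x)" using assms(1) by simp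
  show "(\<lambda>x. k x * f x) \<in> borel_measurable lborel" using assms by auto
  have "C \<ge> 0" using assms(3) abs_ge_zero order_trans by blast
  then show "AE x in lborel. norm (k x * f x) \<le> norm (C * k x)"
    using assms(3) by (intro AE_I2) (simp add: abs_mult mult.commute[of C] mult_left_mono)
qed

lemma integral_kernel_bound:
  fixes k f :: "'a \<Rightarrow> real"
  assumes "integrable lborel k" "f \<in> borel_measurable borel" "\<And>x. \<bar>f x\<bar> \<le> C"
  shows "\<bar>LINT x|lborel. k x * f x\<bar> \<le> C * (LINT x|lborel. \<bar>k x\<bar>)"
proof -
  have "\<bar>LINT x|lborel. k x * f x\<bar> \<le> (LINT x|lborel. \<bar>k x * f x\<bar>)"
    using integral_norm_bound[of lborel "\<lambda>x. k x * f x"] by simp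
  also have "\<dots> \<le> (LINT x|lborel. C * \<bar>k x\<bar>)"
  proof (rule integral_mono)
    show "integrable lborel (\<lambda>x. \<bar>k x * f x\<bar>)" by (intro integrable_abs bounded_mult_integrable[OF assms])
    show "integrable lborel (\<lambda>x. C * \<bar>k x\<bar>)" using assms(1) by simp
    show "\<bar>k x * f x\<bar> \<le> C * \<bar>k x\<bar>" for x
      using mult_right_mono[OF assms(3)[of x], of "\<bar>k x\<bar>"] by (simp add: abs_mult mult.commute)
  qed
  finally show ?thesis by simp
qed

lemma Q_measurable:
  assumes [measurable]: "f \<in> borel_measurable borel" shows "Q f \<in> borel_measurable borel"
  unfolding Q_def[abs_def] by measurable
lemma P_measurable:
  assumes [measurable]: "f \<in> borel_measurable borel" shows "P f \<in> borel_measurable borel"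
  unfolding P_def[abs_def] by measurable

lemma Q_bound:
  assumes "f \<in> borel_measurable borel" "\<And>x. \<bar>f x\<bar> \<le> C" shows "\<bar>Q f x\<bar> \<le> C"
proof -
  have "(LINT y|lborel. \<bar>p x y\<bar>) = 1" using integral_p[of x] p_nonneg by simp
  then show ?thesis unfolding Q_def using integral_kernel_bound[OF p_integrable assms, of x] by simp
qed

lemma P_bound:
  assumes "f \<in> borel_measurable borel" "\<And>x. \<bar>f x\<bar> \<le> C" shows "\<bar>P f y\<bar> \<le> C * (1 + \<kappa>)"
proof -
  have "C \<ge> 0" using assms(2) abs_ge_zero order_trans by blast
  have "(LINT x|lborel. \<bar>ps y x\<bar>) \<le> 1 + \<kappa>" using integral_ps_le[of y] ps_nonneg by simp
  then have "C * (LINT x|lborel. \<bar>ps y x\<bar>) \<le> C * (1 + \<kappa>)" using \<open>C \<ge> 0\<close> by (rule mult_left_mono)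
  then show ?thesis unfolding P_def using integral_kernel_bound[OF ps_integrable assms, of y] by simp
qed

lemma Q_diff: "f \<in> borel_measurable borel \<Longrightarrow> (\<And>x. \<bar>f x\<bar> \<le> C) \<Longrightarrow> g \<in> borel_measurable borel \<Longrightarrow> (\<And>x. \<bar>g x\<bar> \<le> D)
  \<Longrightarrow> Q (\<lambda>x. f x - g x) x = Q f x - Q g x"
  unfolding Q_def using bounded_mult_integrable[OF p_integrable, of f C x] bounded_mult_integrable[OF p_integrable, of g D x]
  by (simp add: right_diff_distrib)

lemma P_Q_close:
  assumes "f \<in> borel_measurable borel" "\<And>x. \<bar>f x\<bar> \<le> C" shows "\<bar>Q f y - P f y\<bar> \<le> C * \<kappa>"
proof -
  have "C \<ge> 0" using assms(2) abs_ge_zero order_trans by blast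
  have "P f y - Q f y = (LINT x|lborel. (ps y x - p y x) * f x)"
    unfolding P_def Q_def using bounded_mult_integrable[OF p_integrable assms] bounded_mult_integrable[OF ps_integrable assms]
    by (simp add: left_diff_distrib)
  then have "\<bar>Q f y - P f y\<bar> \<le> C * (LINT x|lborel. \<bar>ps y x - p y x\<bar>)"
    using integral_kernel_bound[OF diff_integrable assms, of y] by (simp add: abs_minus_commute)
  also have "\<dots> \<le> C * \<kappa>" using \<open>C \<ge> 0\<close> by (intro mult_left_mono integral_diff_le)
  finally show ?thesis .
qed

text \<open>Fubini's theorem. Integrability is asked of \<open>h w\<close>, since w itself has
  infinite mass for truncated potentials.\<close>

lemma duality:
  assumes f [measurable]: "f \<in> borel_measurable borel" "\<And>x. \<bar>f x\<bar> \<le> C"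
    and h [measurable]: "h \<in> borel_measurable borel" and hw: "integrable lborel (\<lambda>x. h x * w x)"
  shows "integrable lborel (\<lambda>y. P h y * w y)"
    and "(LINT y|lborel. f y * P h y * w y) = (LINT x|lborel. Q f x * h x * w x)"
proof -
  have C: "C \<ge> 0" using f(2) abs_ge_zero order_trans by blast
  have pt: "f y * (ps y x * h x) * w y = f y * (p x y * (h x * w x))" for f :: "'a \<Rightarrow> real" and x y
    using w_pos[of y] by (simp add: ps_def)
  have main: "integrable (lborel \<Otimes>\<^sub>M lborel) (\<lambda>(x, y). f y * (p x y * (h x * w x)))"
    if f [measurable]: "f \<in> borel_measurable borel" and "\<And>x. \<bar>f x\<bar> \<le> C" "C \<ge> 0" for f C
  proof (rule integrableI_bounded)
    show "(\<lambda>(x, y). f y * (p x y * (h x * w x))) \<in> borel_measurable (lborel \<Otimes>\<^sub>M lborel)" by measurable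
    have "(\<integral>\<^sup>+z. ennreal (norm (case z of (x, y) \<Rightarrow> f y * (p x y * (h x * w x)))) \<partial>(lborel \<Otimes>\<^sub>M lborel))
       = (\<integral>\<^sup>+x. \<integral>\<^sup>+y. ennreal (norm (f y * (p x y * (h x * w x)))) \<partial>lborel \<partial>lborel)"
      by (subst lborel.nn_integral_fst[symmetric]) auto
    also have "\<dots> \<le> (\<integral>\<^sup>+x. \<integral>\<^sup>+y. ennreal (C * \<bar>h x * w x\<bar>) * ennreal (p x y) \<partial>lborel \<partial>lborel)"
    proof (intro nn_integral_mono)
      fix x y
      have "norm (f y * (p x y * (h x * w x))) = \<bar>f y\<bar> * (\<bar>h x * w x\<bar> * p x y)"
        using p_nonneg[of x y] by (simp add: abs_mult mult_ac)
      also have "\<dots> \<le> C * (\<bar>h x * w x\<bar> * p x y)" using that(2)[of y] p_nonneg[of x y] by (intro mult_right_mono) auto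
      finally show "ennreal (norm (f y * (p x y * (h x * w x)))) \<le> ennreal (C * \<bar>h x * w x\<bar>) * ennreal (p x y)"
        using p_nonneg[of x y] \<open>C \<ge> 0\<close> by (simp add: ennreal_mult[symmetric] ennreal_leI mult.assoc)
    qed
    also have "\<dots> = (\<integral>\<^sup>+x. ennreal (C * \<bar>h x * w x\<bar>) \<partial>lborel)"
      by (simp add: nn_integral_cmult p_total)
    also have "\<dots> < \<infinity>" using hw \<open>C \<ge> 0\<close>
      by (subst nn_integral_eq_integral) (auto simp: mult.commute)
    finally show "(\<integral>\<^sup>+z. ennreal (norm (case z of (x, y) \<Rightarrow> f y * (p x y * (h x * w x)))) \<partial>(lborel \<Otimes>\<^sub>M lborel)) < \<infinity>" .
  qed
  have Pf: "f y * P h y * w y = (LINT x|lborel. f y * (p x y * (h x * w x)))" for f y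
    unfolding pt[symmetric] P_def by simp
  have Qf: "Q f x * h x * w x = (LINT y|lborel. f y * (p x y * (h x * w x)))" for x
  proof -
    have "(LINT y|lborel. f y * (p x y * (h x * w x))) = (LINT y|lborel. (p x y * f y) * (h x * w x))" by (simp only: mult_ac)
    also have "\<dots> = (LINT y|lborel. p x y * f y) * (h x * w x)" by (rule integral_mult_left_zero)
    finally show ?thesis by (simp add: Q_def mult.assoc)
  qed
  show "integrable lborel (\<lambda>y. P h y * w y)"
    using lborel_pair.integrable_snd[OF main[of "\<lambda>_. 1" 1]] Pf[of "\<lambda>_. 1"] by simp
  have "(LINT y|lborel. f y * P h y * w y) = (LINT y|lborel. LINT x|lborel. f y * (p x y * (h x * w x)))" by (simp only: Pf)
  also have "\<dots> = (LINT x|lborel. LINT y|lborel. f y * (p x y * (h x * w x)))"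
    by (rule lborel_pair.Fubini_integral[OF main[OF f C]])
  also have "\<dots> = (LINT x|lborel. Q f x * h x * w x)" by (simp only: Qf)
  finally show "(LINT y|lborel. f y * P h y * w y) = (LINT x|lborel. Q f x * h x * w x)" .
qed

end

locale almost_reversible_chain = almost_reversible +
  fixes h0 :: "'a \<Rightarrow> real" and C :: real
  assumes h0_meas [measurable]: "h0 \<in> borel_measurable borel" and h0_nonneg: "h0 x \<ge> 0" and h0_le: "h0 x \<le> C"
    and h0_integrable: "integrable lborel (\<lambda>x. h0 x * w x)" and h0_integral: "(LINT x|lborel. h0 x * w x) = 1"
begin

text \<open>\<open>h k\<close> is the density, relative to \<open>w\<close>, of the law of the chain after \<open>k\<close> steps.\<close>

definition "h k = (P ^^ k) h0"

lemma h_0: "h 0 = h0" and h_Suc: "h (Suc k) = P (h k)" by (simp_all add: h_def)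

lemma C_nonneg: "C \<ge> 0" using h0_nonneg h0_le order_trans by blast

lemma h_meas [measurable]: "h k \<in> borel_measurable borel"
  by (induction k) (simp_all add: h_0 h_Suc P_measurable)

lemma h_nonneg: "h k x \<ge> 0"
  by (induction k arbitrary: x) (auto simp: h_0 h_Suc h0_nonneg P_def ps_nonneg)

lemma h_bound: "\<bar>h k x\<bar> \<le> C * (1 + \<kappa>) ^ k"
proof (induction k arbitrary: x)
  case 0 then show ?case using h0_nonneg[of x] h0_le[of x] by (simp add: h_0)
next
  case (Suc k) then show ?case using P_bound[OF h_meas, of k "C * (1 + \<kappa>) ^ k" x] by (simp add: h_Suc mult_ac)
qed

lemma h_integrable: "integrable lborel (\<lambda>x. h k x * w x)"
proof (induction k)
  case (Suc k) then show ?case using duality(1)[of "\<lambda>_. 0" 0 "h k"] by (simp add: h_Suc)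
qed (simp add: h_0 h0_integrable)

lemma bounded_h_integrable:
  assumes "f \<in> borel_measurable borel" "\<And>x. \<bar>f x\<bar> \<le> D"
  shows "integrable lborel (\<lambda>x. f x * h k x * w x)"
  using bounded_mult_integrable[OF h_integrable assms, of k] by (simp add: mult_ac)

lemma h_integral: "(LINT x|lborel. h k x * w x) = 1"
proof (induction k)
  case (Suc k)
  have "Q (\<lambda>_. 1) x = 1" for x by (simp add: Q_def integral_p)
  then show ?case using Suc duality(2)[of "\<lambda>_. 1" 1 "h k", OF _ _ _ h_integrable] by (simp add: h_Suc)
qed (simp add: h_0 h0_integral)

lemma Q_pow:
  assumes "f \<in> borel_measurable borel" "\<And>x. \<bar>f x\<bar> \<le> D"
  shows "(Q ^^ n) f \<in> borel_measurable borel" "\<bar>(Q ^^ n) f x\<bar> \<le> D"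
  using assms by (induction n arbitrary: x) (auto simp: Q_measurable intro!: Q_bound)

lemma expectation_shift:
  assumes "f \<in> borel_measurable borel" "\<And>x. \<bar>f x\<bar> \<le> D"
  shows "(LINT x|lborel. f x * h (n + m) x * w x) = (LINT x|lborel. (Q ^^ n) f x * h m x * w x)"
  using assms
proof (induction n arbitrary: f)
  case (Suc n)
  have "(LINT x|lborel. f x * h (Suc n + m) x * w x) = (LINT x|lborel. Q f x * h (n + m) x * w x)"
    using duality(2)[OF Suc.prems h_meas h_integrable] by (simp add: h_Suc)
  also have "\<dots> = (LINT x|lborel. (Q ^^ n) (Q f) x * h m x * w x)"
    by (intro Suc.IH Q_measurable Q_bound Suc.prems)
  finally show ?case by (simp add: funpow_swap1)
qed simp

text \<open>For an exactly reversible chain the two functions coincide. Replacing Q by P in one step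
  costs \<kappa> times the current sup bound \<open>C (1 + \<kappa>)^n\<close>, and Q does not
  enlarge the errors made before.\<close>

lemma Q_pow_close: "\<bar>(Q ^^ n) h0 x - h n x\<bar> \<le> real n * (C * \<kappa> * (1 + \<kappa>) ^ n)"
proof (induction n arbitrary: x)
  case (Suc n)
  have b: "\<And>x. \<bar>h0 x\<bar> \<le> C" using h0_nonneg h0_le by simp
  note q = Q_pow[OF h0_meas b, of n]
  have mono: "C * \<kappa> * (1 + \<kappa>) ^ n \<le> C * \<kappa> * (1 + \<kappa>) ^ Suc n"
    using C_nonneg \<kappa> by (intro mult_left_mono power_increasing) auto
  have "\<bar>(Q ^^ Suc n) h0 x - h (Suc n) x\<bar> = \<bar>Q (\<lambda>x. (Q ^^ n) h0 x - h n x) x + (Q (h n) x - P (h n) x)\<bar>"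
    using Q_diff[OF q h_meas h_bound, of n x] by (simp add: h_Suc)
  also have "\<dots> \<le> \<bar>Q (\<lambda>x. (Q ^^ n) h0 x - h n x) x\<bar> + \<bar>Q (h n) x - P (h n) x\<bar>" by (rule abs_triangle_ineq)
  also have "\<dots> \<le> real n * (C * \<kappa> * (1 + \<kappa>) ^ n) + C * (1 + \<kappa>) ^ n * \<kappa>"
    using q(1) by (intro add_mono Q_bound P_Q_close h_bound Suc.IH) auto
  also have "\<dots> = real (Suc n) * (C * \<kappa> * (1 + \<kappa>) ^ n)" by (simp add: algebra_simps)
  also have "\<dots> \<le> real (Suc n) * (C * \<kappa> * (1 + \<kappa>) ^ Suc n)" by (intro mult_left_mono mono) simp
  finally show ?case .
qed (simp add: h_0)

definition "F n = (LINT x|lborel. h0 x * h n x * w x)"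

text \<open>Duality moves n of the n + m steps onto the initial density as powers of Q, and
  \<open>Q_pow_close\<close> exchanges the result for \<open>h n\<close>. The common bound K gives
  one error term for all pairs of times.\<close>

lemma F_close:
  assumes "n \<le> K" shows "\<bar>F (n + m) - (LINT x|lborel. h n x * h m x * w x)\<bar> \<le> real K * (C * \<kappa> * (1 + \<kappa>) ^ K)"
proof -
  have b: "\<And>x. \<bar>h0 x\<bar> \<le> C" using h0_nonneg h0_le by simp
  have "F (n + m) - (LINT x|lborel. h n x * h m x * w x) = (LINT x|lborel. (Q ^^ n) h0 x * h m x * w x) - (LINT x|lborel. h n x * h m x * w x)"
    unfolding F_def expectation_shift[OF h0_meas b] by simp
  also have "\<dots> = (LINT x|lborel. ((Q ^^ n) h0 x - h n x) * h m x * w x)"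
    using bounded_h_integrable[OF Q_pow[OF h0_meas b]] bounded_h_integrable[OF h_meas h_bound]
    by (simp add: left_diff_distrib)
  also have "\<dots> = (LINT x|lborel. (h m x * w x) * ((Q ^^ n) h0 x - h n x))" by (simp only: mult_ac)
  also have "\<bar>\<dots>\<bar> \<le> real n * (C * \<kappa> * (1 + \<kappa>) ^ n) * (LINT x|lborel. \<bar>h m x * w x\<bar>)"
    using Q_pow(1)[OF h0_meas b] by (intro integral_kernel_bound h_integrable Q_pow_close) auto
  also have "(LINT x|lborel. \<bar>h m x * w x\<bar>) = 1"
    using h_integral[of m] h_nonneg w_pos by (simp add: abs_mult less_imp_le)
  also have "real n * (C * \<kappa> * (1 + \<kappa>) ^ n) * 1 \<le> real K * (C * \<kappa> * (1 + \<kappa>) ^ K)"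
    using assms C_nonneg \<kappa> by (simp, intro mult_mono power_increasing) auto
  finally show ?thesis .
qed

text \<open>Up to the reversibility error \<open>F (n + m)\<close> is the inner product of \<open>h n\<close> and \<open>h m\<close>, so second
  differences of \<open>F\<close> are squared norms.\<close>

lemma increment_norm:
  assumes nm: "n \<le> K" "m \<le> K"
  shows "integrable lborel (\<lambda>x. (h n x - h m x)\<^sup>2 * w x)"
    and "(LINT x|lborel. (h n x - h m x)\<^sup>2 * w x) \<le> F (2 * n) - 2 * F (n + m) + F (2 * m) + 4 * (real K * (C * \<kappa> * (1 + \<kappa>) ^ K))"
proof -
  let ?B = "\<lambda>n m. LINT x|lborel. h n x * h m x * w x"
  note ih = bounded_h_integrable[OF h_meas h_bound]
  have e: "(h n x - h m x)\<^sup>2 * w x = h n x * h n x * w x - 2 * (h n x * h m x * w x) + h m x * h m x * w x" for x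
    by (simp add: power2_eq_square algebra_simps)
  show "integrable lborel (\<lambda>x. (h n x - h m x)\<^sup>2 * w x)"
    unfolding e by (intro Bochner_Integration.integrable_add Bochner_Integration.integrable_diff integrable_mult_right ih)
  have "(LINT x|lborel. (h n x - h m x)\<^sup>2 * w x) = ?B n n - 2 * ?B n m + ?B m m"
    unfolding e using ih by simp
  also have "\<dots> \<le> F (2 * n) - 2 * F (n + m) + F (2 * m) + 4 * (real K * (C * \<kappa> * (1 + \<kappa>) ^ K))"
    using F_close[OF nm(1), of n] F_close[OF nm(1), of m] F_close[OF nm(2), of m] unfolding mult_2 abs_le_iff by linarith
  finally show "(LINT x|lborel. (h n x - h m x)\<^sup>2 * w x) \<le> F (2 * n) - 2 * F (n + m) + F (2 * m) + 4 * (real K * (C * \<kappa> * (1 + \<kappa>) ^ K))" .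
qed

lemma expectation_increment:
  assumes f [measurable]: "f \<in> borel_measurable borel" "\<And>x. \<bar>f x\<bar> \<le> D" and f2: "integrable lborel (\<lambda>x. (f x)\<^sup>2 * w x)"
    and nm: "n \<le> K" "m \<le> K"
  shows "((LINT x|lborel. f x * h n x * w x) - (LINT x|lborel. f x * h m x * w x))\<^sup>2
     \<le> (LINT x|lborel. (f x)\<^sup>2 * w x) * (F (2 * n) - 2 * F (n + m) + F (2 * m) + 4 * (real K * (C * \<kappa> * (1 + \<kappa>) ^ K)))"
proof -
  have "(LINT x|lborel. f x * h n x * w x) - (LINT x|lborel. f x * h m x * w x) = (LINT x|lborel. f x * (h n x - h m x) * w x)"
    using bounded_h_integrable[OF f] by (simp add: left_diff_distrib right_diff_distrib)
  also have "\<dots>\<^sup>2 \<le> (LINT x|lborel. (f x)\<^sup>2 * w x) * (LINT x|lborel. (h n x - h m x)\<^sup>2 * w x)"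
    using w_pos by (intro weighted_Cauchy_Schwarz f2 increment_norm(1)[OF nm]) (auto simp: less_imp_le)
  also have "\<dots> \<le> (LINT x|lborel. (f x)\<^sup>2 * w x) * (F (2 * n) - 2 * F (n + m) + F (2 * m) + 4 * (real K * (C * \<kappa> * (1 + \<kappa>) ^ K)))"
    using w_pos by (intro mult_left_mono increment_norm(2)[OF nm]) (simp add: less_imp_le)
  finally show ?thesis .
qed

text \<open>The sup bound on the density \<open>h n\<close>, tested against f. In the limit of small
  steps it becomes a bound on the density of the diffusion that is uniform in time.\<close>

lemma expectation_bound:
  assumes f [measurable]: "f \<in> borel_measurable borel" and fw: "integrable lborel (\<lambda>x. f x * w x)"
  shows "\<bar>LINT x|lborel. f x * h n x * w x\<bar> \<le> C * (1 + \<kappa>) ^ n * (LINT x|lborel. \<bar>f x\<bar> * w x)"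
proof -
  have "\<bar>LINT x|lborel. (f x * w x) * h n x\<bar> \<le> C * (1 + \<kappa>) ^ n * (LINT x|lborel. \<bar>f x * w x\<bar>)"
    by (rule integral_kernel_bound[OF fw h_meas h_bound])
  moreover have "(LINT x|lborel. \<bar>f x * w x\<bar>) = (LINT x|lborel. \<bar>f x\<bar> * w x)"
    using w_pos by (simp add: abs_mult less_imp_le)
  ultimately show ?thesis by (simp add: mult_ac)
qed

end

section \<open>Gaussian kernels\<close>

lemma nn_integral_reflect:
  fixes f :: "'a::euclidean_space \<Rightarrow> ennreal"
  assumes "f \<in> borel_measurable borel"
  shows "(\<integral>\<^sup>+x. f (v - x) \<partial>lborel) = (\<integral>\<^sup>+x. f x \<partial>lborel)"
proof -
  have "(lborel :: 'a measure) = distr lborel borel (\<lambda>x. v + (- 1) *\<^sub>R x)"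
    using lborel_affine[of "-1" v] by (simp add: density_1)
  then have "(\<integral>\<^sup>+x. f x \<partial>lborel) = (\<integral>\<^sup>+x. f x \<partial>distr lborel borel (\<lambda>x. v + (- 1) *\<^sub>R x))" by simp
  also have "\<dots> = (\<integral>\<^sup>+x. f (v + (- 1) *\<^sub>R x) \<partial>lborel)"
    using assms by (intro nn_integral_distr) auto
  finally show ?thesis by simp
qed

lemma nn_integral_scale:
  fixes f :: "'a::euclidean_space \<Rightarrow> ennreal"
  assumes "f \<in> borel_measurable borel" "c > 0"
  shows "(\<integral>\<^sup>+x. f x \<partial>lborel) = ennreal (c ^ DIM('a)) * (\<integral>\<^sup>+x. f (c *\<^sub>R x) \<partial>lborel)"
proof -
  have [measurable]: "f \<in> borel_measurable borel" by fact
  have "(lborel :: 'a measure) = density (distr lborel borel (\<lambda>x. 0 + c *\<^sub>R x)) (\<lambda>_. ennreal (\<bar>c\<bar> ^ DIM('a)))"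
    using assms(2) by (intro lborel_affine) auto
  then have "(\<integral>\<^sup>+x. f x \<partial>lborel) = (\<integral>\<^sup>+x. f x \<partial>density (distr lborel borel (\<lambda>x. 0 + c *\<^sub>R x)) (\<lambda>_. ennreal (\<bar>c\<bar> ^ DIM('a))))"
    by simp
  also have "\<dots> = (\<integral>\<^sup>+x. ennreal (c ^ DIM('a)) * f (c *\<^sub>R x) \<partial>lborel)"
    using assms(2) by (simp add: nn_integral_density nn_integral_distr)
  finally show ?thesis by (simp add: nn_integral_cmult)
qed

lemma matrix_vector_measurable [measurable (raw)]:
  fixes A :: "real ^ 'n ^ 'm::finite" and f :: "'b \<Rightarrow> real ^ 'n::finite"
  assumes "f \<in> borel_measurable M"
  shows "(\<lambda>x. A *v f x) \<in> borel_measurable M"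
proof -
  have "(*v) A \<in> borel_measurable borel"
    by (intro borel_measurable_continuous_onI linear_continuous_on matrix_vector_mul_bounded_linear)
  from measurable_compose[OF assms this] show ?thesis .
qed

text \<open>The uniqueness argument for Haar measure: the image of Lebesgue measure under an invertible
  linear map is translation invariant, hence a multiple of Lebesgue measure.\<close>

lemma linear_change_of_variables:
  fixes A :: "real ^ 'n::finite ^ 'n"
  assumes "invertible A"
  obtains c where "c > 0" "\<And>F. F \<in> borel_measurable borel \<Longrightarrow>
     (\<integral>\<^sup>+\<xi>. F (A *v \<xi>) \<partial>lborel) = ennreal c * (\<integral>\<^sup>+y. F y \<partial>lborel)"
proof -
  obtain A' where A': "A' ** A = mat 1" "A ** A' = mat 1" using assms unfolding invertible_def by blast
  have AA': "A *v (A' *v y) = y" "A' *v (A *v y) = y" for y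
    by (simp_all only: matrix_vector_mul_assoc A' matrix_vector_mul_lid)
  \<comment> \<open>Both sides equal the double integral of F(A \<xi>) G(A \<xi> + y), evaluated
    directly and after translating \<xi> by the preimage of y.\<close>
  have key: "(\<integral>\<^sup>+\<xi>. F (A *v \<xi>) \<partial>lborel) * (\<integral>\<^sup>+y. G y \<partial>lborel) = (\<integral>\<^sup>+\<xi>. G (A *v \<xi>) \<partial>lborel) * (\<integral>\<^sup>+y. F y \<partial>lborel)"
    if [measurable]: "F \<in> borel_measurable borel" "G \<in> borel_measurable borel" for F G :: "real ^ 'n \<Rightarrow> ennreal"
  proof -
    have "(\<integral>\<^sup>+\<xi>. F (A *v \<xi>) \<partial>lborel) * (\<integral>\<^sup>+y. G y \<partial>lborel) = (\<integral>\<^sup>+\<xi>. F (A *v \<xi>) * (\<integral>\<^sup>+y. G y \<partial>lborel) \<partial>lborel)"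
      by (rule nn_integral_multc[symmetric]) measurable
    also have "\<dots> = (\<integral>\<^sup>+\<xi>. \<integral>\<^sup>+y. F (A *v \<xi>) * G (A *v \<xi> + y) \<partial>lborel \<partial>lborel)"
      by (intro nn_integral_cong) (simp add: nn_integral_cmult nn_integral_translation)
    also have "\<dots> = (\<integral>\<^sup>+y. \<integral>\<^sup>+\<xi>. F (A *v \<xi>) * G (A *v \<xi> + y) \<partial>lborel \<partial>lborel)"
      by (rule lborel_pair.Fubini') measurable
    also have "\<dots> = (\<integral>\<^sup>+y. \<integral>\<^sup>+\<xi>. F (A *v \<xi> - y) * G (A *v \<xi>) \<partial>lborel \<partial>lborel)"
    proof (rule nn_integral_cong)
      fix y :: "real ^ 'n"
      have "(\<integral>\<^sup>+\<xi>. F (A *v \<xi> - y) * G (A *v \<xi>) \<partial>lborel)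
          = (\<integral>\<^sup>+\<xi>. F (A *v (A' *v y + \<xi>) - y) * G (A *v (A' *v y + \<xi>)) \<partial>lborel)"
        by (rule nn_integral_translation[symmetric]) measurable
      then show "(\<integral>\<^sup>+\<xi>. F (A *v \<xi>) * G (A *v \<xi> + y) \<partial>lborel) = (\<integral>\<^sup>+\<xi>. F (A *v \<xi> - y) * G (A *v \<xi>) \<partial>lborel)"
        by (simp add: matrix_vector_right_distrib AA' add.commute)
    qed
    also have "\<dots> = (\<integral>\<^sup>+\<xi>. \<integral>\<^sup>+y. F (A *v \<xi> - y) * G (A *v \<xi>) \<partial>lborel \<partial>lborel)"
      by (rule lborel_pair.Fubini') measurable
    also have "\<dots> = (\<integral>\<^sup>+\<xi>. G (A *v \<xi>) * (\<integral>\<^sup>+y. F y \<partial>lborel) \<partial>lborel)"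
    proof (rule nn_integral_cong)
      fix \<xi> :: "real ^ 'n"
      have "(\<integral>\<^sup>+y. F (A *v \<xi> - y) * G (A *v \<xi>) \<partial>lborel) = (\<integral>\<^sup>+y. F (A *v \<xi> - y) \<partial>lborel) * G (A *v \<xi>)"
        by (rule nn_integral_multc) measurable
      then show "(\<integral>\<^sup>+y. F (A *v \<xi> - y) * G (A *v \<xi>) \<partial>lborel) = G (A *v \<xi>) * (\<integral>\<^sup>+y. F y \<partial>lborel)"
        by (simp add: nn_integral_reflect mult.commute)
    qed
    also have "\<dots> = (\<integral>\<^sup>+\<xi>. G (A *v \<xi>) \<partial>lborel) * (\<integral>\<^sup>+y. F y \<partial>lborel)"
      by (rule nn_integral_multc) measurable
    finally show ?thesis .
  qed
  \<comment> \<open>Taking the indicator of the unit ball for G identifies the constant as a ratio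
    of volumes; it remains to see that both are finite and positive.\<close>
  let ?B = "cball (0::real^'n) 1"
  have B [measurable]: "?B \<in> sets borel" by simp
  have pre: "(\<integral>\<^sup>+\<xi>. indicator ?B (A *v \<xi>) \<partial>lborel) = emeasure lborel {\<xi>. norm (A *v \<xi>) \<le> 1}" (is "_ = emeasure lborel ?C")
  proof -
    have "(\<lambda>\<xi>. indicator ?B (A *v \<xi>) :: ennreal) = indicator ?C" by (auto simp: fun_eq_iff indicator_def)
    moreover have "?C \<in> sets lborel" by measurable
    ultimately show ?thesis by simp
  qed
  obtain a where a: "a > 0" "\<And>x. norm (A *v x) \<le> a * norm x"
    using linear_bounded_pos[OF matrix_vector_mul_linear[of A]] by blast
  obtain a' where a': "a' > 0" "\<And>x. norm (A' *v x) \<le> a' * norm x"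
    using linear_bounded_pos[OF matrix_vector_mul_linear[of A']] by blast
  have "?C \<subseteq> cball 0 a'"
  proof
    fix \<xi> assume "\<xi> \<in> ?C"
    then have "norm (A *v \<xi>) \<le> 1" by simp
    then have "a' * norm (A *v \<xi>) \<le> a'" using a'(1) by (simp add: mult_left_le)
    then show "\<xi> \<in> cball 0 a'" using a'(2)[of "A *v \<xi>"] AA'(2)[of \<xi>] by simp
  qed
  then have "bounded ?C" using bounded_cball bounded_subset by blast
  then have fin: "emeasure lborel ?C < \<infinity>" by (rule emeasure_bounded_finite)
  have "ball 0 (1 / a) \<subseteq> ?C"
  proof
    fix \<xi> :: "real^'n" assume "\<xi> \<in> ball 0 (1 / a)"
    then have "a * norm \<xi> \<le> 1" using a(1) by (simp add: field_simps)
    then show "\<xi> \<in> ?C" using a(2)[of \<xi>] by simp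
  qed
  moreover have "?C \<in> sets lborel" by measurable
  ultimately have "emeasure lborel (ball (0::real^'n) (1 / a)) \<le> emeasure lborel ?C" by (rule emeasure_mono)
  moreover have "emeasure lborel (ball (0::real^'n) (1 / a)) > 0"
    using a(1) content_ball_pos[of "1 / a" "0 :: real^'n"] by (auto simp: measure_def zero_less_iff_neq_zero)
  ultimately have pos: "emeasure lborel ?C > 0" by (rule less_le_trans[rotated])
  define v where "v = measure lborel ?B"
  have v: "emeasure lborel ?B = ennreal v" "v > 0"
  proof -
    show e: "emeasure lborel ?B = ennreal v"
      unfolding v_def using emeasure_bounded_finite[of ?B] by (intro emeasure_eq_ennreal_measure) auto
    show "v > 0" unfolding v_def by (simp add: content_cball_pos)
  qed
  define u where "u = measure lborel ?C"
  have u: "emeasure lborel ?C = ennreal u" "u > 0"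
  proof -
    show e: "emeasure lborel ?C = ennreal u" unfolding u_def using fin by (intro emeasure_eq_ennreal_measure) auto
    show "u > 0" using pos unfolding e by simp
  qed
  have "(\<integral>\<^sup>+\<xi>. F (A *v \<xi>) \<partial>lborel) = ennreal (u / v) * (\<integral>\<^sup>+y. F y \<partial>lborel)"
    if F: "F \<in> borel_measurable borel" for F :: "real ^ 'n \<Rightarrow> ennreal"
  proof -
    have "(\<integral>\<^sup>+\<xi>. F (A *v \<xi>) \<partial>lborel) * ennreal v = ennreal u * (\<integral>\<^sup>+y. F y \<partial>lborel)"
      using key[OF F, of "indicator ?B"] by (simp add: pre u v)
    then have "(\<integral>\<^sup>+\<xi>. F (A *v \<xi>) \<partial>lborel) * (ennreal v * ennreal (1 / v)) = ennreal u * (\<integral>\<^sup>+y. F y \<partial>lborel) * ennreal (1 / v)"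
      by (simp only: mult.assoc[symmetric])
    moreover have "ennreal v * ennreal (1 / v) = 1" using v(2) by (simp flip: ennreal_mult)
    moreover have "ennreal (u / v) = ennreal u * ennreal (1 / v)" using u(2) v(2) by (simp flip: ennreal_mult)
    ultimately show ?thesis by (simp add: mult_ac)
  qed
  then show ?thesis using that[of "u / v"] u(2) v(2) by simp
qed

definition gauss :: "real \<Rightarrow> real ^ 'n::finite \<Rightarrow> real" where
  "gauss h x = (\<Prod>i\<in>UNIV. normal_density 0 (sqrt h) (x $ i))"

lemma gauss_measurable [measurable]: "gauss h \<in> borel_measurable borel"
  unfolding gauss_def[abs_def] by measurable

lemma gauss_nonneg: "gauss h x \<ge> 0"
  unfolding gauss_def by (intro prod_nonneg) simp

lemma gauss_eq:
  assumes "h > 0"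
  shows "gauss h (x :: real ^ 'n::finite) = (1 / sqrt (2 * pi * h)) ^ CARD('n) * exp (- (norm x)\<^sup>2 / (2 * h))"
proof -
  have "gauss h x = (\<Prod>i\<in>UNIV. 1 / sqrt (2 * pi * h) * exp (- (x $ i)\<^sup>2 / (2 * h)))"
    unfolding gauss_def normal_density_def using assms by simp
  also have "\<dots> = (1 / sqrt (2 * pi * h)) ^ CARD('n) * exp (\<Sum>i\<in>UNIV. - (x $ i)\<^sup>2 / (2 * h))"
    by (simp only: prod.distrib exp_sum finite prod_constant)
  also have "(\<Sum>i\<in>UNIV. - (x $ i)\<^sup>2 / (2 * h)) = - (norm x)\<^sup>2 / (2 * h)"
    by (simp add: norm_vec_def L2_set_def sum_nonneg sum_divide_distrib[symmetric] sum_negf)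
  finally show ?thesis .
qed

lemma prod_Basis_vec:
  fixes F :: "real ^ 'n::finite \<Rightarrow> real"
  shows "prod F Basis = (\<Prod>i\<in>UNIV. F (axis i 1))"
proof -
  have "(Basis :: (real ^ 'n) set) = range (\<lambda>i. axis i 1)" by (auto simp: Basis_vec_def)
  then have "prod F Basis = prod F (range (\<lambda>i. axis i 1))" by (rule arg_cong)
  also have "\<dots> = prod (F \<circ> (\<lambda>i. axis i 1)) UNIV"
    by (rule prod.reindex) (auto simp: inj_def axis_eq_axis)
  finally show ?thesis by (simp add: o_def)
qed

lemma has_bochner_integral_prod_vec:
  fixes f :: "'n::finite \<Rightarrow> real \<Rightarrow> real"
  assumes f: "\<And>i. has_bochner_integral lborel (f i) (I i)"
  shows "has_bochner_integral lborel (\<lambda>x::real^'n. \<Prod>i\<in>UNIV. f i (x $ i)) (\<Prod>i\<in>UNIV. I i)"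
proof -
  interpret product_sigma_finite "\<lambda>_::real^'n. lborel :: real measure" by standard
  \<comment> \<open>Lebesgue measure is a product over the set \<open>Basis\<close> and not over the
    index type; g relabels the factors from coordinates to basis vectors.\<close>
  define g where "g b = f (SOME i. b = axis i 1)" for b :: "real ^ 'n"
  have g: "g (axis i 1) = f i" for i by (simp add: g_def axis_eq_axis)
  have gi: "integrable lborel (g b)" for b
    using f unfolding g_def by (auto simp: has_bochner_integral_iff)
  then have gm: "g b \<in> borel_measurable borel" for b
    using borel_measurable_integrable[of lborel "g b"] by simp
  have coord: "(\<Sum>c\<in>Basis. x c *\<^sub>R c) \<bullet> b = x b" if "b \<in> Basis" for b :: "real ^ 'n" and x
    using that by (simp add: inner_sum_left inner_Basis if_distrib cong: if_cong)
  have eq: "(\<Prod>i\<in>UNIV. f i ((\<Sum>c\<in>Basis. x c *\<^sub>R c) $ i)) = (\<Prod>b\<in>(Basis::(real^'n) set). g b (x b))" for x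
  proof -
    have "(\<Prod>b\<in>(Basis::(real^'n) set). g b (x b)) = (\<Prod>i\<in>UNIV. f i (x (axis i 1)))"
      by (simp add: prod_Basis_vec g)
    also have "\<dots> = (\<Prod>i\<in>UNIV. f i ((\<Sum>c\<in>Basis. x c *\<^sub>R c) $ i))"
    proof (intro prod.cong refl)
      fix i :: 'n
      have "(\<Sum>c\<in>Basis. x c *\<^sub>R c) \<bullet> axis i 1 = x (axis i 1)" by (rule coord) (auto simp: Basis_vec_def)
      then show "f i (x (axis i 1)) = f i ((\<Sum>c\<in>Basis. x c *\<^sub>R c) $ i)" by (simp add: inner_axis)
    qed
    finally show ?thesis by simp
  qed
  have fm: "f i \<in> borel_measurable borel" for i using gm[of "axis i 1"] by (simp add: g)
  have [measurable]: "(\<lambda>x::real^'n. \<Prod>i\<in>UNIV. f i (x $ i)) \<in> borel_measurable borel"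
  proof (intro borel_measurable_prod)
    fix i :: 'n
    have "(\<lambda>x::real^'n. x $ i) \<in> borel_measurable borel" by measurable
    from measurable_compose[OF this fm[of i]] show "(\<lambda>x::real^'n. f i (x $ i)) \<in> borel_measurable borel" .
  qed
  have m: "(\<lambda>x. \<Sum>c\<in>Basis. x c *\<^sub>R c) \<in> measurable (\<Pi>\<^sub>M b\<in>Basis. lborel) (borel :: (real^'n) measure)"
    by measurable
  let ?F = "\<lambda>x::real^'n. \<Prod>i\<in>UNIV. f i (x $ i)"
  have Fm: "?F \<in> borel_measurable borel" by measurable
  have "integrable (\<Pi>\<^sub>M b\<in>Basis. lborel) (\<lambda>x. \<Prod>b\<in>(Basis::(real^'n) set). g b (x b))"
    by (intro product_integrable_prod gi) auto
  then have int: "integrable lborel ?F"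
    using integrable_distr_eq[OF m Fm] unfolding lborel_eq[symmetric] eq by blast
  have "integral\<^sup>L lborel ?F = integral\<^sup>L (\<Pi>\<^sub>M b\<in>Basis. lborel) (\<lambda>x. \<Prod>b\<in>(Basis::(real^'n) set). g b (x b))"
    using integral_distr[OF m Fm] unfolding lborel_eq[symmetric] eq .
  also have "\<dots> = (\<Prod>b\<in>(Basis::(real^'n) set). integral\<^sup>L lborel (g b))"
    by (intro product_integral_prod gi) auto
  also have "\<dots> = (\<Prod>i\<in>UNIV. I i)"
    by (simp add: prod_Basis_vec g has_bochner_integral_integral_eq[OF f])
  finally show ?thesis using int by (simp add: has_bochner_integral_iff)
qed

lemma normal_density_moments:
  assumes "h > 0"
  shows "has_bochner_integral lborel (\<lambda>x. normal_density 0 (sqrt h) x) 1"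
    and "has_bochner_integral lborel (\<lambda>x. normal_density 0 (sqrt h) x * x) 0"
    and "has_bochner_integral lborel (\<lambda>x. normal_density 0 (sqrt h) x * (x * x)) h"
  using normal_moment_even[of "sqrt h" 0 0] normal_moment_nz_1[of "sqrt h" 0] normal_moment_even[of "sqrt h" 0 1] assms
  by (simp_all add: power2_eq_square)

lemma gauss_total: "h > 0 \<Longrightarrow> has_bochner_integral lborel (gauss h :: real ^ 'n::finite \<Rightarrow> real) 1"
  using has_bochner_integral_prod_vec[of "\<lambda>_. normal_density 0 (sqrt h)" "\<lambda>_. 1"] normal_density_moments(1)[of h]
  by (simp add: gauss_def[abs_def])

lemma gauss_moment_1:
  fixes i :: "'n::finite"
  assumes "h > 0" shows "has_bochner_integral lborel (\<lambda>x. gauss h x * x $ i) 0"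
proof -
  have "has_bochner_integral lborel (\<lambda>x::real^'n. \<Prod>j\<in>UNIV. normal_density 0 (sqrt h) (x $ j) * (if j = i then x $ j else 1))
     (\<Prod>j\<in>UNIV. if j = i then 0 else 1)"
    by (rule has_bochner_integral_prod_vec) (use normal_density_moments[OF assms] in auto)
  moreover have "(\<Prod>j\<in>UNIV. normal_density 0 (sqrt h) (x $ j) * (if j = i then x $ j else 1)) = gauss h x * x $ i" for x :: "real^'n"
    by (simp add: prod.distrib gauss_def prod.delta)
  moreover have "(\<Prod>j\<in>UNIV. if j = i then 0 else 1 :: real) = 0" by (intro prod_zero bexI[of _ i]) auto
  ultimately show ?thesis by simp
qed

lemma gauss_moment_2:
  fixes i j :: "'n::finite"
  assumes "h > 0" shows "has_bochner_integral lborel (\<lambda>x. gauss h x * (x $ i * x $ j)) (if i = j then h else 0)"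
proof -
  let ?F = "\<lambda>k y. normal_density 0 (sqrt h) y * ((if k = i then y else 1) * (if k = j then y else 1))"
  let ?I = "\<lambda>k. if k = i then (if k = j then h else 0) else if k = j then 0 else 1"
  have "has_bochner_integral lborel (\<lambda>x::real^'n. \<Prod>k\<in>UNIV. ?F k (x $ k)) (\<Prod>k\<in>UNIV. ?I k)"
    by (rule has_bochner_integral_prod_vec) (use normal_density_moments[OF assms] in auto)
  moreover have "(\<Prod>k\<in>UNIV. ?F k (x $ k)) = gauss h x * (x $ i * x $ j)" for x :: "real^'n"
    by (simp add: prod.distrib gauss_def prod.delta)
  moreover have "(\<Prod>k\<in>UNIV. ?I k) = (if i = j then h else 0)"
  proof (cases "i = j")
    case True
    then have "(\<Prod>k\<in>UNIV. ?I k) = (\<Prod>k\<in>UNIV. if k = i then h else 1)" by (intro prod.cong) auto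
    then show ?thesis using True by (simp add: prod.delta)
  next
    case False
    then have "(\<Prod>k\<in>UNIV. ?I k) = 0" by (intro prod_zero bexI[of _ i]) auto
    then show ?thesis using False by simp
  qed
  ultimately show ?thesis by simp
qed

lemma gauss_scale:
  assumes [measurable]: "F \<in> borel_measurable borel" and h: "h > 0"
  shows "(\<integral>\<^sup>+x. F x * ennreal (gauss h x) \<partial>lborel) = (\<integral>\<^sup>+x. F (sqrt h *\<^sub>R x) * ennreal (gauss 1 (x :: real ^ 'n::finite)) \<partial>lborel)"
proof -
  have "sqrt h ^ CARD('n) * gauss h (sqrt h *\<^sub>R x) = gauss 1 x" for x :: "real ^ 'n"
  proof -
    have "sqrt h ^ CARD('n) * (1 / sqrt (2 * pi * h)) ^ CARD('n) = (sqrt h * (1 / sqrt (2 * pi * h))) ^ CARD('n)"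
      by (simp only: power_mult_distrib)
    also have "sqrt h * (1 / sqrt (2 * pi * h)) = 1 / sqrt (2 * pi)" using h by (simp add: real_sqrt_mult)
    finally show ?thesis using h by (simp add: gauss_eq power_mult_distrib)
  qed
  then have *: "ennreal (sqrt h ^ CARD('n)) * ennreal (gauss h (sqrt h *\<^sub>R x)) = ennreal (gauss 1 x)" for x :: "real ^ 'n"
    using h by (simp add: ennreal_mult[symmetric] gauss_nonneg)
  have "(\<integral>\<^sup>+x. F x * ennreal (gauss h x) \<partial>lborel)
     = ennreal (sqrt h ^ CARD('n)) * (\<integral>\<^sup>+x. F (sqrt h *\<^sub>R x) * ennreal (gauss h (sqrt h *\<^sub>R x)) \<partial>lborel)"
    using h by (subst nn_integral_scale[of _ "sqrt h"]) auto
  also have "\<dots> = (\<integral>\<^sup>+x. ennreal (sqrt h ^ CARD('n)) * (F (sqrt h *\<^sub>R x) * ennreal (gauss h (sqrt h *\<^sub>R x))) \<partial>lborel)"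
    by (rule nn_integral_cmult[symmetric]) measurable
  also have "\<dots> = (\<integral>\<^sup>+x. F (sqrt h *\<^sub>R x) * ennreal (gauss 1 x) \<partial>lborel)"
    using * by (simp add: mult.left_commute)
  finally show ?thesis .
qed

text \<open>Completing the square gives c |x| - |x|^2 / 2 \<le> c^2 - |x|^2 / 4, so the integrand is
  at most a constant times the Gaussian density of variance 2.\<close>

lemma gauss_exponential_moment:
  "(\<integral>\<^sup>+x. ennreal (exp (c * norm x)) * ennreal (gauss 1 (x :: real ^ 'n::finite)) \<partial>lborel) < \<infinity>"
proof -
  define D where "D = (1 / sqrt (2 * pi)) ^ CARD('n) * exp (c\<^sup>2) / (1 / sqrt (2 * pi * 2)) ^ CARD('n)"
  have "D \<ge> 0" by (simp add: D_def)
  have "exp (c * norm x) * gauss 1 x \<le> D * gauss 2 x" for x :: "real ^ 'n"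
  proof -
    have "0 \<le> (norm x / 2 - c)\<^sup>2" by simp
    then have "c * norm x + - (norm x)\<^sup>2 / 2 \<le> c\<^sup>2 + - (norm x)\<^sup>2 / 4" by (simp add: power2_diff power_divide field_simps)
    then have "exp (c * norm x + - (norm x)\<^sup>2 / 2) \<le> exp (c\<^sup>2 + - (norm x)\<^sup>2 / 4)" by simp
    then have "(1 / sqrt (2 * pi)) ^ CARD('n) * exp (c * norm x + - (norm x)\<^sup>2 / 2) \<le> (1 / sqrt (2 * pi)) ^ CARD('n) * exp (c\<^sup>2 + - (norm x)\<^sup>2 / 4)"
      by (rule mult_left_mono) simp
    also have "(1 / sqrt (2 * pi)) ^ CARD('n) * exp (c\<^sup>2 + - (norm x)\<^sup>2 / 4) = D * gauss 2 x"
    proof -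
      have "(1 / sqrt (2 * pi * 2)) ^ CARD('n) \<noteq> 0" by simp
      then show ?thesis unfolding D_def gauss_eq[of 2, simplified] exp_add by simp
    qed
    finally show ?thesis unfolding gauss_eq[of 1, simplified] exp_add by (simp add: mult_ac)
  qed
  then have "(\<integral>\<^sup>+x. ennreal (exp (c * norm x)) * ennreal (gauss 1 (x :: real ^ 'n)) \<partial>lborel) \<le> (\<integral>\<^sup>+x. ennreal (D * gauss 2 (x :: real ^ 'n)) \<partial>lborel)"
    by (intro nn_integral_mono) (simp add: ennreal_mult[symmetric] gauss_nonneg ennreal_leI)
  also have "\<dots> < \<infinity>"
    using gauss_total[of 2, where 'n='n] \<open>D \<ge> 0\<close>
    by (subst nn_integral_eq_integral) (auto simp: has_bochner_integral_iff gauss_nonneg)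
  finally show ?thesis .
qed

section \<open>The Euler kernel\<close>

lemma inner_matrix_transpose: "(A *v x) \<bullet> y = x \<bullet> (transpose A *v y)"
  for A :: "real ^ 'n::finite ^ 'm::finite"
  using dot_lmul_matrix[of x "transpose A" y] by (simp only: vector_transpose_matrix)

text \<open>The polynomial is absorbed into the exponential, so that exponential moments of the
  Gaussian suffice later. From exp s \<ge> (1 + s / 3)^3 come s^3 \<le> 27 exp s and s \<le> exp s,
  hence 28.\<close>

lemma cubic_exp_bound:
  fixes s k :: real assumes "s \<ge> 0" "k \<ge> 0"
  shows "(s ^ 3 + s) * exp (k * s) \<le> 28 * exp ((k + 1) * s)"
proof -
  have "exp s = exp (s / 3) ^ 3" by (simp add: exp_of_nat_mult[symmetric])
  also have "\<dots> \<ge> (1 + s / 3) ^ 3" using assms(1) by (intro power_mono exp_ge_add_one_self) simp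
  finally have "(1 + s / 3) ^ 3 \<le> exp s" .
  moreover have "(1 + s / 3) ^ 3 = 1 + s + s ^ 2 / 3 + s ^ 3 / 27"
    by (simp add: power3_eq_cube power2_eq_square field_simps)
  moreover have "s ^ 2 \<ge> 0" by simp
  moreover have "exp s > 0" by simp
  ultimately have "s ^ 3 + s \<le> 28 * exp s" using assms(1) by linarith
  then have "(s ^ 3 + s) * exp (k * s) \<le> 28 * exp s * exp (k * s)" by (rule mult_right_mono) simp
  also have "\<dots> = 28 * exp ((k + 1) * s)" by (simp add: exp_add[symmetric] algebra_simps)
  finally show ?thesis .
qed

lemma abs_exp_minus_1_le: "\<bar>exp x - 1\<bar> \<le> \<bar>x\<bar> * exp \<bar>x\<bar>" for x :: real
proof (cases "x \<ge> 0")
  case True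
  have "1 - x \<le> exp (- x)" using exp_ge_add_one_self[of "- x"] by simp
  then have "exp x * (1 - x) \<le> exp x * exp (- x)" by (rule mult_left_mono) simp
  then show ?thesis using True by (simp add: exp_minus_inverse algebra_simps)
next
  case False
  then have "exp x \<le> 1" by simp
  then have "\<bar>exp x - 1\<bar> \<le> \<bar>x\<bar>" using exp_ge_add_one_self[of x] by linarith
  also have "\<dots> \<le> \<bar>x\<bar> * exp \<bar>x\<bar>" by (simp add: mult_left_le_one_le mult_le_cancel_left1)
  finally show ?thesis .
qed

text \<open>\<open>D\<close> plays the role of \<open>\<nabla>U\<close>.  Only the error of the trapezoidal rule for \<open>U\<close> enters the defect of
  detailed balance, and its cubic bound makes this defect \<open>O(h\<^bsup>3/2\<^esup>)\<close>.\<close>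

locale euler_kernel =
  fixes A :: "real ^ 'n::finite ^ 'n" and U :: "real ^ 'n \<Rightarrow> real" and D :: "real ^ 'n \<Rightarrow> real ^ 'n" and K :: real
  assumes inv_A: "invertible A"
    and U_meas [measurable]: "U \<in> borel_measurable borel" and D_meas [measurable]: "D \<in> borel_measurable borel"
    and D_bound: "norm (D x) \<le> K" and D_lipschitz: "norm (D x - D y) \<le> K * norm (x - y)"
    and trapezoid_1: "\<bar>U y - U x - (y - x) \<bullet> (D x + D y) / 2\<bar> \<le> K * norm (y - x)"
    and trapezoid_3: "\<bar>U y - U x - (y - x) \<bullet> (D x + D y) / 2\<bar> \<le> K * norm (y - x) ^ 3"
begin

lemma K_nonneg: "K \<ge> 0" using D_bound[of 0] norm_ge_zero order_trans by blast

definition "A' = (SOME A'. A ** A' = mat 1 \<and> A' ** A = mat 1)"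

lemma A': "A *v (A' *v y) = y" "A' *v (A *v y) = y"
proof -
  have "A ** A' = mat 1 \<and> A' ** A = mat 1"
    unfolding A'_def using inv_A unfolding invertible_def by (rule someI_ex)
  then show "A *v (A' *v y) = y" "A' *v (A *v y) = y"
    by (simp_all only: matrix_vector_mul_assoc matrix_vector_mul_lid)
qed

text \<open>This is 1 / |det A|, the normalization of the Gaussian density pushed forward by
  A.\<close>

definition "jac = (SOME c. c > 0 \<and> (\<forall>F\<in>borel_measurable borel. (\<integral>\<^sup>+\<xi>. F (A *v \<xi>) \<partial>lborel) = ennreal c * (\<integral>\<^sup>+y. F y \<partial>lborel)))"

lemma jac: "jac > 0" "F \<in> borel_measurable borel \<Longrightarrow> (\<integral>\<^sup>+\<xi>. F (A *v \<xi>) \<partial>lborel) = ennreal jac * (\<integral>\<^sup>+y. F y \<partial>lborel)"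
proof -
  have "jac > 0 \<and> (\<forall>F\<in>borel_measurable borel. (\<integral>\<^sup>+\<xi>. F (A *v \<xi>) \<partial>lborel) = ennreal jac * (\<integral>\<^sup>+y. F y \<partial>lborel))"
    unfolding jac_def
  proof (rule someI_ex)
    obtain c where "c > 0" "\<And>F. F \<in> borel_measurable borel \<Longrightarrow> (\<integral>\<^sup>+\<xi>. F (A *v \<xi>) \<partial>lborel) = ennreal c * (\<integral>\<^sup>+y. F y \<partial>lborel)"
      by (rule linear_change_of_variables[OF inv_A]) blast
    then show "\<exists>c>0. \<forall>F\<in>borel_measurable borel. (\<integral>\<^sup>+\<xi>. F (A *v \<xi>) \<partial>lborel) = ennreal c * (\<integral>\<^sup>+y. F y \<partial>lborel)" by blast
  qed
  then show "jac > 0" "F \<in> borel_measurable borel \<Longrightarrow> (\<integral>\<^sup>+\<xi>. F (A *v \<xi>) \<partial>lborel) = ennreal jac * (\<integral>\<^sup>+y. F y \<partial>lborel)"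
    by auto
qed

text \<open>For D = \<nabla>U the factor 1/2 makes the diffusion with this drift and noise matrix A
  reversible for \<open>exp (- U)\<close>; with A = sqrt 2 \<sigma> it is the drift of the
  stochastic equation.\<close>

definition "drift x = - (1 / 2) *\<^sub>R (A *v (transpose A *v D x))"
definition "move h x \<xi> = x + (h *\<^sub>R drift x + A *v \<xi>)"
definition "p h x y = jac * gauss h (A' *v (y - x - h *\<^sub>R drift x))"
definition "w x = exp (- U x)"

lemma drift_meas [measurable]: "drift \<in> borel_measurable borel"
  unfolding drift_def[abs_def] by measurable
lemma w_meas' [measurable]: "w \<in> borel_measurable borel" unfolding w_def[abs_def] by measurable

lemma move_meas [measurable]:
  assumes [measurable]: "f \<in> measurable M borel" "g \<in> measurable M borel"
  shows "(\<lambda>z. move h (f z) (g z)) \<in> measurable M borel"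
  unfolding move_def by measurable

lemma p_measurable [measurable]:
  assumes [measurable]: "f \<in> measurable M borel" "g \<in> measurable M borel"
  shows "(\<lambda>z. p h (f z) (g z)) \<in> borel_measurable M"
  unfolding p_def by measurable

lemma p_nonneg': "p h x y \<ge> 0" using jac(1) by (simp add: p_def gauss_nonneg)

lemma nn_integral_p:
  assumes [measurable]: "F \<in> borel_measurable borel"
  shows "(\<integral>\<^sup>+y. ennreal (p h x y) * F y \<partial>lborel) = (\<integral>\<^sup>+\<xi>. F (move h x \<xi>) * ennreal (gauss h \<xi>) \<partial>lborel)"
proof -
  let ?m = "x + h *\<^sub>R drift x"
  have "(\<integral>\<^sup>+\<xi>. F (move h x \<xi>) * ennreal (gauss h \<xi>) \<partial>lborel)
     = (\<integral>\<^sup>+\<xi>. F (?m + A *v \<xi>) * ennreal (gauss h (A' *v (A *v \<xi>))) \<partial>lborel)"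
    by (simp add: move_def A' add.assoc)
  also have "\<dots> = ennreal jac * (\<integral>\<^sup>+z. F (?m + z) * ennreal (gauss h (A' *v z)) \<partial>lborel)"
    by (rule jac(2)) measurable
  also have "\<dots> = (\<integral>\<^sup>+z. ennreal jac * (F (?m + z) * ennreal (gauss h (A' *v z))) \<partial>lborel)"
    by (rule nn_integral_cmult[symmetric]) measurable
  also have "\<dots> = (\<integral>\<^sup>+z. ennreal (p h x (?m + z)) * F (?m + z) \<partial>lborel)"
    using jac(1) by (intro nn_integral_cong) (simp add: p_def ennreal_mult gauss_nonneg mult_ac)
  also have "\<dots> = (\<integral>\<^sup>+y. ennreal (p h x y) * F y \<partial>lborel)"
    by (rule nn_integral_translation) measurable
  finally show ?thesis by simp
qed

lemma distr_gauss:
  "density lborel (\<lambda>y. ennreal (p h x y)) = distr (density lborel (\<lambda>\<xi>. ennreal (gauss h \<xi>))) borel (move h x)"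
proof (rule measure_eqI)
  fix B assume "B \<in> sets (density lborel (\<lambda>y. ennreal (p h x y)))"
  then have [measurable]: "B \<in> sets borel" by simp
  have "emeasure (density lborel (\<lambda>y. ennreal (p h x y))) B = (\<integral>\<^sup>+\<xi>. indicator B (move h x \<xi>) * ennreal (gauss h \<xi>) \<partial>lborel)"
    by (subst emeasure_density) (auto simp: nn_integral_p)
  also have "\<dots> = (\<integral>\<^sup>+\<xi>. ennreal (gauss h \<xi>) * indicator (move h x -` B) \<xi> \<partial>lborel)"
    by (intro nn_integral_cong) (auto simp: indicator_def)
  also have "\<dots> = emeasure (density lborel (\<lambda>\<xi>. ennreal (gauss h \<xi>))) (move h x -` B)"
  proof (rule emeasure_density[symmetric])
    have "move h x \<in> borel_measurable borel" by measurable
    from measurable_sets[OF this, of B] show "move h x -` B \<in> sets lborel" by simp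
  qed measurable
  also have "\<dots> = emeasure (distr (density lborel (\<lambda>\<xi>. ennreal (gauss h \<xi>))) borel (move h x)) B"
    by (subst emeasure_distr) auto
  finally show "emeasure (density lborel (\<lambda>y. ennreal (p h x y))) B = emeasure (distr (density lborel (\<lambda>\<xi>. ennreal (gauss h \<xi>))) borel (move h x)) B" .
qed simp

lemma integral_p_move:
  assumes [measurable]: "f \<in> borel_measurable borel"
  shows "(LINT y|lborel. p h x y * f y) = (LINT \<xi>|lborel. gauss h \<xi> * f (move h x \<xi>))"
proof -
  have "(LINT y|lborel. p h x y * f y) = (LINT y|density lborel (\<lambda>y. ennreal (p h x y)). f y)"
    by (subst integral_density) (auto simp: p_nonneg')
  also have "\<dots> = (LINT \<xi>|density lborel (\<lambda>\<xi>. ennreal (gauss h \<xi>)). f (move h x \<xi>))"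
    unfolding distr_gauss by (rule integral_distr) measurable
  also have "\<dots> = (LINT \<xi>|lborel. gauss h \<xi> * f (move h x \<xi>))"
    by (subst integral_density) (auto simp: gauss_nonneg)
  finally show ?thesis .
qed

lemma p_total': "h > 0 \<Longrightarrow> (\<integral>\<^sup>+y. ennreal (p h x y) \<partial>lborel) = 1"
  using nn_integral_p[of "\<lambda>_. 1" h x] gauss_total[of h, where 'n='n]
  by (simp add: nn_integral_eq_integral has_bochner_integral_iff gauss_nonneg)

lemma A_bound: obtains a where "a \<ge> 0" "\<And>x. norm (A *v x) \<le> a * norm x" "\<And>x. norm (transpose A *v x) \<le> a * norm x"
proof -
  obtain a1 where a1: "a1 > 0" "\<And>x. norm (A *v x) \<le> a1 * norm x"
    using linear_bounded_pos[OF matrix_vector_mul_linear[of A]] by blast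
  obtain a2 where a2: "a2 > 0" "\<And>x. norm (transpose A *v x) \<le> a2 * norm x"
    using linear_bounded_pos[OF matrix_vector_mul_linear[of "transpose A"]] by blast
  have "norm (A *v x) \<le> (a1 + a2) * norm x" "norm (transpose A *v x) \<le> (a1 + a2) * norm x" for x
    using a1(1) a2(1)
    by (auto simp del: transpose_matrix_vector intro!: order_trans[OF a1(2)] order_trans[OF a2(2)] mult_right_mono)
  then show ?thesis using that[of "a1 + a2"] a1 a2 by simp
qed

lemma drift_bound: obtains k where "k \<ge> 0" "\<And>x. norm (drift x) \<le> k"
proof -
  obtain a where a: "a \<ge> 0" "\<And>x. norm (A *v x) \<le> a * norm x" "\<And>x. norm (transpose A *v x) \<le> a * norm x"
    by (rule A_bound) blast
  have "norm (drift x) \<le> a * (a * K)" for x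
  proof -
    have "norm (drift x) \<le> norm (A *v (transpose A *v D x))" by (simp add: drift_def)
    also have "\<dots> \<le> a * norm (transpose A *v D x)" by (rule a(2))
    also have "\<dots> \<le> a * (a * norm (D x))" by (intro mult_left_mono a)
    also have "\<dots> \<le> a * (a * K)" by (intro mult_left_mono D_bound a)
    finally show ?thesis .
  qed
  then show ?thesis using that[of "a * (a * K)"] a(1) K_nonneg by simp
qed

lemma drift_lipschitz: obtains k where "k \<ge> 0" "\<And>x y. norm (drift x - drift y) \<le> k * norm (x - y)"
proof -
  obtain a where a: "a \<ge> 0" "\<And>x. norm (A *v x) \<le> a * norm x" "\<And>x. norm (transpose A *v x) \<le> a * norm x"
    by (rule A_bound) blast
  have "norm (drift x - drift y) \<le> a * (a * K) * norm (x - y)" for x y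
  proof -
    have "drift x - drift y = - (1 / 2) *\<^sub>R (A *v (transpose A *v (D x - D y)))"
      by (simp add: drift_def matrix_vector_mult_diff_distrib scaleR_diff_right del: transpose_matrix_vector)
    then have "norm (drift x - drift y) \<le> norm (A *v (transpose A *v (D x - D y)))" by simp
    also have "\<dots> \<le> a * norm (transpose A *v (D x - D y))" by (rule a(2))
    also have "\<dots> \<le> a * (a * norm (D x - D y))" by (intro mult_left_mono a)
    also have "\<dots> \<le> a * (a * (K * norm (x - y)))" by (intro mult_left_mono D_lipschitz a)
    finally show ?thesis by (simp add: mult.assoc)
  qed
  then show ?thesis using that[of "a * (a * K)"] a(1) K_nonneg by simp
qed

text \<open>Substituting \<xi> = sqrt h \<eta> and using h \<le> 1 bounds the step by sqrt h times
  an affine function of |\<eta>|. Both the cubed step and h times the step are then of order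
  h^(3/2), with an exponential moment as constant. The case k = 0 serves the Taylor
  remainder.\<close>

lemma step_moments:
  assumes "k \<ge> 0"
  obtains M where "M \<ge> 0" "\<And>h x. 0 < h \<Longrightarrow> h \<le> 1 \<Longrightarrow>
    (\<integral>\<^sup>+\<xi>. ennreal ((norm (h *\<^sub>R drift x + A *v \<xi>) ^ 3 + h * norm (h *\<^sub>R drift x + A *v \<xi>)) * exp (k * norm (h *\<^sub>R drift x + A *v \<xi>))) * ennreal (gauss h \<xi>) \<partial>lborel)
      \<le> ennreal (M * (h * sqrt h))"
proof -
  obtain a where a: "a \<ge> 0" "\<And>x. norm (A *v x) \<le> a * norm x" "\<And>x. norm (transpose A *v x) \<le> a * norm x"
    by (rule A_bound) blast
  obtain kb where kb: "kb \<ge> 0" "\<And>x. norm (drift x) \<le> kb" by (rule drift_bound) blast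
  define I where "I = enn2real (\<integral>\<^sup>+\<eta>. ennreal (exp ((k + 1) * a * norm \<eta>)) * ennreal (gauss 1 (\<eta> :: real ^ 'n)) \<partial>lborel)"
  have I: "(\<integral>\<^sup>+\<eta>. ennreal (exp ((k + 1) * a * norm \<eta>)) * ennreal (gauss 1 (\<eta> :: real ^ 'n)) \<partial>lborel) = ennreal I"
    unfolding I_def using gauss_exponential_moment[of "(k + 1) * a", where 'n='n] by (simp add: less_top)
  have "I \<ge> 0" by (simp add: I_def)
  define M where "M = 28 * exp ((k + 1) * kb) * I"
  have "M \<ge> 0" using \<open>I \<ge> 0\<close> by (simp add: M_def)
  moreover have "(\<integral>\<^sup>+\<xi>. ennreal ((norm (h *\<^sub>R drift x + A *v \<xi>) ^ 3 + h * norm (h *\<^sub>R drift x + A *v \<xi>)) * exp (k * norm (h *\<^sub>R drift x + A *v \<xi>))) * ennreal (gauss h \<xi>) \<partial>lborel)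
      \<le> ennreal (M * (h * sqrt h))" if h: "0 < h" "h \<le> 1" for h x
  proof -
    define \<tau> where "\<tau> = sqrt h"
    have \<tau>: "0 < \<tau>" "\<tau> \<le> 1" "h = \<tau> * \<tau>" using h by (auto simp: \<tau>_def)
    have pt: "(norm (h *\<^sub>R drift x + A *v (\<tau> *\<^sub>R \<eta>)) ^ 3 + h * norm (h *\<^sub>R drift x + A *v (\<tau> *\<^sub>R \<eta>))) * exp (k * norm (h *\<^sub>R drift x + A *v (\<tau> *\<^sub>R \<eta>)))
       \<le> 28 * exp ((k + 1) * kb) * (h * \<tau>) * exp ((k + 1) * a * norm \<eta>)" for \<eta>
    proof -
      define s where "s = kb + a * norm \<eta>"
      let ?v = "norm (h *\<^sub>R drift x + A *v (\<tau> *\<^sub>R \<eta>))"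
      have s0: "s \<ge> 0" using a kb by (simp add: s_def)
      have "?v \<le> norm (h *\<^sub>R drift x) + norm (A *v (\<tau> *\<^sub>R \<eta>))" by (rule norm_triangle_ineq)
      also have "norm (h *\<^sub>R drift x) \<le> \<tau> * kb"
      proof -
        have "h * norm (drift x) \<le> \<tau> * kb" unfolding \<tau>(3) using \<tau> kb(2)[of x]
          by (intro mult_mono) (auto simp: mult_left_le)
        then show ?thesis using h by simp
      qed
      also have "norm (A *v (\<tau> *\<^sub>R \<eta>)) \<le> \<tau> * (a * norm \<eta>)" using a(2)[of "\<tau> *\<^sub>R \<eta>"] \<tau> by (simp add: mult_ac)
      finally have v: "?v \<le> \<tau> * s" by (simp add: s_def distrib_left)
      have vs: "?v \<le> s" using v mult_right_mono[OF \<tau>(2) s0] by simp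
      have "?v ^ 3 + h * ?v \<le> (\<tau> * s) ^ 3 + h * (\<tau> * s)" using v h by (intro add_mono power_mono mult_left_mono) auto
      also have "\<dots> = h * \<tau> * (s ^ 3 + s)" by (simp add: \<tau>(3) power3_eq_cube algebra_simps)
      finally have "(?v ^ 3 + h * ?v) * exp (k * ?v) \<le> h * \<tau> * (s ^ 3 + s) * exp (k * s)"
        using assms vs h s0 \<tau> by (intro mult_mono) (auto intro!: mult_left_mono mult_nonneg_nonneg add_nonneg_nonneg)
      also have "\<dots> = h * \<tau> * ((s ^ 3 + s) * exp (k * s))" by (simp only: mult.assoc)
      also have "\<dots> \<le> h * \<tau> * (28 * exp ((k + 1) * s))"
        using h \<tau> by (intro mult_left_mono cubic_exp_bound s0 assms) auto
      also have "exp ((k + 1) * s) = exp ((k + 1) * kb) * exp ((k + 1) * a * norm \<eta>)"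
        by (simp add: s_def distrib_left exp_add mult.assoc)
      finally show ?thesis by (simp add: mult_ac)
    qed
    have "(\<integral>\<^sup>+\<xi>. ennreal ((norm (h *\<^sub>R drift x + A *v \<xi>) ^ 3 + h * norm (h *\<^sub>R drift x + A *v \<xi>)) * exp (k * norm (h *\<^sub>R drift x + A *v \<xi>))) * ennreal (gauss h \<xi>) \<partial>lborel)
      = (\<integral>\<^sup>+\<eta>. ennreal ((norm (h *\<^sub>R drift x + A *v (\<tau> *\<^sub>R \<eta>)) ^ 3 + h * norm (h *\<^sub>R drift x + A *v (\<tau> *\<^sub>R \<eta>))) * exp (k * norm (h *\<^sub>R drift x + A *v (\<tau> *\<^sub>R \<eta>)))) * ennreal (gauss 1 \<eta>) \<partial>lborel)"
      unfolding \<tau>_def by (rule gauss_scale[OF _ h(1)]) measurable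
    also have "\<dots> \<le> (\<integral>\<^sup>+\<eta>. ennreal (28 * exp ((k + 1) * kb) * (h * \<tau>)) * (ennreal (exp ((k + 1) * a * norm \<eta>)) * ennreal (gauss 1 (\<eta> :: real ^ 'n))) \<partial>lborel)"
    proof (rule nn_integral_mono)
      fix \<eta> :: "real ^ 'n"
      have "ennreal (28 * exp ((k + 1) * kb) * (h * \<tau>)) * ennreal (exp ((k + 1) * a * norm \<eta>)) = ennreal (28 * exp ((k + 1) * kb) * (h * \<tau>) * exp ((k + 1) * a * norm \<eta>))"
        using h \<tau> by (intro ennreal_mult[symmetric]) auto
      then show "ennreal ((norm (h *\<^sub>R drift x + A *v (\<tau> *\<^sub>R \<eta>)) ^ 3 + h * norm (h *\<^sub>R drift x + A *v (\<tau> *\<^sub>R \<eta>))) * exp (k * norm (h *\<^sub>R drift x + A *v (\<tau> *\<^sub>R \<eta>)))) * ennreal (gauss 1 \<eta>)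
        \<le> ennreal (28 * exp ((k + 1) * kb) * (h * \<tau>)) * (ennreal (exp ((k + 1) * a * norm \<eta>)) * ennreal (gauss 1 \<eta>))"
        unfolding mult.assoc[symmetric, of "ennreal (28 * exp ((k + 1) * kb) * (h * \<tau>))"] by (simp only:) (intro mult_right_mono ennreal_leI pt; simp)
    qed
    also have "\<dots> = ennreal (28 * exp ((k + 1) * kb) * (h * \<tau>)) * ennreal I"
      unfolding I[symmetric] by (rule nn_integral_cmult) measurable
    also have "\<dots> = ennreal (M * (h * sqrt h))"
    proof -
      have "28 * exp ((k + 1) * kb) * (h * \<tau>) \<ge> 0" using h \<tau>(1) by simp
      moreover have "28 * exp ((k + 1) * kb) * (h * \<tau>) * I = M * (h * sqrt h)" unfolding M_def \<tau>_def by (simp only: mult_ac)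
      ultimately show ?thesis using \<open>I \<ge> 0\<close> by (metis ennreal_mult)
    qed
    finally show ?thesis .
  qed
  ultimately show ?thesis using that by blast
qed

text \<open>The logarithm of the detailed balance ratio: the error of the trapezoidal rule for U,
  plus the mismatch of the squared drifts in the two Gaussian exponents.\<close>

definition "E h x y = U y - U x - (y - x) \<bullet> (D x + D y) / 2 - h / 8 * ((norm (transpose A *v D x))\<^sup>2 - (norm (transpose A *v D y))\<^sup>2)"

text \<open>When the two Gaussian exponents are expanded, the squares of \<open>A' (y - x)\<close>
  cancel and the cross terms combine to (y - x) \<bullet> (D x + D y) / 2. This is how the
  trapezoidal rule arises.\<close>

lemma detailed_balance_error:
  assumes h: "h > 0" shows "w x * p h x y / w y = p h y x * exp (E h x y)"
proof -
  have half: "A' *v drift x = - (1 / 2) *\<^sub>R (transpose A *v D x)" for x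
    by (simp only: drift_def matrix_vector_mult_scaleR A')
  have sq: "(norm (A' *v (r - h *\<^sub>R drift x)))\<^sup>2 = (norm (A' *v r))\<^sup>2 + h * (r \<bullet> D x) + h\<^sup>2 / 4 * (norm (transpose A *v D x))\<^sup>2" for r x
  proof -
    have "A' *v (r - h *\<^sub>R drift x) = A' *v r + (h / 2) *\<^sub>R (transpose A *v D x)"
      by (simp add: matrix_vector_mult_diff_distrib half matrix_vector_mult_scaleR del: transpose_matrix_vector)
    moreover have "(norm (u + (h / 2) *\<^sub>R g))\<^sup>2 = (norm u)\<^sup>2 + h * (u \<bullet> g) + (h / 2)\<^sup>2 * (norm g)\<^sup>2" for u g :: "real ^ 'n"
      unfolding power2_norm_eq_inner
      by (simp add: inner_add_left inner_add_right inner_commute power2_eq_square algebra_simps)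
    ultimately have "(norm (A' *v (r - h *\<^sub>R drift x)))\<^sup>2 = (norm (A' *v r))\<^sup>2 + h * ((A' *v r) \<bullet> (transpose A *v D x)) + (h / 2)\<^sup>2 * (norm (transpose A *v D x))\<^sup>2"
      by (simp only:)
    moreover have "(A' *v r) \<bullet> (transpose A *v D x) = r \<bullet> D x"
      using inner_matrix_transpose[of A "A' *v r" "D x"] by (simp only: A')
    ultimately show ?thesis by (simp add: power_divide)
  qed
  have neg: "(norm (A' *v (x - y)))\<^sup>2 = (norm (A' *v (y - x)))\<^sup>2"
  proof -
    have "A' *v (x - y) = - (A' *v (y - x))" by (simp add: matrix_vector_mult_diff_distrib)
    then show ?thesis by (simp only: norm_minus_cancel)
  qed
  have e: "- U x + - (norm (A' *v (y - x - h *\<^sub>R drift x)))\<^sup>2 / (2 * h) - (- U y) = - (norm (A' *v (x - y - h *\<^sub>R drift y)))\<^sup>2 / (2 * h) + E h x y"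
  proof -
    have alg: "- a + - (N + h * P + h\<^sup>2 / 4 * dx) / (2 * h) - (- b) = - (N + h * (- Q) + h\<^sup>2 / 4 * dy) / (2 * h) + (b - a - (P + Q) / 2 - h / 8 * (dx - dy))"
      for a b N P Q dx dy :: real
      using h by (simp add: field_simps power2_eq_square)
    have "(x - y) \<bullet> D y = - ((y - x) \<bullet> D y)" by (simp add: inner_diff_left)
    then show ?thesis unfolding sq neg E_def inner_add_right by (simp only: alg)
  qed
  have "w x * p h x y / w y = jac * (1 / sqrt (2 * pi * h)) ^ CARD('n) * (exp (- U x) * exp (- (norm (A' *v (y - x - h *\<^sub>R drift x)))\<^sup>2 / (2 * h)) / exp (- U y))"
    unfolding w_def p_def gauss_eq[OF h] by (simp add: mult_ac)
  also have "exp (- U x) * exp (- (norm (A' *v (y - x - h *\<^sub>R drift x)))\<^sup>2 / (2 * h)) / exp (- U y) = exp (- (norm (A' *v (x - y - h *\<^sub>R drift y)))\<^sup>2 / (2 * h) + E h x y)"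
    unfolding e[symmetric] by (simp only: exp_add exp_diff)
  finally show ?thesis unfolding p_def gauss_eq[OF h] exp_add by (simp add: mult_ac)
qed

text \<open>The two bounds have different roles: the linear one controls exp |E| by an exponential
  moment, the other one carries the order h^(3/2).\<close>

lemma E_bounds:
  obtains k where "k \<ge> 0" "\<And>h x y. 0 < h \<Longrightarrow> h \<le> 1 \<Longrightarrow> \<bar>E h x y\<bar> \<le> k * norm (y - x)"
    "\<And>h x y. 0 < h \<Longrightarrow> h \<le> 1 \<Longrightarrow> \<bar>E h x y\<bar> \<le> k * (norm (y - x) ^ 3 + h * norm (y - x))"
proof -
  obtain a where a: "a \<ge> 0" "\<And>x. norm (A *v x) \<le> a * norm x" "\<And>x. norm (transpose A *v x) \<le> a * norm x"
    by (rule A_bound) blast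
  define q where "q = a * a * K * K"
  have q: "q \<ge> 0" using a K_nonneg by (simp add: q_def)
  have quad: "\<bar>(norm (transpose A *v D x))\<^sup>2 - (norm (transpose A *v D y))\<^sup>2\<bar> \<le> 2 * q * norm (y - x)" for x y
  proof -
    let ?u = "transpose A *v D x" and ?v = "transpose A *v D y"
    have n: "norm (transpose A *v D x) \<le> a * K" for x using a(3)[of "D x"] mult_left_mono[OF D_bound a(1), of x] by linarith
    have "\<bar>(norm ?u)\<^sup>2 - (norm ?v)\<^sup>2\<bar> = \<bar>norm ?u - norm ?v\<bar> * (norm ?u + norm ?v)"
      by (simp add: power2_eq_square square_diff_square_factored abs_mult mult.commute)
    also have "\<bar>norm ?u - norm ?v\<bar> \<le> a * (K * norm (x - y))"
    proof -
      have "\<bar>norm ?u - norm ?v\<bar> \<le> norm (?u - ?v)" by (rule norm_triangle_ineq3)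
      also have "?u - ?v = transpose A *v (D x - D y)" by (rule matrix_vector_mult_diff_distrib[symmetric])
      also have "norm \<dots> \<le> a * norm (D x - D y)" by (rule a(3))
      also have "\<dots> \<le> a * (K * norm (x - y))" by (intro mult_left_mono D_lipschitz a)
      finally show ?thesis .
    qed
    also have "a * (K * norm (x - y)) * (norm ?u + norm ?v) \<le> a * (K * norm (x - y)) * (2 * (a * K))"
      using n[of x] n[of y] a K_nonneg by (intro mult_left_mono) auto
    finally show ?thesis by (simp add: q_def norm_minus_commute mult_ac mult_right_mono)
  qed
  have E1: "\<bar>E h x y\<bar> \<le> \<bar>U y - U x - (y - x) \<bullet> (D x + D y) / 2\<bar> + h * (q * norm (y - x))" if "0 < h" for h x y
  proof -
    have "\<bar>E h x y\<bar> \<le> \<bar>U y - U x - (y - x) \<bullet> (D x + D y) / 2\<bar> + \<bar>h / 8 * ((norm (transpose A *v D x))\<^sup>2 - (norm (transpose A *v D y))\<^sup>2)\<bar>"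
      unfolding E_def by (rule abs_triangle_ineq4)
    also have "\<bar>h / 8 * ((norm (transpose A *v D x))\<^sup>2 - (norm (transpose A *v D y))\<^sup>2)\<bar> \<le> h / 8 * (2 * q * norm (y - x))"
      unfolding abs_mult using that by (simp only: abs_of_pos divide_pos_pos) (intro mult_mono quad; simp add: q)
    also have "\<dots> \<le> h * (q * norm (y - x))" using that q by simp
    finally show ?thesis by simp
  qed
  have "\<bar>E h x y\<bar> \<le> (K + q) * norm (y - x)" if "0 < h" "h \<le> 1" for h x y
    using E1[OF that(1), of x y] trapezoid_1[of y x] mult_right_mono[OF that(2), of "q * norm (y - x)"] q
    by (simp add: distrib_right)
  moreover have "\<bar>E h x y\<bar> \<le> (K + q) * (norm (y - x) ^ 3 + h * norm (y - x))" if "0 < h" "h \<le> 1" for h x y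
  proof -
    have "\<bar>E h x y\<bar> \<le> K * norm (y - x) ^ 3 + q * (h * norm (y - x))"
      using E1[OF that(1), of x y] trapezoid_3[of y x] by (simp add: mult_ac)
    also have "\<dots> \<le> K * norm (y - x) ^ 3 + q * (h * norm (y - x)) + (q * norm (y - x) ^ 3 + K * (h * norm (y - x)))"
      using q K_nonneg that by simp
    also have "\<dots> = (K + q) * (norm (y - x) ^ 3 + h * norm (y - x))" by (simp add: algebra_simps)
    finally show ?thesis .
  qed
  moreover have "K + q \<ge> 0" using q K_nonneg by simp
  ultimately show ?thesis using that[of "K + q"] by blast
qed

text \<open>In |exp E - 1| \<le> |E| exp |E| the two estimates of \<open>E_bounds\<close> are used
  in the two places. The error is expressed through \<open>p h y x\<close>, so the average is over a
  step that starts at y, and \<open>step_moments\<close> applies.\<close>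

lemma almost_reversible_euler:
  obtains M where "M \<ge> 0" "\<And>h. 0 < h \<Longrightarrow> h \<le> 1 \<Longrightarrow> almost_reversible w (p h) (M * (h * sqrt h))"
proof -
  obtain k where k: "k \<ge> 0" "\<And>h x y. 0 < h \<Longrightarrow> h \<le> 1 \<Longrightarrow> \<bar>E h x y\<bar> \<le> k * norm (y - x)"
    "\<And>h x y. 0 < h \<Longrightarrow> h \<le> 1 \<Longrightarrow> \<bar>E h x y\<bar> \<le> k * (norm (y - x) ^ 3 + h * norm (y - x))"
    by (rule E_bounds) blast
  obtain M where M: "M \<ge> 0" "\<And>h x. 0 < h \<Longrightarrow> h \<le> 1 \<Longrightarrow>
    (\<integral>\<^sup>+\<xi>. ennreal ((norm (h *\<^sub>R drift x + A *v \<xi>) ^ 3 + h * norm (h *\<^sub>R drift x + A *v \<xi>)) * exp (k * norm (h *\<^sub>R drift x + A *v \<xi>))) * ennreal (gauss h \<xi>) \<partial>lborel)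
      \<le> ennreal (M * (h * sqrt h))" by (rule step_moments[OF k(1)]) blast
  have "almost_reversible w (p h) (k * M * (h * sqrt h))" if h: "0 < h" "h \<le> 1" for h
  proof
    show "w \<in> borel_measurable borel" by measurable
    show "w x > 0" for x by (simp add: w_def)
    show "p h x y \<ge> 0" for x y by (rule p_nonneg')
    show "(\<lambda>z. p h (fst z) (snd z)) \<in> borel_measurable (borel \<Otimes>\<^sub>M borel)" by measurable
    show "(\<integral>\<^sup>+y. ennreal (p h x y) \<partial>lborel) = 1" for x by (rule p_total'[OF h(1)])
    show "0 \<le> k * M * (h * sqrt h)" using k M h by simp
    fix y :: "real ^ 'n"
    let ?G = "\<lambda>r. (norm r ^ 3 + h * norm r) * exp (k * norm r)"
    have pt: "\<bar>w x * p h x y / w y - p h y x\<bar> \<le> p h y x * (k * ?G (x - y))" for x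
    proof -
      have "\<bar>w x * p h x y / w y - p h y x\<bar> = p h y x * \<bar>exp (E h x y) - 1\<bar>"
      proof -
        have "w x * p h x y / w y - p h y x = p h y x * (exp (E h x y) - 1)"
          unfolding detailed_balance_error[OF h(1)] by (simp add: right_diff_distrib)
        then show ?thesis using p_nonneg'[of h y x] by (simp add: abs_mult)
      qed
      also have "\<dots> \<le> p h y x * (\<bar>E h x y\<bar> * exp \<bar>E h x y\<bar>)"
        by (intro mult_left_mono abs_exp_minus_1_le p_nonneg')
      also have "\<dots> \<le> p h y x * (k * (norm (y - x) ^ 3 + h * norm (y - x)) * exp (k * norm (y - x)))"
        using k(2)[OF h, of x y] k(3)[OF h, of x y] k(1) h
        by (intro mult_left_mono mult_mono p_nonneg') (auto intro!: mult_nonneg_nonneg add_nonneg_nonneg)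
      finally show ?thesis by (simp add: norm_minus_commute mult.assoc)
    qed
    have "(\<integral>\<^sup>+x. ennreal \<bar>w x * p h x y / w y - p h y x\<bar> \<partial>lborel) \<le> (\<integral>\<^sup>+x. ennreal (p h y x) * (ennreal k * ennreal (?G (x - y))) \<partial>lborel)"
    proof (rule nn_integral_mono)
      fix x
      have "ennreal (p h y x) * (ennreal k * ennreal (?G (x - y))) = ennreal (p h y x * (k * ?G (x - y)))"
        using k(1) h p_nonneg'[of h y x] by (simp add: ennreal_mult)
      then show "ennreal \<bar>w x * p h x y / w y - p h y x\<bar> \<le> ennreal (p h y x) * (ennreal k * ennreal (?G (x - y)))"
        by (simp only: ennreal_leI pt)
    qed
    also have "\<dots> = (\<integral>\<^sup>+\<xi>. ennreal k * ennreal (?G (move h y \<xi> - y)) * ennreal (gauss h \<xi>) \<partial>lborel)"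
      by (rule nn_integral_p) measurable
    also have "\<dots> = (\<integral>\<^sup>+\<xi>. ennreal k * (ennreal (?G (h *\<^sub>R drift y + A *v \<xi>)) * ennreal (gauss h \<xi>)) \<partial>lborel)"
      by (simp add: move_def mult.assoc)
    also have "\<dots> = ennreal k * (\<integral>\<^sup>+\<xi>. ennreal (?G (h *\<^sub>R drift y + A *v \<xi>)) * ennreal (gauss h \<xi>) \<partial>lborel)"
      by (rule nn_integral_cmult) measurable
    also have "\<dots> \<le> ennreal k * ennreal (M * (h * sqrt h))" by (intro mult_left_mono M(2)[OF h]) simp
    also have "\<dots> = ennreal (k * M * (h * sqrt h))" using k(1) M(1) h by (simp add: ennreal_mult[symmetric] mult.assoc)
    finally show "(\<integral>\<^sup>+x. ennreal \<bar>w x * p h x y / w y - p h y x\<bar> \<partial>lborel) \<le> ennreal (k * M * (h * sqrt h))" .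
  qed
  then show ?thesis using that[of "k * M"] k(1) M(1) by simp
qed

end

section \<open>Taylor expansion and trapezoidal rule along segments\<close>

definition dir_deriv :: "real ^ 'n::finite \<Rightarrow> (real ^ 'n \<Rightarrow> real) \<Rightarrow> real ^ 'n \<Rightarrow> real" where
  "dir_deriv v f x = (\<Sum>i\<in>UNIV. v $ i * partial_deriv i f x)"

lemma partial_deriv_lincomb:
  assumes "\<And>j. j \<in> J \<Longrightarrow> g j differentiable_on UNIV"
  shows "(\<lambda>x. \<Sum>j\<in>J. c j * g j x) differentiable_on UNIV"
    and "partial_deriv i (\<lambda>x. \<Sum>j\<in>J. c j * g j x) = (\<lambda>x. \<Sum>j\<in>J. c j * partial_deriv i (g j) x)"
proof -
  have "(\<lambda>x. \<Sum>j\<in>J. c j * g j x) differentiable_on UNIV \<and>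
    partial_deriv i (\<lambda>x. \<Sum>j\<in>J. c j * g j x) = (\<lambda>x. \<Sum>j\<in>J. c j * partial_deriv i (g j) x)"
    using assms
  proof (induction J rule: infinite_finite_induct)
    case (insert j J)
    have cg: "(\<lambda>x. c j * g j x) differentiable_on UNIV"
      using insert.prems by (intro differentiable_on_mult) auto
    have "partial_deriv i (\<lambda>x. c j * g j x) = (\<lambda>x. c j * partial_deriv i (g j) x)"
      using partial_deriv_mult[of "\<lambda>_. c j" "g j" i] insert.prems by (simp add: partial_deriv_const)
    then show ?case using insert cg by (simp add: partial_deriv_add differentiable_on_add)
  qed (auto simp: partial_deriv_const)
  then show "(\<lambda>x. \<Sum>j\<in>J. c j * g j x) differentiable_on UNIV"
    "partial_deriv i (\<lambda>x. \<Sum>j\<in>J. c j * g j x) = (\<lambda>x. \<Sum>j\<in>J. c j * partial_deriv i (g j) x)" by auto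
qed

definition derivs_bounded :: "real \<Rightarrow> (real ^ 'n::finite \<Rightarrow> real) \<Rightarrow> bool" where
  "derivs_bounded K f \<longleftrightarrow> continuously_differentiable 3 f \<and>
     (\<forall>x i. \<bar>partial_deriv i f x\<bar> \<le> K \<and> (\<forall>j. \<bar>partial_deriv i (partial_deriv j f) x\<bar> \<le> K \<and>
        (\<forall>k. \<bar>partial_deriv i (partial_deriv j (partial_deriv k f)) x\<bar> \<le> K)))"

lemma derivs_bounded_differentiable:
  assumes "derivs_bounded K f"
  shows "f differentiable_on UNIV" "partial_deriv i f differentiable_on UNIV"
    "partial_deriv i (partial_deriv j f) differentiable_on UNIV"
  using assms by (auto simp: derivs_bounded_def eval_nat_numeral)

lemma derivs_bounded_nonneg: "derivs_bounded K f \<Longrightarrow> K \<ge> 0"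
  unfolding derivs_bounded_def using abs_ge_zero order_trans by blast

text \<open>The gradient and not the function is asked to have bounded support, so that a truncated
  potential, which is constant where the potential is large, qualifies.\<close>

lemma derivs_bounded_exists:
  assumes f: "continuously_differentiable 3 f" and b: "bounded {x. \<exists>i. partial_deriv i f x \<noteq> 0}"
  shows "\<exists>K. derivs_bounded K f"
proof -
  let ?S = "closure {x. \<exists>i. partial_deriv i f x \<noteq> 0}"
  have bS: "bounded ?S" using b by (rule bounded_closure)
  have closed_supp: "closure {x. g x \<noteq> 0} \<subseteq> ?S" if "{x. g x \<noteq> 0} \<subseteq> ?S" for g :: "real ^ 'a \<Rightarrow> real"
    using that by (intro closure_minimal) auto
  have s1: "{x. partial_deriv i f x \<noteq> 0} \<subseteq> ?S" for i using closure_subset[of "{x. \<exists>i. partial_deriv i f x \<noteq> 0}"] by auto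
  have s2: "{x. partial_deriv j (partial_deriv i f) x \<noteq> 0} \<subseteq> ?S" for i j
    using closed_supp[OF s1] partial_deriv_support[of j "partial_deriv i f"] by blast
  have s3: "{x. partial_deriv k (partial_deriv j (partial_deriv i f)) x \<noteq> 0} \<subseteq> ?S" for i j k
    using closed_supp[OF s2] partial_deriv_support[of k "partial_deriv j (partial_deriv i f)"] by blast
  have bd: "\<exists>K. \<forall>x. \<bar>g x\<bar> \<le> K" if "continuous_on UNIV g" "{x. g x \<noteq> 0} \<subseteq> ?S" for g :: "real ^ 'a \<Rightarrow> real"
    using continuous_bounded_support_bounded[OF that(1) bounded_subset[OF bS that(2)]] by metis
  have c1: "continuously_differentiable 2 (partial_deriv i f)" for i using f by (simp add: eval_nat_numeral)
  have c2: "continuously_differentiable 1 (partial_deriv j (partial_deriv i f))" for i j using c1[of i] by (simp add: eval_nat_numeral)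
  have c3: "continuous_on UNIV (partial_deriv k (partial_deriv j (partial_deriv i f)))" for i j k using c2[of j i] by simp
  note cc = continuously_differentiable_continuous
  have "\<forall>i. \<exists>K. \<forall>x. \<bar>partial_deriv i f x\<bar> \<le> K" using bd[OF cc[OF c1] s1] by blast
  then obtain K1 where K1: "\<And>i x. \<bar>partial_deriv i f x\<bar> \<le> K1 i" by metis
  have "\<forall>i j. \<exists>K. \<forall>x. \<bar>partial_deriv j (partial_deriv i f) x\<bar> \<le> K" using bd[OF cc[OF c2] s2] by blast
  then obtain K2 where K2: "\<And>i j x. \<bar>partial_deriv j (partial_deriv i f) x\<bar> \<le> K2 i j" by metis
  have "\<forall>i j k. \<exists>K. \<forall>x. \<bar>partial_deriv k (partial_deriv j (partial_deriv i f)) x\<bar> \<le> K" using bd[OF c3 s3] by blast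
  then obtain K3 where K3: "\<And>i j k x. \<bar>partial_deriv k (partial_deriv j (partial_deriv i f)) x\<bar> \<le> K3 i j k" by metis
  define K where "K = Max (range K1 \<union> range (\<lambda>(i, j). K2 i j) \<union> range (\<lambda>(i, j, k). K3 i j k))"
  have "K1 i \<le> K" "K2 i j \<le> K" "K3 i j k \<le> K" for i j k
  proof -
    have "K2 i j \<in> range (\<lambda>(i, j). K2 i j)" "K3 i j k \<in> range (\<lambda>(i, j, k). K3 i j k)"
      by (rule image_eqI[of _ _ "(i, j)"]; simp) (rule image_eqI[of _ _ "(i, j, k)"]; simp)
    then show "K1 i \<le> K" "K2 i j \<le> K" "K3 i j k \<le> K" unfolding K_def by (intro Max_ge; simp)+
  qed
  then have "derivs_bounded K f"
    unfolding derivs_bounded_def using f K1 K2 K3 by (meson order_trans)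
  then show ?thesis by blast
qed

lemma test_function_derivs_bounded:
  assumes "test_function f" shows "\<exists>K. derivs_bounded K f"
proof (rule derivs_bounded_exists)
  show "continuously_differentiable 3 f" using assms by (simp add: test_function_iff smooth_def)
  have "bounded (closure {x. f x \<noteq> 0})" using assms by (simp add: test_function_iff bounded_closure)
  then show "bounded {x. \<exists>i. partial_deriv i f x \<noteq> 0}"
    by (rule bounded_subset) (auto dest: partial_deriv_support)
qed

lemma abs_dir_sum_le:
  fixes v :: "real ^ 'n::finite"
  assumes "\<And>i. \<bar>c i\<bar> \<le> B" shows "\<bar>\<Sum>i\<in>UNIV. v $ i * c i\<bar> \<le> real CARD('n) * norm v * B"
proof -
  have "B \<ge> 0" using assms abs_ge_zero order_trans by blast
  have "\<bar>\<Sum>i\<in>UNIV. v $ i * c i\<bar> \<le> (\<Sum>i\<in>UNIV. \<bar>v $ i * c i\<bar>)" by (rule sum_abs)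
  also have "\<dots> \<le> (\<Sum>i\<in>(UNIV::'n set). norm v * B)"
    using component_le_norm_cart[of v] assms \<open>B \<ge> 0\<close> by (intro sum_mono) (simp add: abs_mult mult_mono)
  finally show ?thesis by simp
qed

context
  fixes K :: real and f :: "real ^ 'n::finite \<Rightarrow> real"
  assumes f: "derivs_bounded K f"
begin

lemma dir_deriv_line:
  "((\<lambda>t. f (x + t *\<^sub>R v)) has_real_derivative dir_deriv v f (x + t *\<^sub>R v)) (at t)"
  "((\<lambda>t. dir_deriv v f (x + t *\<^sub>R v)) has_real_derivative dir_deriv v (dir_deriv v f) (x + t *\<^sub>R v)) (at t)"
  "((\<lambda>t. dir_deriv v (dir_deriv v f) (x + t *\<^sub>R v)) has_real_derivative dir_deriv v (dir_deriv v (dir_deriv v f)) (x + t *\<^sub>R v)) (at t)"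
proof -
  note d = derivs_bounded_differentiable[OF f]
  have 1: "dir_deriv v f differentiable_on UNIV" and p1: "partial_deriv j (dir_deriv v f) = (\<lambda>x. \<Sum>i\<in>UNIV. v $ i * partial_deriv j (partial_deriv i f) x)" for j
    unfolding dir_deriv_def[abs_def] using partial_deriv_lincomb[where J=UNIV and g="\<lambda>i. partial_deriv i f" and c="($) v"] d(2) by auto
  have pd: "partial_deriv j (dir_deriv v f) differentiable_on UNIV" for j
    unfolding p1 using partial_deriv_lincomb(1)[where J=UNIV and g="\<lambda>i. partial_deriv j (partial_deriv i f)" and c="($) v"] d(3) by auto
  have 2: "dir_deriv v (dir_deriv v f) differentiable_on UNIV"
    unfolding dir_deriv_def[of v "dir_deriv v f", abs_def]
    using partial_deriv_lincomb(1)[where J=UNIV and g="\<lambda>j. partial_deriv j (dir_deriv v f)" and c="($) v"] pd by auto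
  show "((\<lambda>t. f (x + t *\<^sub>R v)) has_real_derivative dir_deriv v f (x + t *\<^sub>R v)) (at t)"
    "((\<lambda>t. dir_deriv v f (x + t *\<^sub>R v)) has_real_derivative dir_deriv v (dir_deriv v f) (x + t *\<^sub>R v)) (at t)"
    "((\<lambda>t. dir_deriv v (dir_deriv v f) (x + t *\<^sub>R v)) has_real_derivative dir_deriv v (dir_deriv v (dir_deriv v f)) (x + t *\<^sub>R v)) (at t)"
    using has_real_derivative_line[OF d(1), of x v t] has_real_derivative_line[OF 1, of x v t] has_real_derivative_line[OF 2, of x v t]
    by (simp_all add: dir_deriv_def)
qed

lemma dir_deriv_2: "dir_deriv v (dir_deriv v f) x = (\<Sum>i\<in>UNIV. v $ i * (\<Sum>j\<in>UNIV. v $ j * partial_deriv i (partial_deriv j f) x))"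
  unfolding dir_deriv_def[abs_def]
  using partial_deriv_lincomb(2)[where J=UNIV and g="\<lambda>i. partial_deriv i f" and c="($) v"] derivs_bounded_differentiable(2)[OF f] by auto

lemma dir_deriv_3: "dir_deriv v (dir_deriv v (dir_deriv v f)) x =
   (\<Sum>i\<in>UNIV. v $ i * (\<Sum>j\<in>UNIV. v $ j * (\<Sum>k\<in>UNIV. v $ k * partial_deriv i (partial_deriv j (partial_deriv k f)) x)))"
proof -
  note d = derivs_bounded_differentiable[OF f]
  have a: "partial_deriv i (\<lambda>x. \<Sum>k\<in>UNIV. v $ k * partial_deriv j (partial_deriv k f) x)
      = (\<lambda>x. \<Sum>k\<in>UNIV. v $ k * partial_deriv i (partial_deriv j (partial_deriv k f)) x)" for i j
    using partial_deriv_lincomb(2)[where J=UNIV and g="\<lambda>k. partial_deriv j (partial_deriv k f)" and c="($) v"] d(3) by auto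
  have b: "(\<lambda>x. \<Sum>k\<in>UNIV. v $ k * partial_deriv j (partial_deriv k f) x) differentiable_on UNIV" for j
    using partial_deriv_lincomb(1)[where J=UNIV and g="\<lambda>k. partial_deriv j (partial_deriv k f)" and c="($) v"] d(3) by auto
  have "partial_deriv i (dir_deriv v (dir_deriv v f))
      = (\<lambda>x. \<Sum>j\<in>UNIV. v $ j * (\<Sum>k\<in>UNIV. v $ k * partial_deriv i (partial_deriv j (partial_deriv k f)) x))" for i
    unfolding dir_deriv_2[abs_def]
    using partial_deriv_lincomb(2)[where J=UNIV and g="\<lambda>j x. \<Sum>k\<in>UNIV. v $ k * partial_deriv j (partial_deriv k f) x" and c="($) v"] b a by auto
  then show ?thesis by (subst dir_deriv_def) simp
qed

lemma dir_deriv_bounds: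
  defines "n \<equiv> real CARD('n)"
  shows "\<bar>dir_deriv v f x\<bar> \<le> n * norm v * K"
    "\<bar>dir_deriv v (dir_deriv v (dir_deriv v f)) x\<bar> \<le> n ^ 3 * K * norm v ^ 3"
proof -
  note b = f[unfolded derivs_bounded_def]
  show "\<bar>dir_deriv v f x\<bar> \<le> n * norm v * K"
    unfolding dir_deriv_def n_def using b by (intro abs_dir_sum_le) auto
  have "\<bar>dir_deriv v (dir_deriv v (dir_deriv v f)) x\<bar> \<le> n * norm v * (n * norm v * (n * norm v * K))"
    unfolding dir_deriv_3 n_def using b by (intro abs_dir_sum_le) auto
  then show "\<bar>dir_deriv v (dir_deriv v (dir_deriv v f)) x\<bar> \<le> n ^ 3 * K * norm v ^ 3"
    by (simp add: power3_eq_cube mult_ac)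
qed

lemma taylor_3:
  "\<bar>f (x + v) - f x - dir_deriv v f x - dir_deriv v (dir_deriv v f) x / 2\<bar> \<le> real CARD('n) ^ 3 * K * norm v ^ 3"
proof -
  define d where "d m t = ((dir_deriv v ^^ m) f) (x + t *\<^sub>R v)" for m t
  have "\<exists>t>0. t < 1 \<and> d 0 1 = (\<Sum>m<3. d m 0 / fact m * 1 ^ m) + d 3 t / fact 3 * 1 ^ 3"
  proof (rule Maclaurin)
    show "\<forall>m t. m < 3 \<and> 0 \<le> t \<and> t \<le> 1 \<longrightarrow> (d m has_real_derivative d (Suc m) t) (at t)"
      using dir_deriv_line[where x=x and v=v] by (auto simp: d_def[abs_def] eval_nat_numeral less_Suc_eq)
  qed auto
  then obtain t where "f (x + v) = f x + dir_deriv v f x + dir_deriv v (dir_deriv v f) x / 2 + d 3 t / 6"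
    by (auto simp: d_def eval_nat_numeral)
  moreover have "\<bar>d 3 t\<bar> \<le> real CARD('n) ^ 3 * K * norm v ^ 3"
    using dir_deriv_bounds(2)[of v "x + t *\<^sub>R v"] by (simp add: d_def eval_nat_numeral)
  ultimately show ?thesis by simp
qed

text \<open>Along the segment the function is expanded to third order and its derivative, at the far
  end, to second order. All terms but the remainders cancel; these enter with the factors 1/6 and
  1/4.\<close>

lemma trapezoid_3:
  "\<bar>f (x + v) - f x - (dir_deriv v f x + dir_deriv v f (x + v)) / 2\<bar> \<le> real CARD('n) ^ 3 * K * norm v ^ 3"
proof -
  define d where "d m t = ((dir_deriv v ^^ Suc m) f) (x + t *\<^sub>R v)" for m t
  have "\<exists>t>0. t < 1 \<and> d 0 1 = (\<Sum>m<2. d m 0 / fact m * 1 ^ m) + d 2 t / fact 2 * 1 ^ 2"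
  proof (rule Maclaurin)
    show "\<forall>m t. m < 2 \<and> 0 \<le> t \<and> t \<le> 1 \<longrightarrow> (d m has_real_derivative d (Suc m) t) (at t)"
      using dir_deriv_line[where x=x and v=v] by (auto simp: d_def[abs_def] eval_nat_numeral less_Suc_eq)
  qed auto
  then obtain t where t: "dir_deriv v f (x + v) = dir_deriv v f x + dir_deriv v (dir_deriv v f) x + d 2 t / 2"
    by (auto simp: d_def eval_nat_numeral)
  have "\<bar>d 2 t\<bar> \<le> real CARD('n) ^ 3 * K * norm v ^ 3"
    using dir_deriv_bounds(2)[of v "x + t *\<^sub>R v"] by (simp add: d_def eval_nat_numeral)
  define D where "D m t = ((dir_deriv v ^^ m) f) (x + t *\<^sub>R v)" for m t
  have "\<exists>t>0. t < 1 \<and> D 0 1 = (\<Sum>m<3. D m 0 / fact m * 1 ^ m) + D 3 t / fact 3 * 1 ^ 3"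
  proof (rule Maclaurin)
    show "\<forall>m t. m < 3 \<and> 0 \<le> t \<and> t \<le> 1 \<longrightarrow> (D m has_real_derivative D (Suc m) t) (at t)"
      using dir_deriv_line[where x=x and v=v] by (auto simp: D_def[abs_def] eval_nat_numeral less_Suc_eq)
  qed auto
  then obtain s where s: "f (x + v) = f x + dir_deriv v f x + dir_deriv v (dir_deriv v f) x / 2 + D 3 s / 6"
    by (auto simp: D_def eval_nat_numeral)
  have "\<bar>D 3 s\<bar> \<le> real CARD('n) ^ 3 * K * norm v ^ 3"
    using dir_deriv_bounds(2)[of v "x + s *\<^sub>R v"] by (simp add: D_def eval_nat_numeral)
  moreover have "f (x + v) - f x - (dir_deriv v f x + dir_deriv v f (x + v)) / 2 = D 3 s / 6 - d 2 t / 4"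
    unfolding s t by (simp add: field_simps)
  ultimately show ?thesis using \<open>\<bar>d 2 t\<bar> \<le> _\<close> unfolding abs_le_iff by linarith
qed

lemma increment_bound: "\<bar>f (x + v) - f x\<bar> \<le> real CARD('n) * norm v * K"
proof -
  have "\<exists>z>0. z < 1 \<and> f (x + 1 *\<^sub>R v) - f (x + 0 *\<^sub>R v) = (1 - 0) * dir_deriv v f (x + z *\<^sub>R v)"
    by (rule MVT2) (auto intro: dir_deriv_line)
  then show ?thesis using dir_deriv_bounds(1)[of v] by auto
qed

lemma partial_deriv_increment_bound: "\<bar>partial_deriv i f (x + v) - partial_deriv i f x\<bar> \<le> real CARD('n) * norm v * K"
proof -
  have "\<exists>z>0. z < 1 \<and> partial_deriv i f (x + 1 *\<^sub>R v) - partial_deriv i f (x + 0 *\<^sub>R v) = (1 - 0) * dir_deriv v (partial_deriv i f) (x + z *\<^sub>R v)"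
    using has_real_derivative_line[OF derivs_bounded_differentiable(2)[OF f], where x=x and v=v]
    by (intro MVT2) (auto simp: dir_deriv_def)
  then obtain z where "partial_deriv i f (x + v) - partial_deriv i f x = dir_deriv v (partial_deriv i f) (x + z *\<^sub>R v)" by auto
  moreover have "\<bar>dir_deriv v (partial_deriv i f) y\<bar> \<le> real CARD('n) * norm v * K" for y
    unfolding dir_deriv_def using f[unfolded derivs_bounded_def] by (intro abs_dir_sum_le) auto
  ultimately show ?thesis by simp
qed

end

lemma dir_deriv_grad: "dir_deriv v f x = v \<bullet> grad f x"
  by (simp add: dir_deriv_def inner_vec_def grad_def)

lemma norm_vec_le_bound:
  fixes v :: "real ^ 'n::finite"
  assumes "\<And>i. \<bar>v $ i\<bar> \<le> B" shows "norm v \<le> real CARD('n) * B"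
proof -
  have "norm v \<le> (\<Sum>i\<in>UNIV. \<bar>v $ i\<bar>)" by (rule norm_le_l1_cart)
  also have "\<dots> \<le> real CARD('n) * B" using sum_bounded_above[of UNIV "\<lambda>i. \<bar>v $ i\<bar>" B] assms by simp
  finally show ?thesis .
qed

lemma euler_kernel_of_derivs_bounded:
  fixes U :: "real ^ 'n::finite \<Rightarrow> real"
  assumes A: "invertible A" and U: "derivs_bounded K U"
  obtains K' where "euler_kernel A U (grad U) K'"
proof -
  define n where "n = real CARD('n)"
  have n: "n \<ge> 1" unfolding n_def by (simp add: Suc_leI)
  have K: "K \<ge> 0" by (rule derivs_bounded_nonneg[OF U])
  \<comment> \<open>One constant for all four bounds: since n \<ge> 1 it dominates n K, n^2 K, n^3 K
    and the 2 n K of the linear trapezoidal estimate.\<close>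
  define K' where "K' = 2 * n ^ 3 * K"
  have pw: "n * K \<le> n ^ 3 * K" "n * n * K \<le> n ^ 3 * K" "n ^ 3 * K \<ge> 0"
    using n K power_increasing[of 1 3 n] power_increasing[of 2 3 n]
    by (auto intro!: mult_right_mono simp: power2_eq_square)
  have k: "n * n * K \<le> K'" "n ^ 3 * K \<le> K'" "2 * (n * K) \<le> K'"
    unfolding K'_def using pw by linarith+
  have gb: "norm (grad U x) \<le> n * K" for x
    unfolding n_def using U by (intro norm_vec_le_bound) (auto simp: grad_def derivs_bounded_def)
  have "euler_kernel A U (grad U) K'"
  proof
    show "invertible A" by fact
    have c3: "continuously_differentiable 3 U" using U by (simp add: derivs_bounded_def)
    show "U \<in> borel_measurable borel"
      using continuously_differentiable_continuous[OF c3] by (rule borel_measurable_continuous_onI)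
    have "continuous_on UNIV (grad U)"
      unfolding grad_def[abs_def]
      by (intro continuous_on_vec_lambda differentiable_imp_continuous_on derivs_bounded_differentiable(2)[OF U])
    then show "grad U \<in> borel_measurable borel" by (rule borel_measurable_continuous_onI)
    fix x y :: "real ^ 'n"
    have xy: "x + (y - x) = y" by simp
    show "norm (grad U x) \<le> K'" using gb[of x] pw unfolding K'_def by linarith
    have "norm (grad U x - grad U y) \<le> n * (n * norm (x - y) * K)"
      unfolding n_def using partial_deriv_increment_bound[OF U, where x=y and v="x - y"]
      by (intro norm_vec_le_bound) (simp add: grad_def)
    also have "\<dots> = n * n * K * norm (x - y)" by (simp add: mult_ac)
    also have "\<dots> \<le> K' * norm (x - y)" by (intro mult_right_mono k) simp
    finally show "norm (grad U x - grad U y) \<le> K' * norm (x - y)" .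
    have eq: "U y - U x - (y - x) \<bullet> (grad U x + grad U y) / 2
       = U (x + (y - x)) - U x - (dir_deriv (y - x) U x + dir_deriv (y - x) U (x + (y - x))) / 2"
      by (simp add: dir_deriv_grad inner_add_right)
    show "\<bar>U y - U x - (y - x) \<bullet> (grad U x + grad U y) / 2\<bar> \<le> K' * norm (y - x) ^ 3"
    proof -
      have "n ^ 3 * K * norm (y - x) ^ 3 \<le> K' * norm (y - x) ^ 3"
        by (intro mult_right_mono k) simp
      then show ?thesis unfolding eq using trapezoid_3[OF U, of x "y - x"] by (simp add: n_def)
    qed
    have "\<bar>U y - U x - (y - x) \<bullet> (grad U x + grad U y) / 2\<bar> \<le> 2 * (n * K) * norm (y - x)"
    proof -
      have "\<bar>U y - U x\<bar> \<le> n * K * norm (y - x)" using increment_bound[OF U, of x "y - x"] by (simp add: n_def mult_ac)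
      moreover have "\<bar>dir_deriv (y - x) U z\<bar> \<le> n * K * norm (y - x)" for z
        using dir_deriv_bounds(1)[OF U, of "y - x" z] by (simp add: n_def mult_ac)
      note this[of x] this[of y]
      moreover have "\<bar>a - (b + c) / 2\<bar> \<le> 2 * q" if "\<bar>a\<bar> \<le> q" "\<bar>b\<bar> \<le> q" "\<bar>c\<bar> \<le> q" for a b c q :: real
        using that by (auto simp: abs_le_iff add_divide_distrib)
      ultimately have "\<bar>U y - U x - (dir_deriv (y - x) U x + dir_deriv (y - x) U y) / 2\<bar> \<le> 2 * (n * K * norm (y - x))"
        by blast
      then show ?thesis unfolding eq xy by (simp only: mult.assoc)
    qed
    also have "\<dots> \<le> K' * norm (y - x)" by (intro mult_right_mono k) simp
    finally show "\<bar>U y - U x - (y - x) \<bullet> (grad U x + grad U y) / 2\<bar> \<le> K' * norm (y - x)" .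
  qed
  then show ?thesis by (rule that)
qed

section \<open>Expansion of one Euler step in terms of the generator\<close>

context euler_kernel begin

definition "gen f x = drift x \<bullet> grad f x + (\<Sum>i\<in>UNIV. \<Sum>j\<in>UNIV. (A ** transpose A) $ i $ j * partial_deriv i (partial_deriv j f) x) / 2"

lemma step_mean:
  assumes h: "h > 0"
  shows "has_bochner_integral lborel (\<lambda>\<xi>. gauss h \<xi> * (h *\<^sub>R drift x + A *v \<xi>) $ i) (h * drift x $ i)"
proof -
  have "has_bochner_integral lborel (\<lambda>\<xi>. (h * drift x $ i) * gauss h \<xi> + (\<Sum>k\<in>UNIV. A $ i $ k * (gauss h \<xi> * \<xi> $ k)))
     ((h * drift x $ i) * 1 + (\<Sum>k\<in>UNIV. A $ i $ k * 0))"
    by (intro has_bochner_integral_add has_bochner_integral_sum has_bochner_integral_mult_right gauss_total gauss_moment_1 h)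
  moreover have "(h * drift x $ i) * gauss h \<xi> + (\<Sum>k\<in>UNIV. A $ i $ k * (gauss h \<xi> * \<xi> $ k)) = gauss h \<xi> * (h *\<^sub>R drift x + A *v \<xi>) $ i" for \<xi>
    by (simp add: matrix_vector_mult_def distrib_left sum_distrib_left mult_ac)
  ultimately show ?thesis by simp
qed

lemma step_covariance:
  assumes h: "h > 0"
  shows "has_bochner_integral lborel (\<lambda>\<xi>. gauss h \<xi> * ((h *\<^sub>R drift x + A *v \<xi>) $ i * (h *\<^sub>R drift x + A *v \<xi>) $ j))
     (h\<^sup>2 * (drift x $ i * drift x $ j) + h * (A ** transpose A) $ i $ j)"
proof -
  let ?b = "\<lambda>i. h * drift x $ i"
  have "has_bochner_integral lborel (\<lambda>\<xi>. (?b i * ?b j) * gauss h \<xi>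
       + (\<Sum>k\<in>UNIV. (?b i * A $ j $ k) * (gauss h \<xi> * \<xi> $ k)) + (\<Sum>k\<in>UNIV. (?b j * A $ i $ k) * (gauss h \<xi> * \<xi> $ k))
       + (\<Sum>k\<in>UNIV. \<Sum>l\<in>UNIV. (A $ i $ k * A $ j $ l) * (gauss h \<xi> * (\<xi> $ k * \<xi> $ l))))
     ((?b i * ?b j) * 1 + (\<Sum>k\<in>UNIV. (?b i * A $ j $ k) * 0) + (\<Sum>k\<in>UNIV. (?b j * A $ i $ k) * 0)
       + (\<Sum>k\<in>UNIV. \<Sum>l\<in>UNIV. (A $ i $ k * A $ j $ l) * (if k = l then h else 0)))"
    by (intro has_bochner_integral_add has_bochner_integral_sum has_bochner_integral_mult_right gauss_total gauss_moment_1 gauss_moment_2 h)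
  moreover have "(?b i * ?b j) * gauss h \<xi>
       + (\<Sum>k\<in>UNIV. (?b i * A $ j $ k) * (gauss h \<xi> * \<xi> $ k)) + (\<Sum>k\<in>UNIV. (?b j * A $ i $ k) * (gauss h \<xi> * \<xi> $ k))
       + (\<Sum>k\<in>UNIV. \<Sum>l\<in>UNIV. (A $ i $ k * A $ j $ l) * (gauss h \<xi> * (\<xi> $ k * \<xi> $ l)))
      = gauss h \<xi> * ((h *\<^sub>R drift x + A *v \<xi>) $ i * (h *\<^sub>R drift x + A *v \<xi>) $ j)" for \<xi>
  proof -
    define a where "a i = (\<Sum>k\<in>UNIV. A $ i $ k * \<xi> $ k)" for i
    have e1: "(\<Sum>k\<in>UNIV. (b * A $ j $ k) * (gauss h \<xi> * \<xi> $ k)) = gauss h \<xi> * (b * a j)" for b j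
      by (simp add: a_def sum_distrib_left mult_ac)
    have e2: "(\<Sum>k\<in>UNIV. \<Sum>l\<in>UNIV. (A $ i $ k * A $ j $ l) * (gauss h \<xi> * (\<xi> $ k * \<xi> $ l))) = gauss h \<xi> * (a i * a j)"
      unfolding a_def sum_product by (simp add: sum_distrib_left mult_ac)
    have e3: "(h *\<^sub>R drift x + A *v \<xi>) $ i = ?b i + a i" for i
      by (simp add: matrix_vector_mult_def a_def)
    show ?thesis unfolding e1 e2 e3 by (simp add: algebra_simps)
  qed
  moreover have "(?b i * ?b j) * 1 + (\<Sum>k\<in>UNIV. (?b i * A $ j $ k) * 0) + (\<Sum>k\<in>UNIV. (?b j * A $ i $ k) * 0)
       + (\<Sum>k\<in>UNIV. \<Sum>l\<in>UNIV. (A $ i $ k * A $ j $ l) * (if k = l then h else 0))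
     = h\<^sup>2 * (drift x $ i * drift x $ j) + h * (A ** transpose A) $ i $ j"
    by (simp add: if_distrib[of "\<lambda>c. _ * c"] matrix_matrix_mult_def transpose_def sum_distrib_left power2_eq_square mult_ac cong: if_cong)
  ultimately show ?thesis by simp
qed

text \<open>A Taylor expansion to second order in the step, whose first two moments are known
  exactly. Besides h times the generator there remain the cubic remainder and h^2 times a quadratic
  form in the drift, both of order h^(3/2) uniformly in x.\<close>

lemma step_generator:
  assumes f: "derivs_bounded B f" and fb: "\<And>x. \<bar>f x\<bar> \<le> C"
  obtains M where "M \<ge> 0" "\<And>h x. 0 < h \<Longrightarrow> h \<le> 1 \<Longrightarrow> \<bar>(LINT y|lborel. p h x y * f y) - f x - h * gen f x\<bar> \<le> M * (h * sqrt h)"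
proof -
  have B: "B \<ge> 0" by (rule derivs_bounded_nonneg[OF f])
  define n where "n = real CARD('n)"
  have [measurable]: "f \<in> borel_measurable borel"
    using f by (intro borel_measurable_continuous_onI continuously_differentiable_continuous) (auto simp: derivs_bounded_def)
  obtain kb where kb: "kb \<ge> 0" "\<And>x. norm (drift x) \<le> kb" by (rule drift_bound) blast
  obtain M where M: "M \<ge> 0" "\<And>h x. 0 < h \<Longrightarrow> h \<le> 1 \<Longrightarrow>
    (\<integral>\<^sup>+\<xi>. ennreal ((norm (h *\<^sub>R drift x + A *v \<xi>) ^ 3 + h * norm (h *\<^sub>R drift x + A *v \<xi>)) * exp (0 * norm (h *\<^sub>R drift x + A *v \<xi>))) * ennreal (gauss h \<xi>) \<partial>lborel)
      \<le> ennreal (M * (h * sqrt h))" by (rule step_moments[of 0]) auto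
  define N where "N = n ^ 3 * B * M + n * n * kb * kb * B"
  have N: "N \<ge> 0" using B M kb by (simp add: N_def n_def)
  moreover have "\<bar>(LINT y|lborel. p h x y * f y) - f x - h * gen f x\<bar> \<le> N * (h * sqrt h)" if h: "0 < h" "h \<le> 1" for h x
  proof -
    define v where "v \<xi> = h *\<^sub>R drift x + A *v \<xi>" for \<xi>
    have [measurable]: "v \<in> borel_measurable borel" unfolding v_def[abs_def] by measurable
    define R where "R \<xi> = f (x + v \<xi>) - f x - dir_deriv (v \<xi>) f x - dir_deriv (v \<xi>) (dir_deriv (v \<xi>) f) x / 2" for \<xi>
    let ?H = "\<lambda>i j. partial_deriv i (partial_deriv j f) x"
    let ?J = "\<Sum>i\<in>UNIV. \<Sum>j\<in>UNIV. ?H i j * (h\<^sup>2 * (drift x $ i * drift x $ j) + h * (A ** transpose A) $ i $ j)"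
    have i1: "has_bochner_integral lborel (\<lambda>\<xi>. gauss h \<xi> * dir_deriv (v \<xi>) f x) (h * (drift x \<bullet> grad f x))"
    proof -
      have "has_bochner_integral lborel (\<lambda>\<xi>. \<Sum>i\<in>UNIV. partial_deriv i f x * (gauss h \<xi> * v \<xi> $ i)) (\<Sum>i\<in>UNIV. partial_deriv i f x * (h * drift x $ i))"
        unfolding v_def by (intro has_bochner_integral_sum has_bochner_integral_mult_right step_mean h)
      then show ?thesis by (simp add: dir_deriv_def sum_distrib_left inner_vec_def grad_def mult_ac)
    qed
    have i2: "has_bochner_integral lborel (\<lambda>\<xi>. gauss h \<xi> * dir_deriv (v \<xi>) (dir_deriv (v \<xi>) f) x) ?J"
    proof -
      have "has_bochner_integral lborel (\<lambda>\<xi>. \<Sum>i\<in>UNIV. \<Sum>j\<in>UNIV. ?H i j * (gauss h \<xi> * (v \<xi> $ i * v \<xi> $ j))) ?J"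
        unfolding v_def by (intro has_bochner_integral_sum has_bochner_integral_mult_right step_covariance h)
      moreover have "(\<Sum>i\<in>UNIV. \<Sum>j\<in>UNIV. ?H i j * (gauss h \<xi> * (v \<xi> $ i * v \<xi> $ j))) = gauss h \<xi> * dir_deriv (v \<xi>) (dir_deriv (v \<xi>) f) x" for \<xi>
        unfolding dir_deriv_2[OF f] by (simp add: sum_distrib_left mult_ac)
      ultimately show ?thesis by simp
    qed
    have i0: "has_bochner_integral lborel (\<lambda>\<xi>. f x * gauss h \<xi>) (f x * 1)"
      by (intro has_bochner_integral_mult_right gauss_total h)
    have gi: "integrable lborel (gauss h :: real ^ 'n \<Rightarrow> real)" using gauss_total[OF h(1), where 'n='n] by (simp add: has_bochner_integral_iff)
    have i3: "integrable lborel (\<lambda>\<xi>. gauss h \<xi> * f (x + v \<xi>))"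
    proof (rule Bochner_Integration.integrable_bound)
      show "integrable lborel (\<lambda>\<xi>::real^'n. C * gauss h \<xi>)" using gi by simp
      show "AE \<xi> in lborel. norm (gauss h \<xi> * f (x + v \<xi>)) \<le> norm (C * gauss h \<xi>)"
      proof (intro AE_I2)
        fix \<xi>
        have "\<bar>f (x + v \<xi>)\<bar> \<le> \<bar>C\<bar>" using fb[of "x + v \<xi>"] by linarith
        then show "norm (gauss h \<xi> * f (x + v \<xi>)) \<le> norm (C * gauss h \<xi>)"
          by (simp add: abs_mult mult.commute[of "\<bar>C\<bar>"] mult_left_mono)
      qed
    qed measurable
    have Rm: "gauss h \<xi> * R \<xi> = gauss h \<xi> * f (x + v \<xi>) - f x * gauss h \<xi> - gauss h \<xi> * dir_deriv (v \<xi>) f x - gauss h \<xi> * dir_deriv (v \<xi>) (dir_deriv (v \<xi>) f) x / 2" for \<xi>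
      by (simp add: R_def algebra_simps)
    have hR: "has_bochner_integral lborel (\<lambda>\<xi>. gauss h \<xi> * R \<xi>)
       ((LINT \<xi>|lborel. gauss h \<xi> * f (x + v \<xi>)) - f x * 1 - h * (drift x \<bullet> grad f x) - ?J / 2)"
      unfolding Rm by (intro has_bochner_integral_diff has_bochner_integral_divide_zero i0 i1 i2 has_bochner_integral_integrable i3)
    then have iR: "integrable lborel (\<lambda>\<xi>. gauss h \<xi> * R \<xi>)" by (simp add: has_bochner_integral_iff)
    have "(LINT \<xi>|lborel. gauss h \<xi> * R \<xi>) = (LINT y|lborel. p h x y * f y) - f x - h * (drift x \<bullet> grad f x) - ?J / 2"
    proof -
      have "(LINT y|lborel. p h x y * f y) = (LINT \<xi>|lborel. gauss h \<xi> * f (x + v \<xi>))"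
        using integral_p_move[of f h x] by (simp add: move_def v_def)
      then show ?thesis using has_bochner_integral_integral_eq[OF hR] by simp
    qed
    moreover have "h * (drift x \<bullet> grad f x) + ?J / 2 = h * gen f x + h\<^sup>2 * (\<Sum>i\<in>UNIV. drift x $ i * (\<Sum>j\<in>UNIV. drift x $ j * ?H i j)) / 2"
      by (simp add: gen_def sum_distrib_left sum.distrib distrib_left add_divide_distrib sum_divide_distrib mult_ac)
    ultimately have eq: "(LINT y|lborel. p h x y * f y) - f x - h * gen f x
       = (LINT \<xi>|lborel. gauss h \<xi> * R \<xi>) + h\<^sup>2 * (\<Sum>i\<in>UNIV. drift x $ i * (\<Sum>j\<in>UNIV. drift x $ j * ?H i j)) / 2" by linarith
    have "\<bar>LINT \<xi>|lborel. gauss h \<xi> * R \<xi>\<bar> \<le> n ^ 3 * B * M * (h * sqrt h)"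
    proof -
      have Rb: "\<bar>R \<xi>\<bar> \<le> n ^ 3 * B * norm (v \<xi>) ^ 3" for \<xi> unfolding R_def n_def by (rule taylor_3[OF f])
      have "ennreal \<bar>LINT \<xi>|lborel. gauss h \<xi> * R \<xi>\<bar> \<le> (\<integral>\<^sup>+\<xi>. ennreal (norm (gauss h \<xi> * R \<xi>)) \<partial>lborel)"
        using integral_norm_bound_ennreal[OF iR] by simp
      also have "\<dots> \<le> (\<integral>\<^sup>+\<xi>. ennreal (n ^ 3 * B) * (ennreal ((norm (v \<xi>) ^ 3 + h * norm (v \<xi>)) * exp (0 * norm (v \<xi>))) * ennreal (gauss h \<xi>)) \<partial>lborel)"
      proof (rule nn_integral_mono)
        fix \<xi>
        have "norm (gauss h \<xi> * R \<xi>) \<le> gauss h \<xi> * (n ^ 3 * B * norm (v \<xi>) ^ 3)"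
          using Rb[of \<xi>] gauss_nonneg[of h \<xi>] by (simp add: abs_mult mult_left_mono)
        also have "\<dots> \<le> gauss h \<xi> * (n ^ 3 * B * (norm (v \<xi>) ^ 3 + h * norm (v \<xi>)))"
          using B h gauss_nonneg[of h \<xi>] by (intro mult_left_mono) (auto simp: n_def)
        finally have "norm (gauss h \<xi> * R \<xi>) \<le> n ^ 3 * B * ((norm (v \<xi>) ^ 3 + h * norm (v \<xi>)) * gauss h \<xi>)" by (simp only: mult_ac)
        then show "ennreal (norm (gauss h \<xi> * R \<xi>)) \<le> ennreal (n ^ 3 * B) * (ennreal ((norm (v \<xi>) ^ 3 + h * norm (v \<xi>)) * exp (0 * norm (v \<xi>))) * ennreal (gauss h \<xi>))"
          using B h gauss_nonneg[of h \<xi>] by (subst ennreal_mult[symmetric], simp, simp, subst ennreal_mult[symmetric]) (auto simp: n_def intro: ennreal_leI)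
      qed
      also have "\<dots> = ennreal (n ^ 3 * B) * (\<integral>\<^sup>+\<xi>. ennreal ((norm (v \<xi>) ^ 3 + h * norm (v \<xi>)) * exp (0 * norm (v \<xi>))) * ennreal (gauss h \<xi>) \<partial>lborel)"
        by (rule nn_integral_cmult) measurable
      also have "\<dots> \<le> ennreal (n ^ 3 * B) * ennreal (M * (h * sqrt h))"
        unfolding v_def by (intro mult_left_mono M(2) h) simp
      also have "\<dots> = ennreal (n ^ 3 * B * M * (h * sqrt h))"
        using B M(1) h by (subst ennreal_mult[symmetric]) (auto simp: n_def mult.assoc)
      finally show ?thesis using B M(1) h by (subst (asm) ennreal_le_iff) (auto simp: n_def)
    qed
    moreover have "\<bar>h\<^sup>2 * (\<Sum>i\<in>UNIV. drift x $ i * (\<Sum>j\<in>UNIV. drift x $ j * ?H i j)) / 2\<bar> \<le> n * n * kb * kb * B * (h * sqrt h)"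
    proof -
      have "\<bar>\<Sum>i\<in>UNIV. drift x $ i * (\<Sum>j\<in>UNIV. drift x $ j * ?H i j)\<bar> \<le> n * norm (drift x) * (n * norm (drift x) * B)"
        unfolding n_def using f[unfolded derivs_bounded_def] by (intro abs_dir_sum_le) auto
      also have "\<dots> \<le> n * kb * (n * kb * B)" using kb B by (intro mult_mono) (auto simp: n_def)
      finally have s: "\<bar>\<Sum>i\<in>UNIV. drift x $ i * (\<Sum>j\<in>UNIV. drift x $ j * ?H i j)\<bar> \<le> n * n * kb * kb * B" by (simp add: mult_ac)
      have hh: "h\<^sup>2 / 2 \<le> h * sqrt h"
      proof -
        have "h \<le> sqrt h" using h by (simp add: real_le_rsqrt power2_eq_square mult_left_le)
        then have "h * h \<le> h * sqrt h" using h by (intro mult_left_mono) auto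
        moreover have "h * h \<ge> 0" by simp
        ultimately show ?thesis unfolding power2_eq_square by linarith
      qed
      have "\<bar>h\<^sup>2 * (\<Sum>i\<in>UNIV. drift x $ i * (\<Sum>j\<in>UNIV. drift x $ j * ?H i j)) / 2\<bar>
          = h\<^sup>2 / 2 * \<bar>\<Sum>i\<in>UNIV. drift x $ i * (\<Sum>j\<in>UNIV. drift x $ j * ?H i j)\<bar>" by (simp add: abs_mult)
      also have "\<dots> \<le> h * sqrt h * (n * n * kb * kb * B)" using s hh h by (intro mult_mono) auto
      finally show ?thesis by (simp only: mult_ac)
    qed
    ultimately show ?thesis unfolding eq N_def distrib_right by (simp only: abs_le_iff) linarith
  qed
  ultimately show ?thesis using that by blast
qed

end

text \<open>Independence of X from the path concerns two sigma-algebras, while the increments are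
  mutually independent. In the product formula the first property splits off the factor with index
  0, and the second one separates the others.\<close>

lemma indep_vars_initial_and_increments:
  fixes B :: "real \<Rightarrow> 'w \<Rightarrow> real ^ 'n::finite" and \<tau> :: "nat \<Rightarrow> real"
  assumes B: "brownian_motion M B" and X: "X \<in> borel_measurable M" and ind: "independent_of_process M X B"
    and \<tau>: "0 \<le> \<tau> 0" "mono \<tau>"
  shows "prob_space.indep_vars M (\<lambda>_. borel) (\<lambda>k \<omega>. case k of 0 \<Rightarrow> X \<omega> | Suc k \<Rightarrow> B (\<tau> (Suc k)) \<omega> - B (\<tau> k) \<omega>) {..N}"
proof -
  interpret prob_space M using B by (simp add: brownian_motion_def)
  have Bm [measurable]: "t \<ge> 0 \<Longrightarrow> B t \<in> borel_measurable M" for t using B by (simp add: brownian_motion_def)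
  have \<tau>0: "\<tau> k \<ge> 0" for k using \<tau> monoD[OF \<tau>(2), of 0 k] by simp
  let ?D = "\<lambda>k \<omega>. B (\<tau> (Suc k)) \<omega> - B (\<tau> k) \<omega>"
  let ?Z = "\<lambda>k \<omega>. case k of 0 \<Rightarrow> X \<omega> | Suc k \<Rightarrow> ?D k \<omega>"
  let ?VB = "vimage_algebra (space M) (\<lambda>\<omega>. \<lambda>t\<in>{0..}. B t \<omega>) (\<Pi>\<^sub>M t\<in>{0..}. borel)"
  let ?VX = "vimage_algebra (space M) X borel"
  have Dm: "?D k \<in> borel_measurable M" for k using \<tau>0 by measurable
  have Zm: "?Z k \<in> borel_measurable M" for k using X Dm by (cases k) auto
  have DV: "?D k -` A \<inter> space M \<in> sets ?VB" if "A \<in> sets borel" for k A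
  proof -
    have 1: "(\<lambda>\<omega>. \<lambda>t\<in>{0..}. B t \<omega>) \<in> measurable ?VB (\<Pi>\<^sub>M t\<in>{0..}. borel)"
      by (rule measurable_vimage_algebra1) (auto simp: space_PiM)
    have 2: "(\<lambda>f. f (\<tau> (Suc k)) - f (\<tau> k)) \<in> measurable (\<Pi>\<^sub>M t\<in>{0..}. borel :: (real^'n) measure) borel"
      using \<tau>0 by (intro borel_measurable_diff measurable_component_singleton) auto
    have "(\<lambda>\<omega>. (\<lambda>t\<in>{0..}. B t \<omega>) (\<tau> (Suc k)) - (\<lambda>t\<in>{0..}. B t \<omega>) (\<tau> k)) \<in> measurable ?VB borel"
      using measurable_compose[OF 1 2] .
    then have "?D k \<in> measurable ?VB borel" using \<tau>0 by simp
    from measurable_sets[OF this that] show ?thesis by simp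
  qed
  have indS: "indep_set (sets ?VX) (sets ?VB)" using ind by (simp add: independent_of_process_def)
  have indD: "indep_vars (\<lambda>_. borel) ?D {..<N}" for N
    using B \<tau> by (auto simp: brownian_motion_def)
  have "indep_vars (\<lambda>_. borel) ?Z {..N} \<longleftrightarrow>
     (\<forall>A\<in>(\<Pi> i\<in>{..N}. sets borel). prob (\<Inter>j\<in>{..N}. ?Z j -` A j \<inter> space M) = (\<Prod>j\<in>{..N}. prob (?Z j -` A j \<inter> space M)))"
    by (rule indep_vars_finite)
      (auto simp: Zm sets.sigma_sets_eq[of "borel :: (real^'n) measure", simplified] Int_stable_def)
  moreover have "prob (\<Inter>j\<in>{..N}. ?Z j -` A j \<inter> space M) = (\<Prod>j\<in>{..N}. prob (?Z j -` A j \<inter> space M))"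
    if A: "A \<in> (\<Pi> i\<in>{..N}. sets borel)" for A
  proof (cases N)
    case 0 then show ?thesis by simp
  next
    case (Suc n)
    have As: "A i \<in> sets borel" if "i \<le> N" for i using A that by auto
    have IN: "(\<Inter>j\<in>{..N}. ?Z j -` A j \<inter> space M) = (X -` A 0 \<inter> space M) \<inter> (\<Inter>j\<in>{..<N}. ?D j -` A (Suc j) \<inter> space M)"
      unfolding lessThan_Suc_atMost[symmetric] lessThan_Suc_eq_insert_0 by auto
    have "prob (\<Inter>j\<in>{..N}. ?Z j -` A j \<inter> space M) = prob (X -` A 0 \<inter> space M) * prob (\<Inter>j\<in>{..<N}. ?D j -` A (Suc j) \<inter> space M)"
      unfolding IN
    proof (rule indep_setD[OF indS])
      show "X -` A 0 \<inter> space M \<in> sets ?VX" using As[of 0] by (intro in_vimage_algebra) auto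
      show "(\<Inter>j\<in>{..<N}. ?D j -` A (Suc j) \<inter> space M) \<in> sets ?VB"
        using Suc As by (intro sets.finite_INT DV) auto
    qed
    also have "prob (\<Inter>j\<in>{..<N}. ?D j -` A (Suc j) \<inter> space M) = (\<Prod>j\<in>{..<N}. prob (?D j -` A (Suc j) \<inter> space M))"
      using Suc As by (intro indep_varsD_finite[OF indD]) auto
    also have "prob (X -` A 0 \<inter> space M) * \<dots> = (\<Prod>j\<in>{..N}. prob (?Z j -` A j \<inter> space M))"
      unfolding lessThan_Suc_atMost[symmetric] prod.lessThan_Suc_shift by simp
    finally show ?thesis .
  qed
  ultimately show ?thesis by blast
qed

section \<open>The law of the Euler chain\<close>

context euler_kernel begin

primrec path :: "real \<Rightarrow> (nat \<Rightarrow> real ^ 'n) \<Rightarrow> nat \<Rightarrow> real ^ 'n" where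
  "path h z 0 = z 0"
| "path h z (Suc k) = move h (path h z k) (z (Suc k))"

lemma path_cong: "(\<And>i. i \<le> k \<Longrightarrow> z i = z' i) \<Longrightarrow> path h z k = path h z' k"
  by (induction k) auto

lemma path_measurable_PiM: "k \<le> m \<Longrightarrow> (\<lambda>z. path h z k) \<in> borel_measurable (\<Pi>\<^sub>M i\<in>{..m}. borel)"
proof (induction k)
  case (Suc k)
  have "(\<lambda>z. path h z k) \<in> borel_measurable (\<Pi>\<^sub>M i\<in>{..m}. borel)" "(\<lambda>z. z (Suc k)) \<in> borel_measurable (\<Pi>\<^sub>M i\<in>{..m}. (borel :: (real^'n) measure))"
    using Suc by (auto intro: measurable_component_singleton)
  then show ?case unfolding path.simps by (rule move_meas)
qed (auto intro: measurable_component_singleton)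

lemma path_measurable: "(\<And>i. Z i \<in> borel_measurable M) \<Longrightarrow> (\<lambda>\<omega>. path h (\<lambda>i. Z i \<omega>) k) \<in> borel_measurable M"
  by (induction k) (auto intro: move_meas)

text \<open>The state after k steps is a function of \<open>Z 0\<close> to \<open>Z k\<close> and
  hence independent of the next noise. Their joint law is a product, and Fubini's theorem turns one
  step into one application of P to the density.\<close>

lemma path_distribution:
  assumes "prob_space M" and chain: "almost_reversible_chain w (p h) \<kappa> h0 C"
    and ind: "prob_space.indep_vars M (\<lambda>_. borel) Z {..N}" and Zm: "\<And>i. Z i \<in> borel_measurable M"
    and Z0: "distr M borel (Z 0) = density lborel (\<lambda>x. ennreal (h0 x * w x))"
    and Zs: "\<And>k. k < N \<Longrightarrow> distr M borel (Z (Suc k)) = density lborel (\<lambda>x. ennreal (gauss h x))"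
  shows "k \<le> N \<Longrightarrow> distr M borel (\<lambda>\<omega>. path h (\<lambda>i. Z i \<omega>) k) = density lborel (\<lambda>x. ennreal (almost_reversible_chain.h w (p h) h0 k x * w x))"
proof (induction k)
  interpret prob_space M by fact
  interpret c: almost_reversible_chain w "p h" \<kappa> h0 C by fact
  case 0 then show ?case using Z0 by (simp add: c.h_0)
next
  case (Suc k)
  interpret prob_space M by fact
  interpret c: almost_reversible_chain w "p h" \<kappa> h0 C by fact
  let ?X = "\<lambda>k \<omega>. path h (\<lambda>i. Z i \<omega>) k"
  have [measurable]: "Z i \<in> borel_measurable M" for i by (rule Zm)
  have [measurable]: "?X k \<in> borel_measurable M" for k by (rule path_measurable[OF Zm])
  have IH: "distr M borel (?X k) = density lborel (\<lambda>x. ennreal (c.h k x * w x))" using Suc by simp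
  have hw: "c.h k x * w x \<ge> 0" for k x by (intro mult_nonneg_nonneg c.h_nonneg) (simp add: w_def)
  have indep: "indep_var borel (?X k) borel (Z (Suc k))"
  proof -
    have "indep_var borel ((\<lambda>z. path h z k) \<circ> (\<lambda>\<omega>. restrict (\<lambda>i. Z i \<omega>) {..k})) borel ((\<lambda>z. z (Suc k)) \<circ> (\<lambda>\<omega>. restrict (\<lambda>i. Z i \<omega>) {Suc k}))"
      by (rule indep_var_compose[OF indep_var_restrict[OF ind]])
        (use Suc in \<open>auto intro: path_measurable_PiM measurable_component_singleton\<close>)
    moreover have "(\<lambda>z. path h z k) \<circ> (\<lambda>\<omega>. restrict (\<lambda>i. Z i \<omega>) {..k}) = ?X k"
      by (auto simp: fun_eq_iff intro!: path_cong)
    moreover have "(\<lambda>z. z (Suc k)) \<circ> (\<lambda>\<omega>. restrict (\<lambda>i. Z i \<omega>) {Suc k}) = Z (Suc k)" by auto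
    ultimately show ?thesis by simp
  qed
  have joint: "distr M (borel \<Otimes>\<^sub>M borel) (\<lambda>\<omega>. (?X k \<omega>, Z (Suc k) \<omega>)) = distr M borel (?X k) \<Otimes>\<^sub>M distr M borel (Z (Suc k))"
    using indep unfolding indep_var_distribution_eq by simp
  interpret d1: prob_space "distr M borel (?X k)" by (rule prob_space_distr) measurable
  interpret d2: prob_space "distr M borel (Z (Suc k))" by (rule prob_space_distr) measurable
  have Zd: "distr M borel (Z (Suc k)) = density lborel (\<lambda>x. ennreal (gauss h x))" using Suc by (intro Zs) simp
  show ?case
  proof (rule measure_eqI)
    fix B assume "B \<in> sets (distr M borel (?X (Suc k)))"
    then have B [measurable]: "B \<in> sets borel" by simp
    have inner: "(\<integral>\<^sup>+\<xi>. indicator B (move h x \<xi>) \<partial>distr M borel (Z (Suc k))) = (\<integral>\<^sup>+y. ennreal (p h x y) * indicator B y \<partial>lborel)" for x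
      unfolding Zd by (subst nn_integral_density, measurable, subst nn_integral_p) (auto simp: mult.commute)
    have "emeasure (distr M borel (?X (Suc k))) B = (\<integral>\<^sup>+\<omega>. indicator B (move h (?X k \<omega>) (Z (Suc k) \<omega>)) \<partial>M)"
      by (subst nn_integral_indicator[symmetric], simp, subst nn_integral_distr) auto
    also have "\<dots> = (\<integral>\<^sup>+z. indicator B (move h (fst z) (snd z)) \<partial>distr M (borel \<Otimes>\<^sub>M borel) (\<lambda>\<omega>. (?X k \<omega>, Z (Suc k) \<omega>)))"
      by (subst nn_integral_distr) auto
    also have "\<dots> = (\<integral>\<^sup>+x. \<integral>\<^sup>+\<xi>. indicator B (move h x \<xi>) \<partial>distr M borel (Z (Suc k)) \<partial>distr M borel (?X k))"
      unfolding joint by (subst d2.nn_integral_fst[symmetric]) auto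
    also have "\<dots> = (\<integral>\<^sup>+x. (\<integral>\<^sup>+y. ennreal (p h x y) * indicator B y \<partial>lborel) \<partial>distr M borel (?X k))"
      unfolding inner ..
    also have "\<dots> = (\<integral>\<^sup>+x. ennreal (c.h k x * w x) * (\<integral>\<^sup>+y. ennreal (p h x y) * indicator B y \<partial>lborel) \<partial>lborel)"
      unfolding IH by (rule nn_integral_density) measurable
    also have "\<dots> = (\<integral>\<^sup>+x. \<integral>\<^sup>+y. ennreal (c.h k x * w x) * (ennreal (p h x y) * indicator B y) \<partial>lborel \<partial>lborel)"
      by (intro nn_integral_cong nn_integral_cmult[symmetric]) measurable
    also have "\<dots> = (\<integral>\<^sup>+y. \<integral>\<^sup>+x. ennreal (c.h k x * w x) * (ennreal (p h x y) * indicator B y) \<partial>lborel \<partial>lborel)"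
      by (rule lborel_pair.Fubini') measurable
    also have "\<dots> = (\<integral>\<^sup>+y. ennreal (c.h (Suc k) y * w y) * indicator B y \<partial>lborel)"
    proof (rule nn_integral_cong)
      fix y
      have "(\<integral>\<^sup>+x. ennreal (c.h k x * w x) * (ennreal (p h x y) * indicator B y) \<partial>lborel) = (\<integral>\<^sup>+x. ennreal (w y * (c.ps y x * c.h k x)) * indicator B y \<partial>lborel)"
      proof (rule nn_integral_cong)
        fix x
        have "c.h k x * w x * p h x y = w y * (c.ps y x * c.h k x)" using c.w_pos[of y] by (simp add: c.ps_def)
        then have "ennreal (c.h k x * w x) * ennreal (p h x y) = ennreal (w y * (c.ps y x * c.h k x))"
          using ennreal_mult[OF hw[of k x] p_nonneg'[of h x y]] by (simp only:)
        then show "ennreal (c.h k x * w x) * (ennreal (p h x y) * indicator B y) = ennreal (w y * (c.ps y x * c.h k x)) * indicator B y"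
          by (simp only: mult.assoc[symmetric])
      qed
      also have "\<dots> = (\<integral>\<^sup>+x. ennreal (w y * (c.ps y x * c.h k x)) \<partial>lborel) * indicator B y"
        by (rule nn_integral_multc) measurable
      also have "(\<integral>\<^sup>+x. ennreal (w y * (c.ps y x * c.h k x)) \<partial>lborel) = ennreal (LINT x|lborel. w y * (c.ps y x * c.h k x))"
        using c.bounded_mult_integrable[OF c.ps_integrable c.h_meas c.h_bound, of y k] c.w_pos[of y] c.ps_nonneg c.h_nonneg
        by (intro nn_integral_eq_integral) auto
      also have "(LINT x|lborel. w y * (c.ps y x * c.h k x)) = c.h (Suc k) y * w y"
        by (simp add: c.h_Suc c.P_def)
      finally show "(\<integral>\<^sup>+x. ennreal (c.h k x * w x) * (ennreal (p h x y) * indicator B y) \<partial>lborel) = ennreal (c.h (Suc k) y * w y) * indicator B y" .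
    qed
    also have "\<dots> = emeasure (density lborel (\<lambda>x. ennreal (c.h (Suc k) x * w x))) B"
      by (rule emeasure_density[symmetric]) auto
    finally show "emeasure (distr M borel (?X (Suc k))) B = emeasure (density lborel (\<lambda>x. ennreal (c.h (Suc k) x * w x))) B" .
  qed simp
qed

end

section \<open>Convergence of the Euler chain\<close>

text \<open>Additive noise cancels exactly between scheme and solution, so the comparison works for
  a single path. In one step the error is multiplied by 1 + h k and gains h k \<theta>, where
  \<theta> bounds the oscillation of z over times closer than \<delta>; a discrete Gronwall argument
  sums this up.\<close>

lemma euler_pathwise:
  fixes b :: "'a::euclidean_space \<Rightarrow> 'a" and z \<beta> :: "real \<Rightarrow> 'a" and X :: "real \<Rightarrow> nat \<Rightarrow> 'a"
  assumes cont: "continuous_on {0..T} z" and k: "k \<ge> 0" and lip: "\<And>x y. norm (b x - b y) \<le> k * norm (x - y)"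
    and sol: "\<And>t. 0 \<le> t \<Longrightarrow> t \<le> T \<Longrightarrow> z t = z 0 + integral {0..t} (\<lambda>s. b (z s)) + \<beta> t"
    and X0: "\<And>h. X h 0 = z 0"
    and XS: "\<And>h j. X h (Suc j) = X h j + (h *\<^sub>R b (X h j) + (\<beta> (real (Suc j) * h) - \<beta> (real j * h)))"
    and \<eta>: "\<eta> > 0"
  obtains \<delta> where "\<delta> > 0" "\<And>h j. 0 < h \<Longrightarrow> h < \<delta> \<Longrightarrow> real j * h \<le> T \<Longrightarrow> norm (X h j - z (real j * h)) \<le> \<eta>"
proof -
  \<comment> \<open>The exponential anticipates the Gronwall factor (1 + h k)^j \<le> exp (k
    T).\<close>
  define \<theta> where "\<theta> = \<eta> * exp (- (k * T))"
  have \<theta>: "\<theta> > 0" using \<eta> by (simp add: \<theta>_def)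
  have "uniformly_continuous_on {0..T} z" by (rule compact_uniformly_continuous[OF cont]) simp
  then obtain \<delta> where \<delta>: "\<delta> > 0" "\<And>s t. s \<in> {0..T} \<Longrightarrow> t \<in> {0..T} \<Longrightarrow> dist s t < \<delta> \<Longrightarrow> dist (z s) (z t) < \<theta>"
    unfolding uniformly_continuous_on_def using \<theta> by metis
  have "k-lipschitz_on UNIV b" using lip k by (intro lipschitz_onI) (auto simp: dist_norm)
  then have cb: "continuous_on UNIV b" by (rule lipschitz_on_continuous_on)
  have cbz: "continuous_on {0..T} (\<lambda>s. b (z s))" by (rule continuous_on_compose2[OF cb cont]) simp
  have "norm (X h j - z (real j * h)) \<le> \<eta>" if h: "0 < h" "h < \<delta>" and jT: "real j * h \<le> T" for h j
  proof -
    have "norm (X h j - z (real j * h)) \<le> ((1 + h * k) ^ j - 1) * \<theta>" if "real j * h \<le> T" for j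
      using that
    proof (induction j)
      case 0 then show ?case by (simp add: X0)
    next
      case (Suc j)
      let ?s = "real j * h" and ?t = "real (Suc j) * h"
      have st: "0 \<le> ?s" "?s \<le> ?t" "?t \<le> T" "?t - ?s = h" using h Suc.prems by (auto simp: algebra_simps)
      have IH: "norm (X h j - z ?s) \<le> ((1 + h * k) ^ j - 1) * \<theta>" using Suc st by simp
      have ii: "(\<lambda>s. b (z s)) integrable_on {0..?t}"
        by (intro integrable_continuous_interval continuous_on_subset[OF cbz]) (use st in auto)
      have "z ?t - z ?s = integral {?s..?t} (\<lambda>s. b (z s)) + (\<beta> ?t - \<beta> ?s)"
        using sol[of ?s] sol[of ?t] Henstock_Kurzweil_Integration.integral_combine[OF st(1,2) ii] st by (simp add: algebra_simps)
      moreover have "integral {?s..?t} (\<lambda>s. b (X h j) - b (z s)) = h *\<^sub>R b (X h j) - integral {?s..?t} (\<lambda>s. b (z s))"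
      proof (subst Henstock_Kurzweil_Integration.integral_diff)
        show "(\<lambda>s. b (z s)) integrable_on {?s..?t}"
          by (intro integrable_continuous_interval continuous_on_subset[OF cbz]) (use st in auto)
      qed (use st(2) in \<open>auto simp: st(4) content_real simp del: of_nat_Suc\<close>)
      ultimately have eq: "X h (Suc j) - z ?t = (X h j - z ?s) + integral {?s..?t} (\<lambda>s. b (X h j) - b (z s))"
        by (simp add: XS algebra_simps)
      have "norm (integral {?s..?t} (\<lambda>s. b (X h j) - b (z s))) \<le> k * (norm (X h j - z ?s) + \<theta>) * (?t - ?s)"
      proof (rule integral_bound[OF st(2)])
        show "continuous_on {?s..?t} (\<lambda>s. b (X h j) - b (z s))"
          by (intro continuous_intros continuous_on_subset[OF cbz]) (use st in auto)
        fix s assume s: "s \<in> {?s..?t}"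
        have "dist (z ?s) (z s) < \<theta>"
        proof (rule \<delta>(2))
          show "s \<in> {0..T}" "?s \<in> {0..T}" using s st order_trans[OF st(1)] by (auto simp del: of_nat_Suc)
          show "dist ?s s < \<delta>" using s st(4) h unfolding dist_real_def by (simp del: of_nat_Suc)
        qed
        then have "norm (X h j - z s) \<le> norm (X h j - z ?s) + \<theta>"
          using norm_triangle_ineq[of "X h j - z ?s" "z ?s - z s"] by (simp add: dist_norm)
        then have "k * norm (X h j - z s) \<le> k * (norm (X h j - z ?s) + \<theta>)" using k by (rule mult_left_mono)
        then show "norm (b (X h j) - b (z s)) \<le> k * (norm (X h j - z ?s) + \<theta>)" using lip[of "X h j" "z s"] by linarith
      qed
      then have "norm (X h (Suc j) - z ?t) \<le> norm (X h j - z ?s) + k * (norm (X h j - z ?s) + \<theta>) * h"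
        unfolding eq st(4) using norm_triangle_ineq[of "X h j - z ?s" "integral {?s..?t} (\<lambda>s. b (X h j) - b (z s))"] by linarith
      also have "\<dots> = (1 + h * k) * norm (X h j - z ?s) + h * k * \<theta>" by (simp add: algebra_simps)
      also have "\<dots> \<le> (1 + h * k) * (((1 + h * k) ^ j - 1) * \<theta>) + h * k * \<theta>"
        using h k by (intro add_right_mono mult_left_mono IH) auto
      also have "\<dots> = ((1 + h * k) ^ Suc j - 1) * \<theta>" by (simp add: algebra_simps)
      finally show ?case .
    qed
    from this[OF jT] have "norm (X h j - z (real j * h)) \<le> (1 + h * k) ^ j * \<theta>" using \<theta> by (simp add: algebra_simps)
    also have "(1 + h * k) ^ j \<le> exp (k * T)"
    proof -
      have "(1 + h * k) ^ j \<le> exp (h * k) ^ j" using h k by (intro power_mono exp_ge_add_one_self) auto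
      also have "\<dots> = exp (k * (real j * h))" by (simp add: exp_of_nat_mult[symmetric] mult_ac)
      also have "\<dots> \<le> exp (k * T)" using jT k by (simp add: mult_left_mono)
      finally show ?thesis .
    qed
    then have "(1 + h * k) ^ j * \<theta> \<le> exp (k * T) * \<theta>" using \<theta> by (intro mult_right_mono) auto
    also have "\<dots> = \<eta>" by (simp add: \<theta>_def exp_minus)
    finally show ?thesis .
  qed
  with \<delta>(1) that show ?thesis by blast
qed

section \<open>Truncation of the potential with three derivatives\<close>

lemma DERIV_pos_part_square: "((\<lambda>u::real. max 0 u ^ 2) has_real_derivative 2 * max 0 x) (at x)"
proof -
  consider "x < 0" | "x = 0" | "x > 0" by linarith
  then show ?thesis
  proof cases
    case 1
    have "((\<lambda>u::real. 0) has_real_derivative 0) (at x)" by simp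
    then have "((\<lambda>u::real. max 0 u ^ 2) has_real_derivative 0) (at x)"
      by (rule has_field_derivative_transform_within_open[of _ _ _ "{..<0}"]) (use 1 in auto)
    then show ?thesis using 1 by simp
  next
    case 2
    have "((\<lambda>h::real. max 0 h) \<longlongrightarrow> max 0 0) (at 0)" by (intro tendsto_intros)
    then have "((\<lambda>h::real. max 0 h) \<longlongrightarrow> 0) (at 0)" by simp
    moreover have "\<forall>\<^sub>F h in at 0. max 0 h = (max 0 (0 + h) ^ 2 - max 0 0 ^ 2) / (h::real)"
      by (auto simp: eventually_at_filter max_def power2_eq_square)
    ultimately have "((\<lambda>h::real. (max 0 (0 + h) ^ 2 - max 0 0 ^ 2) / h) \<longlongrightarrow> 0) (at 0)" by (rule Lim_transform_eventually)
    then show ?thesis using 2 by (simp add: DERIV_def)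
  next
    case 3
    have "((\<lambda>u::real. u ^ 2) has_real_derivative 2 * x) (at x)" by (auto intro!: derivative_eq_intros)
    then have "((\<lambda>u::real. max 0 u ^ 2) has_real_derivative 2 * x) (at x)"
      by (rule has_field_derivative_transform_within_open[of _ _ _ "{0<..}"]) (use 3 in auto)
    then show ?thesis using 3 by simp
  qed
qed

lemma DERIV_pos_part_power:
  "((\<lambda>u::real. max 0 u ^ (k + 2)) has_real_derivative real (k + 2) * max 0 x ^ (k + 1)) (at x)"
proof (induction k)
  case 0 then show ?case using DERIV_pos_part_square[of x] by (simp add: numeral_2_eq_2)
next
  case (Suc k)
  have e: "max 0 u ^ (Suc k + 2) = max 0 u ^ (k + 2) * u" for u :: real by (simp add: max_def)
  have "((\<lambda>u::real. max 0 u ^ (k + 2) * u) has_real_derivative (real (k + 2) * max 0 x ^ (k + 1)) * x + 1 * max 0 x ^ (k + 2)) (at x)"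
    by (rule DERIV_mult[OF Suc DERIV_ident])
  moreover have "(real (k + 2) * max 0 x ^ (k + 1)) * x + 1 * max 0 x ^ (k + 2) = real (Suc k + 2) * max 0 x ^ (Suc k + 1)"
    by (cases "x > 0") (auto simp: max_def algebra_simps)
  ultimately show ?case unfolding e by simp
qed

text \<open>The third backward difference of a truncated power: up to a factor the quadratic
  B-spline for k = 2, its derivative for k = 1 and its iterated integrals for k = 3 and k =
  4.\<close>

definition spline :: "nat \<Rightarrow> real \<Rightarrow> real" where
  "spline k x = max 0 x ^ k - 3 * max 0 (x - 1) ^ k + 3 * max 0 (x - 2) ^ k - max 0 (x - 3) ^ k"

lemma DERIV_spline: "(spline (k + 2) has_real_derivative real (k + 2) * spline (k + 1) x) (at x)"
proof -
  have "((\<lambda>u. max 0 (u - c) ^ (k + 2)) has_real_derivative real (k + 2) * max 0 (x - c) ^ (k + 1)) (at x)" for c :: real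
    using DERIV_shift[of "\<lambda>u. max 0 u ^ (k + 2)" "real (k + 2) * max 0 (x - c) ^ (k + 1)" x "- c"] DERIV_pos_part_power[of k "x - c"]
    by (simp del: power_Suc power_Suc2 of_nat_add add_2_eq_Suc add_2_eq_Suc')
  note d = this[of 0] this[of 1] this[of 2] this[of 3]
  have "((\<lambda>u. max 0 (u - 0) ^ (k + 2) - 3 * max 0 (u - 1) ^ (k + 2) + 3 * max 0 (u - 2) ^ (k + 2) - max 0 (u - 3) ^ (k + 2)) has_real_derivative
     real (k + 2) * max 0 (x - 0) ^ (k + 1) - 3 * (real (k + 2) * max 0 (x - 1) ^ (k + 1)) + 3 * (real (k + 2) * max 0 (x - 2) ^ (k + 1)) - real (k + 2) * max 0 (x - 3) ^ (k + 1)) (at x)"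
    by (intro DERIV_diff DERIV_add DERIV_cmult d)
  then show ?thesis unfolding spline_def[abs_def] by (simp add: algebra_simps)
qed

lemma spline_left: "x \<le> 0 \<Longrightarrow> k > 0 \<Longrightarrow> spline k x = 0"
  by (simp add: spline_def max_def)

lemma spline_3_right: "x \<ge> 3 \<Longrightarrow> spline 3 x = 6"
  by (simp add: spline_def max_def power3_eq_cube algebra_simps)

text \<open>This sign puts \<open>cut R 0\<close> below the identity, which keeps the initial
  densities bounded uniformly in R.\<close>

lemma spline_4_nonneg: "spline 4 x \<ge> 0"
proof (cases "x \<le> 3")
  case True
  \<comment> \<open>(3/2)^4 = 81/16 exceeds 3, and for x \<le> 3 one has 3/2 (x - 1) \<le>
    x.\<close>
  have "3 * max 0 (x - 1) ^ 4 \<le> (3 / 2 * max 0 (x - 1)) ^ 4" by (simp add: power_mult_distrib power_divide)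
  also have "\<dots> \<le> max 0 x ^ 4" using True by (intro power_mono) (auto simp: max_def)
  finally have "3 * max 0 (x - 1) ^ 4 \<le> max 0 x ^ 4" .
  moreover have "max 0 (x - 3) ^ 4 = 0" using True by simp
  moreover have "3 * max 0 (x - 2) ^ 4 \<ge> 0" by simp
  ultimately show ?thesis unfolding spline_def by linarith
next
  case False
  then have "spline 4 x = 24 * x - 36" by (simp add: spline_def max_def power4_eq_xxxx algebra_simps)
  then show ?thesis using False by simp
qed

text \<open>\<open>cut R j\<close> is the \<open>j\<close>-th derivative of a \<open>C\<^sup>3\<close> function that is the identity below \<open>R\<close> and constant
  above \<open>R + 3\<close>; one minus its first derivative is an integrated quadratic B-spline.\<close>

definition cut :: "real \<Rightarrow> nat \<Rightarrow> real \<Rightarrow> real" where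
  "cut R j u = (if j = 0 then u - spline 4 (u - R) / 24 else if j = 1 then 1 - spline 3 (u - R) / 6
     else if j = 2 then - spline 2 (u - R) / 2 else - spline 1 (u - R))"

lemma cut_DERIV: "j < 3 \<Longrightarrow> (cut R j has_real_derivative cut R (Suc j) u) (at u)"
proof -
  have s: "((\<lambda>u. spline (k + 2) (u - R)) has_real_derivative real (k + 2) * spline (k + 1) (u - R)) (at u)" for k
    using DERIV_shift[of "spline (k + 2)" "real (k + 2) * spline (k + 1) (u - R)" u "- R"] DERIV_spline[of k "u - R"]
    by (simp del: of_nat_add add_2_eq_Suc add_2_eq_Suc')
  assume "j < 3"
  then consider "j = 0" | "j = 1" | "j = 2" by linarith
  then show ?thesis
  proof cases
    case 1
    then show ?thesis using DERIV_diff[OF DERIV_ident DERIV_cdivide[OF s[of 2], of 24]]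
      by (simp add: cut_def[abs_def] eval_nat_numeral)
  next
    case 2
    then show ?thesis using DERIV_diff[OF DERIV_const[of 1] DERIV_cdivide[OF s[of 1], of 6]]
      by (simp add: cut_def[abs_def] eval_nat_numeral)
  next
    case 3
    then show ?thesis using DERIV_minus[OF DERIV_cdivide[OF s[of 0], of 2]]
      by (simp add: cut_def[abs_def] eval_nat_numeral)
  qed
qed

lemma cut_continuous: "continuous_on UNIV (cut R 3)"
  unfolding cut_def[abs_def] spline_def by (auto intro!: continuous_intros)

lemma cut_below: "u \<le> R \<Longrightarrow> cut R 0 u = u" by (simp add: cut_def spline_left)
lemma cut_le: "cut R 0 u \<le> u" using spline_4_nonneg[of "u - R"] by (simp add: cut_def)
lemma cut_deriv_above: "u \<ge> R + 3 \<Longrightarrow> cut R 1 u = 0" using spline_3_right[of "u - R"] by (simp add: cut_def)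

text \<open>The gradient vanishes where U is at least R + 3, and coercivity makes the remaining set
  bounded.\<close>

lemma cut_compose:
  fixes U :: "real ^ 'n::finite \<Rightarrow> real"
  assumes U: "smooth U" and coercive: "\<And>R. bounded {x. U x \<le> R}"
  shows "\<exists>K. derivs_bounded K (\<lambda>x. cut R 0 (U x))"
proof (rule derivs_bounded_exists)
  show "continuously_differentiable 3 (\<lambda>x. cut R 0 (U x))"
    using U by (intro continuously_differentiable_compose[where \<phi>="cut R"] cut_DERIV) (auto simp: smooth_def cut_continuous)
  have eq: "partial_deriv i (\<lambda>x. cut R 0 (U x)) = (\<lambda>x. cut R 1 (U x) * partial_deriv i U x)" for i
    using cut_DERIV[of 0 R] by (intro partial_deriv_compose smooth_differentiable U) simp
  then show "bounded {x. \<exists>i. partial_deriv i (\<lambda>x. cut R 0 (U x)) x \<noteq> 0}"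
  proof (intro bounded_subset[OF coercive[of "R + 3"]] subsetI)
    fix x assume "x \<in> {x. \<exists>i. partial_deriv i (\<lambda>x. cut R 0 (U x)) x \<noteq> 0}"
    then have "cut R 1 (U x) \<noteq> 0" by (auto simp: eq)
    then have "\<not> R + 3 \<le> U x" using cut_deriv_above by blast
    then show "x \<in> {x. U x \<le> R + 3}" by simp
  qed
qed

lemma cut_grad:
  fixes U :: "real ^ 'n::finite \<Rightarrow> real"
  assumes U: "smooth U" and x: "U x < R"
  shows "grad (\<lambda>x. cut R 0 (U x)) x = grad U x"
    "partial_deriv i (\<lambda>x. cut R 0 (U x)) x = partial_deriv i U x"
proof -
  have o: "open {x. U x < R}"
    using open_Collect_less[OF smooth_continuous[OF U] continuous_on_const] by simp
  have "U differentiable (at x)" using smooth_differentiable[OF U] by (rule differentiable_on_UNIV_D)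
  then have "partial_deriv i U x = partial_deriv i (\<lambda>x. cut R 0 (U x)) x" for i
    by (intro partial_deriv_outside[OF o]) (use x in \<open>auto simp: cut_below\<close>)
  then show "grad (\<lambda>x. cut R 0 (U x)) x = grad U x" "partial_deriv i (\<lambda>x. cut R 0 (U x)) x = partial_deriv i U x"
    by (simp_all add: grad_def)
qed

text \<open>Makes the limit theorems for filters applicable to \<open>lim\<^bsub>R\<rightarrow>\<infinity>\<^esub> lim\<^bsub>n\<rightarrow>\<infinity>\<^esub>\<close>.\<close>

definition iterated :: "(nat \<times> nat) filter" where
  "iterated = Abs_filter (\<lambda>P. \<forall>\<^sub>F R in sequentially. \<forall>\<^sub>F n in sequentially. P (R, n))"

lemma eventually_iterated: "eventually P iterated \<longleftrightarrow> (\<forall>\<^sub>F R in sequentially. \<forall>\<^sub>F n in sequentially. P (R, n))"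
  unfolding iterated_def
proof (rule eventually_Abs_filter, rule is_filter.intro)
  fix P Q :: "nat \<times> nat \<Rightarrow> bool"
  assume PQ: "\<forall>x. P x \<longrightarrow> Q x" and P: "\<forall>\<^sub>F R in sequentially. \<forall>\<^sub>F n in sequentially. P (R, n)"
  show "\<forall>\<^sub>F R in sequentially. \<forall>\<^sub>F n in sequentially. Q (R, n)"
    by (rule eventually_mono[OF P], erule eventually_mono) (use PQ in blast)
qed (simp_all add: eventually_conj_iff)

lemma iterated_neq_bot: "iterated \<noteq> bot"
  unfolding trivial_limit_def eventually_iterated by simp

lemma tendsto_iteratedI:
  assumes "\<forall>\<^sub>F R in sequentially. ((\<lambda>n. f R n) \<longlongrightarrow> (l :: 'a::topological_space)) sequentially"
  shows "((\<lambda>(R, n). f R n) \<longlongrightarrow> l) iterated"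
proof (rule topological_tendstoI)
  fix S :: "'a set" assume "open S" "l \<in> S"
  then show "\<forall>\<^sub>F x in iterated. (case x of (R, n) \<Rightarrow> f R n) \<in> S"
    unfolding eventually_iterated using assms by (auto elim!: eventually_mono dest: topological_tendstoD)
qed

text \<open>The perturbed equation for one fixed \<epsilon>, with U in place of V - \<epsilon> W.
  The initial law is given by its density relative to \<open>exp (- U)\<close>, the weight for which
  the dynamics is reversible; the bound C on this density propagates in time.\<close>

locale confined_sde =
  fixes M :: "'w measure" and B :: "real \<Rightarrow> 'w \<Rightarrow> real ^ 'n::finite" and q :: "real \<Rightarrow> 'w \<Rightarrow> real ^ 'n"
    and \<sigma> :: "real ^ 'n ^ 'n" and U h0 :: "real ^ 'n \<Rightarrow> real" and C :: real
  assumes brownian: "brownian_motion M B" and inv_\<sigma>: "invertible \<sigma>"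
    and smooth_U: "smooth U" and coercive: "bounded {x. U x \<le> R}"
    and sde: "additive_sde_solution M B (\<lambda>x. (\<sigma> ** transpose \<sigma>) *v (- grad U x)) (sqrt 2 *\<^sub>R \<sigma>) q"
    and init: "distributed M lborel (q 0) (\<lambda>x. ennreal (h0 x * exp (- U x)))"
    and indep: "independent_of_process M (q 0) B"
    and h0_continuous: "continuous_on UNIV h0" and h0_nonneg: "h0 x \<ge> 0" and h0_le: "h0 x \<le> C"
begin

sublocale prob_space M using brownian by (simp add: brownian_motion_def)

lemma B_meas [measurable]: "t \<ge> 0 \<Longrightarrow> B t \<in> borel_measurable M"
  using brownian by (simp add: brownian_motion_def)
lemma q_meas [measurable]: "t \<ge> 0 \<Longrightarrow> q t \<in> borel_measurable M"
  using sde by (simp add: additive_sde_solution_def)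
lemma h0_meas [measurable]: "h0 \<in> borel_measurable borel"
  by (rule borel_measurable_continuous_onI[OF h0_continuous])
lemma U_meas [measurable]: "U \<in> borel_measurable borel"
  by (rule borel_measurable_continuous_onI[OF smooth_continuous[OF smooth_U]])
lemma C_nonneg: "C \<ge> 0" using h0_nonneg h0_le order_trans by blast

definition "A = sqrt 2 *\<^sub>R \<sigma>"
definition "UR R x = cut (real R) 0 (U x)"
text \<open>The constants depend on R and are known only to exist; choosing them makes the kernels
  for all R available as one family.\<close>

definition "KR R = (SOME K. euler_kernel A (UR R) (grad (UR R)) K)"

lemma A_mult: "A ** transpose A = 2 *\<^sub>R (\<sigma> ** transpose \<sigma>)"
proof -
  have s: "sqrt 2 * a * (sqrt 2 * b) = 2 * (a * b)" for a b :: real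
    using real_sqrt_mult_self[of 2] by (metis abs_numeral mult.assoc mult.left_commute)
  show ?thesis by (simp add: A_def vec_eq_iff matrix_matrix_mult_def transpose_def sum_distrib_left s)
qed

sublocale e: euler_kernel A "UR R" "grad (UR R)" "KR R" for R :: nat
proof -
  have "invertible A"
  proof -
    obtain \<sigma>' where "\<sigma> ** \<sigma>' = mat 1" "\<sigma>' ** \<sigma> = mat 1" using inv_\<sigma> by (auto simp: invertible_def)
    then have "A ** ((1 / sqrt 2) *\<^sub>R \<sigma>') = mat 1" "((1 / sqrt 2) *\<^sub>R \<sigma>') ** A = mat 1"
      by (simp_all add: A_def scalar_matrix_assoc[symmetric] matrix_scalar_ac)
    then show ?thesis unfolding invertible_def by blast
  qed
  moreover obtain K where "derivs_bounded K (UR R)"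
    using cut_compose[OF smooth_U coercive] unfolding UR_def[abs_def] by blast
  ultimately have "\<exists>K. euler_kernel A (UR R) (grad (UR R)) K"
    using euler_kernel_of_derivs_bounded by blast
  then show "euler_kernel A (UR R) (grad (UR R)) (KR R)" unfolding KR_def by (rule someI_ex)
qed

definition "\<delta> n = 1 / real (Suc n)"
text \<open>All chains are driven by increments of the same Brownian path and start at the same
  point as q, so they can be compared with q path by path.\<close>

definition "Z n \<omega> i = (case i of 0 \<Rightarrow> q 0 \<omega> | Suc k \<Rightarrow> B (real (Suc k) * \<delta> n) \<omega> - B (real k * \<delta> n) \<omega>)"
definition "X R n k \<omega> = e.path R (\<delta> n) (Z n \<omega>) k"
text \<open>The initial density relative to the weight of the truncated potential.\<close>

definition "hR R x = h0 x * exp (UR R x - U x)"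
definition "\<kappa>R R = (SOME k. k \<ge> 0 \<and> (\<forall>h. 0 < h \<longrightarrow> h \<le> 1 \<longrightarrow> almost_reversible (e.w R) (e.p R h) (k * (h * sqrt h))))"
definition "\<kappa> R n = \<kappa>R R * (\<delta> n * sqrt (\<delta> n))"

lemma \<delta>: "\<delta> n > 0" "\<delta> n \<le> 1" "\<delta> \<longlonglongrightarrow> 0"
proof -
  show "\<delta> \<longlonglongrightarrow> 0" unfolding \<delta>_def[abs_def] by (rule lim_1_over_n[THEN LIMSEQ_Suc])
qed (auto simp: \<delta>_def)

lemma hR_w: "hR R x * e.w R x = h0 x * exp (- U x)"
  by (simp add: hR_def e.w_def mult.assoc flip: exp_add)
text \<open>By \<open>cut_le\<close> the factor that accounts for the truncated weight is at most 1,
  so one C serves all R.\<close>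

lemma hR_bounds: "0 \<le> hR R x" "hR R x \<le> C"
proof -
  have "exp (UR R x - U x) \<le> 1" using cut_le[of "real R" "U x"] by (simp add: UR_def)
  then have "h0 x * exp (UR R x - U x) \<le> h0 x * 1" by (intro mult_left_mono h0_nonneg)
  then show "hR R x \<le> C" using h0_le[of x] by (simp add: hR_def)
qed (simp add: hR_def h0_nonneg)
lemma hR_meas [measurable]: "hR R \<in> borel_measurable borel"
  unfolding hR_def[abs_def] by measurable
lemma hR_inside: "U x \<le> real R \<Longrightarrow> hR R x = h0 x"
  by (simp add: hR_def UR_def cut_below)

lemma initial_density: "integrable lborel (\<lambda>x. h0 x * exp (- U x))" "(LINT x|lborel. h0 x * exp (- U x)) = 1"
proof -
  have d: "density lborel (\<lambda>x. ennreal (h0 x * exp (- U x))) = distr M lborel (q 0)"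
    using init by (simp add: distributed_def)
  interpret d: prob_space "density lborel (\<lambda>x. ennreal (h0 x * exp (- U x)))"
    unfolding d by (rule prob_space_distr) simp
  have "(\<integral>\<^sup>+x. ennreal (h0 x * exp (- U x)) \<partial>lborel) = 1"
    using d.emeasure_space_1 by (subst (asm) emeasure_density) auto
  moreover from this show "integrable lborel (\<lambda>x. h0 x * exp (- U x))"
    by (intro integrableI_bounded) (auto simp: h0_nonneg)
  ultimately show "(LINT x|lborel. h0 x * exp (- U x)) = 1"
    by (subst (asm) nn_integral_eq_integral) (auto simp: h0_nonneg)
qed

sublocale c: almost_reversible_chain "e.w R" "e.p R (\<delta> n)" "\<kappa> R n" "hR R" C for R n
proof -
  obtain k where "k \<ge> 0" "\<And>h. 0 < h \<Longrightarrow> h \<le> 1 \<Longrightarrow> almost_reversible (e.w R) (e.p R h) (k * (h * sqrt h))"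
    by (rule e.almost_reversible_euler[of R]) blast
  then have "\<exists>k\<ge>0. \<forall>h. 0 < h \<longrightarrow> h \<le> 1 \<longrightarrow> almost_reversible (e.w R) (e.p R h) (k * (h * sqrt h))" by blast
  then have "\<kappa>R R \<ge> 0 \<and> (\<forall>h. 0 < h \<longrightarrow> h \<le> 1 \<longrightarrow> almost_reversible (e.w R) (e.p R h) (\<kappa>R R * (h * sqrt h)))"
    unfolding \<kappa>R_def by (rule someI_ex)
  then interpret almost_reversible "e.w R" "e.p R (\<delta> n)" "\<kappa> R n"
    using \<delta> unfolding \<kappa>_def by blast
  show "almost_reversible_chain (e.w R) (e.p R (\<delta> n)) (\<kappa> R n) (hR R) C"
    by unfold_locales (auto simp: hR_bounds hR_w initial_density)
qed

lemma Z_meas: "(\<lambda>\<omega>. Z n \<omega> i) \<in> borel_measurable M"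
  using \<delta>(1)[of n] unfolding Z_def by (cases i) (auto simp: less_imp_le)

lemma X_meas [measurable]: "X R n k \<in> borel_measurable M"
  unfolding X_def[abs_def] using e.path_measurable[where Z="\<lambda>i \<omega>. Z n \<omega> i", OF Z_meas] .

lemma X_distribution: "distr M borel (X R n k) = density lborel (\<lambda>x. ennreal (c.h R n k x * e.w R x))"
  unfolding X_def[abs_def]
proof (rule e.path_distribution[where Z="\<lambda>i \<omega>. Z n \<omega> i", OF prob_space_axioms c.almost_reversible_chain_axioms _ Z_meas _ _ order_refl])
  have "mono (\<lambda>k. real k * \<delta> n)" using \<delta>(1)[of n] by (intro monoI mult_right_mono) auto
  then have "indep_vars (\<lambda>_. borel) (\<lambda>i \<omega>. case i of 0 \<Rightarrow> q 0 \<omega> | Suc k \<Rightarrow> B (real (Suc k) * \<delta> n) \<omega> - B (real k * \<delta> n) \<omega>) {..k}"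
    by (intro indep_vars_initial_and_increments[OF brownian _ indep]) auto
  then show "indep_vars (\<lambda>_. borel) (\<lambda>i \<omega>. Z n \<omega> i) {..k}" unfolding Z_def .
  show "distr M borel (\<lambda>\<omega>. Z n \<omega> 0) = density lborel (\<lambda>x. ennreal (hR R x * e.w R x))"
    using init unfolding Z_def hR_w distributed_def by (simp cong: distr_cong)
  fix j
  have s: "real (Suc j) * \<delta> n - real j * \<delta> n = \<delta> n" by (simp add: algebra_simps)
  have "0 \<le> real j * \<delta> n" "real j * \<delta> n < real (Suc j) * \<delta> n" using \<delta>(1)[of n] by auto
  then have "distributed M lborel (\<lambda>\<omega>. B (real (Suc j) * \<delta> n) \<omega> - B (real j * \<delta> n) \<omega>)
          (\<lambda>x. ennreal (\<Prod>i\<in>UNIV. normal_density 0 (sqrt (real (Suc j) * \<delta> n - real j * \<delta> n)) (x $ i)))"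
    using brownian unfolding brownian_motion_def by blast
  then show "distr M borel (\<lambda>\<omega>. Z n \<omega> (Suc j)) = density lborel (\<lambda>x. ennreal (gauss (\<delta> n) x))"
    unfolding s gauss_def Z_def distributed_def by (simp cong: distr_cong)
qed

lemma expectation_X:
  assumes [measurable]: "f \<in> borel_measurable borel"
  shows "expectation (\<lambda>\<omega>. f (X R n k \<omega>)) = (LINT x|lborel. f x * c.h R n k x * e.w R x)"
proof -
  have "expectation (\<lambda>\<omega>. f (X R n k \<omega>)) = (LINT x|distr M borel (X R n k). f x)"
    by (rule integral_distr[symmetric]) auto
  also have "\<dots> = (LINT x|lborel. (c.h R n k x * e.w R x) * f x)"
    unfolding X_distribution
    by (rule integral_real_density) (auto intro!: mult_nonneg_nonneg c.h_nonneg simp: e.w_def)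
  finally show ?thesis by (simp add: mult_ac)
qed

lemma drift_inside: "U x < real R \<Longrightarrow> e.drift R x = (\<sigma> ** transpose \<sigma>) *v (- grad U x)"
proof -
  assume "U x < real R"
  then have "grad (UR R) x = grad U x" unfolding UR_def[abs_def] by (rule cut_grad[OF smooth_U])
  then have "e.drift R x = - (1 / 2) *\<^sub>R ((A ** transpose A) *v grad U x)"
    unfolding e.drift_def matrix_vector_mul_assoc by simp
  also have "\<dots> = (\<sigma> ** transpose \<sigma>) *v (- grad U x)"
    unfolding A_mult by (simp add: scaleR_matrix_vector_assoc[symmetric] linear_neg[OF matrix_vector_mul_linear])
  finally show ?thesis .
qed

text \<open>Rational times keep the event measurable; by continuity \<open>U < R\<close> then holds on all of \<open>[0, T]\<close>, where
  the truncation is invisible.\<close>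

definition "good T R = {\<omega>\<in>space M. \<forall>s\<in>{s\<in>\<rat>. 0 \<le> s \<and> s \<le> T}. U (q s \<omega>) \<le> real R - 1}"

lemma good_meas [measurable]: "good T R \<in> sets M"
proof -
  have c: "countable {s\<in>\<rat>. 0 \<le> s \<and> s \<le> (T::real)}" by (rule countable_subset[OF _ countable_rat]) auto
  have "(\<Inter>s\<in>{s\<in>\<rat>. 0 \<le> s \<and> s \<le> T}. {\<omega>\<in>space M. U (q s \<omega>) \<le> real R - 1}) \<in> sets M" if "T \<ge> 0"
    by (rule sets.countable_INT'[OF c]) (use that in \<open>auto intro!: exI[of _ 0]\<close>)
  moreover have "good T R = (\<Inter>s\<in>{s\<in>\<rat>. 0 \<le> s \<and> s \<le> T}. {\<omega>\<in>space M. U (q s \<omega>) \<le> real R - 1})" if "T \<ge> 0"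
    using that unfolding good_def by (auto intro!: exI[of _ 0])
  moreover have "good T R = space M" if "\<not> T \<ge> 0" using that by (auto simp: good_def)
  ultimately show ?thesis by (cases "T \<ge> 0") auto
qed

lemma paths_continuous: "AE \<omega> in M. continuous_on {0..} (\<lambda>t. q t \<omega>) \<and> B 0 \<omega> = 0 \<and>
  (\<forall>t\<ge>0. q t \<omega> = q 0 \<omega> + integral {0..t} (\<lambda>s. (\<sigma> ** transpose \<sigma>) *v (- grad U (q s \<omega>))) + A *v B t \<omega>)"
  using sde brownian unfolding additive_sde_solution_def brownian_motion_def A_def by auto

lemma good_all:
  assumes c: "continuous_on {0..} (\<lambda>t. q t \<omega>)" and g: "\<omega> \<in> good T R" and t: "0 \<le> t" "t \<le> T" and T: "T > 0"
  shows "U (q t \<omega>) < real R"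
proof -
  have cU: "continuous_on {0..T} (\<lambda>t. U (q t \<omega>))"
    by (rule continuous_on_compose2[OF smooth_continuous[OF smooth_U] continuous_on_subset[OF c]]) auto
  have "closure {0<..<T} = {0..T}" using T by (rule closure_greaterThanLessThan)
  moreover have "closure ({0<..<T} \<inter> \<rat>) = closure {0<..<T}"
    by (rule closure_open_Int_superset) (auto simp: Rats_closure_real)
  ultimately have cl: "t \<in> closure ({0<..<T} \<inter> \<rat>)" using t by simp
  have "U (q t \<omega>) \<le> real R - 1"
  proof (rule continuous_le_on_closure[OF _ cl])
    show "continuous_on (closure ({0<..<T} \<inter> \<rat>)) (\<lambda>t. U (q t \<omega>))"
      using cU \<open>closure {0<..<T} = {0..T}\<close> \<open>closure ({0<..<T} \<inter> \<rat>) = closure {0<..<T}\<close> by simp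
  qed (use g in \<open>auto simp: good_def\<close>)
  then show ?thesis by simp
qed

lemma prob_good: "T > 0 \<Longrightarrow> (\<lambda>R. prob (space M - good T R)) \<longlonglongrightarrow> 0"
proof -
  assume T: "T > 0"
  have "AE \<omega> in M. \<forall>\<^sub>F R in sequentially. \<omega> \<in> good T R"
    using paths_continuous
  proof (rule AE_mp, intro AE_I2 impI)
    fix \<omega> assume \<omega>: "\<omega> \<in> space M" and c: "continuous_on {0..} (\<lambda>t. q t \<omega>) \<and> B 0 \<omega> = 0 \<and>
      (\<forall>t\<ge>0. q t \<omega> = q 0 \<omega> + integral {0..t} (\<lambda>s. (\<sigma> ** transpose \<sigma>) *v (- grad U (q s \<omega>))) + A *v B t \<omega>)"
    have "continuous_on {0..T} (\<lambda>t. U (q t \<omega>))"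
      by (rule continuous_on_compose2[OF smooth_continuous[OF smooth_U] continuous_on_subset[OF conjunct1[OF c]]]) auto
    then have "bounded ((\<lambda>t. U (q t \<omega>)) ` {0..T})"
      by (intro compact_imp_bounded compact_continuous_image) auto
    then obtain b where "\<forall>t\<in>{0..T}. \<bar>U (q t \<omega>)\<bar> \<le> b" unfolding bounded_iff by auto
    then have b: "\<And>t. t \<in> {0..T} \<Longrightarrow> \<bar>U (q t \<omega>)\<bar> \<le> b" by blast
    show "\<forall>\<^sub>F R in sequentially. \<omega> \<in> good T R"
      using eventually_ge_at_top[of "nat \<lceil>b + 1\<rceil>"]
    proof eventually_elim
      case (elim R)
      then have "b + 1 \<le> real R" by linarith
      then have "U (q s \<omega>) \<le> real R - 1" if "0 \<le> s" "s \<le> T" for s using b[of s] that by (auto simp: abs_le_iff)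
      then show ?case using \<omega> by (auto simp: good_def)
    qed
  qed
  then have "AE \<omega> in M. (\<lambda>R. indicator (space M - good T R) \<omega> :: real) \<longlonglongrightarrow> 0"
    by (rule AE_mp) (auto intro!: AE_I2 tendsto_eventually elim: eventually_mono)
  then have "(\<lambda>R. expectation (indicat_real (space M - good T R))) \<longlonglongrightarrow> expectation (\<lambda>_. 0)"
    by (intro integral_dominated_convergence[where w="\<lambda>_. 1"]) auto
  then show ?thesis by simp
qed

lemma X_tendsto:
  assumes c: "continuous_on {0..} (\<lambda>t. q t \<omega>)" and B0: "B 0 \<omega> = 0"
    and sol: "\<And>t. t \<ge> 0 \<Longrightarrow> q t \<omega> = q 0 \<omega> + integral {0..t} (\<lambda>s. (\<sigma> ** transpose \<sigma>) *v (- grad U (q s \<omega>))) + A *v B t \<omega>"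
    and g: "\<omega> \<in> good (t + 1) R" and k: "(\<lambda>n. real (k n) * \<delta> n) \<longlonglongrightarrow> t" and t: "t \<ge> 0"
  shows "(\<lambda>n. X R n (k n) \<omega>) \<longlonglongrightarrow> q t \<omega>"
proof -
  \<comment> \<open>The extra unit of time leaves room for grid times beyond t.\<close>
  define T where "T = t + 1"
  have T: "T > 0" using t by (simp add: T_def)
  obtain l where l: "l \<ge> 0" "\<And>x y. norm (e.drift R x - e.drift R y) \<le> l * norm (x - y)" by (rule e.drift_lipschitz[of R]) blast
  define Y where "Y h = rec_nat (q 0 \<omega>) (\<lambda>j x. x + (h *\<^sub>R e.drift R x + (A *v B (real (Suc j) * h) \<omega> - A *v B (real j * h) \<omega>)))" for h :: real
  have XY: "X R n k \<omega> = Y (\<delta> n) k" for n k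
    by (induction k) (simp_all add: X_def Y_def Z_def e.move_def matrix_vector_mult_diff_distrib)
  have sol': "q s \<omega> = q 0 \<omega> + integral {0..s} (\<lambda>s. e.drift R (q s \<omega>)) + A *v B s \<omega>" if "0 \<le> s" "s \<le> T" for s
  proof -
    have "integral {0..s} (\<lambda>s. e.drift R (q s \<omega>)) = integral {0..s} (\<lambda>s. (\<sigma> ** transpose \<sigma>) *v (- grad U (q s \<omega>)))"
      using that by (intro integral_cong drift_inside good_all[OF c g[folded T_def] _ _ T]) auto
    then show ?thesis using sol[OF that(1)] by simp
  qed
  have k': "\<forall>\<^sub>F n in sequentially. real (k n) * \<delta> n < T" using order_tendstoD(2)[OF k, of T] by (simp add: T_def)
  have "(\<lambda>n. X R n (k n) \<omega> - q (real (k n) * \<delta> n) \<omega>) \<longlonglongrightarrow> 0"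
  proof (rule tendstoI)
    fix \<eta> :: real assume "\<eta> > 0"
    then have "\<eta> / 2 > 0" by simp
    have "continuous_on {0..T} (\<lambda>t. q t \<omega>)" by (rule continuous_on_subset[OF c]) auto
    from euler_pathwise[where X=Y and T=T and k=l and \<beta>="\<lambda>t. A *v B t \<omega>", OF this l sol' _ _ \<open>\<eta> / 2 > 0\<close>] obtain d where d: "d > 0"
      "\<And>h j. 0 < h \<Longrightarrow> h < d \<Longrightarrow> real j * h \<le> T \<Longrightarrow> norm (Y h j - q (real j * h) \<omega>) \<le> \<eta> / 2"
      by (auto simp: Y_def)
    show "\<forall>\<^sub>F n in sequentially. dist (X R n (k n) \<omega> - q (real (k n) * \<delta> n) \<omega>) 0 < \<eta>"
      using k' order_tendstoD(2)[OF \<delta>(3) d(1)]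
    proof eventually_elim
      case (elim n)
      then show ?case using d(2)[of "\<delta> n" "k n"] \<delta>(1)[of n] \<open>\<eta> > 0\<close> by (simp add: XY)
    qed
  qed
  moreover have "(\<lambda>n. q (real (k n) * \<delta> n) \<omega>) \<longlonglongrightarrow> q t \<omega>"
    by (rule continuous_on_tendsto_compose[OF c k]) (use t \<delta>(1) in \<open>auto simp: less_imp_le\<close>)
  ultimately show ?thesis using tendsto_add by fastforce
qed

text \<open>The functions may depend on R as long as they agree with F where U < R; the initial
  densities \<open>hR R\<close> need this. For given R the bad paths cost at most 2 K times their
  probability, which is small for large R, and on the good paths the chains converge as n
  grows.\<close>

lemma expectation_tendsto:
  fixes f :: "nat \<Rightarrow> real ^ 'n \<Rightarrow> real"
  assumes f [measurable]: "\<And>R. f R \<in> borel_measurable borel" and fK: "\<And>R x. \<bar>f R x\<bar> \<le> K"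
    and F: "continuous_on UNIV F" and fF: "\<And>R x. U x < real R \<Longrightarrow> f R x = F x"
    and k: "(\<lambda>n. real (k n) * \<delta> n) \<longlonglongrightarrow> t" and t: "t \<ge> 0"
  shows "((\<lambda>(R, n). expectation (\<lambda>\<omega>. f R (X R n (k n) \<omega>))) \<longlongrightarrow> expectation (\<lambda>\<omega>. F (q t \<omega>))) iterated"
proof (rule tendstoI)
  fix e :: real assume e: "e > 0"
  have FK: "\<bar>F x\<bar> \<le> K" for x
  proof -
    have "U x < real (nat \<lceil>U x\<rceil> + 1)" by linarith
    then show ?thesis using fF[of x] fK by metis
  qed
  then have K: "K \<ge> 0" using abs_ge_zero order_trans by blast
  have [measurable]: "F \<in> borel_measurable borel" by (rule borel_measurable_continuous_onI[OF F])
  have [measurable]: "q t \<in> borel_measurable M" using t by simp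
  define T where "T = t + 1"
  have T: "T > 0" using t by (simp add: T_def)
  let ?G = "\<lambda>R. space M - good T R"
  have "(\<lambda>R. 2 * K * prob (?G R)) \<longlonglongrightarrow> 0" using tendsto_mult_right_zero[OF prob_good[OF T]] by simp
  then have "\<forall>\<^sub>F R in sequentially. 2 * K * prob (?G R) < e / 2" using e by (intro order_tendstoD(2)) auto
  then show "\<forall>\<^sub>F x in iterated. dist (case x of (R, n) \<Rightarrow> expectation (\<lambda>\<omega>. f R (X R n (k n) \<omega>))) (expectation (\<lambda>\<omega>. F (q t \<omega>))) < e"
    unfolding eventually_iterated
  proof (rule eventually_mono)
    fix R assume R: "2 * K * prob (?G R) < e / 2"
    let ?d = "\<lambda>n \<omega>. f R (X R n (k n) \<omega>) - F (q t \<omega>)"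
    have dK: "\<bar>?d n \<omega>\<bar> \<le> 2 * K" for n \<omega> using fK[of R "X R n (k n) \<omega>"] FK[of "q t \<omega>"] by linarith
    have "AE \<omega> in M. (\<lambda>n. indicator (good T R) \<omega> * \<bar>?d n \<omega>\<bar>) \<longlonglongrightarrow> 0"
      using paths_continuous
    proof (rule AE_mp, intro AE_I2 impI)
      fix \<omega> assume "\<omega> \<in> space M" and c: "continuous_on {0..} (\<lambda>t. q t \<omega>) \<and> B 0 \<omega> = 0 \<and>
        (\<forall>t\<ge>0. q t \<omega> = q 0 \<omega> + integral {0..t} (\<lambda>s. (\<sigma> ** transpose \<sigma>) *v (- grad U (q s \<omega>))) + A *v B t \<omega>)"
      show "(\<lambda>n. indicator (good T R) \<omega> * \<bar>?d n \<omega>\<bar>) \<longlonglongrightarrow> 0"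
      proof (cases "\<omega> \<in> good T R")
        case True
        have XX: "(\<lambda>n. X R n (k n) \<omega>) \<longlonglongrightarrow> q t \<omega>"
          by (rule X_tendsto[OF _ _ _ True[unfolded T_def] k t]) (use c in blast)+
        have 1: "(\<lambda>n. F (X R n (k n) \<omega>)) \<longlonglongrightarrow> F (q t \<omega>)"
          by (rule continuous_on_tendsto_compose[OF F XX]) auto
        have UR: "U (q t \<omega>) < real R" using good_all[OF conjunct1[OF c] True t _ T] by (simp add: T_def)
        have "(\<lambda>n. U (X R n (k n) \<omega>)) \<longlonglongrightarrow> U (q t \<omega>)"
          by (rule continuous_on_tendsto_compose[OF smooth_continuous[OF smooth_U] XX]) auto
        then have "\<forall>\<^sub>F n in sequentially. U (X R n (k n) \<omega>) < real R" using UR by (rule order_tendstoD(2))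
        then have "\<forall>\<^sub>F n in sequentially. F (X R n (k n) \<omega>) = f R (X R n (k n) \<omega>)"
          by eventually_elim (simp add: fF)
        with 1 have "(\<lambda>n. f R (X R n (k n) \<omega>)) \<longlonglongrightarrow> F (q t \<omega>)" by (rule Lim_transform_eventually)
        then have "(\<lambda>n. \<bar>?d n \<omega>\<bar>) \<longlonglongrightarrow> 0" by (intro tendsto_rabs_zero LIM_zero)
        then show ?thesis using True by simp
      qed simp
    qed
    then have "(\<lambda>n. expectation (\<lambda>\<omega>. indicator (good T R) \<omega> * \<bar>?d n \<omega>\<bar>)) \<longlonglongrightarrow> expectation (\<lambda>_. 0)"
      using dK K by (intro integral_dominated_convergence[where w="\<lambda>_. 2 * K"]) (auto split: split_indicator)
    then have "\<forall>\<^sub>F n in sequentially. expectation (\<lambda>\<omega>. indicator (good T R) \<omega> * \<bar>?d n \<omega>\<bar>) < e / 2"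
      using e by (intro order_tendstoD(2)) auto
    then show "\<forall>\<^sub>F n in sequentially. dist (case (R, n) of (R, n) \<Rightarrow> expectation (\<lambda>\<omega>. f R (X R n (k n) \<omega>))) (expectation (\<lambda>\<omega>. F (q t \<omega>))) < e"
    proof eventually_elim
      case (elim n)
      have i1: "integrable M (\<lambda>\<omega>. f R (X R n (k n) \<omega>))" using fK by (intro integrable_const_bound[where B=K]) auto
      have i2: "integrable M (\<lambda>\<omega>. F (q t \<omega>))" using FK by (intro integrable_const_bound[where B=K]) auto
      have i3: "integrable M (\<lambda>\<omega>. indicator (good T R) \<omega> * \<bar>?d n \<omega>\<bar>)"
        using dK K by (intro integrable_const_bound[where B="2 * K"]) (auto split: split_indicator)
      have i4: "integrable M (\<lambda>\<omega>. 2 * K * indicator (?G R) \<omega>)"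
        by (intro integrable_mult_right integrable_real_indicator) (auto simp: emeasure_eq_measure)
      have "\<bar>expectation (?d n)\<bar> \<le> expectation (\<lambda>\<omega>. \<bar>?d n \<omega>\<bar>)" by (rule integral_abs_bound)
      also have "\<dots> \<le> expectation (\<lambda>\<omega>. indicator (good T R) \<omega> * \<bar>?d n \<omega>\<bar> + 2 * K * indicator (?G R) \<omega>)"
        using dK K by (intro integral_mono integrable_abs Bochner_Integration.integrable_diff Bochner_Integration.integrable_add i1 i2 i3 i4) (auto split: split_indicator)
      also have "\<dots> = expectation (\<lambda>\<omega>. indicator (good T R) \<omega> * \<bar>?d n \<omega>\<bar>) + 2 * K * prob (?G R)"
        using i3 i4 by (subst Bochner_Integration.integral_add) auto
      also have "\<dots> < e" using elim R by simp
      finally show ?case using i1 i2 by (simp add: dist_real_def)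
    qed
  qed
qed

end

section \<open>Long-time behaviour of expectations\<close>

text \<open>A discrete Taylor formula: v is the slope of u up to \<eta> per step, and v itself
  changes at a rate of at most d.\<close>

lemma telescope_second_order:
  fixes u v :: "nat \<Rightarrow> real"
  assumes u: "\<And>j. \<bar>u (Suc j) - u j - \<delta> * v j\<bar> \<le> \<eta>" and v: "\<And>j. \<bar>v (Suc j) - v j\<bar> \<le> d * \<delta>" and pos: "\<delta> \<ge> 0" "d \<ge> 0"
  shows "\<bar>u (k + i) - u k - (real i * \<delta>) * v k\<bar> \<le> real i * \<eta> + (real i * \<delta>)\<^sup>2 * d"
proof (induction i)
  case (Suc i)
  have "\<bar>v (k + i) - v k\<bar> \<le> real i * (d * \<delta>)"
  proof (induction i)
    case (Suc i) then show ?case using v[of "k + i"] by (simp add: algebra_simps)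
  qed simp
  then have "\<delta> * \<bar>v (k + i) - v k\<bar> \<le> \<delta> * (real i * (d * \<delta>))" using pos(1) by (rule mult_left_mono)
  then have "\<bar>\<delta> * (v (k + i) - v k)\<bar> \<le> \<delta> * (real i * (d * \<delta>))" using pos(1) by (simp add: abs_mult)
  moreover have "u (k + Suc i) - u k - (real (Suc i) * \<delta>) * v k
    = (u (k + i) - u k - (real i * \<delta>) * v k) + (u (Suc (k + i)) - u (k + i) - \<delta> * v (k + i)) + \<delta> * (v (k + i) - v k)"
    by (simp add: algebra_simps)
  ultimately have "\<bar>u (k + Suc i) - u k - (real (Suc i) * \<delta>) * v k\<bar> \<le> real i * \<eta> + (real i * \<delta>)\<^sup>2 * d + \<eta> + \<delta> * (real i * (d * \<delta>))"
    using Suc u[of "k + i"] by linarith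
  also have "\<dots> = real (Suc i) * \<eta> + (real i ^ 2 + real i) * (\<delta>\<^sup>2 * d)" by (simp add: power2_eq_square algebra_simps)
  also have "(real i ^ 2 + real i) * (\<delta>\<^sup>2 * d) \<le> (real (Suc i))\<^sup>2 * (\<delta>\<^sup>2 * d)"
    using pos by (intro mult_right_mono) (auto simp: power2_eq_square algebra_simps)
  finally show ?case by (simp add: power_mult_distrib mult_ac)
qed simp

text \<open>By convexity an increase from s to t would recur on every later interval of the same
  length, and G would grow linearly beyond K. The hypothesis is midpoint convexity, written with
  doubled times in the form in which the chain supplies it.\<close>

lemma bounded_midpoint_convex_antimono:
  fixes G :: "real \<Rightarrow> real"
  assumes convex: "\<And>s t. 0 \<le> s \<Longrightarrow> 0 \<le> t \<Longrightarrow> G (2 * t) - 2 * G (t + s) + G (2 * s) \<ge> 0"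
    and bound: "\<And>t. t \<ge> 0 \<Longrightarrow> G t \<le> K" and st: "0 \<le> s" "s \<le> t"
  shows "G t \<le> G s"
proof (rule ccontr)
  assume n: "\<not> G t \<le> G s"
  define d where "d = t - s"
  define a where "a n = G (s + real n * d)" for n
  have d: "d \<ge> 0" using st by (simp add: d_def)
  have mono: "a (Suc n) - a n \<le> a (Suc (Suc n)) - a (Suc n)" for n
  proof -
    have m: "(s + real (Suc (Suc n)) * d) / 2 + (s + real n * d) / 2 = s + real (Suc n) * d" by (simp add: field_simps)
    have "2 * (x / 2) = x" for x :: real by simp
    note convex[of "(s + real n * d) / 2" "(s + real (Suc (Suc n)) * d) / 2", unfolded m this]
    moreover have "0 \<le> (s + real n * d) / 2" "0 \<le> (s + real (Suc (Suc n)) * d) / 2" using st d by auto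
    ultimately show ?thesis unfolding a_def by linarith
  qed
  have "a 1 - a 0 \<le> a (Suc n) - a n" for n
  proof (induction n)
    case (Suc n) then show ?case using mono[of n] by linarith
  qed simp
  then have "a 0 + real n * (a 1 - a 0) \<le> a n" for n
  proof (induction n)
    case (Suc n)
    from Suc.IH[OF Suc.prems] Suc.prems[of n] show ?case by (simp add: algebra_simps)
  qed simp
  moreover have "a n \<le> K" for n using st d unfolding a_def by (intro bound) auto
  ultimately have le: "real n * (a 1 - a 0) \<le> K - a 0" for n by (smt (verit))
  have "a 1 - a 0 > 0" using n by (simp add: a_def d_def)
  then obtain n where "real n * (a 1 - a 0) > K - a 0" using reals_Archimedean3 by blast
  with le[of n] show False by simp
qed

lemma convergent_at_top_Cauchy:
  fixes f G :: "real \<Rightarrow> real"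
  assumes G: "(G \<longlongrightarrow> L) at_top" and c: "c \<ge> 0"
    and f: "\<And>s t. 0 \<le> s \<Longrightarrow> 0 \<le> t \<Longrightarrow> (f t - f s)\<^sup>2 \<le> c * (G (2 * t) - 2 * G (t + s) + G (2 * s))"
  shows "\<exists>l. (f \<longlongrightarrow> l) at_top"
proof -
  have "cauchy_filter (filtermap f at_top)"
    unfolding cauchy_filter_metric_filtermap
  proof (intro allI impI)
    fix e :: real assume e: "e > 0"
    \<comment> \<open>The values of G lie within \<theta> of L and enter with total weight 4; adding
      1 to c covers the case c = 0.\<close>
    define \<theta> where "\<theta> = e\<^sup>2 / (4 * (c + 1))"
    have \<theta>: "\<theta> > 0" using e c by (simp add: \<theta>_def)
    have "\<forall>\<^sub>F t in at_top. dist (G t) L < \<theta>" using tendstoD[OF G \<theta>] .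
    then obtain T where T: "\<And>t. t \<ge> T \<Longrightarrow> dist (G t) L < \<theta>" unfolding eventually_at_top_linorder by blast
    have "dist (f s) (f t) < e" if st: "s \<ge> max 0 T" "t \<ge> max 0 T" for s t
    proof -
      have b: "\<bar>G (2 * t) - L\<bar> < \<theta>" "\<bar>G (t + s) - L\<bar> < \<theta>" "\<bar>G (2 * s) - L\<bar> < \<theta>"
        using T[of "2 * t"] T[of "t + s"] T[of "2 * s"] st by (auto simp: dist_real_def)
      then have "G (2 * t) - 2 * G (t + s) + G (2 * s) \<le> 4 * \<theta>" by linarith
      then have "(f t - f s)\<^sup>2 \<le> c * (4 * \<theta>)" using f[of s t] st c by (meson max.boundedE mult_left_mono order_trans)
      also have "\<dots> < (c + 1) * (4 * \<theta>)" using \<theta> by simp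
      also have "\<dots> = e\<^sup>2" using c by (simp add: \<theta>_def field_simps)
      finally have "\<bar>f t - f s\<bar> < e" using e abs_le_square_iff[of e "f t - f s"] by (simp add: not_le[symmetric])
      then show ?thesis by (simp add: dist_real_def abs_minus_commute)
    qed
    then show "\<exists>P. eventually P at_top \<and> (\<forall>x y. P x \<and> P y \<longrightarrow> dist (f x) (f y) < e)"
      using eventually_ge_at_top[of "max 0 T"] by blast
  qed
  then have "\<exists>l. filtermap f at_top \<le> nhds l"
    by (rule cauchy_filter_complete_converges[OF _ complete_UNIV]) (auto simp: filtermap_bot_iff trivial_limit_at_top_linorder)
  then show ?thesis by (simp add: filterlim_def)
qed

lemma convergent_at_top_antimono:
  fixes G :: "real \<Rightarrow> real"
  assumes anti: "\<And>s t. 0 \<le> s \<Longrightarrow> s \<le> t \<Longrightarrow> G t \<le> G s" and bound: "\<And>t. t \<ge> 0 \<Longrightarrow> G t \<ge> 0"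
  shows "\<exists>L. (G \<longlongrightarrow> L) at_top"
proof (rule exI, rule decreasing_tendsto)
  have bdd: "bdd_below (G ` {0..})" using bound by (intro bdd_belowI[of _ 0]) auto
  show "\<forall>\<^sub>F t in at_top. (INF t\<in>{0..}. G t) \<le> G t"
    using eventually_ge_at_top[of 0] by eventually_elim (rule cINF_lower[OF bdd], simp)
  fix x assume "(INF t\<in>{0..}. G t) < x"
  then obtain t where t: "t \<ge> 0" "G t < x" using cInf_lessD[of "G ` {0..}" x] by auto
  show "\<forall>\<^sub>F t in at_top. G t < x"
    using eventually_ge_at_top[of t] by eventually_elim (use t anti le_less_trans in blast)
qed

definition grid :: "real \<Rightarrow> nat \<Rightarrow> nat" where "grid t n = nat \<lfloor>t * real (Suc n)\<rfloor>"

context confined_sde begin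

lemma grid_tendsto: assumes t: "t \<ge> 0" shows "(\<lambda>n. real (grid t n) * \<delta> n) \<longlonglongrightarrow> t"
proof (rule real_tendsto_sandwich)
  have r: "real (grid t n) = of_int \<lfloor>t * real (Suc n)\<rfloor>" for n using t by (simp add: grid_def)
  have d: "(t * real (Suc n)) * \<delta> n = t" for n by (simp add: \<delta>_def)
  show "\<forall>\<^sub>F n in sequentially. t - \<delta> n \<le> real (grid t n) * \<delta> n"
  proof (rule always_eventually, rule allI)
    fix n
    have "t * real (Suc n) - 1 \<le> real (grid t n)" unfolding r by linarith
    then have "(t * real (Suc n) - 1) * \<delta> n \<le> real (grid t n) * \<delta> n"
      using \<delta>(1)[of n] by (intro mult_right_mono) auto
    then show "t - \<delta> n \<le> real (grid t n) * \<delta> n" by (simp only: left_diff_distrib d mult_1)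
  qed
  show "\<forall>\<^sub>F n in sequentially. real (grid t n) * \<delta> n \<le> t"
  proof (rule always_eventually, rule allI)
    fix n
    have "real (grid t n) * \<delta> n \<le> (t * real (Suc n)) * \<delta> n"
      using \<delta>(1)[of n] by (intro mult_right_mono) (auto simp: r simp del: of_nat_Suc)
    then show "real (grid t n) * \<delta> n \<le> t" by (simp only: d)
  qed
  show "(\<lambda>n. t - \<delta> n) \<longlonglongrightarrow> t" using tendsto_diff[OF tendsto_const \<delta>(3)] by simp
qed simp

lemma grid_le: "t \<ge> 0 \<Longrightarrow> real (grid t n) \<le> t * real (Suc n)"
  by (simp add: grid_def del: of_nat_Suc)

lemma sqrt_\<delta>: "(\<lambda>n. sqrt (\<delta> n)) \<longlonglongrightarrow> 0"
  using tendsto_real_sqrt[OF \<delta>(3)] by simp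

text \<open>At most t (n + 1) steps, each with a reversibility error proportional to
  \<open>\<delta> n * sqrt (\<delta> n)\<close>, add up to order \<open>sqrt (\<delta> n)\<close>.
  This is the point at which the exponent 3/2 has to exceed 1.\<close>

lemma grid_error:
  assumes k: "\<And>n. real (k n) \<le> t * real (Suc n)" and t: "t \<ge> 0"
  shows "(\<lambda>n. (1 + \<kappa> R n) ^ k n) \<longlonglongrightarrow> 1"
    and "(\<lambda>n. real (k n) * (C * \<kappa> R n * (1 + \<kappa> R n) ^ k n)) \<longlonglongrightarrow> 0"
proof -
  have kd: "real (k n) * \<kappa> R n \<le> t * \<kappa>R R * sqrt (\<delta> n)" for n
  proof -
    have "real (k n) * \<kappa> R n \<le> (t * real (Suc n)) * \<kappa> R n" by (intro mult_right_mono k c.\<kappa>)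
    also have "\<dots> = t * \<kappa>R R * (real (Suc n) * \<delta> n) * sqrt (\<delta> n)" by (simp only: \<kappa>_def mult_ac)
    also have "real (Suc n) * \<delta> n = 1" by (simp add: \<delta>_def)
    finally show ?thesis by simp
  qed
  have lim: "(\<lambda>n. t * \<kappa>R R * sqrt (\<delta> n)) \<longlonglongrightarrow> 0" using tendsto_mult_right_zero[OF sqrt_\<delta>] by simp
  have z: "(\<lambda>n. real (k n) * \<kappa> R n) \<longlonglongrightarrow> 0"
    by (rule real_tendsto_sandwich[OF _ _ tendsto_const lim]) (use kd c.\<kappa> in auto)
  have e: "(\<lambda>n. exp (real (k n) * \<kappa> R n)) \<longlonglongrightarrow> 1" using tendsto_exp[OF z] by simp
  have l: "1 \<le> (1 + \<kappa> R n) ^ k n" for n using c.\<kappa>[of R n] by (intro one_le_power) simp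
  have u: "(1 + \<kappa> R n) ^ k n \<le> exp (real (k n) * \<kappa> R n)" for n
    unfolding exp_of_nat_mult using c.\<kappa>[of R n] by (intro power_mono exp_ge_add_one_self) auto
  show 1: "(\<lambda>n. (1 + \<kappa> R n) ^ k n) \<longlonglongrightarrow> 1"
    by (rule real_tendsto_sandwich[OF always_eventually always_eventually tendsto_const e]) (use l u in blast)+
  have "(\<lambda>n. C * (real (k n) * \<kappa> R n) * (1 + \<kappa> R n) ^ k n) \<longlonglongrightarrow> C * 0 * 1" by (intro tendsto_intros z 1)
  then show "(\<lambda>n. real (k n) * (C * \<kappa> R n * (1 + \<kappa> R n) ^ k n)) \<longlonglongrightarrow> 0" by (simp add: mult_ac)
qed

lemma w_inside: "U x \<le> real R \<Longrightarrow> e.w R x = exp (- U x)"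
  by (simp add: e.w_def UR_def cut_below)

lemma bounded_support_inside:
  assumes "bounded {x. f x \<noteq> (0::real)}"
  obtains R0 where "\<And>R x. R \<ge> R0 \<Longrightarrow> f x \<noteq> 0 \<Longrightarrow> U x < real R"
proof -
  let ?S = "closure {x. f x \<noteq> 0}"
  have "bounded (U ` ?S)"
    using assms by (intro compact_imp_bounded compact_continuous_image continuous_on_subset[OF smooth_continuous[OF smooth_U]]) (auto simp: compact_closure)
  then obtain b where b: "\<forall>x\<in>?S. \<bar>U x\<bar> \<le> b" unfolding bounded_iff by auto
  have "U x < real R" if "R \<ge> nat \<lceil>b\<rceil> + 1" "f x \<noteq> 0" for R x
  proof -
    have "x \<in> ?S" using that(2) by (meson CollectI closure_subset subsetD)
    then have "U x \<le> b" using b by (auto simp: abs_le_iff)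
    then show ?thesis using that(1) by linarith
  qed
  then show ?thesis by (rule that)
qed

lemma weight_inside:
  assumes "bounded {x. f x \<noteq> (0::real)}"
  shows "\<forall>\<^sub>F R in sequentially. (\<lambda>x. f x * e.w R x) = (\<lambda>x. f x * exp (- U x))"
proof -
  obtain R0 where R0: "\<And>R x. R \<ge> R0 \<Longrightarrow> f x \<noteq> 0 \<Longrightarrow> U x < real R" by (rule bounded_support_inside[OF assms]) blast
  show ?thesis using eventually_ge_at_top[of R0]
  proof eventually_elim
    case (elim R)
    have "f x * e.w R x = f x * exp (- U x)" for x
      using R0[OF elim, of x] w_inside[of x R] by (cases "f x = 0") auto
    then show ?case by (rule ext)
  qed
qed

end

section \<open>Passage from the chains to the diffusion\<close>

context confined_sde begin

abbreviation L where "L \<equiv> unperturbed_generator \<sigma> U"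

lemma expectation_tendsto_bounded_support:
  fixes f :: "real ^ 'n \<Rightarrow> real"
  assumes f: "continuous_on UNIV f" "bounded {x. f x \<noteq> 0}"
    and k: "(\<lambda>n. real (k n) * \<delta> n) \<longlonglongrightarrow> t" and t: "t \<ge> 0"
  shows "((\<lambda>(R, n). expectation (\<lambda>\<omega>. f (X R n (k n) \<omega>))) \<longlongrightarrow> expectation (\<lambda>\<omega>. f (q t \<omega>))) iterated"
proof -
  obtain K where "\<And>x. \<bar>f x\<bar> \<le> K" by (rule continuous_bounded_support_bounded[OF f]) blast
  then show ?thesis
    by (intro expectation_tendsto[where K=K, OF _ _ f(1) _ k t]) (auto intro: borel_measurable_continuous_onI f)
qed

lemma grid_add_tendsto:
  assumes "s \<ge> 0" "t \<ge> 0" shows "(\<lambda>n. real (grid t n + grid s n) * \<delta> n) \<longlonglongrightarrow> t + s"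
  using tendsto_add[OF grid_tendsto[OF assms(2)] grid_tendsto[OF assms(1)]] by (simp add: distrib_right)

lemma grid_double_tendsto:
  assumes "t \<ge> 0" shows "(\<lambda>n. real (2 * grid t n) * \<delta> n) \<longlonglongrightarrow> 2 * t"
  using tendsto_mult[OF tendsto_const grid_tendsto[OF assms]] by (simp add: mult.assoc)

text \<open>The chain densities are at most \<open>C (1 + \<kappa>)^k\<close>, and the second factor
  tends to 1. The law of \<open>q t\<close> thus inherits the bound C on its density relative to
  \<open>exp (- U)\<close>, here tested on functions of bounded support.\<close>

lemma expectation_le_integral:
  assumes f: "continuous_on UNIV f" "bounded {x. f x \<noteq> 0}" and t: "t \<ge> 0"
  shows "\<bar>expectation (\<lambda>\<omega>. f (q t \<omega>))\<bar> \<le> C * (LINT x|lborel. \<bar>f x\<bar> * exp (- U x))"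
proof (rule tendsto_le[OF iterated_neq_bot])
  have [measurable]: "f \<in> borel_measurable borel" by (rule borel_measurable_continuous_onI[OF f(1)])
  let ?I = "LINT x|lborel. \<bar>f x\<bar> * exp (- U x)"
  show "((\<lambda>(R, n). \<bar>expectation (\<lambda>\<omega>. f (X R n (grid t n) \<omega>))\<bar>) \<longlongrightarrow> \<bar>expectation (\<lambda>\<omega>. f (q t \<omega>))\<bar>) iterated"
    using tendsto_rabs[OF expectation_tendsto_bounded_support[OF f grid_tendsto[OF t] t]] by (simp add: case_prod_unfold)
  have "(\<lambda>n. C * (1 + \<kappa> R n) ^ grid t n * ?I) \<longlonglongrightarrow> C * 1 * ?I" for R
    by (intro tendsto_intros grid_error(1)[OF grid_le[OF t] t])
  then show "((\<lambda>(R, n). C * (1 + \<kappa> R n) ^ grid t n * ?I) \<longlongrightarrow> C * ?I) iterated"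
    by (intro tendsto_iteratedI) simp
  have b: "bounded {x. \<bar>f x\<bar> \<noteq> 0}" using f(2) by simp
  have i: "integrable lborel (\<lambda>x. f x * exp (- U x))"
    using f(1) by (intro integrable_continuous_bounded_support continuous_intros smooth_continuous[OF smooth_U] bounded_subset[OF f(2)]) auto
  show "\<forall>\<^sub>F z in iterated. (case z of (R, n) \<Rightarrow> \<bar>expectation (\<lambda>\<omega>. f (X R n (grid t n) \<omega>))\<bar>) \<le> (case z of (R, n) \<Rightarrow> C * (1 + \<kappa> R n) ^ grid t n * ?I)"
    unfolding eventually_iterated using weight_inside[OF f(2)] weight_inside[OF b]
  proof eventually_elim
    case (elim R)
    then show ?case using c.expectation_bound[where R=R, OF _ i[folded elim(1)]]
      by (simp add: expectation_X)
  qed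
qed

text \<open>The continuous-time counterpart of \<open>c.F\<close>, whose second differences dominate
  the squared increments of the expectations of f.\<close>

definition "G t = expectation (\<lambda>\<omega>. h0 (q t \<omega>))"

lemma G_tendsto:
  assumes "(\<lambda>n. real (k n) * \<delta> n) \<longlonglongrightarrow> t" "t \<ge> 0"
  shows "((\<lambda>(R, n). c.F R n (k n)) \<longlongrightarrow> G t) iterated"
proof -
  have "((\<lambda>(R, n). expectation (\<lambda>\<omega>. hR R (X R n (k n) \<omega>))) \<longlongrightarrow> G t) iterated"
    unfolding G_def using hR_bounds
    by (intro expectation_tendsto[where K=C, OF _ _ h0_continuous _ assms]) (auto simp: hR_inside)
  then show ?thesis by (simp add: expectation_X c.F_def)
qed

lemma G_bounds: "t \<ge> 0 \<Longrightarrow> 0 \<le> G t" "t \<ge> 0 \<Longrightarrow> G t \<le> C"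
proof -
  assume [simp]: "t \<ge> 0"
  show "0 \<le> G t" unfolding G_def by (intro Bochner_Integration.integral_nonneg h0_nonneg)
  have "G t \<le> expectation (\<lambda>_. C)"
    unfolding G_def using h0_nonneg h0_le C_nonneg by (intro integral_mono integrable_const_bound[where B=C]) auto
  then show "G t \<le> C" by (simp add: prob_space)
qed

lemma second_difference_tendsto:
  assumes s: "s \<ge> 0" and t: "t \<ge> 0"
  shows "((\<lambda>(R, n). c.F R n (2 * grid t n) - 2 * c.F R n (grid t n + grid s n) + c.F R n (2 * grid s n)
     + 4 * (real (grid t n + grid s n) * (C * \<kappa> R n * (1 + \<kappa> R n) ^ (grid t n + grid s n)))) \<longlongrightarrow> G (2 * t) - 2 * G (t + s) + G (2 * s)) iterated"
proof -
  let ?E = "\<lambda>R n. real (grid t n + grid s n) * (C * \<kappa> R n * (1 + \<kappa> R n) ^ (grid t n + grid s n))"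
  have "real (grid t n + grid s n) \<le> (t + s) * real (Suc n)" for n
    using grid_le[OF s, of n] grid_le[OF t, of n] unfolding of_nat_add by (simp add: distrib_right del: of_nat_Suc)
  then have "(\<lambda>n. ?E R n) \<longlonglongrightarrow> 0" for R using s t by (intro grid_error(2)[where t="t + s"]) auto
  then have E: "((\<lambda>(R, n). ?E R n) \<longlongrightarrow> 0) iterated" by (intro tendsto_iteratedI) auto
  have "((\<lambda>z. (\<lambda>(R, n). c.F R n (2 * grid t n)) z - 2 * (\<lambda>(R, n). c.F R n (grid t n + grid s n)) z + (\<lambda>(R, n). c.F R n (2 * grid s n)) z
     + 4 * (\<lambda>(R, n). ?E R n) z) \<longlongrightarrow> G (2 * t) - 2 * G (t + s) + G (2 * s) + 4 * 0) iterated"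
    using s t by (intro tendsto_intros E G_tendsto grid_double_tendsto grid_add_tendsto) auto
  then show ?thesis by (simp add: case_prod_unfold)
qed

lemma G_convex:
  assumes s: "s \<ge> 0" and t: "t \<ge> 0" shows "G (2 * t) - 2 * G (t + s) + G (2 * s) \<ge> 0"
proof (rule tendsto_lowerbound[OF second_difference_tendsto[OF s t] always_eventually iterated_neq_bot], clarify)
  fix R n
  have "0 \<le> (LINT x|lborel. (c.h R n (grid t n) x - c.h R n (grid s n) x)\<^sup>2 * e.w R x)" by (intro Bochner_Integration.integral_nonneg) (simp add: e.w_def)
  also have "\<dots> \<le> c.F R n (2 * grid t n) - 2 * c.F R n (grid t n + grid s n) + c.F R n (2 * grid s n)
     + 4 * (real (grid t n + grid s n) * (C * \<kappa> R n * (1 + \<kappa> R n) ^ (grid t n + grid s n)))"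
    by (rule c.increment_norm(2)) auto
  finally show "0 \<le> \<dots>" .
qed

lemma expectation_increment_bound:
  assumes f: "continuous_on UNIV f" "bounded {x. f x \<noteq> 0}" and s: "s \<ge> 0" and t: "t \<ge> 0"
  shows "(expectation (\<lambda>\<omega>. f (q t \<omega>)) - expectation (\<lambda>\<omega>. f (q s \<omega>)))\<^sup>2
    \<le> (LINT x|lborel. (f x)\<^sup>2 * exp (- U x)) * (G (2 * t) - 2 * G (t + s) + G (2 * s))"
proof (rule tendsto_le[OF iterated_neq_bot])
  have [measurable]: "f \<in> borel_measurable borel" by (rule borel_measurable_continuous_onI[OF f(1)])
  obtain D where D: "\<And>x. \<bar>f x\<bar> \<le> D" by (rule continuous_bounded_support_bounded[OF f]) blast
  let ?I = "LINT x|lborel. (f x)\<^sup>2 * exp (- U x)"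
  show "((\<lambda>z. ((\<lambda>(R, n). expectation (\<lambda>\<omega>. f (X R n (grid t n) \<omega>))) z - (\<lambda>(R, n). expectation (\<lambda>\<omega>. f (X R n (grid s n) \<omega>))) z)\<^sup>2)
    \<longlongrightarrow> (expectation (\<lambda>\<omega>. f (q t \<omega>)) - expectation (\<lambda>\<omega>. f (q s \<omega>)))\<^sup>2) iterated"
    by (intro tendsto_intros expectation_tendsto_bounded_support f grid_tendsto s t)
  show "((\<lambda>z. ?I * (\<lambda>(R, n). c.F R n (2 * grid t n) - 2 * c.F R n (grid t n + grid s n) + c.F R n (2 * grid s n)
     + 4 * (real (grid t n + grid s n) * (C * \<kappa> R n * (1 + \<kappa> R n) ^ (grid t n + grid s n)))) z) \<longlongrightarrow> ?I * (G (2 * t) - 2 * G (t + s) + G (2 * s))) iterated"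
    by (intro tendsto_intros second_difference_tendsto s t)
  have b: "bounded {x. (f x)\<^sup>2 \<noteq> 0}" using f(2) by simp
  have i: "integrable lborel (\<lambda>x. (f x)\<^sup>2 * exp (- U x))"
    using f(1) by (intro integrable_continuous_bounded_support continuous_intros smooth_continuous[OF smooth_U] bounded_subset[OF f(2)]) auto
  show "\<forall>\<^sub>F z in iterated. ((\<lambda>(R, n). expectation (\<lambda>\<omega>. f (X R n (grid t n) \<omega>))) z - (\<lambda>(R, n). expectation (\<lambda>\<omega>. f (X R n (grid s n) \<omega>))) z)\<^sup>2
     \<le> ?I * (\<lambda>(R, n). c.F R n (2 * grid t n) - 2 * c.F R n (grid t n + grid s n) + c.F R n (2 * grid s n)
     + 4 * (real (grid t n + grid s n) * (C * \<kappa> R n * (1 + \<kappa> R n) ^ (grid t n + grid s n)))) z"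
    unfolding eventually_iterated using weight_inside[OF b]
  proof eventually_elim
    case (elim R)
    show ?case
    proof (rule always_eventually, rule allI)
      fix n
      have "(expectation (\<lambda>\<omega>. f (X R n (grid t n) \<omega>)) - expectation (\<lambda>\<omega>. f (X R n (grid s n) \<omega>)))\<^sup>2
        \<le> ?I * (c.F R n (2 * grid t n) - 2 * c.F R n (grid t n + grid s n) + c.F R n (2 * grid s n)
         + 4 * (real (grid t n + grid s n) * (C * \<kappa> R n * (1 + \<kappa> R n) ^ (grid t n + grid s n))))"
        using c.expectation_increment[where R=R and f=f and D=D and K="grid t n + grid s n" and n="grid t n" and m="grid s n", OF _ D i[folded elim]]
        by (simp add: expectation_X elim)
      then show "((\<lambda>(R, n). expectation (\<lambda>\<omega>. f (X R n (grid t n) \<omega>))) (R, n) - (\<lambda>(R, n). expectation (\<lambda>\<omega>. f (X R n (grid s n) \<omega>))) (R, n))\<^sup>2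
        \<le> ?I * (\<lambda>(R, n). c.F R n (2 * grid t n) - 2 * c.F R n (grid t n + grid s n) + c.F R n (2 * grid s n)
     + 4 * (real (grid t n + grid s n) * (C * \<kappa> R n * (1 + \<kappa> R n) ^ (grid t n + grid s n)))) (R, n)"
        by simp
    qed
  qed
qed

lemma expectation_convergent:
  fixes f :: "real ^ 'n \<Rightarrow> real"
  assumes f: "continuous_on UNIV f" "bounded {x. f x \<noteq> 0}"
  shows "\<exists>l. ((\<lambda>t. expectation (\<lambda>\<omega>. f (q t \<omega>))) \<longlongrightarrow> l) at_top"
proof -
  obtain G' where "(G \<longlongrightarrow> G') at_top"
    using convergent_at_top_antimono[of G] bounded_midpoint_convex_antimono[of G C] G_convex G_bounds by blast
  then show ?thesis
    by (rule convergent_at_top_Cauchy[OF _ _ expectation_increment_bound[OF f]]) (auto intro!: Bochner_Integration.integral_nonneg)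
qed

text \<open>On the closed support of f the truncation is invisible for large R; off it both
  operators give 0, as both are local.\<close>

lemma generator_inside:
  assumes f: "test_function f"
  shows "\<forall>\<^sub>F R in sequentially. e.gen R f = L f"
proof -
  let ?S = "closure {x. f x \<noteq> 0}"
  have "{x. indicat_real ?S x \<noteq> 0} = ?S" by (auto split: split_indicator)
  then have "bounded {x. indicat_real ?S x \<noteq> 0}" using f by (simp add: test_function_iff bounded_closure)
  then obtain R0 where R0: "\<And>R x. R \<ge> R0 \<Longrightarrow> indicat_real ?S x \<noteq> 0 \<Longrightarrow> U x < real R" by (rule bounded_support_inside) blast
  show ?thesis using eventually_ge_at_top[of R0]
  proof eventually_elim
    case (elim R)
    have "e.gen R f x = L f x" for x
    proof (cases "x \<in> ?S")
      case True
      then have "U x < real R" using R0[OF elim] by simp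
      moreover have "(\<Sum>i\<in>UNIV. \<Sum>j\<in>UNIV. (A ** transpose A) $ i $ j * partial_deriv i (partial_deriv j f) x) / 2
        = (\<sigma> ** transpose \<sigma>) \<bullet> hessian f x"
        unfolding A_mult by (simp add: inner_vec_def hessian_def sum_divide_distrib)
      ultimately show ?thesis
        by (simp add: e.gen_def unperturbed_generator_def drift_inside linear_neg[OF matrix_vector_mul_linear] del: transpose_matrix_vector)
    next
      case False
      have 1: "partial_deriv i f y = 0" if "y \<notin> ?S" for i y using partial_deriv_support that by blast
      have "{y. partial_deriv j f y \<noteq> 0} \<subseteq> ?S" for j using 1 by blast
      then have "closure {y. partial_deriv j f y \<noteq> 0} \<subseteq> ?S" for j by (intro closure_minimal) auto
      then have "partial_deriv i (partial_deriv j f) x = 0" for i j using partial_deriv_support False by blast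
      then show ?thesis using 1[OF False]
        by (simp add: e.gen_def unperturbed_generator_sum grad_def inner_vec_def)
    qed
    then show ?case by (rule ext)
  qed
qed

text \<open>\<open>step_generator\<close> averaged over the law of the chain, whose mass is 1; its
  error is uniform in the starting point, so m depends neither on n nor on k.\<close>

lemma one_step:
  assumes f: "test_function f"
  shows "\<forall>\<^sub>F R in sequentially. \<exists>m\<ge>0. \<forall>n k. \<bar>expectation (\<lambda>\<omega>. f (X R n (Suc k) \<omega>)) - expectation (\<lambda>\<omega>. f (X R n k \<omega>))
     - \<delta> n * expectation (\<lambda>\<omega>. L f (X R n k \<omega>))\<bar> \<le> m * (\<delta> n * sqrt (\<delta> n))"
  using generator_inside[OF f]
proof eventually_elim
  case (elim R)
  have Lf: "test_function (L f)" by (rule test_function_generator[OF smooth_U f])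
  have [measurable]: "f \<in> borel_measurable borel" "L f \<in> borel_measurable borel"
    using f Lf by (auto intro!: borel_measurable_continuous_onI smooth_continuous test_function_smooth)
  obtain D where D: "D \<ge> 0" "\<And>x. \<bar>f x\<bar> \<le> D" by (rule test_function_bounded[OF f]) blast
  obtain D' where D': "D' \<ge> 0" "\<And>x. \<bar>L f x\<bar> \<le> D'" by (rule test_function_bounded[OF Lf]) blast
  obtain K where K: "derivs_bounded K f" using test_function_derivs_bounded[OF f] by blast
  obtain m where m: "m \<ge> 0" "\<And>h x. 0 < h \<Longrightarrow> h \<le> 1 \<Longrightarrow> \<bar>(LINT y|lborel. e.p R h x y * f y) - f x - h * e.gen R f x\<bar> \<le> m * (h * sqrt h)"
    by (rule e.step_generator[OF K D(2)]) blast
  have "\<bar>expectation (\<lambda>\<omega>. f (X R n (Suc k) \<omega>)) - expectation (\<lambda>\<omega>. f (X R n k \<omega>)) - \<delta> n * expectation (\<lambda>\<omega>. L f (X R n k \<omega>))\<bar> \<le> m * (\<delta> n * sqrt (\<delta> n))" for n k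
  proof -
    let ?h = "c.h R n k" and ?w = "e.w R"
    have "expectation (\<lambda>\<omega>. f (X R n (Suc k) \<omega>)) = (LINT x|lborel. c.Q R n f x * ?h x * ?w x)"
      unfolding expectation_X[of f, simplified] using c.duality(2)[OF _ D(2) c.h_meas[of R n k] c.h_integrable[of R n k]] by (simp add: c.h_Suc)
    moreover have "(LINT x|lborel. (?h x * ?w x) * (c.Q R n f x - f x - \<delta> n * L f x)) = (LINT x|lborel. c.Q R n f x * ?h x * ?w x) - (LINT x|lborel. f x * ?h x * ?w x) - \<delta> n * (LINT x|lborel. L f x * ?h x * ?w x)"
    proof -
      have i: "integrable lborel (\<lambda>x. c.Q R n f x * ?h x * ?w x)" "integrable lborel (\<lambda>x. f x * ?h x * ?w x)" "integrable lborel (\<lambda>x. L f x * ?h x * ?w x)"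
        by (rule c.bounded_h_integrable[OF c.Q_measurable c.Q_bound[OF _ D(2)]], simp_all)
          (rule c.bounded_h_integrable[OF _ D(2)] c.bounded_h_integrable[OF _ D'(2)], simp)+
      have "(?h x * ?w x) * (c.Q R n f x - f x - \<delta> n * L f x) = c.Q R n f x * ?h x * ?w x - f x * ?h x * ?w x - \<delta> n * (L f x * ?h x * ?w x)" for x
        by (simp add: algebra_simps)
      then show ?thesis using i by simp
    qed
    moreover have "\<bar>LINT x|lborel. (?h x * ?w x) * (c.Q R n f x - f x - \<delta> n * L f x)\<bar> \<le> m * (\<delta> n * sqrt (\<delta> n)) * (LINT x|lborel. \<bar>?h x * ?w x\<bar>)"
    proof (rule c.integral_kernel_bound[OF c.h_integrable])
      show "(\<lambda>x. c.Q R n f x - f x - \<delta> n * L f x) \<in> borel_measurable borel"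
        by (intro borel_measurable_diff borel_measurable_times c.Q_measurable) auto
      show "\<bar>c.Q R n f x - f x - \<delta> n * L f x\<bar> \<le> m * (\<delta> n * sqrt (\<delta> n))" for x
        using m(2)[OF \<delta>(1,2), of n x] by (simp add: elim c.Q_def)
    qed
    moreover have "(LINT x|lborel. \<bar>?h x * ?w x\<bar>) = 1"
      using c.h_integral[of R n k] c.h_nonneg[of R n k] by (simp add: abs_mult e.w_def)
    ultimately show ?thesis by (simp add: expectation_X)
  qed
  then show ?case using m(1) by blast
qed

text \<open>This takes the place of Ito's formula: the one-step expansions of f and of
  \<open>L f\<close> are summed along the grid before the limit is taken. D is a bound for
  \<open>L (L f)\<close>, which controls how fast the slope changes.\<close>

lemma expectation_expansion:
  assumes f: "test_function f"
  obtains D where "\<And>s t. s \<ge> 0 \<Longrightarrow> t \<ge> 0 \<Longrightarrow> \<bar>expectation (\<lambda>\<omega>. f (q (t + s) \<omega>)) - expectation (\<lambda>\<omega>. f (q t \<omega>)) - s * expectation (\<lambda>\<omega>. L f (q t \<omega>))\<bar> \<le> s\<^sup>2 * D"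
proof -
  have Lf: "test_function (L f)" and LLf: "test_function (L (L f))"
    by (intro test_function_generator smooth_U f)+
  have cont: "continuous_on UNIV f" "bounded {x. f x \<noteq> 0}" "continuous_on UNIV (L f)" "bounded {x. L f x \<noteq> 0}"
    using f Lf by (auto simp: test_function_iff smooth_continuous)
  have [measurable]: "L (L f) \<in> borel_measurable borel"
    using LLf by (auto intro!: borel_measurable_continuous_onI smooth_continuous test_function_smooth)
  obtain D where D: "D \<ge> 0" "\<And>x. \<bar>L (L f) x\<bar> \<le> D" by (rule test_function_bounded[OF LLf]) blast
  have "\<bar>expectation (\<lambda>\<omega>. f (q (t + s) \<omega>)) - expectation (\<lambda>\<omega>. f (q t \<omega>)) - s * expectation (\<lambda>\<omega>. L f (q t \<omega>))\<bar> \<le> s\<^sup>2 * D"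
    if s: "s \<ge> 0" and t: "t \<ge> 0" for s t
  proof (rule field_le_epsilon)
    fix e :: real assume e: "e > 0"
    let ?u = "\<lambda>R n k. expectation (\<lambda>\<omega>. f (X R n k \<omega>))" and ?v = "\<lambda>R n k. expectation (\<lambda>\<omega>. L f (X R n k \<omega>))"
    let ?err = "\<lambda>R n. \<bar>?u R n (grid t n + grid s n) - ?u R n (grid t n) - (real (grid s n) * \<delta> n) * ?v R n (grid t n)\<bar>"
    show "\<bar>expectation (\<lambda>\<omega>. f (q (t + s) \<omega>)) - expectation (\<lambda>\<omega>. f (q t \<omega>)) - s * expectation (\<lambda>\<omega>. L f (q t \<omega>))\<bar> \<le> s\<^sup>2 * D + e"
    proof (rule tendsto_upperbound[OF _ _ iterated_neq_bot])
      have g: "((\<lambda>(R, n). real (grid s n) * \<delta> n) \<longlongrightarrow> s) iterated"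
        by (intro tendsto_iteratedI always_eventually allI grid_tendsto s)
      have "((\<lambda>z. \<bar>(\<lambda>(R, n). ?u R n (grid t n + grid s n)) z - (\<lambda>(R, n). ?u R n (grid t n)) z - (\<lambda>(R, n). real (grid s n) * \<delta> n) z * (\<lambda>(R, n). ?v R n (grid t n)) z\<bar>)
        \<longlongrightarrow> \<bar>expectation (\<lambda>\<omega>. f (q (t + s) \<omega>)) - expectation (\<lambda>\<omega>. f (q t \<omega>)) - s * expectation (\<lambda>\<omega>. L f (q t \<omega>))\<bar>) iterated"
        using s t by (intro tendsto_intros g expectation_tendsto_bounded_support cont grid_tendsto grid_add_tendsto) auto
      then show "((\<lambda>(R, n). ?err R n) \<longlongrightarrow> \<bar>expectation (\<lambda>\<omega>. f (q (t + s) \<omega>)) - expectation (\<lambda>\<omega>. f (q t \<omega>)) - s * expectation (\<lambda>\<omega>. L f (q t \<omega>))\<bar>) iterated"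
        by (simp add: case_prod_unfold)
      show "\<forall>\<^sub>F z in iterated. (case z of (R, n) \<Rightarrow> ?err R n) \<le> s\<^sup>2 * D + e"
        unfolding eventually_iterated using one_step[OF f] one_step[OF Lf]
      proof eventually_elim
        case (elim R)
        obtain a where a: "a \<ge> 0" "\<And>n k. \<bar>?u R n (Suc k) - ?u R n k - \<delta> n * ?v R n k\<bar> \<le> a * (\<delta> n * sqrt (\<delta> n))" using elim(1) by blast
        obtain b where b: "b \<ge> 0" "\<And>n k. \<bar>?v R n (Suc k) - ?v R n k - \<delta> n * expectation (\<lambda>\<omega>. L (L f) (X R n k \<omega>))\<bar> \<le> b * (\<delta> n * sqrt (\<delta> n))" using elim(2) by blast
        have v: "\<bar>?v R n (Suc k) - ?v R n k\<bar> \<le> (D + b * sqrt (\<delta> n)) * \<delta> n" for n k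
        proof -
          have "\<bar>expectation (\<lambda>\<omega>. L (L f) (X R n k \<omega>))\<bar> \<le> expectation (\<lambda>\<omega>. \<bar>L (L f) (X R n k \<omega>)\<bar>)" by (rule integral_abs_bound)
          also have "\<dots> \<le> expectation (\<lambda>_. D)"
            using D by (intro integral_mono integrable_const_bound[where B=D]) auto
          finally have "\<bar>expectation (\<lambda>\<omega>. L (L f) (X R n k \<omega>))\<bar> \<le> D" by (simp add: prob_space)
          then have "\<delta> n * \<bar>expectation (\<lambda>\<omega>. L (L f) (X R n k \<omega>))\<bar> \<le> \<delta> n * D" using \<delta>(1)[of n] by (intro mult_left_mono) auto
          then have "\<bar>\<delta> n * expectation (\<lambda>\<omega>. L (L f) (X R n k \<omega>))\<bar> \<le> \<delta> n * D" using \<delta>(1)[of n] by (simp add: abs_mult)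
          then show ?thesis using b(2)[of n k] by (simp add: algebra_simps)
        qed
        have err: "?err R n \<le> (real (grid s n) * \<delta> n) * a * sqrt (\<delta> n) + (real (grid s n) * \<delta> n)\<^sup>2 * (D + b * sqrt (\<delta> n))" for n
          using telescope_second_order[where u="?u R n" and v="?v R n" and k="grid t n" and i="grid s n", OF a(2) v] \<delta>(1)[of n] D(1) b(1)
          by (simp add: mult_ac)
        have "(\<lambda>n. (real (grid s n) * \<delta> n) * a * sqrt (\<delta> n) + (real (grid s n) * \<delta> n)\<^sup>2 * (D + b * sqrt (\<delta> n))) \<longlonglongrightarrow> s * a * 0 + s\<^sup>2 * (D + b * 0)"
          by (intro tendsto_intros grid_tendsto s sqrt_\<delta>)
        then have "\<forall>\<^sub>F n in sequentially. (real (grid s n) * \<delta> n) * a * sqrt (\<delta> n) + (real (grid s n) * \<delta> n)\<^sup>2 * (D + b * sqrt (\<delta> n)) < s\<^sup>2 * D + e"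
          by (rule order_tendstoD(2)) (use e in simp)
        then show ?case
          by eventually_elim (use err in \<open>auto intro: order_trans[OF _ less_imp_le]\<close>)
      qed
    qed
  qed
  then show ?thesis by (rule that)
qed

text \<open>Let u and v be the limits for f and for \<open>L f\<close>. For large t the expansion
  over a time span s turns into |u - u - s v| \<le> s^2 D, and small s forces v = 0.\<close>

theorem expectation_generator_tendsto_0:
  assumes f: "test_function f"
  shows "((\<lambda>t. expectation (\<lambda>\<omega>. L f (q t \<omega>))) \<longlongrightarrow> 0) at_top"
proof -
  have Lf: "test_function (L f)" by (rule test_function_generator[OF smooth_U f])
  have cont: "continuous_on UNIV f" "bounded {x. f x \<noteq> 0}" "continuous_on UNIV (L f)" "bounded {x. L f x \<noteq> 0}"
    using f Lf by (auto simp: test_function_iff smooth_continuous)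
  obtain u where u: "((\<lambda>t. expectation (\<lambda>\<omega>. f (q t \<omega>))) \<longlongrightarrow> u) at_top" using expectation_convergent[OF cont(1,2)] by blast
  obtain v where v: "((\<lambda>t. expectation (\<lambda>\<omega>. L f (q t \<omega>))) \<longlongrightarrow> v) at_top" using expectation_convergent[OF cont(3,4)] by blast
  obtain D where D: "\<And>s t. s \<ge> 0 \<Longrightarrow> t \<ge> 0 \<Longrightarrow> \<bar>expectation (\<lambda>\<omega>. f (q (t + s) \<omega>)) - expectation (\<lambda>\<omega>. f (q t \<omega>)) - s * expectation (\<lambda>\<omega>. L f (q t \<omega>))\<bar> \<le> s\<^sup>2 * D"
    by (rule expectation_expansion[OF f]) blast
  have le: "\<bar>u - u - s * v\<bar> \<le> s\<^sup>2 * D" if s: "s > 0" for s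
  proof (rule tendsto_upperbound)
    have "filterlim (\<lambda>t. t + s) at_top at_top" by (rule filterlim_at_top_mono[OF filterlim_ident]) (use s in auto)
    then have "((\<lambda>t. expectation (\<lambda>\<omega>. f (q (t + s) \<omega>))) \<longlongrightarrow> u) at_top" by (rule filterlim_compose[OF u])
    then show "((\<lambda>t. \<bar>expectation (\<lambda>\<omega>. f (q (t + s) \<omega>)) - expectation (\<lambda>\<omega>. f (q t \<omega>)) - s * expectation (\<lambda>\<omega>. L f (q t \<omega>))\<bar>) \<longlongrightarrow> \<bar>u - u - s * v\<bar>) at_top"
      by (intro tendsto_intros u v)
    show "\<forall>\<^sub>F t in at_top. \<bar>expectation (\<lambda>\<omega>. f (q (t + s) \<omega>)) - expectation (\<lambda>\<omega>. f (q t \<omega>)) - s * expectation (\<lambda>\<omega>. L f (q t \<omega>))\<bar> \<le> s\<^sup>2 * D"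
      using eventually_ge_at_top[of 0] by eventually_elim (use s in \<open>intro D, auto\<close>)
  qed simp
  have "v = 0"
  proof (rule ccontr)
    assume "v \<noteq> 0"
    \<comment> \<open>Chosen so that s (|D| + 1) equals |v| / 2.\<close>
    define s where "s = \<bar>v\<bar> / 2 / (\<bar>D\<bar> + 1)"
    have s: "s > 0" using \<open>v \<noteq> 0\<close> by (simp add: s_def)
    have "s * \<bar>v\<bar> \<le> s * (s * D)" using le[OF s] s by (simp add: abs_mult power2_eq_square mult.assoc)
    then have "\<bar>v\<bar> \<le> s * D" using s by simp
    also have "\<dots> \<le> s * (\<bar>D\<bar> + 1)" using s by (intro mult_left_mono) auto
    also have "\<dots> = \<bar>v\<bar> / 2"
    proof -
      have "x / y * y = x" if "y > 0" for x y :: real using that by simp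
      then show ?thesis unfolding s_def using abs_ge_zero[of D] by (metis add_strict_increasing2 zero_less_one add_increasing add_nonneg_pos)
    qed
    finally show False using \<open>v \<noteq> 0\<close> by simp
  qed
  then show ?thesis using v by simp
qed

text \<open>A constant mean will be subtracted from a test function, so the bound is needed without
  bounded support. The cutoffs \<open>\<phi> k\<close> exhaust the space.\<close>

lemma expectation_le_integral_bounded:
  assumes f: "continuous_on UNIV f" "\<And>x. \<bar>f x\<bar> \<le> K" and t: "t \<ge> 0" and U: "integrable lborel (\<lambda>x. exp (- U x))"
  shows "\<bar>expectation (\<lambda>\<omega>. f (q t \<omega>))\<bar> \<le> C * (LINT x|lborel. \<bar>f x\<bar> * exp (- U x))"
proof -
  have [measurable]: "f \<in> borel_measurable borel" by (rule borel_measurable_continuous_onI[OF f(1)])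
  have [measurable]: "q t \<in> borel_measurable M" using t by simp
  have i: "integrable lborel (\<lambda>x. \<bar>f x\<bar> * exp (- U x))"
    by (rule Bochner_Integration.integrable_bound[OF integrable_mult_right[OF U, of K]]) (auto simp: abs_mult intro!: always_eventually mult_right_mono order_trans[OF f(2)])
  define \<phi> where "\<phi> k x = max 0 (min 1 (real k - norm x))" for k and x :: "real ^ 'n"
  have \<phi>: "0 \<le> \<phi> k x" "\<phi> k x \<le> 1" "continuous_on UNIV (\<phi> k)" for k x
    unfolding \<phi>_def by (auto intro!: continuous_intros)
  have [measurable]: "\<phi> k \<in> borel_measurable borel" for k by (rule borel_measurable_continuous_onI[OF \<phi>(3)])
  have \<phi>1: "(\<lambda>k. \<bar>f x\<bar> * \<phi> k x) \<longlonglongrightarrow> \<bar>f x\<bar>" for x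
  proof (rule tendsto_eventually)
    show "\<forall>\<^sub>F k in sequentially. \<bar>f x\<bar> * \<phi> k x = \<bar>f x\<bar>"
      using eventually_ge_at_top[of "nat \<lceil>norm x\<rceil> + 1"]
    proof eventually_elim
      case (elim k)
      then have "real k - norm x \<ge> 1" by linarith
      then show ?case by (simp add: \<phi>_def)
    qed
  qed
  have le: "\<bar>f x\<bar> * \<phi> k x \<le> \<bar>f x\<bar>" for k x using \<phi>(1,2)[of k x] by (simp add: mult_left_le)
  have "\<bar>expectation (\<lambda>\<omega>. f (q t \<omega>))\<bar> \<le> expectation (\<lambda>\<omega>. \<bar>f (q t \<omega>)\<bar>)" by (rule integral_abs_bound)
  also have "\<dots> \<le> C * (LINT x|lborel. \<bar>f x\<bar> * exp (- U x))"
  proof (rule tendsto_upperbound)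
    show "(\<lambda>k. expectation (\<lambda>\<omega>. \<bar>f (q t \<omega>)\<bar> * \<phi> k (q t \<omega>))) \<longlonglongrightarrow> expectation (\<lambda>\<omega>. \<bar>f (q t \<omega>)\<bar>)"
    proof (rule integral_dominated_convergence[where w="\<lambda>_. K"])
      show "AE \<omega> in M. norm (\<bar>f (q t \<omega>)\<bar> * \<phi> k (q t \<omega>)) \<le> K" for k
        using \<phi>(1) order_trans[OF le f(2)] by (auto simp: abs_mult)
    qed (use \<phi>1 in auto)
    show "\<forall>\<^sub>F k in sequentially. expectation (\<lambda>\<omega>. \<bar>f (q t \<omega>)\<bar> * \<phi> k (q t \<omega>)) \<le> C * (LINT x|lborel. \<bar>f x\<bar> * exp (- U x))"
    proof (rule always_eventually, rule allI)
      fix k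
      have b: "bounded {x. \<bar>f x\<bar> * \<phi> k x \<noteq> 0}"
        by (rule bounded_subset[of "cball 0 (real k)"]) (auto simp: \<phi>_def)
      have c: "continuous_on UNIV (\<lambda>x. \<bar>f x\<bar> * \<phi> k x)" by (intro continuous_intros f(1) \<phi>(3))
      have "expectation (\<lambda>\<omega>. \<bar>f (q t \<omega>)\<bar> * \<phi> k (q t \<omega>)) \<le> C * (LINT x|lborel. \<bar>\<bar>f x\<bar> * \<phi> k x\<bar> * exp (- U x))"
        using expectation_le_integral[OF c b t] by linarith
      also have "\<dots> \<le> C * (LINT x|lborel. \<bar>f x\<bar> * exp (- U x))"
      proof (intro mult_left_mono C_nonneg integral_mono i)
        show "integrable lborel (\<lambda>x. \<bar>\<bar>f x\<bar> * \<phi> k x\<bar> * exp (- U x))"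
          by (rule Bochner_Integration.integrable_bound[OF i]) (use le \<phi>(1) in \<open>auto simp: abs_mult intro!: always_eventually mult_right_mono\<close>)
        show "\<bar>\<bar>f x\<bar> * \<phi> k x\<bar> * exp (- U x) \<le> \<bar>f x\<bar> * exp (- U x)" for x
          using le[of x k] \<phi>(1)[of k x] by (intro mult_right_mono) (auto simp: abs_mult)
      qed
      finally show "expectation (\<lambda>\<omega>. \<bar>f (q t \<omega>)\<bar> * \<phi> k (q t \<omega>)) \<le> C * (LINT x|lborel. \<bar>f x\<bar> * exp (- U x))" .
    qed
  qed simp
  finally show ?thesis .
qed

end

section \<open>The perturbed dynamics\<close>

text \<open>The quotient stays below a negative constant far out, and |x|^(\<alpha> + 1) \<ge> |x|
  for |x| \<ge> 1 because \<alpha> > 0. The resulting linear bound is the form in which coercivity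
  is proved.\<close>

lemma growth_lower_bound:
  fixes V :: "real ^ 'n::finite \<Rightarrow> real"
  assumes "growth_assumption V"
  obtains c r where "c > 0" "r > 0" "\<And>x. norm x \<ge> r \<Longrightarrow> c * norm x \<le> x \<bullet> grad V x"
proof -
  obtain \<alpha> where \<alpha>: "\<alpha> > 0" "Limsup at_infinity (\<lambda>x. ereal (- (x \<bullet> grad V x) / norm x powr (\<alpha> + 1))) < 0"
    using assms unfolding growth_assumption_def by blast
  from ereal_dense2[OF \<alpha>(2)] obtain d :: real where d: "Limsup at_infinity (\<lambda>x. ereal (- (x \<bullet> grad V x) / norm x powr (\<alpha> + 1))) < ereal d" "d < 0"
    by auto
  from Limsup_lessD[OF d(1)] obtain b where b: "\<And>x. norm x \<ge> b \<Longrightarrow> - (x \<bullet> grad V x) / norm x powr (\<alpha> + 1) < d"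
    unfolding eventually_at_infinity by auto
  have "- d * norm x \<le> x \<bullet> grad V x" if x: "norm x \<ge> max b 1" for x
  proof -
    have p: "norm x powr (\<alpha> + 1) > 0" using x by auto
    have "- (x \<bullet> grad V x) < d * norm x powr (\<alpha> + 1)"
      using b[of x] x unfolding pos_divide_less_eq[OF p] by simp
    moreover have "norm x powr 1 \<le> norm x powr (\<alpha> + 1)" using x \<alpha>(1) by (intro powr_mono) auto
    then have "(- d) * norm x \<le> (- d) * norm x powr (\<alpha> + 1)" using x d(2) by (intro mult_left_mono) auto
    ultimately show ?thesis by linarith
  qed
  with d(2) show ?thesis by (intro that[of "- d" "max b 1"]) auto
qed

text \<open>On a ray beyond radius r the radial derivative of V is at least c, so V grows at least
  linearly from its bounded values on the sphere.\<close>

lemma growth_coercive: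
  fixes V :: "real ^ 'n::finite \<Rightarrow> real"
  assumes V: "smooth V" and growth: "growth_assumption V"
  shows "bounded {x. V x \<le> R}"
proof -
  obtain c r where cr: "c > 0" "r > 0" "\<And>x. norm x \<ge> r \<Longrightarrow> c * norm x \<le> x \<bullet> grad V x"
    by (rule growth_lower_bound[OF growth]) blast
  have "bounded (V ` cball 0 r)"
    by (intro compact_imp_bounded compact_continuous_image continuous_on_subset[OF smooth_continuous[OF V]]) auto
  then obtain m where m: "\<forall>x\<in>cball 0 r. \<bar>V x\<bar> \<le> m" unfolding bounded_iff by auto
  have "norm x \<le> r + (R + m) / c \<or> norm x \<le> r" if x: "V x \<le> R" for x
  proof (rule disjCI)
    assume n: "\<not> norm x \<le> r"
    define e where "e = (1 / norm x) *\<^sub>R x"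
    have e: "norm e = 1" "x = norm x *\<^sub>R e" using n cr(2) by (auto simp: e_def)
    let ?f = "\<lambda>t. V (0 + t *\<^sub>R e)"
    have d: "(?f has_real_derivative e \<bullet> grad V (0 + t *\<^sub>R e)) (at t)" for t
      using has_real_derivative_line[OF smooth_differentiable[OF V], of 0 e t] by (simp add: grad_def inner_vec_def)
    obtain z where z: "r < z" "z < norm x" "?f (norm x) - ?f r = (norm x - r) * (e \<bullet> grad V (0 + z *\<^sub>R e))"
      using MVT2[of r "norm x" ?f "\<lambda>t. e \<bullet> grad V (0 + t *\<^sub>R e)"] d n by auto
    have "c * norm (z *\<^sub>R e) \<le> (z *\<^sub>R e) \<bullet> grad V (z *\<^sub>R e)" using z cr(2) e by (intro cr(3)) auto
    then have "z * c \<le> z * (e \<bullet> grad V (z *\<^sub>R e))" using z cr(2) e by (simp add: mult.commute)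
    then have "c \<le> e \<bullet> grad V (z *\<^sub>R e)" using z(1) cr(2) by simp
    then have "(norm x - r) * c \<le> (norm x - r) * (e \<bullet> grad V (z *\<^sub>R e))" using n by (intro mult_left_mono) auto
    moreover have "\<bar>V (r *\<^sub>R e)\<bar> \<le> m" using m cr(2) e by auto
    ultimately have "(norm x - r) * c \<le> R + m" using z(3) x e(2) by (simp add: abs_le_iff)
    then show "norm x \<le> r + (R + m) / c" using cr(1) by (simp add: field_simps)
  qed
  then have "{x. V x \<le> R} \<subseteq> cball 0 (max (r + (R + m) / c) r)" by (simp add: subset_iff le_max_iff_disj)
  then show ?thesis by (rule bounded_subset[OF bounded_cball])
qed

lemma grad_perturbed:
  assumes "smooth V" "smooth W"
  shows "grad (\<lambda>x. V x - c * W x) x = grad V x - c *\<^sub>R grad W x"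
proof -
  have e: "(\<lambda>x. V x - c * W x) = (\<lambda>x. V x + (- c) * W x)" by simp
  have d: "V differentiable_on UNIV" "(\<lambda>x. - c * W x) differentiable_on UNIV" "(\<lambda>x. - c) differentiable_on UNIV" "W differentiable_on UNIV"
    using smooth_differentiable[OF smooth_mult[OF smooth_const[of "- c"] assms(2)]]
    by (auto intro: smooth_differentiable smooth_const assms simp del: mult_minus_left)
  show ?thesis
    unfolding e by (simp only: grad_def vec_eq_iff partial_deriv_add[OF d(1,2)] partial_deriv_mult[OF d(3,4)] partial_deriv_const) simp
qed

lemma generator_perturbed:
  assumes "smooth V" "smooth W"
  shows "unperturbed_generator \<sigma> (\<lambda>x. V x - c * W x) f x = unperturbed_generator \<sigma> V f x + c * carre \<sigma> W f x"
  unfolding unperturbed_generator_def carre_alt grad_perturbed[OF assms]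
  by (simp add: matrix_vector_mult_diff_distrib matrix_vector_mult_scaleR inner_diff_left)

text \<open>The integral of a function that is not integrable is 0 by convention, and so is a
  quotient by 0. Without integrability the Gibbs density would vanish identically and could not be
  the density of a random variable.\<close>

lemma integrable_exp_of_distributed:
  assumes "prob_space M" and X: "distributed M lborel X (\<lambda>x. ennreal (gibbs_density V x))"
  shows "integrable lborel (\<lambda>x. exp (- V x))"
proof (rule ccontr)
  interpret prob_space M by fact
  assume "\<not> ?thesis"
  then have "gibbs_density V x = 0" for x
    by (simp add: gibbs_density_def partition_function_def not_integrable_integral_eq)
  then have "distr M lborel X = density lborel (\<lambda>x. 0)" using X by (simp add: distributed_def)
  then have "emeasure (distr M lborel X) UNIV = 0" by (simp add: emeasure_density)
  moreover have "X \<in> measurable M lborel" using X by (simp add: distributed_def)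
  then have "emeasure (distr M lborel X) UNIV = 1" by (simp add: emeasure_distr emeasure_space_1)
  ultimately show False by simp
qed

text \<open>Relative to the perturbed weight the Gibbs density is
  \<open>exp (- \<epsilon> * W x)\<close> over the partition function, which the bound b on W
  controls. A bounded perturbation also leaves the potential coercive.\<close>

lemma perturbed_confined_sde:
  fixes V W :: "real ^ 'n::finite \<Rightarrow> real"
  assumes V: "smooth V" "growth_assumption V" and \<sigma>: "invertible \<sigma>" and W: "test_function W" "\<And>x. \<bar>W x\<bar> \<le> b"
    and B: "brownian_motion M B" and \<epsilon>: "\<epsilon> > 0"
    and q: "additive_sde_solution M B (perturbed_drift \<sigma> V W \<epsilon>) (sqrt 2 *\<^sub>R \<sigma>) q"
    and q0: "distributed M lborel (q 0) (\<lambda>x. ennreal (gibbs_density V x))" and ind: "independent_of_process M (q 0) B"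
  shows "confined_sde M B q \<sigma> (\<lambda>x. V x - \<epsilon> * W x) (\<lambda>x. exp (- \<epsilon> * W x) / partition_function V) (exp (\<epsilon> * b) / partition_function V)"
proof
  have "prob_space M" using B by (simp add: brownian_motion_def)
  then interpret gibbs V by (unfold_locales, intro V, intro integrable_exp_of_distributed[OF _ q0])
  have sW: "smooth W" using W(1) by (rule test_function_smooth)
  show "smooth (\<lambda>x. V x - \<epsilon> * W x)" using V sW by (intro smooth_diff smooth_mult smooth_const)
  have "V x \<le> R + \<epsilon> * b" if "V x - \<epsilon> * W x \<le> R" for x R
  proof -
    have "W x \<le> b" using W(2)[of x] by linarith
    then have "\<epsilon> * W x \<le> \<epsilon> * b" using \<epsilon> by simp
    then show ?thesis using that by linarith
  qed
  then show "bounded {x. V x - \<epsilon> * W x \<le> R}" for R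
    by (intro bounded_subset[OF growth_coercive[OF V, of "R + \<epsilon> * b"]]) auto
  have "perturbed_drift \<sigma> V W \<epsilon> = (\<lambda>x. (\<sigma> ** transpose \<sigma>) *v (- grad (\<lambda>x. V x - \<epsilon> * W x) x))"
    by (rule ext) (simp add: perturbed_drift_def grad_perturbed V sW)
  then show "additive_sde_solution M B (\<lambda>x. (\<sigma> ** transpose \<sigma>) *v (- grad (\<lambda>x. V x - \<epsilon> * W x) x)) (sqrt 2 *\<^sub>R \<sigma>) q"
    using q by simp
  have "exp (- \<epsilon> * W x) / partition_function V * exp (- (V x - \<epsilon> * W x)) = gibbs_density V x" for x
    by (simp add: gibbs_density_def flip: exp_add)
  then show "distributed M lborel (q 0) (\<lambda>x. ennreal (exp (- \<epsilon> * W x) / partition_function V * exp (- (V x - \<epsilon> * W x))))"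
    using q0 by simp
  show "continuous_on UNIV (\<lambda>x. exp (- \<epsilon> * W x) / partition_function V)"
    using partition_pos by (intro continuous_intros smooth_continuous sW) auto
  show "0 \<le> exp (- \<epsilon> * W x) / partition_function V" for x using partition_pos by simp
  show "exp (- \<epsilon> * W x) / partition_function V \<le> exp (\<epsilon> * b) / partition_function V" for x
  proof -
    have "- W x \<le> b" using W(2)[of x] by linarith
    then have "\<epsilon> * - W x \<le> \<epsilon> * b" using \<epsilon> by (intro mult_left_mono) auto
    then show ?thesis using partition_pos by (intro divide_right_mono) auto
  qed
qed (use assms in auto)

locale perturbed_dynamics =
  fixes V W :: "real ^ 'n::finite \<Rightarrow> real" and \<sigma> :: "real ^ 'n ^ 'n" and M :: "'w measure"
    and B :: "real \<Rightarrow> 'w \<Rightarrow> real ^ 'n" and q :: "real \<Rightarrow> real \<Rightarrow> 'w \<Rightarrow> real ^ 'n" and b :: real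
  assumes V: "smooth V" "growth_assumption V" and \<sigma>: "invertible \<sigma>" and W: "test_function W" "\<bar>W x\<bar> \<le> b"
    and B: "brownian_motion M B"
    and q: "\<epsilon> > 0 \<Longrightarrow> additive_sde_solution M B (perturbed_drift \<sigma> V W \<epsilon>) (sqrt 2 *\<^sub>R \<sigma>) (q \<epsilon>)"
    and q0: "\<epsilon> > 0 \<Longrightarrow> distributed M lborel (q \<epsilon> 0) (\<lambda>x. ennreal (gibbs_density V x))"
    and ind: "\<epsilon> > 0 \<Longrightarrow> independent_of_process M (q \<epsilon> 0) B"
begin

sublocale prob_space M using B by (simp add: brownian_motion_def)
sublocale gibbs V
  using q0[of 1] by (unfold_locales, intro V, intro integrable_exp_of_distributed[OF prob_space_axioms]) simp

lemma confined: "\<epsilon> > 0 \<Longrightarrow> confined_sde M B (q \<epsilon>) \<sigma> (\<lambda>x. V x - \<epsilon> * W x) (\<lambda>x. exp (- \<epsilon> * W x) / partition_function V) (exp (\<epsilon> * b) / partition_function V)"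
  using V \<sigma> W B q q0 ind by (intro perturbed_confined_sde) auto

lemma smooth_W: "smooth W" using W(1) by (rule test_function_smooth)

lemma perturbed_convergent:
  assumes "\<epsilon> > 0" "test_function f" shows "\<exists>l. ((\<lambda>t. expectation (\<lambda>\<omega>. f (q \<epsilon> t \<omega>))) \<longlongrightarrow> l) at_top"
proof -
  interpret c: confined_sde M B "q \<epsilon>" \<sigma> "\<lambda>x. V x - \<epsilon> * W x" "\<lambda>x. exp (- \<epsilon> * W x) / partition_function V" "exp (\<epsilon> * b) / partition_function V"
    by (rule confined[OF assms(1)])
  show ?thesis using assms(2) by (intro c.expectation_convergent) (auto simp: test_function_iff smooth_continuous)
qed

lemma perturbed_generator_tendsto_0:
  assumes "\<epsilon> > 0" "test_function f"
  shows "((\<lambda>t. expectation (\<lambda>\<omega>. unperturbed_generator \<sigma> V f (q \<epsilon> t \<omega>) + \<epsilon> * carre \<sigma> W f (q \<epsilon> t \<omega>))) \<longlongrightarrow> 0) at_top"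
proof -
  interpret c: confined_sde M B "q \<epsilon>" \<sigma> "\<lambda>x. V x - \<epsilon> * W x" "\<lambda>x. exp (- \<epsilon> * W x) / partition_function V" "exp (\<epsilon> * b) / partition_function V"
    by (rule confined[OF assms(1)])
  show ?thesis using c.expectation_generator_tendsto_0[OF assms(2)] by (simp add: generator_perturbed V smooth_W)
qed

text \<open>One factor exp (\<epsilon> b) bounds the initial density, and another one compares the
  perturbed weight with \<open>exp (- V)\<close>. The constant does not depend on t, so the estimate
  survives the limit of large times.\<close>

lemma perturbed_expectation_le:
  assumes \<epsilon>: "\<epsilon> > 0" and t: "t \<ge> 0" and f: "continuous_on UNIV f" "\<And>x. \<bar>f x\<bar> \<le> K"
  shows "\<bar>expectation (\<lambda>\<omega>. f (q \<epsilon> t \<omega>))\<bar> \<le> exp (2 * \<epsilon> * b) * (LINT x|\<mu>. \<bar>f x\<bar>)"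
proof -
  interpret c: confined_sde M B "q \<epsilon>" \<sigma> "\<lambda>x. V x - \<epsilon> * W x" "\<lambda>x. exp (- \<epsilon> * W x) / partition_function V" "exp (\<epsilon> * b) / partition_function V"
    by (rule confined[OF \<epsilon>])
  have [measurable]: "f \<in> borel_measurable borel" "W \<in> borel_measurable borel"
    using f(1) smooth_continuous[OF smooth_W] by (auto intro: borel_measurable_continuous_onI)
  have w: "exp (- (V x - \<epsilon> * W x)) \<le> exp (\<epsilon> * b) * exp (- V x)" for x
  proof -
    have "W x \<le> b" using W(2)[of x] by linarith
    then have "\<epsilon> * W x \<le> \<epsilon> * b" using \<epsilon> by simp
    then show ?thesis by (simp flip: exp_add)
  qed
  have i1: "integrable lborel (\<lambda>x. exp (- (V x - \<epsilon> * W x)))"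
    by (rule Bochner_Integration.integrable_bound[OF integrable_mult_right[OF integrable_exp, of "exp (\<epsilon> * b)"]])
      (use w in \<open>auto intro!: always_eventually\<close>)
  have fi: "integrable lborel (\<lambda>x. \<bar>f x\<bar> * v x)" if "integrable lborel v" for v
    using f(2) by (intro Bochner_Integration.integrable_bound[OF integrable_mult_right[OF that, of K]])
      (use borel_measurable_integrable[OF that] in \<open>auto simp: abs_mult intro!: always_eventually mult_right_mono order_trans[OF f(2) abs_ge_self]\<close>)
  have "\<bar>expectation (\<lambda>\<omega>. f (q \<epsilon> t \<omega>))\<bar> \<le> exp (\<epsilon> * b) / partition_function V * (LINT x|lborel. \<bar>f x\<bar> * exp (- (V x - \<epsilon> * W x)))"
    by (rule c.expectation_le_integral_bounded[OF f t i1])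
  also have "\<dots> \<le> exp (\<epsilon> * b) / partition_function V * (LINT x|lborel. exp (\<epsilon> * b) * (\<bar>f x\<bar> * exp (- V x)))"
  proof (intro mult_left_mono integral_mono fi i1 integrable_mult_right integrable_exp)
    fix x show "\<bar>f x\<bar> * exp (- (V x - \<epsilon> * W x)) \<le> exp (\<epsilon> * b) * (\<bar>f x\<bar> * exp (- V x))"
      using mult_left_mono[OF w[of x], of "\<bar>f x\<bar>"] by (simp only: mult_ac abs_ge_zero True_implies_equals)
  qed (use partition_pos in auto)
  also have "\<dots> = exp (2 * \<epsilon> * b) * ((LINT x|lborel. \<bar>f x\<bar> * exp (- V x)) / partition_function V)"
  proof -
    have "exp (2 * \<epsilon> * b) = exp (\<epsilon> * b) * exp (\<epsilon> * b)" by (simp flip: exp_add)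
    then show ?thesis by simp
  qed
  also have "(LINT x|lborel. \<bar>f x\<bar> * exp (- V x)) / partition_function V = (LINT x|\<mu>. \<bar>f x\<bar>)"
    by (subst integral_\<mu>) (auto simp: gibbs_density_def)
  finally show ?thesis .
qed

text \<open>The expectation of the perturbed generator of u tends to 0 and may be subtracted. What
  is left of \<psi> minus its mean is an L1(\<mu>) error below e / 2, times a factor that tends to 1
  with \<epsilon>, and \<epsilon> times the bounded function
  \<open>carre \<sigma> W u\<close>.\<close>

lemma perturbed_limit_tendsto:
  assumes S: "unperturbed_semigroup \<sigma> V S" and \<psi>: "test_function \<psi>"
    and lim: "\<And>\<epsilon>. \<epsilon> > 0 \<Longrightarrow> ((\<lambda>t. expectation (\<lambda>\<omega>. \<psi> (q \<epsilon> t \<omega>))) \<longlongrightarrow> l \<epsilon>) at_top"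
  shows "(l \<longlongrightarrow> (LINT x|\<mu>. \<psi> x)) (at_right 0)"
proof (rule tendstoI)
  interpret s: gibbs_semigroup V \<sigma> S using S by unfold_locales
  let ?L = "unperturbed_generator \<sigma> V"
  define m where "m = (LINT x|\<mu>. \<psi> x)"
  fix e :: real assume e: "e > 0"
  then obtain u where u: "test_function u" "(LINT x|\<mu>. \<bar>\<psi> x - m - ?L u x\<bar>) < e / 2"
    using s.generator_range_dense[OF \<sigma> \<psi>, of "e / 2"] unfolding m_def by auto
  have Lu: "test_function (?L u)" and Wu: "test_function (carre \<sigma> W u)"
    by (intro test_function_generator V u) (rule test_function_carre(2)[OF smooth_W u(1)])
  obtain k1 where k1: "k1 \<ge> 0" "\<And>x. \<bar>\<psi> x\<bar> \<le> k1" by (rule test_function_bounded[OF \<psi>]) blast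
  obtain k2 where k2: "k2 \<ge> 0" "\<And>x. \<bar>?L u x\<bar> \<le> k2" by (rule test_function_bounded[OF Lu]) blast
  obtain k3 where k3: "k3 \<ge> 0" "\<And>x. \<bar>carre \<sigma> W u x\<bar> \<le> k3" by (rule test_function_bounded[OF Wu]) blast
  note c = smooth_continuous[OF test_function_smooth]
  have [measurable]: "\<psi> \<in> borel_measurable borel" "?L u \<in> borel_measurable borel" "carre \<sigma> W u \<in> borel_measurable borel"
    by (intro borel_measurable_continuous_onI c \<psi> Lu Wu)+
  have le: "\<bar>l \<epsilon> - m\<bar> \<le> exp (2 * \<epsilon> * b) * (e / 2) + \<epsilon> * k3" if \<epsilon>: "\<epsilon> > 0" for \<epsilon>
  proof (rule tendsto_upperbound)
    show "((\<lambda>t. \<bar>expectation (\<lambda>\<omega>. \<psi> (q \<epsilon> t \<omega>)) - m - expectation (\<lambda>\<omega>. ?L u (q \<epsilon> t \<omega>) + \<epsilon> * carre \<sigma> W u (q \<epsilon> t \<omega>))\<bar>) \<longlongrightarrow> \<bar>l \<epsilon> - m\<bar>) at_top"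
      using tendsto_rabs[OF tendsto_diff[OF tendsto_diff[OF lim[OF \<epsilon>] tendsto_const[of m]] perturbed_generator_tendsto_0[OF \<epsilon> u(1)]]] by simp
    show "\<forall>\<^sub>F t in at_top. \<bar>expectation (\<lambda>\<omega>. \<psi> (q \<epsilon> t \<omega>)) - m - expectation (\<lambda>\<omega>. ?L u (q \<epsilon> t \<omega>) + \<epsilon> * carre \<sigma> W u (q \<epsilon> t \<omega>))\<bar> \<le> exp (2 * \<epsilon> * b) * (e / 2) + \<epsilon> * k3"
      using eventually_ge_at_top[of 0]
    proof eventually_elim
      case (elim t)
      interpret c: confined_sde M B "q \<epsilon>" \<sigma> "\<lambda>x. V x - \<epsilon> * W x" "\<lambda>x. exp (- \<epsilon> * W x) / partition_function V" "exp (\<epsilon> * b) / partition_function V"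
        by (rule confined[OF \<epsilon>])
      have [measurable]: "q \<epsilon> t \<in> borel_measurable M" using elim by (rule c.q_meas)
      have i: "integrable M (\<lambda>\<omega>. \<psi> (q \<epsilon> t \<omega>))" "integrable M (\<lambda>\<omega>. ?L u (q \<epsilon> t \<omega>))" "integrable M (\<lambda>\<omega>. carre \<sigma> W u (q \<epsilon> t \<omega>))"
        by (rule integrable_const_bound[where B=k1] integrable_const_bound[where B=k2] integrable_const_bound[where B=k3], use k1 k2 k3 in \<open>auto; fail\<close>, simp)+
      have "\<bar>\<psi> x - m - ?L u x\<bar> \<le> k1 + \<bar>m\<bar> + k2" for x using k1(2)[of x] k2(2)[of x] by linarith
      then have "\<bar>expectation (\<lambda>\<omega>. \<psi> (q \<epsilon> t \<omega>) - m - ?L u (q \<epsilon> t \<omega>))\<bar> \<le> exp (2 * \<epsilon> * b) * (LINT x|\<mu>. \<bar>\<psi> x - m - ?L u x\<bar>)"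
        by (intro perturbed_expectation_le[OF \<epsilon> elim, where f="\<lambda>x. \<psi> x - m - ?L u x"] continuous_intros c \<psi> Lu)
      also have "\<dots> \<le> exp (2 * \<epsilon> * b) * (e / 2)" using u(2) by (intro mult_left_mono) auto
      finally have 1: "\<bar>expectation (\<lambda>\<omega>. \<psi> (q \<epsilon> t \<omega>) - m - ?L u (q \<epsilon> t \<omega>))\<bar> \<le> exp (2 * \<epsilon> * b) * (e / 2)" .
      have "\<bar>expectation (\<lambda>\<omega>. carre \<sigma> W u (q \<epsilon> t \<omega>))\<bar> \<le> expectation (\<lambda>\<omega>. \<bar>carre \<sigma> W u (q \<epsilon> t \<omega>)\<bar>)" by (rule integral_abs_bound)
      also have "\<dots> \<le> expectation (\<lambda>_. k3)" using i(3) k3 by (intro integral_mono) auto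
      finally have "\<bar>expectation (\<lambda>\<omega>. carre \<sigma> W u (q \<epsilon> t \<omega>))\<bar> \<le> k3" by (simp add: prob_space)
      then have "\<bar>\<epsilon> * expectation (\<lambda>\<omega>. carre \<sigma> W u (q \<epsilon> t \<omega>))\<bar> \<le> \<epsilon> * k3" using \<epsilon> by (simp add: abs_mult)
      moreover have "expectation (\<lambda>\<omega>. \<psi> (q \<epsilon> t \<omega>)) - m - expectation (\<lambda>\<omega>. ?L u (q \<epsilon> t \<omega>) + \<epsilon> * carre \<sigma> W u (q \<epsilon> t \<omega>))
        = expectation (\<lambda>\<omega>. \<psi> (q \<epsilon> t \<omega>) - m - ?L u (q \<epsilon> t \<omega>)) - \<epsilon> * expectation (\<lambda>\<omega>. carre \<sigma> W u (q \<epsilon> t \<omega>))"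
        using i by (simp add: prob_space)
      ultimately show ?case using 1 by linarith
    qed
  qed simp
  have "((\<lambda>\<epsilon>. exp (2 * \<epsilon> * b) * (e / 2) + \<epsilon> * k3) \<longlongrightarrow> exp (2 * 0 * b) * (e / 2) + 0 * k3) (at_right 0)"
    by (intro tendsto_intros)
  then have "\<forall>\<^sub>F \<epsilon> in at_right 0. exp (2 * \<epsilon> * b) * (e / 2) + \<epsilon> * k3 < e" by (rule order_tendstoD(2)) (use e in simp)
  with eventually_at_right_less[of 0]
  show "\<forall>\<^sub>F \<epsilon> in at_right 0. dist (l \<epsilon>) (LINT x|\<mu>. \<psi> x) < e"
    by eventually_elim (use le in \<open>unfold dist_real_def m_def[symmetric], fastforce intro: le_less_trans\<close>)
qed

end

theorem theorem3p3:
  fixes V W g :: "real ^ 'n::finite \<Rightarrow> real"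
    and \<sigma> :: "real ^ 'n ^ 'n"
    and M :: "'w measure"
    and B :: "real \<Rightarrow> 'w \<Rightarrow> real ^ 'n"
    and q :: "real \<Rightarrow> real \<Rightarrow> 'w \<Rightarrow> real ^ 'n"
    and \<rho> :: "real \<Rightarrow> real \<Rightarrow> real ^ 'n \<Rightarrow> real"
    and S :: "real \<Rightarrow> (real ^ 'n \<Rightarrow> real) \<Rightarrow> real ^ 'n \<Rightarrow> real"
  assumes "smooth V" and "growth_assumption V" and "confinement_assumption \<sigma> V"
    and "invertible \<sigma>"
    and "test_function W" and "test_function g"
    and "brownian_motion M B"
    and "\<And>\<epsilon>. \<epsilon> > 0 \<Longrightarrow> additive_sde_solution M B (perturbed_drift \<sigma> V W \<epsilon>) (sqrt 2 *\<^sub>R \<sigma>) (q \<epsilon>)"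
    and "\<And>\<epsilon>. \<epsilon> > 0 \<Longrightarrow> distributed M lborel (q \<epsilon> 0) (\<lambda>x. ennreal (gibbs_density V x))"
    and "\<And>\<epsilon>. \<epsilon> > 0 \<Longrightarrow> independent_of_process M (q \<epsilon> 0) B"
    and "\<And>\<epsilon> t x. \<epsilon> > 0 \<Longrightarrow> t \<ge> 0 \<Longrightarrow> \<rho> \<epsilon> t x \<ge> 0"
    and "\<And>\<epsilon> t. \<epsilon> > 0 \<Longrightarrow> t \<ge> 0 \<Longrightarrow> distributed M lborel (q \<epsilon> t) (\<lambda>x. ennreal (\<rho> \<epsilon> t x))"
    and "unperturbed_semigroup \<sigma> V S"
  shows "(\<exists>r :: real \<Rightarrow> real.
      (\<forall>\<epsilon>>0. ((\<lambda>t. response \<rho> (gibbs_density V) t \<epsilon> (unperturbed_generator \<sigma> V g)) \<longlongrightarrow> r \<epsilon>) at_top) \<and>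
      (r \<longlongrightarrow> (LINT x|lborel. W x * unperturbed_generator \<sigma> V g x * gibbs_density V x)) (at_right 0)) \<and>
    set_integrable lborel {0..} (\<lambda>s. LINT x|lborel.
      S s (unperturbed_generator \<sigma> V g) x * unperturbed_generator \<sigma> V W x * gibbs_density V x) \<and>
    (LINT x|lborel. W x * unperturbed_generator \<sigma> V g x * gibbs_density V x) =
      - (LINT s:{0..}|lborel. LINT x|lborel.
          S s (unperturbed_generator \<sigma> V g) x * unperturbed_generator \<sigma> V W x * gibbs_density V x)"
proof -
  obtain b where b: "\<And>x. \<bar>W x\<bar> \<le> b" using test_function_bounded[OF assms(5)] by blast
  interpret perturbed_dynamics V W \<sigma> M B q b
    by unfold_locales (use assms b in auto)
  interpret s: gibbs_semigroup V \<sigma> S using assms(13) by unfold_locales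
  let ?L = "unperturbed_generator \<sigma> V" and ?\<rho> = "gibbs_density V"
  define \<psi> where "\<psi> = carre \<sigma> W g"
  have Lg: "test_function (?L g)" and \<psi>: "test_function \<psi>"
    unfolding \<psi>_def by (intro test_function_generator V assms) (rule test_function_carre(1)[OF W(1) test_function_smooth[OF assms(6)]])
  note bm = borel_measurable_continuous_onI[OF smooth_continuous[OF test_function_smooth]]
  have [measurable]: "?L g \<in> borel_measurable borel" "\<psi> \<in> borel_measurable borel" "W \<in> borel_measurable borel"
    by (intro bm Lg \<psi> W)+
  obtain l where l: "\<And>\<epsilon>. \<epsilon> > 0 \<Longrightarrow> ((\<lambda>t. expectation (\<lambda>\<omega>. \<psi> (q \<epsilon> t \<omega>))) \<longlongrightarrow> l \<epsilon>) at_top"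
    using perturbed_convergent[OF _ \<psi>] by metis
  \<comment> \<open>Integration by parts against the constant 1; it removes the subtracted
    equilibrium term of the response.\<close>
  have zero: "(LINT x|lborel. ?L g x * ?\<rho> x) = 0"
    using generator_\<mu>[OF assms(6) smooth_const[of 1], of \<sigma>] by (simp add: integral_\<mu> carre_def grad_def partial_deriv_const zero_vec_def[symmetric])
  \<comment> \<open>Integration by parts against W; its minus sign meets the one in front of
    \<open>l \<epsilon>\<close>.\<close>
  have W\<psi>: "(LINT x|lborel. W x * ?L g x * ?\<rho> x) = - (LINT x|\<mu>. \<psi> x)"
    using generator_\<mu>[OF assms(6) smooth_W, of \<sigma>] by (simp add: integral_\<mu> \<psi>_def carre_sym[of \<sigma> W])
  \<comment> \<open>\<open>L g\<close> is the perturbed generator of g minus \<epsilon> \<psi>. For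
    fixed \<epsilon> the first part vanishes as t \<rightarrow> \<infinity> even after division by
    \<epsilon>, and minus the expectation of \<psi> remains.\<close>
  have r: "((\<lambda>t. response \<rho> ?\<rho> t \<epsilon> (?L g)) \<longlongrightarrow> - l \<epsilon>) at_top" if \<epsilon>: "\<epsilon> > 0" for \<epsilon>
  proof (rule Lim_transform_eventually)
    show "((\<lambda>t. (1 / \<epsilon>) * expectation (\<lambda>\<omega>. ?L g (q \<epsilon> t \<omega>) + \<epsilon> * \<psi> (q \<epsilon> t \<omega>)) - expectation (\<lambda>\<omega>. \<psi> (q \<epsilon> t \<omega>))) \<longlongrightarrow> - l \<epsilon>) at_top"
      using tendsto_diff[OF tendsto_mult[OF tendsto_const[of "1 / \<epsilon>"] perturbed_generator_tendsto_0[OF \<epsilon> assms(6)]] l[OF \<epsilon>]] by (simp add: \<psi>_def)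
    show "\<forall>\<^sub>F t in at_top. (1 / \<epsilon>) * expectation (\<lambda>\<omega>. ?L g (q \<epsilon> t \<omega>) + \<epsilon> * \<psi> (q \<epsilon> t \<omega>)) - expectation (\<lambda>\<omega>. \<psi> (q \<epsilon> t \<omega>)) = response \<rho> ?\<rho> t \<epsilon> (?L g)"
      using eventually_ge_at_top[of 0]
    proof eventually_elim
      case (elim t)
      have d: "distributed M lborel (q \<epsilon> t) (\<lambda>x. ennreal (\<rho> \<epsilon> t x))" using assms(12) \<epsilon> elim by blast
      then have [measurable]: "q \<epsilon> t \<in> borel_measurable M" by (simp add: distributed_def)
      obtain k1 where k1: "\<And>x. \<bar>?L g x\<bar> \<le> k1" by (rule test_function_bounded[OF Lg]) blast
      obtain k2 where k2: "\<And>x. \<bar>\<psi> x\<bar> \<le> k2" by (rule test_function_bounded[OF \<psi>]) blast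
      have "integrable M (\<lambda>\<omega>. ?L g (q \<epsilon> t \<omega>))" "integrable M (\<lambda>\<omega>. \<psi> (q \<epsilon> t \<omega>))"
        by (rule integrable_const_bound[where B=k1] integrable_const_bound[where B=k2], use k1 k2 in \<open>auto; fail\<close>, simp)+
      moreover have "(LINT x|lborel. ?L g x * \<rho> \<epsilon> t x) = expectation (\<lambda>\<omega>. ?L g (q \<epsilon> t \<omega>))"
        using distributed_integral[OF d, of "?L g"] assms(11)[OF \<epsilon> elim] by (simp add: mult.commute)
      ultimately show ?case using \<epsilon> by (simp add: response_def zero distrib_left)
    qed
  qed
  have "((\<lambda>\<epsilon>. - l \<epsilon>) \<longlongrightarrow> (LINT x|lborel. W x * ?L g x * ?\<rho> x)) (at_right 0)"
    unfolding W\<psi> by (intro tendsto_minus perturbed_limit_tendsto[OF assms(13) \<psi> l])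
  with r have "\<exists>r. (\<forall>\<epsilon>>0. ((\<lambda>t. response \<rho> ?\<rho> t \<epsilon> (?L g)) \<longlongrightarrow> r \<epsilon>) at_top) \<and>
      (r \<longlongrightarrow> (LINT x|lborel. W x * ?L g x * ?\<rho> x)) (at_right 0)"
    by (intro exI[of _ "\<lambda>\<epsilon>. - l \<epsilon>"]) simp
  then show ?thesis using s.green_kubo_semigroup[OF assms(6,5)] by (intro conjI)
qed

end
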